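(* Let $E$ be a left $A$-module with a left covariant derivative $\nabla_E:E\to\Omega^1A\otimes_AE$. (1) If $(E,\nabla_E)$ has zero curvature, i.e. $R_E=(\mathrm d\otimes\mathrm{id}_E-\mathrm{id}\wedge\nabla_E)\nabla_E=0$, then the formula $[\underline v]\triangleright e=\underline v\triangleright e$ (for $\underline v\in\mathcal T\mathrm{Vec}A_\bullet$, $e\in E$) defines an action of the algebra $\mathcal DA=\mathcal T\mathrm{Vec}A_\bullet/\mathcal W$ on $E$. (2) Conversely, if $\Omega^2A$ is finitely generated projective as a right $A$-module and the formula $[\underline v]\triangleright e=\underline v\triangleright e$ defines an action of $\mathcal DA$ on $(E,\nabla_E)$, then $(E,\nabla_E)$ has zero curvature.
   Context: Setting. $A$ is a unital algebra over $\mathbb C$ and $(\Omega A=\oplus_{n\ge0}\Omega^nA,\mathrm d,\wedge)$ is a differential graded algebra with $\Omega^0A=A$, $\mathrm d^2=0$, graded Leibniz rule, generated over $A$ by $\Omega^1A$, with $\Omega^1A=A.\mathrm dA$ (no graded commutativity). $\Omega^1A$ is finitely generated projective as a right $A$-module; $\mathrm{Vec}A=\mathrm{Hom}_A(\Omega^1A,A)$ (right module maps), a bimodule by $(a.v)(\xi)=a\,v(\xi)$, $(v.a)(\xi)=v(a\xi)$; $\mathrm{ev}:\mathrm{Vec}A\otimes_A\Omega^1A\to A$ is evaluation and $\sum_i\xi_i\otimes u_i\in\Omega^1A\otimes_A\mathrm{Vec}A$ is the dual basis ($\xi=\sum_i\xi_i.u_i(\xi)$). $\Omega^{\otimes n}A$,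 $\mathrm{Vec}^{\otimes n}A$ are $n$-fold tensor powers over $A$ (equal to $A$ for $n=0$). $\mathrm{ev}^{\langle n\rangle}:\mathrm{Vec}^{\otimes n}A\otimes_A\Omega^{\otimes n}A\to A$ is nested evaluation: $\mathrm{ev}^{\langle1\rangle}=\mathrm{ev}$, $\mathrm{ev}^{\langle n+1\rangle}=\mathrm{ev}(\mathrm{id}\otimes\mathrm{ev}^{\langle n\rangle}\otimes\mathrm{id})$. Covariant derivatives. A left covariant derivative satisfies $\nabla_E(ae)=\mathrm da\otimes e+a\nabla_E(e)$. A right bimodule covariant derivative $(\square,\sigma^{-1})$ on $\Omega^1A$ is fixed: $\square:\Omega^1A\to\Omega^1A\otimes_A\Omega^1A$ with $\square(\xi a)=\square(\xi)a+\xi\otimes\mathrm da$ and $\square(a\xi)=a\square(\xi)+\sigma^{-1}(\mathrm da\otimes\xi)$, where $\sigma^{-1}:\Omega^{\otimes2}A\to\Omega^{\otimes2}A$ is a bimodule map (not assumed invertible). Extend by $\square^{\langle0\rangle}=\mathrm d$, $\square^{\langle1\rangle}=\square$, $\square^{\langle n+1\rangle}=\mathrm{id}^{\otimes n}\otimes\square+(\mathrm{id}^{\otimes n}\otimes\sigma^{-1})(\square^{\langle n\rangle}\otimes\mathrm{id}):\Omega^{\otimes n+1}A\to\Omega^{\otimes n+2}A$. The dual left bimodule covariant derivative $\square:\mathrm{Vec}A\to\Omega^1A\otimes_A\mathrm{Vec}A$ is determined by $\mathrm d\circ\mathrm{ev}=(\mathrm{id}\otimes\mathrm{ev})(\square\otimes\mathrm{id})+(\mathrm{ev}\otimes\mathrm{id})(\mathrm{id}\otimes\square)$,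 with $\sigma=(\mathrm{ev}\otimes\mathrm{id}\otimes\mathrm{id})(\mathrm{id}\otimes\sigma^{-1}\otimes\mathrm{id})(\mathrm{id}\otimes\mathrm{id}\otimes\mathrm{coev}(1)):\mathrm{Vec}A\otimes_A\Omega^1A\to\Omega^1A\otimes_A\mathrm{Vec}A$, $\mathrm{coev}(1)=\sum_i\xi_i\otimes u_i$. It extends to $\square^{\langle n\rangle}:\mathrm{Vec}^{\otimes n}A\to\Omega^1A\otimes_A\mathrm{Vec}^{\otimes n}A$ by $\square^{\langle0\rangle}=\mathrm d$, $\square^{\langle n+1\rangle}=\square\otimes\mathrm{id}^{\otimes n}+(\sigma\otimes\mathrm{id}^{\otimes n})(\mathrm{id}\otimes\square^{\langle n\rangle})$. Product and action. $\mathcal T\mathrm{Vec}A=\bigoplus_{n\ge0}\mathrm{Vec}^{\otimes n}A$ carries an associative unital product $\bullet$ determined by $a\bullet\underline w=a.\underline w$, $u\bullet\underline w=u\otimes\underline w+(\mathrm{ev}\otimes\mathrm{id}^{\otimes m})(u\otimes\square^{\langle m\rangle}\underline w)$ and $(u\otimes\underline v)\bullet\underline w=u\bullet(\underline v\bullet\underline w)-\big((\mathrm{ev}\otimes\mathrm{id}^{\otimes n})(u\otimes\square^{\langle n\rangle}\underline v)\big)\bullet\underline w$, for $a\in A$, $u\in\mathrm{Vec}A$, $\underline v\in\mathrm{Vec}^{\otimes n}A$, $\underline w\in\mathrm{Vec}^{\otimes m}A$. $\mathcal T\mathrm{Vec}A_\bullet$ denotes this algebra, with left $A$-action the usual one and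 right $A$-action $\bullet$. It acts on $(E,\nabla_E)$ by $\underline v\triangleright e=(\mathrm{ev}^{\langle n\rangle}\otimes\mathrm{id}_E)(\underline v\otimes\nabla_E^{(n)}e)$ for $\underline v\in\mathrm{Vec}^{\otimes n}A$, where $\nabla_E^{(1)}=\nabla_E$, $\nabla_E^{(n+1)}=(\square^{\langle n\rangle}\otimes\mathrm{id}_E+\mathrm{id}^{\otimes n}\otimes\nabla_E)\nabla_E^{(n)}$ (and $a\triangleright e=a.e$ for $n=0$). The algebra $\mathcal DA$. $\mathcal R=\sum_i\mathrm d\xi_i\otimes u_i-\sum_{i,j}\xi_i\wedge\xi_j\otimes(u_j\bullet u_i)\in\Omega^2A\otimes_A\mathcal T\mathrm{Vec}A_\bullet$. $(\Omega^2A)'=\mathrm{Hom}_A(\Omega^2A,A)$ (right module maps), and $\widehat{\mathcal R}:(\Omega^2A)'\to\mathcal T\mathrm{Vec}A_\bullet$ is $\widehat{\mathcal R}(\alpha)=(\alpha\otimes\mathrm{id})\mathcal R$. $\mathcal W$ is the two-sided ideal of $\mathcal T\mathrm{Vec}A_\bullet$ (for $\bullet$) generated by the image of $\widehat{\mathcal R}$; $\mathcal DA=\mathcal T\mathrm{Vec}A_\bullet/\mathcal W$ and $[\underline v]$ is the class of $\underline v$. *)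

theory Defs
  imports
    Complex_Main
    "HOL-Algebra.QuotRing"
    "HOL-Algebra.Module"
    "HOL-Algebra.Generated_Rings"
    "HOL-Algebra.Generated_Groups"
    "HOL-Algebra.Free_Abelian_Groups"
begin

section \<open>Modules over a noncommutative ring\<close>

text \<open>The record \<open>module\<close> of HOL-Algebra extends \<open>ring\<close>; in the modules below its fields
  \<open>mult\<close> and \<open>one\<close> carry no meaning, unless stated otherwise.  The library locale
  \<open>module\<close> requires a commutative ring of scalars, hence the following variant.\<close>

locale left_module = R?: ring R + M?: abelian_group M
  for R :: "('a, 'x) ring_scheme" (structure) and M :: "('a, 'b, 'y) module_scheme" (structure) +
  assumes smult_closed:
      "\<lbrakk>a \<in> carrier R; x \<in> carrier M\<rbrakk> \<Longrightarrow> a \<odot>\<^bsub>M\<^esub> x \<in> carrier M"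
    and smult_l_distr:
      "\<lbrakk>a \<in> carrier R; b \<in> carrier R; x \<in> carrier M\<rbrakk> \<Longrightarrow>
        (a \<oplus>\<^bsub>R\<^esub> b) \<odot>\<^bsub>M\<^esub> x = a \<odot>\<^bsub>M\<^esub> x \<oplus>\<^bsub>M\<^esub> b \<odot>\<^bsub>M\<^esub> x"
    and smult_r_distr:
      "\<lbrakk>a \<in> carrier R; x \<in> carrier M; y \<in> carrier M\<rbrakk> \<Longrightarrow>
        a \<odot>\<^bsub>M\<^esub> (x \<oplus>\<^bsub>M\<^esub> y) = a \<odot>\<^bsub>M\<^esub> x \<oplus>\<^bsub>M\<^esub> a \<odot>\<^bsub>M\<^esub> y"
    and smult_assoc:
      "\<lbrakk>a \<in> carrier R; b \<in> carrier R; x \<in> carrier M\<rbrakk> \<Longrightarrow>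
        (a \<otimes>\<^bsub>R\<^esub> b) \<odot>\<^bsub>M\<^esub> x = a \<odot>\<^bsub>M\<^esub> (b \<odot>\<^bsub>M\<^esub> x)"
    and smult_one: "x \<in> carrier M \<Longrightarrow> \<one>\<^bsub>R\<^esub> \<odot>\<^bsub>M\<^esub> x = x"

record ('a, 'b) bimodule = "('a, 'b) module" +
  rsmult :: "['b, 'a] \<Rightarrow> 'b" (infixl \<open>\<odot>\<^sub>r\<index>\<close> 70)

definition rhom ::
  "('a, 'x) ring_scheme \<Rightarrow> ('a, 'm, 'y) bimodule_scheme \<Rightarrow> ('a, 'p, 'z) bimodule_scheme \<Rightarrow>
    ('m \<Rightarrow> 'p) set"
  where "rhom A M P = {f \<in> carrier M \<rightarrow>\<^sub>E carrier P.
    (\<forall>x\<in>carrier M. \<forall>y\<in>carrier M. f (x \<oplus>\<^bsub>M\<^esub> y) = f x \<oplus>\<^bsub>P\<^esub> f y) \<and>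
    (\<forall>x\<in>carrier M. \<forall>a\<in>carrier A. f (x \<odot>\<^sub>r\<^bsub>M\<^esub> a) = f x \<odot>\<^sub>r\<^bsub>P\<^esub> a)}"

definition free_mod :: "('a, 'x) ring_scheme \<Rightarrow> nat \<Rightarrow> ('a, nat \<Rightarrow> 'a) bimodule"
  where "free_mod A n = \<lparr>carrier = {..<n} \<rightarrow>\<^sub>E carrier A, monoid.mult = undefined, one = undefined,
    ring.zero = (\<lambda>k\<in>{..<n}. \<zero>\<^bsub>A\<^esub>), add = (\<lambda>f g. \<lambda>k\<in>{..<n}. f k \<oplus>\<^bsub>A\<^esub> g k),
    smult = (\<lambda>a f. \<lambda>k\<in>{..<n}. a \<otimes>\<^bsub>A\<^esub> f k), rsmult = (\<lambda>f a. \<lambda>k\<in>{..<n}. f k \<otimes>\<^bsub>A\<^esub> a)\<rparr>"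

text \<open>Finitely generated projective right module: a direct summand of some $A^n$.\<close>

definition fgp_right :: "('a, 'x) ring_scheme \<Rightarrow> ('a, 'm, 'y) bimodule_scheme \<Rightarrow> bool"
  where "fgp_right A M \<longleftrightarrow>
    (\<exists>n. \<exists>i\<in>rhom A M (free_mod A n). \<exists>p\<in>rhom A (free_mod A n) M. \<forall>x\<in>carrier M. p (i x) = x)"


section \<open>Tensor products\<close>

text \<open>For an $A$-bimodule $M$ and a left $A$-module $N$ we build
  $\bigoplus_n M^{\otimes n}\otimes_A N$ as the free abelian group on all words
  $(x_1,\dots,x_n;y)$, of any length $n \ge 0$, with $x_i \in M$ and $y \in N$, modulo the subgroup
  generated by the usual relators.  Each relator involves words of one length only, so the
  quotient is graded by $n$, with degree $n$ part \<open>tdeg A M N n\<close> equal to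
  $M^{\otimes n}\otimes_A N$.  In degree 1 only the right action on $M$ is used, and this is the
  tensor product $M \otimes_A N$.  For $N = A$ the degree $n$ part is
  $M^{\otimes n}\otimes_A A = M^{\otimes n}$, with degree 0 part $A$.\<close>

type_synonym ('m, 'n) tensor = "('m list \<times> 'n \<Rightarrow>\<^sub>0 int) set"

definition twords :: "('a, 'm, 'y) bimodule_scheme \<Rightarrow> ('a, 'n, 'z) module_scheme \<Rightarrow> ('m list \<times> 'n) set"
  where "twords M N = {(xs, y). set xs \<subseteq> carrier M \<and> y \<in> carrier N}"

definition trels ::
  "('a, 'x) ring_scheme \<Rightarrow> ('a, 'm, 'y) bimodule_scheme \<Rightarrow> ('a, 'n, 'z) module_scheme \<Rightarrow>
    ('m list \<times> 'n \<Rightarrow>\<^sub>0 int) set"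
  where "trels A M N =
     {frag_of (xs @ (x \<oplus>\<^bsub>M\<^esub> x') # zs, y) - frag_of (xs @ x # zs, y) - frag_of (xs @ x' # zs, y)
      | xs x x' zs y. set xs \<subseteq> carrier M \<and> x \<in> carrier M \<and> x' \<in> carrier M \<and>
                      set zs \<subseteq> carrier M \<and> y \<in> carrier N}
   \<union> {frag_of (xs, y \<oplus>\<^bsub>N\<^esub> y') - frag_of (xs, y) - frag_of (xs, y')
      | xs y y'. set xs \<subseteq> carrier M \<and> y \<in> carrier N \<and> y' \<in> carrier N}
   \<union> {frag_of (xs @ (x \<odot>\<^sub>r\<^bsub>M\<^esub> a) # x' # zs, y) - frag_of (xs @ x # (a \<odot>\<^bsub>M\<^esub> x') # zs, y)
      | xs x a x' zs y. set xs \<subseteq> carrier M \<and> x \<in> carrier M \<and> a \<in> carrier A \<and> x' \<in> carrier M \<and>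
                        set zs \<subseteq> carrier M \<and> y \<in> carrier N}
   \<union> {frag_of (xs @ [x \<odot>\<^sub>r\<^bsub>M\<^esub> a], y) - frag_of (xs @ [x], a \<odot>\<^bsub>N\<^esub> y)
      | xs x a y. set xs \<subseteq> carrier M \<and> x \<in> carrier M \<and> a \<in> carrier A \<and> y \<in> carrier N}"

definition tgroup ::
  "('a, 'x) ring_scheme \<Rightarrow> ('a, 'm, 'y) bimodule_scheme \<Rightarrow> ('a, 'n, 'z) module_scheme \<Rightarrow>
    ('m, 'n) tensor monoid"
  where "tgroup A M N =
    free_Abelian_group (twords M N) Mod
      generate (free_Abelian_group (twords M N)) (trels A M N)"

definition tclass ::
  "('a, 'x) ring_scheme \<Rightarrow> ('a, 'm, 'y) bimodule_scheme \<Rightarrow> ('a, 'n, 'z) module_scheme \<Rightarrow>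
    ('m list \<times> 'n \<Rightarrow>\<^sub>0 int) \<Rightarrow> ('m, 'n) tensor"
  where "tclass A M N c =
    generate (free_Abelian_group (twords M N)) (trels A M N) #>\<^bsub>free_Abelian_group (twords M N)\<^esub> c"

definition tpure ::
  "('a, 'x) ring_scheme \<Rightarrow> ('a, 'm, 'y) bimodule_scheme \<Rightarrow> ('a, 'n, 'z) module_scheme \<Rightarrow>
    'm list \<Rightarrow> 'n \<Rightarrow> ('m, 'n) tensor"
  where "tpure A M N xs y = tclass A M N (frag_of (xs, y))"

definition tdeg ::
  "('a, 'x) ring_scheme \<Rightarrow> ('a, 'm, 'y) bimodule_scheme \<Rightarrow> ('a, 'n, 'z) module_scheme \<Rightarrow>
    nat \<Rightarrow> ('m, 'n) tensor set"
  where "tdeg A M N n =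
    {tclass A M N c | c. Poly_Mapping.keys c \<subseteq> {(xs, y) \<in> twords M N. length xs = n}}"

text \<open>The left action is $a(x_1\otimes\dots\otimes x_n\otimes y) = ax_1\otimes\dots\otimes y$.  Here
  and in \<open>tlift\<close> any representative of a class may be chosen.\<close>

fun word_smult ::
  "('a, 'm, 'y) bimodule_scheme \<Rightarrow> ('a, 'n, 'z) module_scheme \<Rightarrow> 'a \<Rightarrow> 'm list \<times> 'n \<Rightarrow> 'm list \<times> 'n"
  where
    "word_smult M N a ([], y) = ([], a \<odot>\<^bsub>N\<^esub> y)"
  | "word_smult M N a (x # xs, y) = ((a \<odot>\<^bsub>M\<^esub> x) # xs, y)"

definition tmod ::
  "('a, 'x) ring_scheme \<Rightarrow> ('a, 'm, 'y) bimodule_scheme \<Rightarrow> ('a, 'n, 'z) module_scheme \<Rightarrow>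
    ('a, ('m, 'n) tensor) module"
  where "tmod A M N = \<lparr>carrier = carrier (tgroup A M N), monoid.mult = undefined, one = undefined,
    ring.zero = one (tgroup A M N), add = monoid.mult (tgroup A M N),
    smult = (\<lambda>a X. tclass A M N
      (frag_extend (\<lambda>w. frag_of (word_smult M N a w)) (SOME c. c \<in> X)))\<rparr>"

text \<open>The additive map on classes induced by a map \<open>f\<close> on words which is additive in each
  argument and $A$-balanced; \<open>P\<close> is the target.\<close>

definition tlift ::
  "('p, 'x) ring_scheme \<Rightarrow> ('m list \<Rightarrow> 'n \<Rightarrow> 'p) \<Rightarrow> ('m, 'n) tensor \<Rightarrow> 'p"
  where "tlift P f X = (let c = (SOME c. c \<in> X) in
    finsum P (\<lambda>(xs, y). [Poly_Mapping.lookup c (xs, y)] \<cdot>\<^bsub>P\<^esub> f xs y) (Poly_Mapping.keys c))"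

text \<open>\<open>tprepend A M N zs X\<close> is $z_1\otimes\dots\otimes z_k\otimes X$, and \<open>tcat A M N X Y\<close> is
  $X \otimes Y$ for $X \in \bigoplus_n M^{\otimes n}$ and
  $Y \in \bigoplus_n M^{\otimes n}\otimes_A N$.\<close>

definition tprepend ::
  "('a, 'x) ring_scheme \<Rightarrow> ('a, 'm, 'y) bimodule_scheme \<Rightarrow> ('a, 'n, 'z) module_scheme \<Rightarrow>
    'm list \<Rightarrow> ('m, 'n) tensor \<Rightarrow> ('m, 'n) tensor"
  where "tprepend A M N zs = tlift (tmod A M N) (\<lambda>xs y. tpure A M N (zs @ xs) y)"

definition tcat ::
  "('a, 'x) ring_scheme \<Rightarrow> ('a, 'm, 'y) bimodule_scheme \<Rightarrow> ('a, 'n, 'z) module_scheme \<Rightarrow>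
    ('m, 'a) tensor \<Rightarrow> ('m, 'n) tensor \<Rightarrow> ('m, 'n) tensor"
  where "tcat A M N X Y =
    tlift (tmod A M N) (\<lambda>xs a. tprepend A M N xs (a \<odot>\<^bsub>tmod A M N\<^esub> Y)) X"


section \<open>Differential graded algebras and vector fields\<close>

definition complex_ring :: "complex ring"
  where "complex_ring = \<lparr>carrier = UNIV, monoid.mult = (*), one = 1, ring.zero = 0, add = (+)\<rparr>"

text \<open>Here \<open>mult\<close> is the wedge product, \<open>smult\<close> the action of the complex numbers,
  \<open>hpart C n\<close> is $\Omega^n A$ and \<open>dif\<close> is $\mathrm{d}$.\<close>

record 'w dga = "(complex, 'w) module" +
  hpart :: "nat \<Rightarrow> 'w set"
  dif :: "'w \<Rightarrow> 'w"

locale dga = ring C + cmod: module complex_ring C for C :: "('w, 'x) dga_scheme" (structure) +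
  assumes smult_mult:
      "\<lbrakk>x \<in> carrier C; y \<in> carrier C\<rbrakk> \<Longrightarrow> (c \<odot> x) \<otimes> y = c \<odot> (x \<otimes> y)"
      "\<lbrakk>x \<in> carrier C; y \<in> carrier C\<rbrakk> \<Longrightarrow> x \<otimes> (c \<odot> y) = c \<odot> (x \<otimes> y)"
    and hpart_submodule: "submodule (hpart C n) complex_ring C"
    and direct_sum: "x \<in> carrier C \<Longrightarrow>
      \<exists>!f. (\<forall>n. f n \<in> hpart C n) \<and> finite {n. f n \<noteq> \<zero>} \<and> x = (\<Oplus>n\<in>{n. f n \<noteq> \<zero>}. f n)"
    and one_hpart: "\<one> \<in> hpart C 0"
    and mult_hpart: "\<lbrakk>x \<in> hpart C m; y \<in> hpart C n\<rbrakk> \<Longrightarrow> x \<otimes> y \<in> hpart C (m + n)"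
    and dif_hpart: "x \<in> hpart C n \<Longrightarrow> dif C x \<in> hpart C (Suc n)"
    and dif_add: "\<lbrakk>x \<in> carrier C; y \<in> carrier C\<rbrakk> \<Longrightarrow> dif C (x \<oplus> y) = dif C x \<oplus> dif C y"
    and dif_smult: "x \<in> carrier C \<Longrightarrow> dif C (c \<odot> x) = c \<odot> dif C x"
    and dif_dif: "x \<in> carrier C \<Longrightarrow> dif C (dif C x) = \<zero>"
    and leibniz: "\<lbrakk>x \<in> hpart C n; y \<in> carrier C\<rbrakk> \<Longrightarrow>
      dif C (x \<otimes> y) = dif C x \<otimes> y \<oplus> (- 1) ^ n \<odot> (x \<otimes> dif C y)"
    and generated: "carrier C = generate_ring C (hpart C 0 \<union> hpart C 1)"
    and forms1: "hpart C 1 = generate (add_monoid C) {a \<otimes> dif C b | a b. a \<in> hpart C 0 \<and> b \<in> hpart C 0}"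

text \<open>\<open>Form C n\<close> is the $A$-bimodule $\Omega^n A$.  \<open>Form C 0\<close> serves both as the algebra $A$ and
  as $A$ regarded as a bimodule over itself.\<close>

definition Form :: "('w, 'x) dga_scheme \<Rightarrow> nat \<Rightarrow> ('w, 'w) bimodule"
  where "Form C n = \<lparr>carrier = hpart C n, monoid.mult = monoid.mult C, one = one C,
    ring.zero = ring.zero C, add = add C,
    smult = monoid.mult C, rsmult = monoid.mult C\<rparr>"

definition Vec :: "('w, 'x) dga_scheme \<Rightarrow> ('w, 'w \<Rightarrow> 'w) bimodule"
  where "Vec C = \<lparr>carrier = rhom (Form C 0) (Form C 1) (Form C 0),
    monoid.mult = undefined, one = undefined,
    ring.zero = (\<lambda>\<xi>\<in>hpart C 1. \<zero>\<^bsub>C\<^esub>), add = (\<lambda>u v. \<lambda>\<xi>\<in>hpart C 1. u \<xi> \<oplus>\<^bsub>C\<^esub> v \<xi>),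
    smult = (\<lambda>a v. \<lambda>\<xi>\<in>hpart C 1. a \<otimes>\<^bsub>C\<^esub> v \<xi>), rsmult = (\<lambda>v a. \<lambda>\<xi>\<in>hpart C 1. v (a \<otimes>\<^bsub>C\<^esub> \<xi>))\<rparr>"

text \<open>\<open>TForm C N\<close> is $\bigoplus_n \Omega^{\otimes n}A\otimes_A N$ and \<open>TVec C\<close> is
  $\mathcal{T}\mathrm{Vec}A = \bigoplus_n \mathrm{Vec}^{\otimes n}A$, as left $A$-modules.\<close>

abbreviation TForm :: "('w, 'x) dga_scheme \<Rightarrow> ('w, 'n, 'z) module_scheme \<Rightarrow> ('w, ('w, 'n) tensor) module"
  where "TForm C N \<equiv> tmod (Form C 0) (Form C 1) N"

abbreviation fpure :: "('w, 'x) dga_scheme \<Rightarrow> ('w, 'n, 'z) module_scheme \<Rightarrow> 'w list \<Rightarrow> 'n \<Rightarrow> ('w, 'n) tensor"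
  where "fpure C N \<equiv> tpure (Form C 0) (Form C 1) N"

abbreviation fdeg :: "('w, 'x) dga_scheme \<Rightarrow> ('w, 'n, 'z) module_scheme \<Rightarrow> nat \<Rightarrow> ('w, 'n) tensor set"
  where "fdeg C N \<equiv> tdeg (Form C 0) (Form C 1) N"

abbreviation TVec :: "('w, 'x) dga_scheme \<Rightarrow> ('w, ('w \<Rightarrow> 'w, 'w) tensor) module"
  where "TVec C \<equiv> tmod (Form C 0) (Vec C) (Form C 0)"

abbreviation vpure :: "('w, 'x) dga_scheme \<Rightarrow> ('w \<Rightarrow> 'w) list \<Rightarrow> 'w \<Rightarrow> ('w \<Rightarrow> 'w, 'w) tensor"
  where "vpure C \<equiv> tpure (Form C 0) (Vec C) (Form C 0)"

text \<open>The right action of $b \in A$ on $\bigoplus_n \Omega^{\otimes n}A$.\<close>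

definition fract :: "('w, 'x) dga_scheme \<Rightarrow> ('w, 'w) tensor \<Rightarrow> 'w \<Rightarrow> ('w, 'w) tensor"
  where "fract C X b = tlift (TForm C (Form C 0)) (\<lambda>xs a. fpure C (Form C 0) xs (a \<otimes>\<^bsub>C\<^esub> b)) X"

text \<open>$(\mathrm{ev}\otimes\mathrm{id})(v\otimes X)$ for $X \in \Omega^{\otimes n}A$, $n \ge 1$.\<close>

definition contract :: "('w, 'x) dga_scheme \<Rightarrow> ('w \<Rightarrow> 'w) \<Rightarrow> ('w, 'w) tensor \<Rightarrow> ('w, 'w) tensor"
  where "contract C v = tlift (TForm C (Form C 0)) (\<lambda>xs a. case xs of
      [] \<Rightarrow> \<zero>\<^bsub>TForm C (Form C 0)\<^esub>
    | \<xi> # zs \<Rightarrow> v \<xi> \<odot>\<^bsub>TForm C (Form C 0)\<^esub> fpure C (Form C 0) zs a)"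


section \<open>Bimodule covariant derivatives\<close>

text \<open>A right bimodule covariant derivative \<open>(box, sinv)\<close> on $\Omega^1 A$, with \<open>sinv\<close> standing for
  $\sigma^{-1}$, and a dual basis \<open>bform\<close>, \<open>bvec\<close> of $\Omega^1 A$, indexed by \<open>{..<bn}\<close>; the
  existence of a dual basis says that $\Omega^1 A$ is finitely generated projective.\<close>

record 'w conn = "'w dga" +
  bn :: nat
  bform :: "nat \<Rightarrow> 'w"
  bvec :: "nat \<Rightarrow> 'w \<Rightarrow> 'w"
  box :: "'w \<Rightarrow> ('w, 'w) tensor"
  sinv :: "('w, 'w) tensor \<Rightarrow> ('w, 'w) tensor"

locale bimodule_connection = dga C for C :: "('w, 'x) conn_scheme" (structure) +
  assumes bform: "i < bn C \<Longrightarrow> bform C i \<in> hpart C 1"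
    and bvec: "i < bn C \<Longrightarrow> bvec C i \<in> carrier (Vec C)"
    and dual_basis: "\<xi> \<in> hpart C 1 \<Longrightarrow> \<xi> = (\<Oplus>i\<in>{..<bn C}. bform C i \<otimes> bvec C i \<xi>)"
    and sinv_closed: "X \<in> fdeg C (Form C 0) 2 \<Longrightarrow> sinv C X \<in> fdeg C (Form C 0) 2"
    and sinv_add: "\<lbrakk>X \<in> fdeg C (Form C 0) 2; Y \<in> fdeg C (Form C 0) 2\<rbrakk> \<Longrightarrow>
      sinv C (X \<oplus>\<^bsub>TForm C (Form C 0)\<^esub> Y) = sinv C X \<oplus>\<^bsub>TForm C (Form C 0)\<^esub> sinv C Y"
    and sinv_smult: "\<lbrakk>a \<in> hpart C 0; X \<in> fdeg C (Form C 0) 2\<rbrakk> \<Longrightarrow>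
      sinv C (a \<odot>\<^bsub>TForm C (Form C 0)\<^esub> X) = a \<odot>\<^bsub>TForm C (Form C 0)\<^esub> sinv C X"
    and sinv_rsmult: "\<lbrakk>a \<in> hpart C 0; X \<in> fdeg C (Form C 0) 2\<rbrakk> \<Longrightarrow>
      sinv C (fract C X a) = fract C (sinv C X) a"
    and box_closed: "\<xi> \<in> hpart C 1 \<Longrightarrow> box C \<xi> \<in> fdeg C (Form C 0) 2"
    and box_add: "\<lbrakk>\<xi> \<in> hpart C 1; \<eta> \<in> hpart C 1\<rbrakk> \<Longrightarrow>
      box C (\<xi> \<oplus> \<eta>) = box C \<xi> \<oplus>\<^bsub>TForm C (Form C 0)\<^esub> box C \<eta>"
    and box_right: "\<lbrakk>\<xi> \<in> hpart C 1; a \<in> hpart C 0\<rbrakk> \<Longrightarrow>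
      box C (\<xi> \<otimes> a) =
        fract C (box C \<xi>) a \<oplus>\<^bsub>TForm C (Form C 0)\<^esub> fpure C (Form C 0) [\<xi>, dif C a] \<one>"
    and box_left: "\<lbrakk>\<xi> \<in> hpart C 1; a \<in> hpart C 0\<rbrakk> \<Longrightarrow>
      box C (a \<otimes> \<xi>) =
        a \<odot>\<^bsub>TForm C (Form C 0)\<^esub> box C \<xi> \<oplus>\<^bsub>TForm C (Form C 0)\<^esub>
          sinv C (fpure C (Form C 0) [dif C a, \<xi>] \<one>)"

text \<open>$\mathrm{id}^{\otimes n}\otimes\sigma^{-1}$ on $\Omega^{\otimes n+2}A$.\<close>

definition sinv_last :: "('w, 'x) conn_scheme \<Rightarrow> nat \<Rightarrow> ('w, 'w) tensor \<Rightarrow> ('w, 'w) tensor"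
  where "sinv_last C n = tlift (TForm C (Form C 0)) (\<lambda>xs a.
    if length xs = n + 2
    then tprepend (Form C 0) (Form C 1) (Form C 0) (take n xs)
           (sinv C (fpure C (Form C 0) (drop n xs) a))
    else \<zero>\<^bsub>TForm C (Form C 0)\<^esub>)"

text \<open>\<open>boxF_word C [\<xi>\<^sub>n, \<dots>, \<xi>\<^sub>1] a\<close> is
  $\square^{\langle n\rangle}(\xi_1\otimes\dots\otimes\xi_n a)$; note the reversed list.\<close>

fun boxF_word :: "('w, 'x) conn_scheme \<Rightarrow> 'w list \<Rightarrow> 'w \<Rightarrow> ('w, 'w) tensor"
  where
    "boxF_word C [] a = fpure C (Form C 0) [dif C a] \<one>\<^bsub>C\<^esub>"
  | "boxF_word C (\<xi> # rs) a =
      tprepend (Form C 0) (Form C 1) (Form C 0) (rev rs) (box C (\<xi> \<otimes>\<^bsub>C\<^esub> a))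
      \<oplus>\<^bsub>TForm C (Form C 0)\<^esub>
      sinv_last C (length rs)
        (tcat (Form C 0) (Form C 1) (Form C 0) (boxF_word C rs \<one>\<^bsub>C\<^esub>)
          (fpure C (Form C 0) [\<xi> \<otimes>\<^bsub>C\<^esub> a] \<one>\<^bsub>C\<^esub>))"

definition boxF :: "('w, 'x) conn_scheme \<Rightarrow> ('w, 'w) tensor \<Rightarrow> ('w, 'w) tensor"
  where "boxF C = tlift (TForm C (Form C 0)) (\<lambda>xs a. boxF_word C (rev xs) a)"

text \<open>The dual connection on vector fields: the unique \<open>X\<close> in
  $\Omega^1A\otimes_A\mathrm{Vec}A$ with
  $\mathrm{d}(v(\xi)) = (\mathrm{id}\otimes\mathrm{ev})(X\otimes\xi)
    + (\mathrm{ev}\otimes\mathrm{id})(v\otimes\square\xi)$ for all $\xi$.\<close>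

definition boxV :: "('w, 'x) conn_scheme \<Rightarrow> ('w \<Rightarrow> 'w) \<Rightarrow> ('w, 'w \<Rightarrow> 'w) tensor"
  where "boxV C v = (THE X. X \<in> fdeg C (Vec C) 1 \<and>
    (\<forall>\<xi>\<in>hpart C 1.
      fpure C (Form C 0) [dif C (v \<xi>)] \<one>\<^bsub>C\<^esub> =
        tlift (TForm C (Form C 0)) (\<lambda>xs u. fpure C (Form C 0) xs (u \<xi>)) X
        \<oplus>\<^bsub>TForm C (Form C 0)\<^esub> contract C v (box C \<xi>)))"

definition sig :: "('w, 'x) conn_scheme \<Rightarrow> ('w \<Rightarrow> 'w) \<Rightarrow> 'w \<Rightarrow> ('w, 'w \<Rightarrow> 'w) tensor"
  where "sig C v \<xi> = finsum (TForm C (Vec C)) (\<lambda>i.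
    tlift (TForm C (Vec C)) (\<lambda>xs a. fpure C (Vec C) xs (a \<odot>\<^bsub>Vec C\<^esub> bvec C i))
      (contract C v (sinv C (fpure C (Form C 0) [\<xi>, bform C i] \<one>\<^bsub>C\<^esub>)))) {..<bn C}"

text \<open>$X \otimes \underline{w}$ for $X \in \Omega^1A\otimes_A\mathrm{Vec}A$ and
  $\underline{w} \in \mathcal{T}\mathrm{Vec}A$.\<close>

definition vattach ::
  "('w, 'x) dga_scheme \<Rightarrow> ('w, 'w \<Rightarrow> 'w) tensor \<Rightarrow> ('w \<Rightarrow> 'w, 'w) tensor \<Rightarrow>
    ('w, ('w \<Rightarrow> 'w, 'w) tensor) tensor"
  where "vattach C X w = tlift (TForm C (TVec C)) (\<lambda>xs v.
    fpure C (TVec C) xs (tprepend (Form C 0) (Vec C) (Form C 0) [v] w)) X"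

text \<open>$\square^{\langle n\rangle}(u_1\otimes\dots\otimes u_n a)$, and the resulting map
  $\mathcal{T}\mathrm{Vec}A\to\Omega^1A\otimes_A\mathcal{T}\mathrm{Vec}A$.\<close>

fun boxT_word ::
  "('w, 'x) conn_scheme \<Rightarrow> ('w \<Rightarrow> 'w) list \<Rightarrow> 'w \<Rightarrow> ('w, ('w \<Rightarrow> 'w, 'w) tensor) tensor"
  where
    "boxT_word C [] a = fpure C (TVec C) [dif C a] (vpure C [] \<one>\<^bsub>C\<^esub>)"
  | "boxT_word C (u # us) a =
      vattach C (boxV C u) (vpure C us a) \<oplus>\<^bsub>TForm C (TVec C)\<^esub>
      tlift (TForm C (TVec C)) (\<lambda>xs w. case xs of
          [\<xi>] \<Rightarrow> vattach C (sig C u \<xi>) w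
        | _ \<Rightarrow> \<zero>\<^bsub>TForm C (TVec C)\<^esub>) (boxT_word C us a)"

definition boxT ::
  "('w, 'x) conn_scheme \<Rightarrow> ('w \<Rightarrow> 'w, 'w) tensor \<Rightarrow> ('w, ('w \<Rightarrow> 'w, 'w) tensor) tensor"
  where "boxT C = tlift (TForm C (TVec C)) (boxT_word C)"

text \<open>$(\alpha\otimes\mathrm{id})X$ for $X \in \Omega^nA\otimes_A N$ and a right module map
  $\alpha : \Omega^nA \to A$ (used for $n = 1, 2$).\<close>

definition apply_first :: "('a, 'n, 'z) module_scheme \<Rightarrow> ('w \<Rightarrow> 'a) \<Rightarrow> ('w, 'n) tensor \<Rightarrow> 'n"
  where "apply_first N \<alpha> = tlift N (\<lambda>xs y. case xs of [\<omega>] \<Rightarrow> \<alpha> \<omega> \<odot>\<^bsub>N\<^esub> y | _ \<Rightarrow> \<zero>\<^bsub>N\<^esub>)"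


section \<open>The product on the tensor algebra of vector fields\<close>

definition bullet1 ::
  "('w, 'x) conn_scheme \<Rightarrow> ('w \<Rightarrow> 'w) \<Rightarrow> ('w \<Rightarrow> 'w, 'w) tensor \<Rightarrow> ('w \<Rightarrow> 'w, 'w) tensor"
  where "bullet1 C u w =
    tprepend (Form C 0) (Vec C) (Form C 0) [u] w \<oplus>\<^bsub>TVec C\<^esub> apply_first (TVec C) u (boxT C w)"

text \<open>\<open>bullet_deg C n v w\<close> is $\underline{v}\bullet\underline{w}$ for
  $\underline{v} \in \mathrm{Vec}^{\otimes n}A$, by recursion on $n$: on $a \in A$ it is
  $a\underline{w}$, and
  $(u\otimes\underline{v})\bullet\underline{w} = u\bullet(\underline{v}\bullet\underline{w})
    - ((\mathrm{ev}\otimes\mathrm{id})(u\otimes\square\underline{v}))\bullet\underline{w}$.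
  For $n = 1$ this agrees with \<open>bullet1\<close>, which is $u\bullet\underline{w}$.\<close>

primrec bullet_deg ::
  "('w, 'x) conn_scheme \<Rightarrow> nat \<Rightarrow> ('w \<Rightarrow> 'w, 'w) tensor \<Rightarrow> ('w \<Rightarrow> 'w, 'w) tensor \<Rightarrow>
    ('w \<Rightarrow> 'w, 'w) tensor"
  where
    "bullet_deg C 0 = (\<lambda>v w. tlift (TVec C) (\<lambda>us a.
      if us = [] then a \<odot>\<^bsub>TVec C\<^esub> w else \<zero>\<^bsub>TVec C\<^esub>) v)"
  | "bullet_deg C (Suc n) = (\<lambda>v w. tlift (TVec C) (\<lambda>us a.
      if length us = Suc n
      then bullet1 C (hd us) (bullet_deg C n (vpure C (tl us) a) w)
        \<ominus>\<^bsub>TVec C\<^esub>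
        bullet_deg C n (apply_first (TVec C) (hd us) (boxT C (vpure C (tl us) a))) w
      else \<zero>\<^bsub>TVec C\<^esub>) v)"

definition bullet ::
  "('w, 'x) conn_scheme \<Rightarrow> ('w \<Rightarrow> 'w, 'w) tensor \<Rightarrow> ('w \<Rightarrow> 'w, 'w) tensor \<Rightarrow> ('w \<Rightarrow> 'w, 'w) tensor"
  where "bullet C v w = tlift (TVec C) (\<lambda>us a. bullet_deg C (length us) (vpure C us a) w) v"

definition TVec_alg :: "('w, 'x) conn_scheme \<Rightarrow> ('w \<Rightarrow> 'w, 'w) tensor ring"
  where "TVec_alg C = \<lparr>carrier = carrier (TVec C), monoid.mult = bullet C, one = vpure C [] \<one>\<^bsub>C\<^esub>,
    ring.zero = \<zero>\<^bsub>TVec C\<^esub>, add = add (TVec C)\<rparr>"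


section \<open>The algebra of differential operators\<close>

definition curv_elem :: "('w, 'x) conn_scheme \<Rightarrow> ('w, ('w \<Rightarrow> 'w, 'w) tensor) tensor"
  where "curv_elem C = (let P = tmod (Form C 0) (Form C 2) (TVec C) in
    finsum P (\<lambda>i. tpure (Form C 0) (Form C 2) (TVec C)
        [dif C (bform C i)] (vpure C [bvec C i] \<one>\<^bsub>C\<^esub>)) {..<bn C}
    \<ominus>\<^bsub>P\<^esub>
    finsum P (\<lambda>(i, j). tpure (Form C 0) (Form C 2) (TVec C)
        [bform C i \<otimes>\<^bsub>C\<^esub> bform C j]
        (bullet C (vpure C [bvec C j] \<one>\<^bsub>C\<^esub>) (vpure C [bvec C i] \<one>\<^bsub>C\<^esub>)))
      ({..<bn C} \<times> {..<bn C}))"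

definition curv_hat :: "('w, 'x) conn_scheme \<Rightarrow> ('w \<Rightarrow> 'w) \<Rightarrow> ('w \<Rightarrow> 'w, 'w) tensor"
  where "curv_hat C \<alpha> = apply_first (TVec C) \<alpha> (curv_elem C)"

definition W_ideal :: "('w, 'x) conn_scheme \<Rightarrow> ('w \<Rightarrow> 'w, 'w) tensor set"
  where "W_ideal C = Idl\<^bsub>TVec_alg C\<^esub> (curv_hat C ` rhom (Form C 0) (Form C 2) (Form C 0))"

definition D_alg :: "('w, 'x) conn_scheme \<Rightarrow> ('w \<Rightarrow> 'w, 'w) tensor set ring"
  where "D_alg C = TVec_alg C Quot W_ideal C"

definition D_class :: "('w, 'x) conn_scheme \<Rightarrow> ('w \<Rightarrow> 'w, 'w) tensor \<Rightarrow> ('w \<Rightarrow> 'w, 'w) tensor set"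
  where "D_class C v = W_ideal C +>\<^bsub>TVec_alg C\<^esub> v"


section \<open>Left covariant derivatives, their curvature and the action\<close>

definition left_cov_deriv ::
  "('w, 'x) dga_scheme \<Rightarrow> ('w, 'e, 'z) module_scheme \<Rightarrow> ('e \<Rightarrow> ('w, 'e) tensor) \<Rightarrow> bool"
  where "left_cov_deriv C E nabla \<longleftrightarrow>
    (\<forall>e\<in>carrier E. nabla e \<in> fdeg C E 1) \<and>
    (\<forall>e\<in>carrier E. \<forall>f\<in>carrier E. nabla (e \<oplus>\<^bsub>E\<^esub> f) = nabla e \<oplus>\<^bsub>TForm C E\<^esub> nabla f) \<and>
    (\<forall>a\<in>hpart C 0. \<forall>e\<in>carrier E.
      nabla (a \<odot>\<^bsub>E\<^esub> e) = fpure C E [dif C a] e \<oplus>\<^bsub>TForm C E\<^esub> a \<odot>\<^bsub>TForm C E\<^esub> nabla e)"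

definition curvature ::
  "('w, 'x) dga_scheme \<Rightarrow> ('w, 'e, 'z) module_scheme \<Rightarrow> ('e \<Rightarrow> ('w, 'e) tensor) \<Rightarrow>
    'e \<Rightarrow> ('w, 'e) tensor"
  where "curvature C E nabla e =
    (let P = tmod (Form C 0) (Form C 2) E; pr = tpure (Form C 0) (Form C 2) E in
     tlift P (\<lambda>xs f. case xs of
         [\<xi>] \<Rightarrow> pr [dif C \<xi>] f \<ominus>\<^bsub>P\<^esub>
           tlift P (\<lambda>ys g. case ys of [\<eta>] \<Rightarrow> pr [\<xi> \<otimes>\<^bsub>C\<^esub> \<eta>] g | _ \<Rightarrow> \<zero>\<^bsub>P\<^esub>) (nabla f)
       | _ \<Rightarrow> \<zero>\<^bsub>P\<^esub>) (nabla e))"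

definition zero_curvature ::
  "('w, 'x) dga_scheme \<Rightarrow> ('w, 'e, 'z) module_scheme \<Rightarrow> ('e \<Rightarrow> ('w, 'e) tensor) \<Rightarrow> bool"
  where "zero_curvature C E nabla \<longleftrightarrow>
    (\<forall>e\<in>carrier E. curvature C E nabla e = \<zero>\<^bsub>tmod (Form C 0) (Form C 2) E\<^esub>)"

text \<open>$\square^{\langle n\rangle}\otimes\mathrm{id}_E + \mathrm{id}^{\otimes n}\otimes\nabla_E$ on
  $\Omega^{\otimes n}A\otimes_A E$.\<close>

definition nabla_step ::
  "('w, 'x) conn_scheme \<Rightarrow> ('w, 'e, 'z) module_scheme \<Rightarrow> ('e \<Rightarrow> ('w, 'e) tensor) \<Rightarrow>
    ('w, 'e) tensor \<Rightarrow> ('w, 'e) tensor"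
  where "nabla_step C E nabla = tlift (TForm C E) (\<lambda>xs e.
    tcat (Form C 0) (Form C 1) E (boxF C (fpure C (Form C 0) xs \<one>\<^bsub>C\<^esub>)) (fpure C E [] e)
    \<oplus>\<^bsub>TForm C E\<^esub> tprepend (Form C 0) (Form C 1) E xs (nabla e))"

fun nabla_pow ::
  "('w, 'x) conn_scheme \<Rightarrow> ('w, 'e, 'z) module_scheme \<Rightarrow> ('e \<Rightarrow> ('w, 'e) tensor) \<Rightarrow>
    nat \<Rightarrow> 'e \<Rightarrow> ('w, 'e) tensor"
  where
    "nabla_pow C E nabla 0 e = fpure C E [] e"
  | "nabla_pow C E nabla (Suc 0) e = nabla e"
  | "nabla_pow C E nabla (Suc (Suc n)) e = nabla_step C E nabla (nabla_pow C E nabla (Suc n) e)"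

text \<open>\<open>nested_ev C [v\<^sub>1, \<dots>, v\<^sub>n] a [\<xi>\<^sub>n, \<dots>, \<xi>\<^sub>1]\<close> is
  $\mathrm{ev}^{\langle n\rangle}(v_1\otimes\dots\otimes v_n a\otimes\xi_1\otimes\dots\otimes\xi_n)
   = v_1(v_2(\cdots v_n(a\xi_1)\cdots)\xi_n)$; note the reversed list.\<close>

fun nested_ev :: "('w, 'x) dga_scheme \<Rightarrow> ('w \<Rightarrow> 'w) list \<Rightarrow> 'w \<Rightarrow> 'w list \<Rightarrow> 'w"
  where
    "nested_ev C [] a [] = a"
  | "nested_ev C (v # vs) a (\<xi> # rs) = v (nested_ev C vs a rs \<otimes>\<^bsub>C\<^esub> \<xi>)"
  | "nested_ev C _ a _ = \<zero>\<^bsub>C\<^esub>"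

definition act ::
  "('w, 'x) conn_scheme \<Rightarrow> ('w, 'e, 'z) module_scheme \<Rightarrow> ('e \<Rightarrow> ('w, 'e) tensor) \<Rightarrow>
    ('w \<Rightarrow> 'w, 'w) tensor \<Rightarrow> 'e \<Rightarrow> 'e"
  where "act C E nabla v e = tlift E (\<lambda>us a.
    tlift E (\<lambda>xs f. nested_ev C us a (rev xs) \<odot>\<^bsub>E\<^esub> f) (nabla_pow C E nabla (length us) e)) v"

text \<open>An action of an algebra on the abelian group underlying \<open>E\<close> is a left module structure
  on that group.  For \<open>D_alg C\<close> the complex-linear structure needs no separate condition: both
  multiplication by scalars on \<open>E\<close> and the classes of scalars act through $A$.\<close>

definition with_action :: "('a, 'e, 'z) module_scheme \<Rightarrow> ('r \<Rightarrow> 'e \<Rightarrow> 'e) \<Rightarrow> ('r, 'e) module"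
  where "with_action E f = \<lparr>carrier = carrier E, monoid.mult = monoid.mult E, one = one E,
    ring.zero = ring.zero E, add = add E, smult = f\<rparr>"

definition defines_D_action ::
  "('w, 'x) conn_scheme \<Rightarrow> ('w, 'e, 'z) module_scheme \<Rightarrow> ('e \<Rightarrow> ('w, 'e) tensor) \<Rightarrow> bool"
  where "defines_D_action C E nabla \<longleftrightarrow>
    (\<exists>f. (\<forall>v\<in>carrier (TVec_alg C). \<forall>e\<in>carrier E. f (D_class C v) e = act C E nabla v e) \<and>
         left_module (D_alg C) (with_action E f))"

end

theory Submission
  imports Defs
begin

text \<open>
  The product $\bullet$ and the action on $E$ both have the form $\underline v\mapsto\rho(\underline v)$ with
  $\rho(u\otimes\underline v) = \rho(u)\rho(\underline v)
    - \rho((\mathrm{ev}\otimes\mathrm{id})(u\otimes\square\underline v))$.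
  By induction on the degree of $\underline v$ this recursion alone implies
  $\rho(\underline v\bullet\underline w) = \rho(\underline v)\rho(\underline w)$, which for left
  multiplication is the associativity of $\bullet$.  For the action on $E$ the recursion follows by applying
  $\nabla_E$ to $\underline v\triangleright e =
    (\mathrm{ev}^{\langle n\rangle}\otimes\mathrm{id})(\underline v\otimes\nabla_E^{(n)}e)$ and using the duality
  $\mathrm d\,\mathrm{ev}^{\langle n\rangle}(\underline v\otimes\omega) =
    (\mathrm{id}\otimes\mathrm{ev}^{\langle n\rangle})(\square\underline v\otimes\omega)
    + (\mathrm{ev}^{\langle n\rangle}\otimes\mathrm{id})(\underline v\otimes\square\omega)$.

  Since $\nabla_E e = \sum_i \xi_i\otimes u_i\triangleright e$, the element $\widehat{\mathcal R}(\alpha)$ acts as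
  $(\alpha\otimes\mathrm{id})R_E$.  Hence $\mathcal W$ acts by zero if $R_E = 0$, and conversely the maps
  $\alpha\otimes\mathrm{id}$ separate the elements of $\Omega^2A\otimes_A E$ if $\Omega^2A$ is finitely generated
  projective.\<close>

section \<open>Additive maps\<close>

text \<open>Nearly all maps in the definitions are \<open>tlift\<close>s of functions on words,
  evaluated at an arbitrarily chosen representative, so nothing can be computed until the word
  function is known to be additive and balanced. This obligation, more than the algebra, orders the
  proof. Balancing a letter \<open>u.a\<close> against \<open>a X\<close> in degree n + 1 calls for
  the linearity or the Leibniz rule in degree n; hence well-definedness and these rules are obtained
  together, by induction on the degree. The covariant derivative of vector fields is extended at the
  left end of a word, that of forms at the right end. Nested evaluation joins precisely these two
  ends, since the first vector field is applied to the last form. That is why a single induction can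
  unfold both recursions in the same step, and why the nesting cannot be replaced by a pairing in
  parallel order. The duality is proved for words of forms. As \<Omega>^1 has a dual basis, tensors
  of forms are separated by evaluation on vector fields, so that a function on words of forms is
  well defined as soon as its evaluations depend on the tensor alone.\<close>

definition ahom :: "('a, 'x) ring_scheme \<Rightarrow> ('b, 'y) ring_scheme \<Rightarrow> ('a \<Rightarrow> 'b) \<Rightarrow> bool"
  where "ahom P Q f \<longleftrightarrow> (\<forall>x\<in>carrier P. f x \<in> carrier Q) \<and>
    (\<forall>x\<in>carrier P. \<forall>y\<in>carrier P. f (x \<oplus>\<^bsub>P\<^esub> y) = f x \<oplus>\<^bsub>Q\<^esub> f y)"

text \<open>The additive subgroup generated by \<open>S\<close>, given inductively so that
  comparison of additive maps and membership of their values are proved by checking generators.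
  Homogeneous parts are described as such spans below.\<close>

inductive_set aspan :: "('a, 'x) ring_scheme \<Rightarrow> 'a set \<Rightarrow> 'a set"
  for P :: "('a, 'x) ring_scheme" and S :: "'a set"
  where
    zero: "\<zero>\<^bsub>P\<^esub> \<in> aspan P S"
  | base: "s \<in> S \<Longrightarrow> s \<in> aspan P S"
  | add: "\<lbrakk>x \<in> aspan P S; y \<in> aspan P S\<rbrakk> \<Longrightarrow> x \<oplus>\<^bsub>P\<^esub> y \<in> aspan P S"
  | neg: "x \<in> aspan P S \<Longrightarrow> \<ominus>\<^bsub>P\<^esub> x \<in> aspan P S"

lemma ahomI:
  assumes "\<And>x. x \<in> carrier P \<Longrightarrow> f x \<in> carrier Q"
    and "\<And>x y. \<lbrakk>x \<in> carrier P; y \<in> carrier P\<rbrakk> \<Longrightarrow> f (x \<oplus>\<^bsub>P\<^esub> y) = f x \<oplus>\<^bsub>Q\<^esub> f y"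
  shows "ahom P Q f"
  using assms by (simp add: ahom_def)

lemma ahom_closed: "\<lbrakk>ahom P Q f; x \<in> carrier P\<rbrakk> \<Longrightarrow> f x \<in> carrier Q"
  by (simp add: ahom_def)

lemma ahom_add: "\<lbrakk>ahom P Q f; x \<in> carrier P; y \<in> carrier P\<rbrakk> \<Longrightarrow> f (x \<oplus>\<^bsub>P\<^esub> y) = f x \<oplus>\<^bsub>Q\<^esub> f y"
  by (simp add: ahom_def)

lemma (in abelian_group) double_zero: "\<lbrakk>x \<in> carrier G; x \<oplus> x = x\<rbrakk> \<Longrightarrow> x = \<zero>"
  using add.l_cancel_one by blast

lemma ahom_zero:
  assumes "ahom P Q f" "abelian_group P" "abelian_group Q"
  shows "f \<zero>\<^bsub>P\<^esub> = \<zero>\<^bsub>Q\<^esub>"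
proof -
  interpret P: abelian_group P by fact
  interpret Q: abelian_group Q by fact
  have "f \<zero>\<^bsub>P\<^esub> \<oplus>\<^bsub>Q\<^esub> f \<zero>\<^bsub>P\<^esub> = f \<zero>\<^bsub>P\<^esub>"
    using ahom_add[OF assms(1), of "\<zero>\<^bsub>P\<^esub>" "\<zero>\<^bsub>P\<^esub>"] by simp
  then show ?thesis using ahom_closed[OF assms(1)] Q.double_zero by simp
qed

lemma ahom_neg:
  assumes "ahom P Q f" "abelian_group P" "abelian_group Q" "x \<in> carrier P"
  shows "f (\<ominus>\<^bsub>P\<^esub> x) = \<ominus>\<^bsub>Q\<^esub> f x"
proof -
  interpret P: abelian_group P by fact
  interpret Q: abelian_group Q by fact
  have "f (\<ominus>\<^bsub>P\<^esub> x) \<oplus>\<^bsub>Q\<^esub> f x = \<zero>\<^bsub>Q\<^esub>"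
    using ahom_add[OF assms(1), of "\<ominus>\<^bsub>P\<^esub> x" x] assms ahom_zero[OF assms(1-3)] by (simp add: P.l_neg)
  then show ?thesis using ahom_closed[OF assms(1)] assms(4)
    by (simp add: Q.minus_equality)
qed

lemma ahom_minus:
  assumes "ahom P Q f" "abelian_group P" "abelian_group Q" "x \<in> carrier P" "y \<in> carrier P"
  shows "f (x \<ominus>\<^bsub>P\<^esub> y) = f x \<ominus>\<^bsub>Q\<^esub> f y"
  using assms ahom_add[OF assms(1), of x "\<ominus>\<^bsub>P\<^esub> y"] ahom_neg[OF assms(1-3,5)]
  by (simp add: a_minus_def abelian_group.a_inv_closed)

lemma ahom_finsum:
  assumes "ahom P Q f" "abelian_group P" "abelian_group Q" "g \<in> I \<rightarrow> carrier P"
  shows "f (finsum P g I) = finsum Q (\<lambda>i. f (g i)) I"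
proof -
  interpret P: abelian_group P by fact
  interpret Q: abelian_group Q by fact
  show ?thesis
    using assms(4)
  proof (induction I rule: infinite_finite_induct)
    case (insert i I)
    then show ?case
      by (simp add: ahom_closed[OF assms(1)] ahom_add[OF assms(1)] Pi_iff)
  qed (simp_all add: ahom_zero[OF assms(1-3)])
qed

lemma ahom_comp: "\<lbrakk>ahom P Q f; ahom Q R g\<rbrakk> \<Longrightarrow> ahom P R (\<lambda>x. g (f x))"
  by (simp add: ahom_def)

lemma ahom_id: "ahom P P (\<lambda>x. x)"
  by (simp add: ahom_def)

lemma ahom_sum:
  assumes "abelian_group Q" "ahom P Q f" "ahom P Q g"
  shows "ahom P Q (\<lambda>x. f x \<oplus>\<^bsub>Q\<^esub> g x)"
proof -
  interpret Q: abelian_group Q by fact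
  show ?thesis using assms(2,3) by (auto simp: ahom_def Q.a_ac)
qed

lemma ahom_uminus:
  assumes "abelian_group Q" "ahom P Q f"
  shows "ahom P Q (\<lambda>x. \<ominus>\<^bsub>Q\<^esub> f x)"
proof -
  interpret Q: abelian_group Q by fact
  show ?thesis using assms(2) by (auto simp: ahom_def Q.minus_add)
qed

lemma ahom_diff: "\<lbrakk>abelian_group Q; ahom P Q f; ahom P Q g\<rbrakk> \<Longrightarrow> ahom P Q (\<lambda>x. f x \<ominus>\<^bsub>Q\<^esub> g x)"
  unfolding a_minus_def by (intro ahom_sum ahom_uminus)

lemma ahom_const_zero: "abelian_group Q \<Longrightarrow> ahom P Q (\<lambda>x. \<zero>\<^bsub>Q\<^esub>)"
  by (simp add: ahom_def abelian_group.axioms(1) abelian_monoid.zero_closed abelian_monoid.l_zero)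

lemma (in abelian_group) aspan_closed:
  assumes "S \<subseteq> carrier G" "x \<in> aspan G S" shows "x \<in> carrier G"
  using assms(2,1) by induction auto

lemma aspan_mono:
  assumes "S \<subseteq> T" "x \<in> aspan P S" shows "x \<in> aspan P T"
  using assms(2,1) by induction (auto intro: aspan.intros)

lemma ahom_eq_on_aspan:
  assumes "ahom P Q f" "ahom P Q g" "abelian_group P" "abelian_group Q" "S \<subseteq> carrier P"
    and "\<And>s. s \<in> S \<Longrightarrow> f s = g s" and x: "x \<in> aspan P S"
  shows "f x = g x"
proof -
  interpret P: abelian_group P by fact
  show ?thesis using x
  proof induction
    case zero
    then show ?case using assms by (simp add: ahom_zero)
  next
    case (base s)
    then show ?case using assms by simp
  next
    case (add x y)
    then show ?case using assms P.aspan_closed[OF assms(5)] by (simp add: ahom_add)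
  next
    case (neg x)
    then show ?case using assms P.aspan_closed[OF assms(5)] by (simp add: ahom_neg)
  qed
qed

lemma ahom_aspan:
  assumes "ahom P Q f" "abelian_group P" "abelian_group Q" "S \<subseteq> carrier P"
    and "\<And>s. s \<in> S \<Longrightarrow> f s \<in> aspan Q T" and x: "x \<in> aspan P S"
  shows "f x \<in> aspan Q T"
proof -
  interpret P: abelian_group P by fact
  show ?thesis using x
  proof induction
    case zero
    then show ?case using assms by (simp add: ahom_zero aspan.zero)
  next
    case (base s)
    then show ?case using assms by simp
  next
    case (add x y)
    then show ?case using assms P.aspan_closed[OF assms(4)] by (simp add: ahom_add aspan.add)
  next
    case (neg x)
    then show ?case using assms P.aspan_closed[OF assms(4)] by (simp add: ahom_neg aspan.neg)
  qed
qed

lemma (in abelian_group) aspan_minus: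
  "\<lbrakk>x \<in> aspan G S; y \<in> aspan G S\<rbrakk> \<Longrightarrow> x \<ominus> y \<in> aspan G S"
  by (simp add: a_minus_def aspan.intros)

lemma aspan_finsum:
  assumes "abelian_group P" "S \<subseteq> carrier P" "\<And>i. i \<in> I \<Longrightarrow> g i \<in> aspan P S"
  shows "finsum P g I \<in> aspan P S"
proof -
  interpret P: abelian_group P by fact
  show ?thesis
    using assms(3)
  proof (induction I rule: infinite_finite_induct)
    case (insert i I)
    have "g \<in> I \<rightarrow> carrier P" "g i \<in> carrier P"
      using insert P.aspan_closed[OF assms(2)] by auto
    then show ?case using insert by (simp add: aspan.add)
  qed (simp_all add: aspan.zero)
qed

section \<open>Bimodules and maps out of the tensor algebra\<close>

lemma left_module_ahom:
  "\<lbrakk>left_module A N; a \<in> carrier A\<rbrakk> \<Longrightarrow> ahom N N (\<lambda>x. a \<odot>\<^bsub>N\<^esub> x)"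
  by (simp add: ahom_def left_module.smult_closed left_module.smult_r_distr)

lemma left_module_ahom_scalar:
  "\<lbrakk>left_module A N; x \<in> carrier N\<rbrakk> \<Longrightarrow> ahom A N (\<lambda>a. a \<odot>\<^bsub>N\<^esub> x)"
  by (simp add: ahom_def left_module.smult_closed left_module.smult_l_distr)

text \<open>Apart from closure, the clauses mirror the four families of relators in
  \<open>trels\<close>: for an abelian group \<open>P\<close> they express that \<open>f\<close>
  induces an additive map on the tensor algebra.\<close>

definition tbal ::
  "('a, 'x) ring_scheme \<Rightarrow> ('a, 'm, 'y) bimodule_scheme \<Rightarrow> ('a, 'n, 'z) module_scheme \<Rightarrow>
    ('p, 'v) ring_scheme \<Rightarrow> ('m list \<Rightarrow> 'n \<Rightarrow> 'p) \<Rightarrow> bool"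
  where "tbal A M N P f \<longleftrightarrow>
    (\<forall>xs y. set xs \<subseteq> carrier M \<longrightarrow> y \<in> carrier N \<longrightarrow> f xs y \<in> carrier P) \<and>
    (\<forall>xs x x' zs y. set xs \<subseteq> carrier M \<longrightarrow> x \<in> carrier M \<longrightarrow> x' \<in> carrier M \<longrightarrow>
      set zs \<subseteq> carrier M \<longrightarrow> y \<in> carrier N \<longrightarrow>
      f (xs @ (x \<oplus>\<^bsub>M\<^esub> x') # zs) y = f (xs @ x # zs) y \<oplus>\<^bsub>P\<^esub> f (xs @ x' # zs) y) \<and>
    (\<forall>xs y y'. set xs \<subseteq> carrier M \<longrightarrow> y \<in> carrier N \<longrightarrow> y' \<in> carrier N \<longrightarrow>
      f xs (y \<oplus>\<^bsub>N\<^esub> y') = f xs y \<oplus>\<^bsub>P\<^esub> f xs y') \<and>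
    (\<forall>xs x a x' zs y. set xs \<subseteq> carrier M \<longrightarrow> x \<in> carrier M \<longrightarrow> a \<in> carrier A \<longrightarrow> x' \<in> carrier M \<longrightarrow>
      set zs \<subseteq> carrier M \<longrightarrow> y \<in> carrier N \<longrightarrow>
      f (xs @ (x \<odot>\<^sub>r\<^bsub>M\<^esub> a) # x' # zs) y = f (xs @ x # (a \<odot>\<^bsub>M\<^esub> x') # zs) y) \<and>
    (\<forall>xs x a y. set xs \<subseteq> carrier M \<longrightarrow> x \<in> carrier M \<longrightarrow> a \<in> carrier A \<longrightarrow> y \<in> carrier N \<longrightarrow>
      f (xs @ [x \<odot>\<^sub>r\<^bsub>M\<^esub> a]) y = f (xs @ [x]) (a \<odot>\<^bsub>N\<^esub> y))"

lemma tbalI: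
  assumes "\<And>xs y. \<lbrakk>set xs \<subseteq> carrier M; y \<in> carrier N\<rbrakk> \<Longrightarrow> f xs y \<in> carrier P"
    and "\<And>xs x x' zs y. \<lbrakk>set xs \<subseteq> carrier M; x \<in> carrier M; x' \<in> carrier M; set zs \<subseteq> carrier M;
      y \<in> carrier N\<rbrakk> \<Longrightarrow>
      f (xs @ (x \<oplus>\<^bsub>M\<^esub> x') # zs) y = f (xs @ x # zs) y \<oplus>\<^bsub>P\<^esub> f (xs @ x' # zs) y"
    and "\<And>xs y y'. \<lbrakk>set xs \<subseteq> carrier M; y \<in> carrier N; y' \<in> carrier N\<rbrakk> \<Longrightarrow>
      f xs (y \<oplus>\<^bsub>N\<^esub> y') = f xs y \<oplus>\<^bsub>P\<^esub> f xs y'"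
    and "\<And>xs x a x' zs y. \<lbrakk>set xs \<subseteq> carrier M; x \<in> carrier M; a \<in> carrier A; x' \<in> carrier M;
      set zs \<subseteq> carrier M; y \<in> carrier N\<rbrakk> \<Longrightarrow>
      f (xs @ (x \<odot>\<^sub>r\<^bsub>M\<^esub> a) # x' # zs) y = f (xs @ x # (a \<odot>\<^bsub>M\<^esub> x') # zs) y"
    and "\<And>xs x a y. \<lbrakk>set xs \<subseteq> carrier M; x \<in> carrier M; a \<in> carrier A; y \<in> carrier N\<rbrakk> \<Longrightarrow>
      f (xs @ [x \<odot>\<^sub>r\<^bsub>M\<^esub> a]) y = f (xs @ [x]) (a \<odot>\<^bsub>N\<^esub> y)"
  shows "tbal A M N P f"
  unfolding tbal_def by (intro conjI allI impI) (erule (5) assms | erule (4) assms | erule (3) assms | erule (2) assms | erule (1) assms)+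

lemma tbal_closed:
  "\<lbrakk>tbal A M N P f; set xs \<subseteq> carrier M; y \<in> carrier N\<rbrakk> \<Longrightarrow> f xs y \<in> carrier P"
  by (simp add: tbal_def)

lemma tbal_add_mid:
  "\<lbrakk>tbal A M N P f; set xs \<subseteq> carrier M; x \<in> carrier M; x' \<in> carrier M; set zs \<subseteq> carrier M;
    y \<in> carrier N\<rbrakk> \<Longrightarrow>
    f (xs @ (x \<oplus>\<^bsub>M\<^esub> x') # zs) y = f (xs @ x # zs) y \<oplus>\<^bsub>P\<^esub> f (xs @ x' # zs) y"
  by (simp add: tbal_def)

lemma tbal_add_last:
  "\<lbrakk>tbal A M N P f; set xs \<subseteq> carrier M; y \<in> carrier N; y' \<in> carrier N\<rbrakk> \<Longrightarrow>
    f xs (y \<oplus>\<^bsub>N\<^esub> y') = f xs y \<oplus>\<^bsub>P\<^esub> f xs y'"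
  by (simp add: tbal_def)

lemma tbal_mid:
  "\<lbrakk>tbal A M N P f; set xs \<subseteq> carrier M; x \<in> carrier M; a \<in> carrier A; x' \<in> carrier M;
    set zs \<subseteq> carrier M; y \<in> carrier N\<rbrakk> \<Longrightarrow>
    f (xs @ (x \<odot>\<^sub>r\<^bsub>M\<^esub> a) # x' # zs) y = f (xs @ x # (a \<odot>\<^bsub>M\<^esub> x') # zs) y"
  by (simp add: tbal_def)

lemma tbal_last:
  "\<lbrakk>tbal A M N P f; set xs \<subseteq> carrier M; x \<in> carrier M; a \<in> carrier A; y \<in> carrier N\<rbrakk> \<Longrightarrow>
    f (xs @ [x \<odot>\<^sub>r\<^bsub>M\<^esub> a]) y = f (xs @ [x]) (a \<odot>\<^bsub>N\<^esub> y)"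
  by (simp add: tbal_def)

text \<open>The relators of the tensor algebra relate words of equal length only, so a map may be
  prescribed separately in each degree.\<close>

lemma tbal_by_length:
  assumes "\<And>n. tbal A M N P (F n)"
  shows "tbal A M N P (\<lambda>xs y. F (length xs) xs y)"
  by (rule tbalI)
    (simp_all add: tbal_closed[OF assms] tbal_add_mid[OF assms] tbal_add_last[OF assms]
      tbal_mid[OF assms] tbal_last[OF assms])

text \<open>Word functions are controlled only on words with entries in the carriers. Closure under
  addition and both actions ensures that every word occurring in a law is of this kind.\<close>

lemma tbal_cong:
  assumes "tbal A M N P f"
    and "\<And>xs y. \<lbrakk>set xs \<subseteq> carrier M; y \<in> carrier N\<rbrakk> \<Longrightarrow> f xs y = g xs y"
    and "left_module A N" "left_module A M"
    and r: "\<And>x a. \<lbrakk>x \<in> carrier M; a \<in> carrier A\<rbrakk> \<Longrightarrow> x \<odot>\<^sub>r\<^bsub>M\<^esub> a \<in> carrier M"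
  shows "tbal A M N P g"
proof -
  interpret N: left_module A N by fact
  interpret M: left_module A M by fact
  show ?thesis
    by (rule tbalI)
      (simp_all add: assms(2)[symmetric] r tbal_closed[OF assms(1)]
        tbal_add_mid[OF assms(1)] tbal_add_last[OF assms(1)]
        tbal_mid[OF assms(1)] tbal_last[OF assms(1)] N.smult_closed M.smult_closed)
qed

text \<open>Compatibility of the two actions is what lets left multiplication of the first letter
  respect the balancing relators.\<close>

locale bimod = left_module A M
  for A :: "('a, 'x) ring_scheme" and M :: "('a, 'm, 'y) bimodule_scheme" +
  assumes rsmult_closed:
      "\<lbrakk>x \<in> carrier M; a \<in> carrier A\<rbrakk> \<Longrightarrow> x \<odot>\<^sub>r\<^bsub>M\<^esub> a \<in> carrier M"
    and rsmult_l_distr: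
      "\<lbrakk>x \<in> carrier M; y \<in> carrier M; a \<in> carrier A\<rbrakk> \<Longrightarrow>
        (x \<oplus>\<^bsub>M\<^esub> y) \<odot>\<^sub>r\<^bsub>M\<^esub> a = x \<odot>\<^sub>r\<^bsub>M\<^esub> a \<oplus>\<^bsub>M\<^esub> y \<odot>\<^sub>r\<^bsub>M\<^esub> a"
    and smult_rsmult:
      "\<lbrakk>a \<in> carrier A; x \<in> carrier M; b \<in> carrier A\<rbrakk> \<Longrightarrow>
        (a \<odot>\<^bsub>M\<^esub> x) \<odot>\<^sub>r\<^bsub>M\<^esub> b = a \<odot>\<^bsub>M\<^esub> (x \<odot>\<^sub>r\<^bsub>M\<^esub> b)"
begin

abbreviation T :: "('a, 'n, 'z) module_scheme \<Rightarrow> ('a, ('m, 'n) tensor) module"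
  where "T N \<equiv> tmod A M N"

abbreviation pure :: "('a, 'n, 'z) module_scheme \<Rightarrow> 'm list \<Rightarrow> 'n \<Rightarrow> ('m, 'n) tensor"
  where "pure N \<equiv> tpure A M N"

end

lemma (in abelian_group) minus_self_iff:
  "\<lbrakk>x \<in> carrier G; y \<in> carrier G\<rbrakk> \<Longrightarrow> x \<ominus> y = \<zero> \<longleftrightarrow> x = y"
  using minus_equality[of x "\<ominus> y"] by (auto simp: minus_eq r_neg)

section \<open>Additive extension of word functions to the free abelian group\<close>

lemma keys_add_subset:
  "\<lbrakk>Poly_Mapping.keys c \<subseteq> S; Poly_Mapping.keys d \<subseteq> S\<rbrakk> \<Longrightarrow> Poly_Mapping.keys (c + d) \<subseteq> S"
  by (rule order_trans[OF keys_add Un_least])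

text \<open>\<open>tlift\<close> is this sum at a chosen representative. Detached from the choice it
  is a homomorphism on the free abelian group, and independence of the representative means that it
  kills the relators.\<close>

definition flift :: "('p, 'x) ring_scheme \<Rightarrow> ('m list \<Rightarrow> 'n \<Rightarrow> 'p) \<Rightarrow> ('m list \<times> 'n \<Rightarrow>\<^sub>0 int) \<Rightarrow> 'p"
  where "flift P f c = finsum P (\<lambda>(xs, y). [Poly_Mapping.lookup c (xs, y)] \<cdot>\<^bsub>P\<^esub> f xs y) (Poly_Mapping.keys c)"

lemma tlift_flift: "tlift P f X = flift P f (SOME c. c \<in> X)"
  by (simp add: tlift_def flift_def Let_def)

context
  fixes P :: "('p, 'v) ring_scheme" and f :: "'m list \<Rightarrow> 'n \<Rightarrow> 'p" and W :: "('m list \<times> 'n) set"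
  assumes P: "abelian_group P" and fW: "\<And>xs y. (xs, y) \<in> W \<Longrightarrow> f xs y \<in> carrier P"
begin

interpretation P: abelian_group P by (rule P)

text \<open>Supports may shrink by cancellation when coefficients are added; for additivity all sums
  are first extended to one common finite set, where the new terms have coefficient 0.\<close>

lemma flift_superset:
  assumes "finite S" "Poly_Mapping.keys c \<subseteq> S" "S \<subseteq> W"
  shows "flift P f c = finsum P (\<lambda>(xs, y). [Poly_Mapping.lookup c (xs, y)] \<cdot>\<^bsub>P\<^esub> f xs y) S"
  unfolding flift_def
proof (rule P.add.finprod_mono_neutral_cong_left)
  show "\<And>i. i \<in> S - Poly_Mapping.keys c \<Longrightarrow>
      (case i of (xs, y) \<Rightarrow> [Poly_Mapping.lookup c (xs, y)] \<cdot>\<^bsub>P\<^esub> f xs y) = \<zero>\<^bsub>P\<^esub>"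
    by (auto simp: in_keys_iff add_pow_def)
  show "(\<lambda>(xs, y). [Poly_Mapping.lookup c (xs, y)] \<cdot>\<^bsub>P\<^esub> f xs y) \<in> S \<rightarrow> carrier P"
    using assms fW by (auto intro!: P.add.int_pow_closed)
qed (use assms in auto)

lemma flift_closed:
  assumes "Poly_Mapping.keys c \<subseteq> W"
  shows "flift P f c \<in> carrier P"
  unfolding flift_def by (rule P.finsum_closed) (use assms fW in \<open>auto intro!: P.add.int_pow_closed\<close>)

lemma flift_add:
  assumes "Poly_Mapping.keys c \<subseteq> W" "Poly_Mapping.keys d \<subseteq> W"
  shows "flift P f (c + d) = flift P f c \<oplus>\<^bsub>P\<^esub> flift P f d"
proof -
  let ?S = "Poly_Mapping.keys c \<union> Poly_Mapping.keys d"
  have S: "finite ?S" "?S \<subseteq> W" using assms by auto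
  have cl: "(\<lambda>(xs, y). [Poly_Mapping.lookup e (xs, y)] \<cdot>\<^bsub>P\<^esub> f xs y) \<in> ?S \<rightarrow> carrier P" for e :: "'m list \<times> 'n \<Rightarrow>\<^sub>0 int"
    using S fW by (auto intro!: P.add.int_pow_closed)
  have "flift P f (c + d) = finsum P (\<lambda>(xs, y). [Poly_Mapping.lookup (c + d) (xs, y)] \<cdot>\<^bsub>P\<^esub> f xs y) ?S"
    by (rule flift_superset) (use S keys_add[of c d] in auto)
  also have "\<dots> = finsum P (\<lambda>w. (case w of (xs, y) \<Rightarrow> [Poly_Mapping.lookup c (xs, y)] \<cdot>\<^bsub>P\<^esub> f xs y)
      \<oplus>\<^bsub>P\<^esub> (case w of (xs, y) \<Rightarrow> [Poly_Mapping.lookup d (xs, y)] \<cdot>\<^bsub>P\<^esub> f xs y)) ?S"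
    by (rule P.finsum_cong') (use S fW in
        \<open>auto simp: lookup_add P.add.int_pow_mult intro!: P.add.int_pow_closed P.a_closed\<close>)
  also have "\<dots> = flift P f c \<oplus>\<^bsub>P\<^esub> flift P f d"
    using S by (simp add: P.finsum_addf[OF cl cl] flift_superset[of ?S c] flift_superset[of ?S d])
  finally show ?thesis .
qed

lemma flift_frag_of: "(xs, y) \<in> W \<Longrightarrow> flift P f (frag_of (xs, y)) = f xs y"
  unfolding flift_def using fW[of xs y] by (simp add: keys_frag_of P.finsum_insert)

lemma flift_zero: "flift P f 0 = \<zero>\<^bsub>P\<^esub>"
  by (simp add: flift_def)

lemma flift_uminus:
  assumes "Poly_Mapping.keys c \<subseteq> W"
  shows "flift P f (- c) = \<ominus>\<^bsub>P\<^esub> flift P f c"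
proof -
  have "flift P f (- c) \<oplus>\<^bsub>P\<^esub> flift P f c = \<zero>\<^bsub>P\<^esub>"
    using flift_add[of "- c" c] assms by (simp add: keys_minus flift_zero)
  then show ?thesis
    using assms by (simp add: P.minus_equality flift_closed keys_minus)
qed

lemma flift_diff:
  assumes "Poly_Mapping.keys c \<subseteq> W" "Poly_Mapping.keys d \<subseteq> W"
  shows "flift P f (c - d) = flift P f c \<ominus>\<^bsub>P\<^esub> flift P f d"
  using flift_add[of c "- d"] assms by (simp add: keys_minus flift_uminus a_minus_def)

end

subsection \<open>The tensor algebra as a quotient\<close>

context bimod
begin

context
  fixes N :: "('a, 'n, 'z) module_scheme"
  assumes N: "left_module A N"
begin

interpretation N: left_module A N by (rule N)
interpretation F: comm_group "free_Abelian_group (twords M N)" by (rule abelian_free_Abelian_group)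

private abbreviation (input) "F \<equiv> free_Abelian_group (twords M N)"
private abbreviation (input) "H \<equiv> generate F (trels A M N)"

lemma twords_iff: "(xs, y) \<in> twords M N \<longleftrightarrow> set xs \<subseteq> carrier M \<and> y \<in> carrier N"
  by (simp add: twords_def)

lemma trels_subset: "trels A M N \<subseteq> carrier F"
proof -
  have *: "Poly_Mapping.keys (frag_of a - frag_of b - frag_of c) \<subseteq> S"
    if "a \<in> S" "b \<in> S" "c \<in> S" for a b c :: "'m list \<times> 'n" and S
    using that keys_diff[of "frag_of a - frag_of b" "frag_of c"] keys_diff[of "frag_of a" "frag_of b"]
    by (auto simp: keys_frag_of)
  have **: "Poly_Mapping.keys (frag_of a - frag_of b) \<subseteq> S"
    if "a \<in> S" "b \<in> S" for a b :: "'m list \<times> 'n" and S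
    using that keys_diff[of "frag_of a" "frag_of b"] by (auto simp: keys_frag_of)
  show ?thesis
    unfolding trels_def
    by (intro Un_least subsetI; clarsimp simp only: mem_Collect_eq;
        (rule carrier_free_Abelian_group_iff[THEN iffD2])?; (rule * | rule **);
        simp add: twords_iff M.a_closed N.a_closed rsmult_closed smult_closed N.smult_closed)
qed

lemma H_subgroup: "subgroup H F"
  by (rule F.generate_is_subgroup[OF trels_subset])

lemma H_normal: "H \<lhd> F"
  using F.subgroup_imp_normal[OF H_subgroup] .

interpretation H: normal H F by (rule H_normal)

lemma tclass_alt: "tclass A M N c = H #>\<^bsub>F\<^esub> c"
  by (simp add: tclass_def)

lemma carrier_T: "carrier (T N) = {tclass A M N c | c. Poly_Mapping.keys c \<subseteq> twords M N}"
  by (auto simp: tmod_def tgroup_def carrier_FactGroup tclass_alt)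

lemma tclass_add:
  "\<lbrakk>Poly_Mapping.keys c \<subseteq> twords M N; Poly_Mapping.keys d \<subseteq> twords M N\<rbrakk> \<Longrightarrow>
    tclass A M N (c + d) = tclass A M N c \<oplus>\<^bsub>T N\<^esub> tclass A M N d"
  by (simp add: tmod_def tgroup_def tclass_alt H.rcos_sum)

lemma tclass_zero: "tclass A M N 0 = \<zero>\<^bsub>T N\<^esub>"
  using F.coset_join2[of 0 H] H_subgroup H.one_closed
  by (simp add: tmod_def tgroup_def tclass_alt)

text \<open>Only the additive structure can be transferred from the quotient group, because
  \<open>mult\<close> and \<open>one\<close> of the record \<open>tmod\<close> are
  undefined.\<close>

lemma T_abelian_group: "abelian_group (T N)"
proof -
  have cg: "comm_group (F Mod H)"
    by (rule F.abelian_FactGroup[OF H_subgroup])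
  interpret Q: comm_group "F Mod H" by (rule cg)
  show ?thesis
  proof (rule abelian_groupI)
    fix x assume "x \<in> carrier (T N)"
    then show "\<exists>y\<in>carrier (T N). y \<oplus>\<^bsub>T N\<^esub> x = \<zero>\<^bsub>T N\<^esub>"
      using Q.l_inv Q.inv_closed by (auto simp: tmod_def tgroup_def simp del: mult_FactGroup one_FactGroup)
  qed (use Q.m_assoc Q.m_comm in \<open>auto simp: tmod_def tgroup_def simp del: mult_FactGroup one_FactGroup\<close>)
qed

interpretation TN: abelian_group "T N" by (rule T_abelian_group)

lemma tclass_closed: "Poly_Mapping.keys c \<subseteq> twords M N \<Longrightarrow> tclass A M N c \<in> carrier (T N)"
  by (auto simp: carrier_T)

lemma tclass_uminus:
  assumes "Poly_Mapping.keys c \<subseteq> twords M N"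
  shows "tclass A M N (- c) = \<ominus>\<^bsub>T N\<^esub> tclass A M N c"
proof -
  have "tclass A M N (- c) \<oplus>\<^bsub>T N\<^esub> tclass A M N c = \<zero>\<^bsub>T N\<^esub>"
    using tclass_add[of "- c" c] assms by (simp add: keys_minus tclass_zero)
  then show ?thesis
    using assms by (simp add: TN.minus_equality tclass_closed keys_minus)
qed

lemma tclass_diff:
  assumes "Poly_Mapping.keys c \<subseteq> twords M N" "Poly_Mapping.keys d \<subseteq> twords M N"
  shows "tclass A M N (c - d) = tclass A M N c \<ominus>\<^bsub>T N\<^esub> tclass A M N d"
  using tclass_add[of c "- d"] assms by (simp add: keys_minus tclass_uminus a_minus_def)

lemma tclass_trels:
  assumes "c \<in> trels A M N" shows "tclass A M N c = \<zero>\<^bsub>T N\<^esub>"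
proof -
  have "c \<in> H" using assms by (simp add: generate.incl)
  moreover have "c \<in> carrier F" using assms trels_subset by blast
  ultimately show ?thesis
    using F.coset_join2[OF _ H_subgroup] tclass_zero
      by (metis F.coset_join2 F.one_closed H.one_closed H_subgroup one_free_Abelian_group tclass_alt)
qed

text \<open>Scalar multiplication in \<open>tmod\<close> picks an arbitrary element of the class.
  All of them are supported on admissible words because the elements of the relator subgroup
  are.\<close>

lemma some_rep:
  assumes "X \<in> carrier (T N)"
  shows "Poly_Mapping.keys (SOME c. c \<in> X) \<subseteq> twords M N"
proof -
  obtain c where c: "Poly_Mapping.keys c \<subseteq> twords M N" "X = tclass A M N c"
    using assms by (auto simp: carrier_T)
  have "c \<in> X"
    unfolding c tclass_alt using F.rcos_self[OF _ H_subgroup, of c] c by simp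
  then have "(SOME d. d \<in> X) \<in> X" by (rule someI)
  then obtain h where h: "h \<in> H" "(SOME d. d \<in> X) = h + c"
    unfolding c tclass_alt by (auto simp: r_coset_def)
  have "Poly_Mapping.keys h \<subseteq> twords M N"
    using F.generate_in_carrier[OF trels_subset h(1)] by simp
  then show ?thesis using h c by (simp add: keys_add_subset)
qed

lemma T_induct [consumes 1, case_names zero pure add neg]:
  assumes "X \<in> carrier (T N)"
    and "Q \<zero>\<^bsub>T N\<^esub>"
    and "\<And>xs y. \<lbrakk>set xs \<subseteq> carrier M; y \<in> carrier N\<rbrakk> \<Longrightarrow> Q (pure N xs y)"
    and "\<And>X Y. \<lbrakk>X \<in> carrier (T N); Y \<in> carrier (T N); Q X; Q Y\<rbrakk> \<Longrightarrow> Q (X \<oplus>\<^bsub>T N\<^esub> Y)"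
    and "\<And>X. \<lbrakk>X \<in> carrier (T N); Q X\<rbrakk> \<Longrightarrow> Q (\<ominus>\<^bsub>T N\<^esub> X)"
  shows "Q X"
proof -
  obtain c where c: "Poly_Mapping.keys c \<subseteq> twords M N" "X = tclass A M N c"
    using assms(1) by (auto simp: carrier_T)
  have "Q (tclass A M N c)" using c(1)
  proof (rule free_Abelian_group_induct)
    fix x y :: "'m list \<times> 'n \<Rightarrow>\<^sub>0 int"
    assume "Poly_Mapping.keys x \<subseteq> twords M N" "Poly_Mapping.keys y \<subseteq> twords M N"
      "Q (tclass A M N x)" "Q (tclass A M N y)"
    then show "Q (tclass A M N (x - y))" using assms by (simp add: tclass_diff a_minus_def tclass_closed)
  next
    fix w assume "w \<in> twords M N"
    then show "Q (tclass A M N (frag_of w))"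
      using assms(3)[of "fst w" "snd w"] by (cases w) (simp add: tpure_def twords_iff)
  qed (simp add: tclass_zero assms)
  then show ?thesis using c by simp
qed

lemma pure_closed: "\<lbrakk>set xs \<subseteq> carrier M; y \<in> carrier N\<rbrakk> \<Longrightarrow> pure N xs y \<in> carrier (T N)"
  by (simp add: tpure_def tclass_closed twords_iff keys_frag_of)

lemma tclass_rel3:
  assumes "u \<in> twords M N" "v \<in> twords M N" "w \<in> twords M N"
    and r: "frag_of u - frag_of v - frag_of w \<in> trels A M N"
  shows "tclass A M N (frag_of u) = tclass A M N (frag_of v) \<oplus>\<^bsub>T N\<^esub> tclass A M N (frag_of w)"
proof -
  have k: "Poly_Mapping.keys (frag_of v) \<subseteq> twords M N" "Poly_Mapping.keys (frag_of w) \<subseteq> twords M N"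
    "Poly_Mapping.keys (frag_of u - frag_of v - frag_of w) \<subseteq> twords M N"
    using assms(1-3) trels_subset r by (auto simp: keys_frag_of simp del: carrier_free_Abelian_group_iff
        simp flip: carrier_free_Abelian_group_iff)
  have kk: "Poly_Mapping.keys (frag_of v + frag_of w) \<subseteq> twords M N"
    by (rule keys_add_subset[OF k(1,2)])
  have "frag_of u = (frag_of u - frag_of v - frag_of w) + (frag_of v + frag_of w)"
    by (simp add: algebra_simps)
  then have "tclass A M N (frag_of u) = tclass A M N (frag_of u - frag_of v - frag_of w)
      \<oplus>\<^bsub>T N\<^esub> tclass A M N (frag_of v + frag_of w)"
    using tclass_add[OF k(3) kk] by metis
  then show ?thesis
    unfolding tclass_trels[OF r] tclass_add[OF k(1,2)]
    by (simp add: tclass_closed assms(1-3))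
qed

lemma tclass_rel2:
  assumes "u \<in> twords M N" "v \<in> twords M N"
    and r: "frag_of u - frag_of v \<in> trels A M N"
  shows "tclass A M N (frag_of u) = tclass A M N (frag_of v)"
proof -
  have k: "Poly_Mapping.keys (frag_of v) \<subseteq> twords M N"
    "Poly_Mapping.keys (frag_of u - frag_of v) \<subseteq> twords M N"
    using assms(1-2) trels_subset r by (auto simp: keys_frag_of simp del: carrier_free_Abelian_group_iff
        simp flip: carrier_free_Abelian_group_iff)
  have "frag_of u = (frag_of u - frag_of v) + frag_of v"
    by (simp add: algebra_simps)
  then have "tclass A M N (frag_of u) = tclass A M N (frag_of u - frag_of v) \<oplus>\<^bsub>T N\<^esub> tclass A M N (frag_of v)"
    using tclass_add[OF k(2,1)] by metis
  then show ?thesis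
    unfolding tclass_trels[OF r] by (simp add: tclass_closed assms(1-2))
qed

lemma tbal_pure: "tbal A M N (T N) (pure N)"
proof (rule tbalI)
  fix xs x x' zs y
  assume *: "set xs \<subseteq> carrier M" "x \<in> carrier M" "x' \<in> carrier M" "set zs \<subseteq> carrier M" "y \<in> carrier N"
  show "pure N (xs @ (x \<oplus>\<^bsub>M\<^esub> x') # zs) y = pure N (xs @ x # zs) y \<oplus>\<^bsub>T N\<^esub> pure N (xs @ x' # zs) y"
    unfolding tpure_def
  proof (rule tclass_rel3)
    show "frag_of (xs @ (x \<oplus>\<^bsub>M\<^esub> x') # zs, y) - frag_of (xs @ x # zs, y) - frag_of (xs @ x' # zs, y)
        \<in> trels A M N"
      unfolding trels_def using * by blast
  qed (use * in \<open>simp_all add: twords_iff M.a_closed\<close>)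
next
  fix xs y y'
  assume *: "set xs \<subseteq> carrier M" "y \<in> carrier N" "y' \<in> carrier N"
  show "pure N xs (y \<oplus>\<^bsub>N\<^esub> y') = pure N xs y \<oplus>\<^bsub>T N\<^esub> pure N xs y'"
    unfolding tpure_def
  proof (rule tclass_rel3)
    show "frag_of (xs, y \<oplus>\<^bsub>N\<^esub> y') - frag_of (xs, y) - frag_of (xs, y') \<in> trels A M N"
      unfolding trels_def using * by blast
  qed (use * in \<open>simp_all add: twords_iff N.a_closed\<close>)
next
  fix xs x a x' zs y
  assume *: "set xs \<subseteq> carrier M" "x \<in> carrier M" "a \<in> carrier A" "x' \<in> carrier M" "set zs \<subseteq> carrier M"
    "y \<in> carrier N"
  show "pure N (xs @ (x \<odot>\<^sub>r\<^bsub>M\<^esub> a) # x' # zs) y = pure N (xs @ x # (a \<odot>\<^bsub>M\<^esub> x') # zs) y"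
    unfolding tpure_def
  proof (rule tclass_rel2)
    show "frag_of (xs @ (x \<odot>\<^sub>r\<^bsub>M\<^esub> a) # x' # zs, y) - frag_of (xs @ x # (a \<odot>\<^bsub>M\<^esub> x') # zs, y)
        \<in> trels A M N"
      unfolding trels_def using * by blast
  qed (use * in \<open>simp_all add: twords_iff rsmult_closed smult_closed\<close>)
next
  fix xs x a y
  assume *: "set xs \<subseteq> carrier M" "x \<in> carrier M" "a \<in> carrier A" "y \<in> carrier N"
  show "pure N (xs @ [x \<odot>\<^sub>r\<^bsub>M\<^esub> a]) y = pure N (xs @ [x]) (a \<odot>\<^bsub>N\<^esub> y)"
    unfolding tpure_def
  proof (rule tclass_rel2)
    show "frag_of (xs @ [x \<odot>\<^sub>r\<^bsub>M\<^esub> a], y) - frag_of (xs @ [x], a \<odot>\<^bsub>N\<^esub> y) \<in> trels A M N"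
      unfolding trels_def using * by blast
  qed (use * in \<open>simp_all add: twords_iff rsmult_closed N.smult_closed\<close>)
qed (rule pure_closed)

context
  fixes P :: "('p, 'v) ring_scheme" and f :: "'m list \<Rightarrow> 'n \<Rightarrow> 'p"
  assumes P: "abelian_group P" and f: "tbal A M N P f"
begin

interpretation P: abelian_group P by (rule P)

private lemma fW: "(xs, y) \<in> twords M N \<Longrightarrow> f xs y \<in> carrier P"
  using tbal_closed[OF f] by (simp add: twords_iff)

private lemma fl_closed: "Poly_Mapping.keys c \<subseteq> twords M N \<Longrightarrow> flift P f c \<in> carrier P"
  by (rule flift_closed[OF P fW])

private lemma fl_of: "(xs, y) \<in> twords M N \<Longrightarrow> flift P f (frag_of (xs, y)) = f xs y"
  by (rule flift_frag_of[OF P fW])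

private lemma fl_zero: "flift P f 0 = \<zero>\<^bsub>P\<^esub>"
  by (rule flift_zero[OF P fW])

private lemma fl_uminus:
  "Poly_Mapping.keys c \<subseteq> twords M N \<Longrightarrow> flift P f (- c) = \<ominus>\<^bsub>P\<^esub> flift P f c"
  by (rule flift_uminus[OF P fW])

private lemma fl_add:
  "\<lbrakk>Poly_Mapping.keys c \<subseteq> twords M N; Poly_Mapping.keys d \<subseteq> twords M N\<rbrakk> \<Longrightarrow>
    flift P f (c + d) = flift P f c \<oplus>\<^bsub>P\<^esub> flift P f d"
  by (rule flift_add[OF P fW])

private lemma fl_diff:
  "\<lbrakk>Poly_Mapping.keys c \<subseteq> twords M N; Poly_Mapping.keys d \<subseteq> twords M N\<rbrakk> \<Longrightarrow>
    flift P f (c - d) = flift P f c \<ominus>\<^bsub>P\<^esub> flift P f d"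
  by (rule flift_diff[OF P fW])

lemma flift_trels: "c \<in> trels A M N \<Longrightarrow> flift P f c = \<zero>\<^bsub>P\<^esub>"
proof -
  have *: "flift P f (frag_of (xs, y) - frag_of (ys, y') - frag_of (zs, y'')) = \<zero>\<^bsub>P\<^esub>"
    if "(xs, y) \<in> twords M N" "(ys, y') \<in> twords M N" "(zs, y'') \<in> twords M N"
      "f xs y = f ys y' \<oplus>\<^bsub>P\<^esub> f zs y''" for xs y ys y' zs y''
  proof -
    have "flift P f (frag_of (xs, y) - (frag_of (ys, y') + frag_of (zs, y''))) = \<zero>\<^bsub>P\<^esub>"
      using that fW
      by (simp add: fl_diff fl_add fl_of keys_frag_of keys_add_subset P.minus_self_iff)
    then show ?thesis by (simp add: algebra_simps)
  qed
  have **: "flift P f (frag_of (xs, y) - frag_of (ys, y')) = \<zero>\<^bsub>P\<^esub>"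
    if "(xs, y) \<in> twords M N" "(ys, y') \<in> twords M N" "f xs y = f ys y'" for xs y ys y'
    using that fW by (simp add: fl_diff fl_of keys_frag_of P.minus_self_iff)
  show "c \<in> trels A M N \<Longrightarrow> flift P f c = \<zero>\<^bsub>P\<^esub>"
    unfolding trels_def
    apply (elim UnE; clarsimp simp only: mem_Collect_eq)
       apply (rule *; simp add: twords_iff M.a_closed tbal_add_mid[OF f])
      apply (rule *; simp add: twords_iff N.a_closed tbal_add_last[OF f])
     apply (rule **; simp add: twords_iff rsmult_closed smult_closed tbal_mid[OF f])
    apply (rule **; simp add: twords_iff rsmult_closed N.smult_closed tbal_last[OF f])
    done
qed

lemma flift_H: "c \<in> H \<Longrightarrow> flift P f c = \<zero>\<^bsub>P\<^esub>"
proof (induction rule: generate.induct)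
  case one
  then show ?case by (simp add: fl_zero)
next
  case (incl h)
  then show ?case by (rule flift_trels)
next
  case (inv h)
  then have "Poly_Mapping.keys h \<subseteq> twords M N" using trels_subset by (auto simp del: carrier_free_Abelian_group_iff simp flip: carrier_free_Abelian_group_iff)
  then show ?case using inv by (simp add: fl_uminus flift_trels)
next
  case (eng h1 h2)
  then have "Poly_Mapping.keys h1 \<subseteq> twords M N" "Poly_Mapping.keys h2 \<subseteq> twords M N"
    using F.generate_in_carrier[OF trels_subset] by auto
  then show ?case using eng by (simp add: fl_add)
qed

text \<open>Two representatives differ by an element of the relator subgroup, on which
  \<open>flift\<close> vanishes by balancedness (\<open>flift_H\<close>).\<close>

lemma tlift_tclass:
  assumes "Poly_Mapping.keys c \<subseteq> twords M N"
  shows "tlift P f (tclass A M N c) = flift P f c"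
proof -
  have "c \<in> tclass A M N c"
    unfolding tclass_alt using F.rcos_self[OF _ H_subgroup, of c] assms by simp
  then have "(SOME d. d \<in> tclass A M N c) \<in> tclass A M N c" by (rule someI)
  then obtain h where h: "h \<in> H" "(SOME d. d \<in> tclass A M N c) = h + c"
    unfolding tclass_alt by (auto simp: r_coset_def)
  have "Poly_Mapping.keys h \<subseteq> twords M N"
    using F.generate_in_carrier[OF trels_subset h(1)] by simp
  then show ?thesis
    using h assms by (simp add: tlift_flift fl_add flift_H fl_closed)
qed

lemma tlift_pure: "\<lbrakk>set xs \<subseteq> carrier M; y \<in> carrier N\<rbrakk> \<Longrightarrow> tlift P f (pure N xs y) = f xs y"
  by (simp add: tpure_def tlift_tclass keys_frag_of twords_iff fl_of)

lemma tlift_ahom: "ahom (T N) P (tlift P f)"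
proof (rule ahomI)
  fix X assume "X \<in> carrier (T N)"
  then show "tlift P f X \<in> carrier P" by (auto simp: carrier_T tlift_tclass fl_closed)
next
  fix X Y assume "X \<in> carrier (T N)" "Y \<in> carrier (T N)"
  then show "tlift P f (X \<oplus>\<^bsub>T N\<^esub> Y) = tlift P f X \<oplus>\<^bsub>P\<^esub> tlift P f Y"
    by (auto simp: carrier_T tclass_add[symmetric] tlift_tclass fl_add keys_add_subset)
qed

end

end
end

section \<open>One-sided linear maps, and the left module structure of the tensor algebra\<close>

definition lhom :: "('a, 'x) ring_scheme \<Rightarrow> ('a, 'm, 'y) module_scheme \<Rightarrow> ('a, 'n, 'z) module_scheme \<Rightarrow>
    ('m \<Rightarrow> 'n) \<Rightarrow> bool"
  where "lhom A M N f \<longleftrightarrow> ahom M N f \<and> (\<forall>a\<in>carrier A. \<forall>x\<in>carrier M. f (a \<odot>\<^bsub>M\<^esub> x) = a \<odot>\<^bsub>N\<^esub> f x)"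

lemma lhomI: "\<lbrakk>ahom M N f; \<And>a x. \<lbrakk>a \<in> carrier A; x \<in> carrier M\<rbrakk> \<Longrightarrow> f (a \<odot>\<^bsub>M\<^esub> x) = a \<odot>\<^bsub>N\<^esub> f x\<rbrakk> \<Longrightarrow> lhom A M N f"
  by (simp add: lhom_def)

lemma lhom_ahom: "lhom A M N f \<Longrightarrow> ahom M N f"
  by (simp add: lhom_def)

lemma lhom_smult: "\<lbrakk>lhom A M N f; a \<in> carrier A; x \<in> carrier M\<rbrakk> \<Longrightarrow> f (a \<odot>\<^bsub>M\<^esub> x) = a \<odot>\<^bsub>N\<^esub> f x"
  by (simp add: lhom_def)

lemmas lhom_closed = ahom_closed[OF lhom_ahom]
  and lhom_add = ahom_add[OF lhom_ahom]

lemma lhom_comp: "\<lbrakk>lhom A M N f; lhom A N P g\<rbrakk> \<Longrightarrow> lhom A M P (\<lambda>x. g (f x))"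
  by (simp add: lhom_def ahom_def)

definition rlin :: "('a, 'x) ring_scheme \<Rightarrow> ('a, 'm, 'y) bimodule_scheme \<Rightarrow> ('m \<Rightarrow> 'a) \<Rightarrow> bool"
  where "rlin A M u \<longleftrightarrow> ahom M A u \<and> (\<forall>x\<in>carrier M. \<forall>a\<in>carrier A. u (x \<odot>\<^sub>r\<^bsub>M\<^esub> a) = u x \<otimes>\<^bsub>A\<^esub> a)"

lemma rlin_ahom: "rlin A M u \<Longrightarrow> ahom M A u"
  by (simp add: rlin_def)

lemma rlin_closed: "\<lbrakk>rlin A M u; x \<in> carrier M\<rbrakk> \<Longrightarrow> u x \<in> carrier A"
  by (simp add: rlin_def ahom_def)

lemma rlin_add: "\<lbrakk>rlin A M u; x \<in> carrier M; y \<in> carrier M\<rbrakk> \<Longrightarrow> u (x \<oplus>\<^bsub>M\<^esub> y) = u x \<oplus>\<^bsub>A\<^esub> u y"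
  by (simp add: rlin_def ahom_def)

lemma rlin_rsmult: "\<lbrakk>rlin A M u; x \<in> carrier M; a \<in> carrier A\<rbrakk> \<Longrightarrow> u (x \<odot>\<^sub>r\<^bsub>M\<^esub> a) = u x \<otimes>\<^bsub>A\<^esub> a"
  by (simp add: rlin_def)

lemma left_module_zero_scalar:
  assumes "left_module A N" "x \<in> carrier N" shows "\<zero>\<^bsub>A\<^esub> \<odot>\<^bsub>N\<^esub> x = \<zero>\<^bsub>N\<^esub>"
proof -
  interpret N: left_module A N by fact
  show ?thesis
    using ahom_zero[OF left_module_ahom_scalar[OF assms]] N.is_abelian_group N.M.abelian_group_axioms by blast
qed

lemma left_module_smult_zero:
  assumes "left_module A N" "a \<in> carrier A" shows "a \<odot>\<^bsub>N\<^esub> \<zero>\<^bsub>N\<^esub> = \<zero>\<^bsub>N\<^esub>"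
proof -
  interpret N: left_module A N by fact
  show ?thesis
    using ahom_zero[OF left_module_ahom[OF assms]] N.M.abelian_group_axioms by blast
qed

text \<open>The map ev \<otimes> id with an arbitrary last factor \<open>N\<close>;
  \<open>contract\<close> is the instance in which that factor is the algebra itself.\<close>

definition ctr ::
  "('a, 'x) ring_scheme \<Rightarrow> ('a, 'm, 'y) bimodule_scheme \<Rightarrow> ('a, 'n, 'z) module_scheme \<Rightarrow>
    ('m \<Rightarrow> 'a) \<Rightarrow> ('m, 'n) tensor \<Rightarrow> ('m, 'n) tensor"
  where "ctr A M N u = tlift (tmod A M N) (\<lambda>xs y. case xs of
    [] \<Rightarrow> \<zero>\<^bsub>tmod A M N\<^esub> | x # zs \<Rightarrow> u x \<odot>\<^bsub>tmod A M N\<^esub> tpure A M N zs y)"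

text \<open>The identification of the degree 0 part with \<open>N\<close>, extended by zero to the
  other degrees.\<close>

definition tdown ::
  "('a, 'n, 'z) module_scheme \<Rightarrow> ('m, 'n) tensor \<Rightarrow> 'n"
  where "tdown N = tlift N (\<lambda>xs y. if xs = [] then y else \<zero>\<^bsub>N\<^esub>)"

text \<open>Substitution for the last tensor factor; all maps of the form $\mathrm{id}\otimes\varphi$ below are
  instances.\<close>

definition tbind ::
  "('a, 'x) ring_scheme \<Rightarrow> ('a, 'm, 'y) bimodule_scheme \<Rightarrow> ('a, 'n, 'z) module_scheme \<Rightarrow>
    ('p \<Rightarrow> ('m, 'n) tensor) \<Rightarrow> ('m, 'p) tensor \<Rightarrow> ('m, 'n) tensor"
  where "tbind A M N \<phi> = tlift (tmod A M N) (\<lambda>xs y. tprepend A M N xs (\<phi> y))"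

context bimod
begin

lemma T_ag [simp]: "left_module A N \<Longrightarrow> abelian_group (T N)"
  by (rule T_abelian_group)

lemma T_eqI:
  assumes "left_module A N" "abelian_group P" "ahom (T N) P f" "ahom (T N) P g"
    and "\<And>xs y. \<lbrakk>set xs \<subseteq> carrier M; y \<in> carrier N\<rbrakk> \<Longrightarrow> f (pure N xs y) = g (pure N xs y)"
    and "X \<in> carrier (T N)"
  shows "f X = g X"
  using assms(6)
proof (induction rule: T_induct[OF assms(1), consumes 1, case_names zero pure add neg])
  case zero
  then show ?case using assms by (simp add: ahom_zero)
next
  case (pure xs y)
  then show ?case using assms by simp
next
  case (add X Y)
  then show ?case using assms by (simp add: ahom_add)
next
  case (neg X)
  then show ?case using assms by (simp add: ahom_neg)
qed

text \<open>If the letter concerned is not the first one, each law is an instance of the same law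
  for the word with its first letter multiplied by \<open>a\<close>. For the first letter,
  distributivity and \<open>smult_rsmult\<close> are used. The form with \<open>fst\<close> and
  \<open>snd\<close> covers both clauses of \<open>word_smult\<close> at once.\<close>

lemma tbal_smult:
  assumes N: "left_module A N" and a: "a \<in> carrier A"
  shows "tbal A M N (T N) (\<lambda>xs y. pure N (fst (word_smult M N a (xs, y))) (snd (word_smult M N a (xs, y))))"
proof -
  interpret N: left_module A N by fact
  note B = tbal_pure[OF N]
  show ?thesis
  proof (rule tbalI)
    fix xs y assume "set xs \<subseteq> carrier M" "y \<in> carrier N"
    then show "pure N (fst (word_smult M N a (xs, y))) (snd (word_smult M N a (xs, y))) \<in> carrier (T N)"
      using a by (cases xs) (auto intro!: pure_closed[OF N] smult_closed N.smult_closed)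
  next
    fix xs x x' zs y
    assume *: "set xs \<subseteq> carrier M" "x \<in> carrier M" "x' \<in> carrier M" "set zs \<subseteq> carrier M" "y \<in> carrier N"
    show "pure N (fst (word_smult M N a (xs @ (x \<oplus>\<^bsub>M\<^esub> x') # zs, y))) (snd (word_smult M N a (xs @ (x \<oplus>\<^bsub>M\<^esub> x') # zs, y)))
      = pure N (fst (word_smult M N a (xs @ x # zs, y))) (snd (word_smult M N a (xs @ x # zs, y))) \<oplus>\<^bsub>T N\<^esub>
        pure N (fst (word_smult M N a (xs @ x' # zs, y))) (snd (word_smult M N a (xs @ x' # zs, y)))"
    proof (cases xs)
      case Nil
      then show ?thesis using * a tbal_add_mid[OF B, of "[]" "a \<odot>\<^bsub>M\<^esub> x" "a \<odot>\<^bsub>M\<^esub> x'" zs y]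
        by (simp add: smult_r_distr smult_closed)
    next
      case (Cons z xs')
      then show ?thesis using * a tbal_add_mid[OF B, of "(a \<odot>\<^bsub>M\<^esub> z) # xs'" x x' zs y]
        by (simp add: smult_closed)
    qed
  next
    fix xs y y'
    assume *: "set xs \<subseteq> carrier M" "y \<in> carrier N" "y' \<in> carrier N"
    show "pure N (fst (word_smult M N a (xs, y \<oplus>\<^bsub>N\<^esub> y'))) (snd (word_smult M N a (xs, y \<oplus>\<^bsub>N\<^esub> y')))
      = pure N (fst (word_smult M N a (xs, y))) (snd (word_smult M N a (xs, y))) \<oplus>\<^bsub>T N\<^esub>
        pure N (fst (word_smult M N a (xs, y'))) (snd (word_smult M N a (xs, y')))"
      using * a
      by (cases xs) (simp_all add: N.smult_r_distr N.smult_closed smult_closed tbal_add_last[OF B])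
  next
    fix xs x b x' zs y
    assume *: "set xs \<subseteq> carrier M" "x \<in> carrier M" "b \<in> carrier A" "x' \<in> carrier M" "set zs \<subseteq> carrier M"
      "y \<in> carrier N"
    show "pure N (fst (word_smult M N a (xs @ (x \<odot>\<^sub>r\<^bsub>M\<^esub> b) # x' # zs, y))) (snd (word_smult M N a (xs @ (x \<odot>\<^sub>r\<^bsub>M\<^esub> b) # x' # zs, y)))
      = pure N (fst (word_smult M N a (xs @ x # (b \<odot>\<^bsub>M\<^esub> x') # zs, y))) (snd (word_smult M N a (xs @ x # (b \<odot>\<^bsub>M\<^esub> x') # zs, y)))"
    proof (cases xs)
      case Nil
      then show ?thesis using * a tbal_mid[OF B, of "[]" "a \<odot>\<^bsub>M\<^esub> x" b x' zs y]
        by (simp add: smult_rsmult smult_closed)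
    next
      case (Cons z xs')
      then show ?thesis using * a tbal_mid[OF B, of "(a \<odot>\<^bsub>M\<^esub> z) # xs'" x b x' zs y]
        by (simp add: smult_closed)
    qed
  next
    fix xs x b y
    assume *: "set xs \<subseteq> carrier M" "x \<in> carrier M" "b \<in> carrier A" "y \<in> carrier N"
    show "pure N (fst (word_smult M N a (xs @ [x \<odot>\<^sub>r\<^bsub>M\<^esub> b], y))) (snd (word_smult M N a (xs @ [x \<odot>\<^sub>r\<^bsub>M\<^esub> b], y)))
      = pure N (fst (word_smult M N a (xs @ [x], b \<odot>\<^bsub>N\<^esub> y))) (snd (word_smult M N a (xs @ [x], b \<odot>\<^bsub>N\<^esub> y)))"
    proof (cases xs)
      case Nil
      then show ?thesis using * a tbal_last[OF B, of "[]" "a \<odot>\<^bsub>M\<^esub> x" b y]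
        by (simp add: smult_rsmult smult_closed)
    next
      case (Cons z xs')
      then show ?thesis using * a tbal_last[OF B, of "(a \<odot>\<^bsub>M\<^esub> z) # xs'" x b y]
        by (simp add: smult_closed)
    qed
  qed
qed

text \<open>Turns the scalar action, defined in \<open>tmod\<close> by rewriting a representative
  word by word, into a lift, so that the general facts on \<open>tlift\<close> apply to it.\<close>

lemma smult_tlift:
  assumes N: "left_module A N" and a: "a \<in> carrier A" and X: "X \<in> carrier (T N)"
  shows "a \<odot>\<^bsub>T N\<^esub> X = tlift (T N)
    (\<lambda>xs y. pure N (fst (word_smult M N a (xs, y))) (snd (word_smult M N a (xs, y)))) X"
proof -
  interpret N: left_module A N by fact
  let ?f = "\<lambda>xs y. pure N (fst (word_smult M N a (xs, y))) (snd (word_smult M N a (xs, y)))"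
  let ?g = "\<lambda>w. frag_of (word_smult M N a w)"
  have fW: "?f xs y \<in> carrier (T N)" if "(xs, y) \<in> twords M N" for xs y
    using tbal_closed[OF tbal_smult[OF N a], of xs y] that by (simp add: twords_iff[OF N])
  have W: "word_smult M N a w \<in> twords M N" if "w \<in> twords M N" for w
    using that a by (cases w; cases "fst w") (auto simp: twords_iff[OF N] smult_closed N.smult_closed)
  have k: "Poly_Mapping.keys (frag_extend ?g c) \<subseteq> twords M N" if "Poly_Mapping.keys c \<subseteq> twords M N" for c
    using keys_frag_extend[of ?g c] that W by (fastforce simp: keys_frag_of)
  \<comment> \<open>Shown for every admissible representative, because the one in the definition is
    an unknown choice.\<close>
  have "tclass A M N (frag_extend ?g c) = flift (T N) ?f c" if "Poly_Mapping.keys c \<subseteq> twords M N" for c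
    using that
  proof (rule free_Abelian_group_induct)
    show "tclass A M N (frag_extend ?g 0) = flift (T N) ?f 0"
      by (simp add: tclass_zero[OF N] flift_zero[OF T_ag[OF N] fW])
  next
    fix x y
    assume xy: "Poly_Mapping.keys x \<subseteq> twords M N" "Poly_Mapping.keys y \<subseteq> twords M N"
      "tclass A M N (frag_extend ?g x) = flift (T N) ?f x"
      "tclass A M N (frag_extend ?g y) = flift (T N) ?f y"
    show "tclass A M N (frag_extend ?g (x - y)) = flift (T N) ?f (x - y)"
      unfolding frag_extend_diff tclass_diff[OF N k[OF xy(1)] k[OF xy(2)]] xy(3,4)
      by (rule flift_diff[OF T_ag[OF N] fW xy(1,2), symmetric])
  next
    fix w assume "w \<in> twords M N"
    then show "tclass A M N (frag_extend ?g (frag_of w)) = flift (T N) ?f (frag_of w)"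
      using flift_frag_of[OF T_ag[OF N] fW, where xs = "fst w" and y = "snd w"]
      by (simp add: tpure_def)
  qed
  from this[OF some_rep[OF N X]] show ?thesis
    by (simp add: tmod_def tlift_flift)
qed

lemma smult_pure_Nil:
  "\<lbrakk>left_module A N; a \<in> carrier A; y \<in> carrier N\<rbrakk> \<Longrightarrow> a \<odot>\<^bsub>T N\<^esub> pure N [] y = pure N [] (a \<odot>\<^bsub>N\<^esub> y)"
  by (simp add: smult_tlift pure_closed tlift_pure tbal_smult)

lemma smult_pure_Cons:
  "\<lbrakk>left_module A N; a \<in> carrier A; x \<in> carrier M; set xs \<subseteq> carrier M; y \<in> carrier N\<rbrakk> \<Longrightarrow>
    a \<odot>\<^bsub>T N\<^esub> pure N (x # xs) y = pure N ((a \<odot>\<^bsub>M\<^esub> x) # xs) y"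
  by (simp add: smult_tlift pure_closed tlift_pure tbal_smult)

lemma smult_ahom:
  assumes "left_module A N" "a \<in> carrier A" shows "ahom (T N) (T N) (\<lambda>X. a \<odot>\<^bsub>T N\<^esub> X)"
proof -
  interpret TN: abelian_group "T N" using assms by simp
  note h = tlift_ahom[OF assms(1) T_ag[OF assms(1)] tbal_smult[OF assms]]
  show ?thesis
    by (rule ahomI) (simp_all add: smult_tlift assms ahom_closed[OF h] ahom_add[OF h])
qed

lemma T_left_module [simp]:
  assumes N: "left_module A N" shows "left_module A (T N)"
proof -
  interpret N: left_module A N by fact
  interpret TN: abelian_group "T N" using N by simp
  note c = ahom_closed[OF smult_ahom[OF N]]
  show ?thesis
  proof (intro left_module.intro left_module_axioms.intro)
    show "ring A" by (rule left_module.axioms(1)[OF N])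
    show "abelian_group (T N)" by (rule TN.abelian_group_axioms)
  next
    fix a b X assume *: "a \<in> carrier A" "b \<in> carrier A" "X \<in> carrier (T N)"
    show "(a \<oplus>\<^bsub>A\<^esub> b) \<odot>\<^bsub>T N\<^esub> X = a \<odot>\<^bsub>T N\<^esub> X \<oplus>\<^bsub>T N\<^esub> b \<odot>\<^bsub>T N\<^esub> X"
    proof (rule T_eqI[OF N T_ag[OF N] smult_ahom[OF N] ahom_sum[OF T_ag[OF N]] _ *(3)])
      fix xs y assume "set xs \<subseteq> carrier M" "y \<in> carrier N"
      then show "(a \<oplus>\<^bsub>A\<^esub> b) \<odot>\<^bsub>T N\<^esub> pure N xs y = a \<odot>\<^bsub>T N\<^esub> pure N xs y \<oplus>\<^bsub>T N\<^esub> b \<odot>\<^bsub>T N\<^esub> pure N xs y"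
        using * tbal_add_mid[OF tbal_pure[OF N], of "[]"] tbal_add_last[OF tbal_pure[OF N]]
        by (cases xs) (simp_all add: smult_pure_Nil smult_pure_Cons N smult_l_distr N.smult_l_distr
              smult_closed N.smult_closed)
    qed (use * N in \<open>auto intro!: smult_ahom\<close>)
    show "(a \<otimes>\<^bsub>A\<^esub> b) \<odot>\<^bsub>T N\<^esub> X = a \<odot>\<^bsub>T N\<^esub> (b \<odot>\<^bsub>T N\<^esub> X)"
    proof (rule T_eqI[OF N T_ag[OF N] smult_ahom[OF N] ahom_comp[OF smult_ahom[OF N *(2)] smult_ahom[OF N *(1)]] _ *(3)])
      fix xs y assume "set xs \<subseteq> carrier M" "y \<in> carrier N"
      then show "(a \<otimes>\<^bsub>A\<^esub> b) \<odot>\<^bsub>T N\<^esub> pure N xs y = a \<odot>\<^bsub>T N\<^esub> (b \<odot>\<^bsub>T N\<^esub> pure N xs y)"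
        using *
        by (cases xs) (simp_all add: smult_pure_Nil smult_pure_Cons N smult_assoc N.smult_assoc
              smult_closed N.smult_closed)
    qed (use * N in \<open>auto intro!: smult_ahom\<close>)
  next
    fix X assume *: "X \<in> carrier (T N)"
    show "\<one>\<^bsub>A\<^esub> \<odot>\<^bsub>T N\<^esub> X = X"
    proof (rule T_eqI[OF N T_ag[OF N] smult_ahom[OF N] ahom_id _ *])
      fix xs y assume "set xs \<subseteq> carrier M" "y \<in> carrier N"
      then show "\<one>\<^bsub>A\<^esub> \<odot>\<^bsub>T N\<^esub> pure N xs y = pure N xs y"
        by (cases xs) (simp_all add: smult_pure_Nil smult_pure_Cons N smult_one N.smult_one)
    qed simp
  qed (simp_all add: c ahom_add[OF smult_ahom[OF N]])
qed

subsection \<open>Degrees\<close>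

text \<open>The definition restricts the support of a representative; as the span of the pure
  tensors of length n, the homogeneous part admits induction over generators.\<close>

lemma tdeg_aspan:
  assumes N: "left_module A N"
  shows "tdeg A M N n = aspan (T N) {pure N xs y | xs y. set xs \<subseteq> carrier M \<and> y \<in> carrier N \<and> length xs = n}"
    (is "_ = aspan _ ?S")
proof (intro equalityI subsetI)
  let ?W = "{(xs, y) \<in> twords M N. length xs = n}"
  interpret TN: abelian_group "T N" using N by simp
  fix X assume "X \<in> tdeg A M N n"
  then obtain c where c: "X = tclass A M N c" "Poly_Mapping.keys c \<subseteq> ?W"
    by (auto simp: tdeg_def)
  have "tclass A M N c \<in> aspan (T N) ?S" using c(2)
  proof (rule free_Abelian_group_induct)
    show "tclass A M N 0 \<in> aspan (T N) ?S" by (simp add: tclass_zero[OF N] aspan.zero)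
  next
    fix x y assume *: "Poly_Mapping.keys x \<subseteq> ?W" "Poly_Mapping.keys y \<subseteq> ?W"
      "tclass A M N x \<in> aspan (T N) ?S" "tclass A M N y \<in> aspan (T N) ?S"
    have "Poly_Mapping.keys x \<subseteq> twords M N" "Poly_Mapping.keys y \<subseteq> twords M N" using * by auto
    then show "tclass A M N (x - y) \<in> aspan (T N) ?S"
      using * by (simp add: tclass_diff[OF N] TN.aspan_minus)
  next
    fix w assume "w \<in> ?W"
    then show "tclass A M N (frag_of w) \<in> aspan (T N) ?S"
      by (intro aspan.base) (auto simp: tpure_def twords_iff[OF N])
  qed
  then show "X \<in> aspan (T N) ?S" using c by simp
next
  let ?W = "{(xs, y) \<in> twords M N. length xs = n}"
  have WW: "Poly_Mapping.keys c \<subseteq> twords M N" if "Poly_Mapping.keys c \<subseteq> ?W" for c :: "'m list \<times> 'b \<Rightarrow>\<^sub>0 int"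
    using that by auto
  fix X assume "X \<in> aspan (T N) ?S"
  then show "X \<in> tdeg A M N n"
  proof induction
    case zero
    have "\<zero>\<^bsub>T N\<^esub> = tclass A M N 0" by (simp add: tclass_zero[OF N])
    then show ?case unfolding tdeg_def by fastforce
  next
    case (base s)
    then show ?case unfolding tdeg_def tpure_def
      by (force simp: keys_frag_of twords_iff[OF N])
  next
    case (add x y)
    then obtain c d where cd: "x = tclass A M N c" "y = tclass A M N d"
      "Poly_Mapping.keys c \<subseteq> ?W" "Poly_Mapping.keys d \<subseteq> ?W" by (auto simp: tdeg_def)
    then have "x \<oplus>\<^bsub>T N\<^esub> y = tclass A M N (c + d)" using WW by (simp add: tclass_add[OF N])
    moreover have "Poly_Mapping.keys (c + d) \<subseteq> ?W" by (rule keys_add_subset[OF cd(3,4)])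
    ultimately show ?case unfolding tdeg_def by blast
  next
    case (neg x)
    then obtain c where cd: "x = tclass A M N c" "Poly_Mapping.keys c \<subseteq> ?W" by (auto simp: tdeg_def)
    then have "\<ominus>\<^bsub>T N\<^esub> x = tclass A M N (- c)" using WW by (simp add: tclass_uminus[OF N])
    moreover have "Poly_Mapping.keys (- c) \<subseteq> ?W" using cd by (simp add: keys_minus)
    ultimately show ?case unfolding tdeg_def by blast
  qed
qed

context
  fixes N :: "('a, 'n, 'z) module_scheme"
  assumes N: "left_module A N"
begin

interpretation N: left_module A N by (rule N)
interpretation TN: abelian_group "T N" using N by simp
interpretation TM: left_module A "T N" using N by simp

private lemma gens: "{pure N xs y | xs y. set xs \<subseteq> carrier M \<and> y \<in> carrier N \<and> length xs = n} \<subseteq> carrier (T N)"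
  by (auto intro: pure_closed[OF N])

lemma tdeg_carrier: "X \<in> tdeg A M N n \<Longrightarrow> X \<in> carrier (T N)"
  unfolding tdeg_aspan[OF N] by (rule TN.aspan_closed[OF gens])

lemma tdeg_pure: "\<lbrakk>set xs \<subseteq> carrier M; y \<in> carrier N; length xs = n\<rbrakk> \<Longrightarrow> pure N xs y \<in> tdeg A M N n"
  unfolding tdeg_aspan[OF N] by (rule aspan.base) auto

lemma tdeg_zero: "\<zero>\<^bsub>T N\<^esub> \<in> tdeg A M N n"
  and tdeg_add: "\<lbrakk>X \<in> tdeg A M N n; Y \<in> tdeg A M N n\<rbrakk> \<Longrightarrow> X \<oplus>\<^bsub>T N\<^esub> Y \<in> tdeg A M N n"
  and tdeg_minus: "\<lbrakk>X \<in> tdeg A M N n; Y \<in> tdeg A M N n\<rbrakk> \<Longrightarrow> X \<ominus>\<^bsub>T N\<^esub> Y \<in> tdeg A M N n"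
  and tdeg_neg: "X \<in> tdeg A M N n \<Longrightarrow> \<ominus>\<^bsub>T N\<^esub> X \<in> tdeg A M N n"
  unfolding tdeg_aspan[OF N] by (auto intro: aspan.intros TN.aspan_minus)

lemma tdeg_finsum: "(\<And>i. i \<in> I \<Longrightarrow> g i \<in> tdeg A M N n) \<Longrightarrow> finsum (T N) g I \<in> tdeg A M N n"
  unfolding tdeg_aspan[OF N] by (rule aspan_finsum[OF T_ag[OF N] gens])

lemma tdeg_eqI:
  assumes "abelian_group P" "ahom (T N) P f" "ahom (T N) P g"
    and "\<And>xs y. \<lbrakk>set xs \<subseteq> carrier M; y \<in> carrier N; length xs = n\<rbrakk> \<Longrightarrow> f (pure N xs y) = g (pure N xs y)"
    and X: "X \<in> tdeg A M N n"
  shows "f X = g X"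
  by (rule ahom_eq_on_aspan[OF assms(2,3) T_ag[OF N] assms(1) gens _ X[unfolded tdeg_aspan[OF N]]])
    (use assms(4) in auto)

lemma tdeg_ahom_aspan:
  assumes "abelian_group P" "ahom (T N) P f"
    and "\<And>xs y. \<lbrakk>set xs \<subseteq> carrier M; y \<in> carrier N; length xs = n\<rbrakk> \<Longrightarrow> f (pure N xs y) \<in> aspan P S"
    and X: "X \<in> tdeg A M N n"
  shows "f X \<in> aspan P S"
  by (rule ahom_aspan[OF assms(2) T_ag[OF N] assms(1) gens _ X[unfolded tdeg_aspan[OF N]]])
    (use assms(3) in auto)

text \<open>Every word is either of degree 0 or a word with a prepended letter; this makes it
  possible to treat the tensor algebra as an inductive type.\<close>

lemma tbal_cons_deg:
  assumes P: "abelian_group P"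
    and cons: "\<And>x xs y. \<lbrakk>x \<in> carrier M; set xs \<subseteq> carrier M; y \<in> carrier N; length xs = n\<rbrakk> \<Longrightarrow> f (x # xs) y = g x (pure N xs y)"
    and g: "\<And>x. x \<in> carrier M \<Longrightarrow> ahom (T N) P (g x)"
    and g_add: "\<And>x x' X. \<lbrakk>x \<in> carrier M; x' \<in> carrier M; X \<in> tdeg A M N n\<rbrakk> \<Longrightarrow>
      g (x \<oplus>\<^bsub>M\<^esub> x') X = g x X \<oplus>\<^bsub>P\<^esub> g x' X"
    and g_bal: "\<And>x a X. \<lbrakk>x \<in> carrier M; a \<in> carrier A; X \<in> tdeg A M N n\<rbrakk> \<Longrightarrow>
      g (x \<odot>\<^sub>r\<^bsub>M\<^esub> a) X = g x (a \<odot>\<^bsub>T N\<^esub> X)"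
  shows "tbal A M N P (\<lambda>xs y. if length xs = Suc n then f xs y else \<zero>\<^bsub>P\<^esub>)"
proof -
  interpret P: abelian_group P by fact
  note B = tbal_pure[OF N]
  note pc = pure_closed[OF N]
  note td = tdeg_pure
  show ?thesis
  proof (rule tbalI)
    fix xs y assume "set xs \<subseteq> carrier M" "y \<in> carrier N"
    then show "(if length xs = Suc n then f xs y else \<zero>\<^bsub>P\<^esub>) \<in> carrier P"
      by (cases xs) (auto simp: cons intro!: ahom_closed[OF g] pc)
  next
    fix xs x x' zs y
    assume *: "set xs \<subseteq> carrier M" "x \<in> carrier M" "x' \<in> carrier M" "set zs \<subseteq> carrier M" "y \<in> carrier N"
    then show "(if length (xs @ (x \<oplus>\<^bsub>M\<^esub> x') # zs) = Suc n then f (xs @ (x \<oplus>\<^bsub>M\<^esub> x') # zs) y else \<zero>\<^bsub>P\<^esub>) =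
      (if length (xs @ x # zs) = Suc n then f (xs @ x # zs) y else \<zero>\<^bsub>P\<^esub>) \<oplus>\<^bsub>P\<^esub>
      (if length (xs @ x' # zs) = Suc n then f (xs @ x' # zs) y else \<zero>\<^bsub>P\<^esub>)"
      by (cases xs) (simp_all add: cons g_add pc td tbal_add_mid[OF B] ahom_add[OF g])
  next
    fix xs y y'
    assume *: "set xs \<subseteq> carrier M" "y \<in> carrier N" "y' \<in> carrier N"
    then show "(if length xs = Suc n then f xs (y \<oplus>\<^bsub>N\<^esub> y') else \<zero>\<^bsub>P\<^esub>) =
      (if length xs = Suc n then f xs y else \<zero>\<^bsub>P\<^esub>) \<oplus>\<^bsub>P\<^esub> (if length xs = Suc n then f xs y' else \<zero>\<^bsub>P\<^esub>)"
      by (cases xs) (simp_all add: cons pc tbal_add_last[OF B] ahom_add[OF g])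
  next
    fix xs x a x' zs y
    assume *: "set xs \<subseteq> carrier M" "x \<in> carrier M" "a \<in> carrier A" "x' \<in> carrier M" "set zs \<subseteq> carrier M"
      "y \<in> carrier N"
    then show "(if length (xs @ (x \<odot>\<^sub>r\<^bsub>M\<^esub> a) # x' # zs) = Suc n then f (xs @ (x \<odot>\<^sub>r\<^bsub>M\<^esub> a) # x' # zs) y else \<zero>\<^bsub>P\<^esub>) =
      (if length (xs @ x # (a \<odot>\<^bsub>M\<^esub> x') # zs) = Suc n then f (xs @ x # (a \<odot>\<^bsub>M\<^esub> x') # zs) y else \<zero>\<^bsub>P\<^esub>)"
      by (cases xs) (simp_all add: cons rsmult_closed smult_closed g_bal pc td smult_pure_Cons[OF N] tbal_mid[OF B])
  next
    fix xs x a y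
    assume *: "set xs \<subseteq> carrier M" "x \<in> carrier M" "a \<in> carrier A" "y \<in> carrier N"
    then show "(if length (xs @ [x \<odot>\<^sub>r\<^bsub>M\<^esub> a]) = Suc n then f (xs @ [x \<odot>\<^sub>r\<^bsub>M\<^esub> a]) y else \<zero>\<^bsub>P\<^esub>) =
      (if length (xs @ [x]) = Suc n then f (xs @ [x]) (a \<odot>\<^bsub>N\<^esub> y) else \<zero>\<^bsub>P\<^esub>)"
      by (cases xs) (auto simp: cons rsmult_closed N.smult_closed g_bal pc td smult_pure_Nil[OF N] tbal_last[OF B])
  qed
qed

lemma tbal_prepend:
  assumes "set zs \<subseteq> carrier M" shows "tbal A M N (T N) (\<lambda>xs y. pure N (zs @ xs) y)"
proof (rule tbalI)
  note B = tbal_pure[OF N]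
  fix xs x x' ws y
  assume *: "set xs \<subseteq> carrier M" "x \<in> carrier M" "x' \<in> carrier M" "set ws \<subseteq> carrier M" "y \<in> carrier N"
  then show "pure N (zs @ xs @ (x \<oplus>\<^bsub>M\<^esub> x') # ws) y = pure N (zs @ xs @ x # ws) y \<oplus>\<^bsub>T N\<^esub> pure N (zs @ xs @ x' # ws) y"
    using tbal_add_mid[OF B, of "zs @ xs" x x' ws y] assms by simp
next
  note B = tbal_pure[OF N]
  fix xs x a x' ws y
  assume *: "set xs \<subseteq> carrier M" "x \<in> carrier M" "a \<in> carrier A" "x' \<in> carrier M" "set ws \<subseteq> carrier M"
    "y \<in> carrier N"
  then show "pure N (zs @ xs @ (x \<odot>\<^sub>r\<^bsub>M\<^esub> a) # x' # ws) y = pure N (zs @ xs @ x # (a \<odot>\<^bsub>M\<^esub> x') # ws) y"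
    using tbal_mid[OF B, of "zs @ xs" x a x' ws y] assms by simp
next
  note B = tbal_pure[OF N]
  fix xs x a y
  assume *: "set xs \<subseteq> carrier M" "x \<in> carrier M" "a \<in> carrier A" "y \<in> carrier N"
  then show "pure N (zs @ xs @ [x \<odot>\<^sub>r\<^bsub>M\<^esub> a]) y = pure N (zs @ xs @ [x]) (a \<odot>\<^bsub>N\<^esub> y)"
    using tbal_last[OF B, of "zs @ xs" x a y] assms by simp
qed (use assms in \<open>simp_all add: pure_closed[OF N] tbal_add_last[OF tbal_pure[OF N]]\<close>)

lemma tprepend_ahom: "set zs \<subseteq> carrier M \<Longrightarrow> ahom (T N) (T N) (tprepend A M N zs)"
  unfolding tprepend_def by (rule tlift_ahom[OF N T_ag[OF N] tbal_prepend])

lemma tprepend_pure: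
  "\<lbrakk>set zs \<subseteq> carrier M; set xs \<subseteq> carrier M; y \<in> carrier N\<rbrakk> \<Longrightarrow> tprepend A M N zs (pure N xs y) = pure N (zs @ xs) y"
  unfolding tprepend_def by (rule tlift_pure[OF N T_ag[OF N] tbal_prepend])

lemma tprepend_closed: "\<lbrakk>set zs \<subseteq> carrier M; X \<in> carrier (T N)\<rbrakk> \<Longrightarrow> tprepend A M N zs X \<in> carrier (T N)"
  by (rule ahom_closed[OF tprepend_ahom])

lemma tprepend_append:
  assumes "set us \<subseteq> carrier M" "set zs \<subseteq> carrier M" "X \<in> carrier (T N)"
  shows "tprepend A M N (us @ zs) X = tprepend A M N us (tprepend A M N zs X)"
  by (rule T_eqI[OF N T_ag[OF N] _ ahom_comp[OF tprepend_ahom tprepend_ahom] _ assms(3)])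
    (use assms in \<open>auto intro!: tprepend_ahom simp: tprepend_pure\<close>)

lemma tprepend_Cons:
  "\<lbrakk>x \<in> carrier M; set zs \<subseteq> carrier M; X \<in> carrier (T N)\<rbrakk> \<Longrightarrow>
    tprepend A M N (x # zs) X = tprepend A M N [x] (tprepend A M N zs X)"
  using tprepend_append[of "[x]" zs X] by simp

lemma tprepend_Nil: "X \<in> carrier (T N) \<Longrightarrow> tprepend A M N [] X = X"
  by (rule T_eqI[OF N T_ag[OF N] _ ahom_id])
    (auto intro!: tprepend_ahom simp: tprepend_pure)

text \<open>The target \<open>D\<close> is passed together with a presentation as a span, so that
  the rule serves for the parts \<open>tdeg\<close> of any bimodule and also for the finer parts
  \<open>Tdeg\<close> introduced later.\<close>

lemma tdeg_ahom:
  assumes "abelian_group P" "ahom (T N) P f" "aspan P S = D"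
    and "\<And>xs y. \<lbrakk>set xs \<subseteq> carrier M; y \<in> carrier N; length xs = n\<rbrakk> \<Longrightarrow> f (pure N xs y) \<in> D"
    and X: "X \<in> tdeg A M N n"
  shows "f X \<in> D"
  using tdeg_ahom_aspan[of P f n S] assms by blast

lemma tprepend_tdeg:
  "\<lbrakk>set zs \<subseteq> carrier M; X \<in> tdeg A M N n; m = length zs + n\<rbrakk> \<Longrightarrow> tprepend A M N zs X \<in> tdeg A M N m"
  by (rule tdeg_ahom[OF T_ag[OF N] tprepend_ahom tdeg_aspan[OF N, symmetric]])
    (auto simp: tprepend_pure intro!: tdeg_pure)

lemma tp_add:
  assumes "x \<in> carrier M" "x' \<in> carrier M" "X \<in> carrier (T N)"
  shows "tprepend A M N [x \<oplus>\<^bsub>M\<^esub> x'] X = tprepend A M N [x] X \<oplus>\<^bsub>T N\<^esub> tprepend A M N [x'] X"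
  by (rule T_eqI[OF N T_ag[OF N] _ ahom_sum[OF T_ag[OF N]] _ assms(3)])
    (use assms tbal_add_mid[OF tbal_pure[OF N], of "[]"] in
      \<open>auto intro!: tprepend_ahom simp: tprepend_pure\<close>)

text \<open>The scalar is absorbed by whatever follows \<open>x\<close>: the next letter, or the
  last factor if the word is empty. Accordingly both kinds of balancing relators occur.\<close>

lemma tp_bal:
  assumes "x \<in> carrier M" "a \<in> carrier A" "X \<in> carrier (T N)"
  shows "tprepend A M N [x \<odot>\<^sub>r\<^bsub>M\<^esub> a] X = tprepend A M N [x] (a \<odot>\<^bsub>T N\<^esub> X)"
proof (rule T_eqI[OF N T_ag[OF N] _ ahom_comp[OF smult_ahom[OF N] tprepend_ahom] _ assms(3)])
  fix xs y assume "set xs \<subseteq> carrier M" "y \<in> carrier N"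
  then show "tprepend A M N [x \<odot>\<^sub>r\<^bsub>M\<^esub> a] (pure N xs y) = tprepend A M N [x] (a \<odot>\<^bsub>T N\<^esub> pure N xs y)"
    using assms tbal_mid[OF tbal_pure[OF N], of "[]"] tbal_last[OF tbal_pure[OF N], of "[]"]
    by (cases xs) (simp_all add: smult_pure_Nil[OF N] smult_pure_Cons[OF N] tprepend_pure N.smult_closed
        smult_closed rsmult_closed)
qed (use assms in \<open>auto intro!: tprepend_ahom rsmult_closed\<close>)

lemma smult_tp:
  assumes "a \<in> carrier A" "x \<in> carrier M" "X \<in> carrier (T N)"
  shows "a \<odot>\<^bsub>T N\<^esub> tprepend A M N [x] X = tprepend A M N [a \<odot>\<^bsub>M\<^esub> x] X"
  by (rule T_eqI[OF N T_ag[OF N] ahom_comp[OF tprepend_ahom smult_ahom[OF N]] _ _ assms(3)])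
    (use assms in \<open>auto intro!: tprepend_ahom smult_closed simp: tprepend_pure smult_pure_Cons[OF N] smult_closed\<close>)

lemma smult_tdeg: "\<lbrakk>a \<in> carrier A; X \<in> tdeg A M N n\<rbrakk> \<Longrightarrow> a \<odot>\<^bsub>T N\<^esub> X \<in> tdeg A M N n"
proof (rule tdeg_ahom[OF T_ag[OF N] smult_ahom[OF N] tdeg_aspan[OF N, symmetric]])
  fix xs y assume "a \<in> carrier A" "set xs \<subseteq> carrier M" "y \<in> carrier N" "length xs = n"
  then show "a \<odot>\<^bsub>T N\<^esub> pure N xs y \<in> tdeg A M N n"
    by (cases xs) (auto simp: smult_pure_Nil[OF N] smult_pure_Cons[OF N] N.smult_closed smult_closed
        intro!: tdeg_pure)
qed

lemma pure_Nil_ahom: "ahom N (T N) (pure N [])"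
  by (rule ahomI) (simp_all add: pure_closed[OF N] tbal_add_last[OF tbal_pure[OF N]])

lemma pure_Nil_lhom: "lhom A N (T N) (pure N [])"
  by (rule lhomI[OF pure_Nil_ahom]) (simp add: smult_pure_Nil[OF N])

lemma tp_pure: "\<lbrakk>x \<in> carrier M; set xs \<subseteq> carrier M; y \<in> carrier N\<rbrakk> \<Longrightarrow> tprepend A M N [x] (pure N xs y) = pure N (x # xs) y"
  by (simp add: tprepend_pure)

text \<open>Every law other than closure and additivity in the last argument concerns nonempty
  words, where the function is zero.\<close>

lemma tbal_Nil:
  assumes P: "abelian_group P" and h: "ahom N P h"
  shows "tbal A M N P (\<lambda>xs y. if xs = [] then h y else \<zero>\<^bsub>P\<^esub>)"
proof -
  interpret P: abelian_group P by fact
  show ?thesis by (rule tbalI) (auto simp: ahom_closed[OF h] ahom_add[OF h])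
qed

lemma tdown_ahom: "ahom (T N) N (tdown N)"
  unfolding tdown_def
  using tlift_ahom[OF N N.M.abelian_group_axioms tbal_Nil[OF N.M.abelian_group_axioms ahom_id]] .

lemma tdown_pure: "\<lbrakk>set xs \<subseteq> carrier M; y \<in> carrier N\<rbrakk> \<Longrightarrow> tdown N (pure N xs y) = (if xs = [] then y else \<zero>\<^bsub>N\<^esub>)"
  unfolding tdown_def
  using tlift_pure[OF N N.M.abelian_group_axioms tbal_Nil[OF N.M.abelian_group_axioms ahom_id]] by simp

lemma tdown_lhom: "lhom A (T N) N (tdown N)"
proof (rule lhomI[OF tdown_ahom])
  fix a X assume *: "a \<in> carrier A" "X \<in> carrier (T N)"
  show "tdown N (a \<odot>\<^bsub>T N\<^esub> X) = a \<odot>\<^bsub>N\<^esub> tdown N X"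
  proof (rule T_eqI[OF N N.M.abelian_group_axioms ahom_comp[OF smult_ahom[OF N *(1)] tdown_ahom]
        ahom_comp[OF tdown_ahom left_module_ahom[OF N *(1)]] _ *(2)])
    fix xs y assume "set xs \<subseteq> carrier M" "y \<in> carrier N"
    then show "tdown N (a \<odot>\<^bsub>T N\<^esub> pure N xs y) = a \<odot>\<^bsub>N\<^esub> tdown N (pure N xs y)"
      using * by (cases xs) (simp_all add: smult_pure_Nil[OF N] smult_pure_Cons[OF N] N.smult_closed
        smult_closed tdown_pure left_module_smult_zero[OF N])
  qed
qed

lemma tdeg_0_eq: "X \<in> tdeg A M N 0 \<Longrightarrow> X = pure N [] (tdown N X)"
  by (rule tdeg_eqI[OF T_ag[OF N] ahom_id ahom_comp[OF tdown_ahom pure_Nil_ahom]])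
    (auto simp: tdown_pure)

text \<open>Relators preserve the length, so each degree is handled on its own, degree 0 by
  \<open>tbal_Nil\<close> and the positive ones by \<open>tbal_cons_deg\<close>, and the pieces are
  glued by \<open>tbal_by_length\<close>.\<close>

lemma tbal_cons:
  assumes P: "abelian_group P"
    and nil: "ahom N P (f [])"
    and cons: "\<And>x xs y. \<lbrakk>x \<in> carrier M; set xs \<subseteq> carrier M; y \<in> carrier N\<rbrakk> \<Longrightarrow> f (x # xs) y = g x (pure N xs y)"
    and g: "\<And>x. x \<in> carrier M \<Longrightarrow> ahom (T N) P (g x)"
    and g_add: "\<And>x x' X. \<lbrakk>x \<in> carrier M; x' \<in> carrier M; X \<in> carrier (T N)\<rbrakk> \<Longrightarrow>
      g (x \<oplus>\<^bsub>M\<^esub> x') X = g x X \<oplus>\<^bsub>P\<^esub> g x' X"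
    and g_bal: "\<And>x a X. \<lbrakk>x \<in> carrier M; a \<in> carrier A; X \<in> carrier (T N)\<rbrakk> \<Longrightarrow>
      g (x \<odot>\<^sub>r\<^bsub>M\<^esub> a) X = g x (a \<odot>\<^bsub>T N\<^esub> X)"
  shows "tbal A M N P f"
proof -
  have "tbal A M N P (\<lambda>xs y. if length xs = n then f xs y else \<zero>\<^bsub>P\<^esub>)" for n
  proof (cases n)
    case 0
    have "(\<lambda>xs y. if length xs = n then f xs y else \<zero>\<^bsub>P\<^esub>) = (\<lambda>xs y. if xs = [] then f [] y else \<zero>\<^bsub>P\<^esub>)"
      using 0 by (intro ext) auto
    then show ?thesis using tbal_Nil[OF P nil] by simp
  next
    case (Suc m)
    show ?thesis
      unfolding Suc
      by (rule tbal_cons_deg[OF P, where g = g]) (simp_all add: cons g g_add g_bal tdeg_carrier)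
  qed
  from tbal_by_length[where F = "\<lambda>n xs y. if length xs = n then f xs y else \<zero>\<^bsub>P\<^esub>", OF this]
  show ?thesis by simp
qed

text \<open>A word of length one is a letter in front of a tensor of degree 0, and
  \<open>tdown\<close> converts that tensor into an element of \<open>N\<close>; this makes it a
  case of \<open>tbal_cons_deg\<close>.\<close>

lemma tbal_single:
  assumes P: "abelian_group P"
    and h: "\<And>x. x \<in> carrier M \<Longrightarrow> ahom N P (h x)"
    and h_add: "\<And>x x' y. \<lbrakk>x \<in> carrier M; x' \<in> carrier M; y \<in> carrier N\<rbrakk> \<Longrightarrow>
      h (x \<oplus>\<^bsub>M\<^esub> x') y = h x y \<oplus>\<^bsub>P\<^esub> h x' y"
    and h_bal: "\<And>x a y. \<lbrakk>x \<in> carrier M; a \<in> carrier A; y \<in> carrier N\<rbrakk> \<Longrightarrow>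
      h (x \<odot>\<^sub>r\<^bsub>M\<^esub> a) y = h x (a \<odot>\<^bsub>N\<^esub> y)"
  shows "tbal A M N P (\<lambda>xs y. case xs of [x] \<Rightarrow> h x y | _ \<Rightarrow> \<zero>\<^bsub>P\<^esub>)"
proof -
  have e: "(\<lambda>xs y. case xs of [x] \<Rightarrow> h x y | _ \<Rightarrow> \<zero>\<^bsub>P\<^esub>) = (\<lambda>xs y. if length xs = Suc 0 then h (hd xs) y else \<zero>\<^bsub>P\<^esub>)"
    by (intro ext) (auto split: list.split)
  note td = ahom_closed[OF tdown_ahom tdeg_carrier]
  show ?thesis
    unfolding e
    by (rule tbal_cons_deg[OF P, where g = "\<lambda>x X. h x (tdown N X)"])
      (auto simp: tdown_pure h_add h_bal td lhom_smult[OF tdown_lhom] tdeg_carrier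
        intro: ahom_comp[OF tdown_ahom h])
qed

end

subsection \<open>Contraction and substitution\<close>

context
  fixes N :: "('a, 'n, 'z) module_scheme"
  assumes N: "left_module A N"
begin

interpretation N: left_module A N by (rule N)
interpretation TN: left_module A "T N" using N by simp

lemma tbal_ctr:
  assumes u: "rlin A M u"
  shows "tbal A M N (T N) (\<lambda>xs y. case xs of [] \<Rightarrow> \<zero>\<^bsub>T N\<^esub> | x # zs \<Rightarrow> u x \<odot>\<^bsub>T N\<^esub> pure N zs y)"
  by (rule tbal_cons[OF N T_ag[OF N], where g = "\<lambda>x X. u x \<odot>\<^bsub>T N\<^esub> X"])
    (use u in \<open>auto simp: ahom_const_zero N rlin_closed rlin_add rlin_rsmult TN.smult_l_distr TN.smult_assoc
      intro!: smult_ahom[OF N]\<close>)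

lemma ctr_ahom: "rlin A M u \<Longrightarrow> ahom (T N) (T N) (ctr A M N u)"
  unfolding ctr_def by (rule tlift_ahom[OF N T_ag[OF N] tbal_ctr])

lemma ctr_pure_Nil: "\<lbrakk>rlin A M u; y \<in> carrier N\<rbrakk> \<Longrightarrow> ctr A M N u (pure N [] y) = \<zero>\<^bsub>T N\<^esub>"
  unfolding ctr_def by (subst tlift_pure[OF N T_ag[OF N] tbal_ctr]) auto

lemma ctr_pure_Cons:
  "\<lbrakk>rlin A M u; x \<in> carrier M; set xs \<subseteq> carrier M; y \<in> carrier N\<rbrakk> \<Longrightarrow>
    ctr A M N u (pure N (x # xs) y) = u x \<odot>\<^bsub>T N\<^esub> pure N xs y"
  unfolding ctr_def by (subst tlift_pure[OF N T_ag[OF N] tbal_ctr]) auto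

lemma ctr_closed: "\<lbrakk>rlin A M u; X \<in> carrier (T N)\<rbrakk> \<Longrightarrow> ctr A M N u X \<in> carrier (T N)"
  by (rule ahom_closed[OF ctr_ahom])

lemma ctr_tp:
  assumes "rlin A M u" "x \<in> carrier M" "X \<in> carrier (T N)"
  shows "ctr A M N u (tprepend A M N [x] X) = u x \<odot>\<^bsub>T N\<^esub> X"
  by (rule T_eqI[OF N T_ag[OF N] ahom_comp[OF tprepend_ahom[OF N] ctr_ahom] _ _ assms(3)])
    (use assms in \<open>auto intro!: smult_ahom[OF N] simp: rlin_closed tprepend_pure[OF N] ctr_pure_Cons\<close>)

lemma ctr_tdeg: "\<lbrakk>rlin A M u; X \<in> tdeg A M N (Suc n)\<rbrakk> \<Longrightarrow> ctr A M N u X \<in> tdeg A M N n"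
proof (rule tdeg_ahom[OF N T_ag[OF N] ctr_ahom tdeg_aspan[OF N, symmetric]])
  fix xs y assume "rlin A M u" "set xs \<subseteq> carrier M" "y \<in> carrier N" "length xs = Suc n"
  then show "ctr A M N u (pure N xs y) \<in> tdeg A M N n"
    by (cases xs) (auto simp: ctr_pure_Cons rlin_closed intro!: smult_tdeg[OF N] tdeg_pure[OF N])
qed auto

lemma ctr_add_left:
  assumes "rlin A M u" "rlin A M v" "rlin A M w" "\<And>x. x \<in> carrier M \<Longrightarrow> w x = u x \<oplus>\<^bsub>A\<^esub> v x" "X \<in> carrier (T N)"
  shows "ctr A M N w X = ctr A M N u X \<oplus>\<^bsub>T N\<^esub> ctr A M N v X"
proof (rule T_eqI[OF N T_ag[OF N] ctr_ahom[OF assms(3)] ahom_sum[OF T_ag[OF N] ctr_ahom[OF assms(1)]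
        ctr_ahom[OF assms(2)]] _ assms(5)])
  fix xs y assume "set xs \<subseteq> carrier M" "y \<in> carrier N"
  then show "ctr A M N w (pure N xs y) = ctr A M N u (pure N xs y) \<oplus>\<^bsub>T N\<^esub> ctr A M N v (pure N xs y)"
    using assms by (cases xs) (simp_all add: ctr_pure_Nil ctr_pure_Cons TN.smult_l_distr rlin_closed pure_closed[OF N])
qed

lemma ctr_smult_left:
  assumes "rlin A M u" "rlin A M w" "a \<in> carrier A" "\<And>x. x \<in> carrier M \<Longrightarrow> w x = a \<otimes>\<^bsub>A\<^esub> u x" "X \<in> carrier (T N)"
  shows "ctr A M N w X = a \<odot>\<^bsub>T N\<^esub> ctr A M N u X"
proof (rule T_eqI[OF N T_ag[OF N] ctr_ahom[OF assms(2)] ahom_comp[OF ctr_ahom[OF assms(1)] smult_ahom[OF N assms(3)]]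
       _ assms(5)])
  fix xs y assume "set xs \<subseteq> carrier M" "y \<in> carrier N"
  then show "ctr A M N w (pure N xs y) = a \<odot>\<^bsub>T N\<^esub> ctr A M N u (pure N xs y)"
    using assms by (cases xs) (simp_all add: ctr_pure_Nil ctr_pure_Cons TN.smult_assoc rlin_closed pure_closed[OF N]
      left_module_smult_zero[OF T_left_module[OF N]])
qed

lemma ctr_smult_right:
  assumes "rlin A M u" "rlin A M w" "a \<in> carrier A" "\<And>x. x \<in> carrier M \<Longrightarrow> w x = u (a \<odot>\<^bsub>M\<^esub> x)" "X \<in> carrier (T N)"
  shows "ctr A M N w X = ctr A M N u (a \<odot>\<^bsub>T N\<^esub> X)"
proof (rule T_eqI[OF N T_ag[OF N] ctr_ahom[OF assms(2)] ahom_comp[OF smult_ahom[OF N assms(3)] ctr_ahom[OF assms(1)]]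
       _ assms(5)])
  fix xs y assume "set xs \<subseteq> carrier M" "y \<in> carrier N"
  then show "ctr A M N w (pure N xs y) = ctr A M N u (a \<odot>\<^bsub>T N\<^esub> pure N xs y)"
    using assms by (cases xs) (simp_all add: ctr_pure_Nil ctr_pure_Cons smult_pure_Cons[OF N]
        smult_pure_Nil[OF N] N.smult_closed smult_closed)
qed

context
  fixes b :: "nat \<Rightarrow> 'm" and u :: "nat \<Rightarrow> 'm \<Rightarrow> 'a" and k :: nat
  assumes b: "\<And>i. i < k \<Longrightarrow> b i \<in> carrier M" and u: "\<And>i. i < k \<Longrightarrow> rlin A M (u i)"
    and dual: "\<And>x. x \<in> carrier M \<Longrightarrow> x = finsum M (\<lambda>i. b i \<odot>\<^sub>r\<^bsub>M\<^esub> u i x) {..<k}"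
begin

text \<open>The first letter is expanded in the dual basis, and its coefficients are moved across
  the tensor sign, where they become the contractions of \<open>X\<close>. Positive degree
  guarantees a first letter.\<close>

lemma ctr_expansion:
  assumes X: "X \<in> tdeg A M N (Suc n)"
  shows "X = finsum (T N) (\<lambda>i. tprepend A M N [b i] (ctr A M N (u i) X)) {..<k}"
proof -
  have fs: "ahom M (T N) (\<lambda>x. tprepend A M N [x] Y)" if "Y \<in> carrier (T N)" for Y
    by (rule ahomI) (use that in \<open>simp_all add: tprepend_closed[OF N] tp_add[OF N]\<close>)
  have h: "ahom (T N) (T N) (\<lambda>X. finsum (T N) (\<lambda>i. tprepend A M N [b i] (ctr A M N (u i) X)) {..<k})"
  proof (rule ahomI)
    fix X assume "X \<in> carrier (T N)"
    then show "finsum (T N) (\<lambda>i. tprepend A M N [b i] (ctr A M N (u i) X)) {..<k} \<in> carrier (T N)"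
      by (intro TN.M.finsum_closed) (auto intro!: tprepend_closed[OF N] ctr_closed b u)
  next
    fix X Y assume XY: "X \<in> carrier (T N)" "Y \<in> carrier (T N)"
    have "finsum (T N) (\<lambda>i. tprepend A M N [b i] (ctr A M N (u i) (X \<oplus>\<^bsub>T N\<^esub> Y))) {..<k}
      = finsum (T N) (\<lambda>i. tprepend A M N [b i] (ctr A M N (u i) X) \<oplus>\<^bsub>T N\<^esub> tprepend A M N [b i] (ctr A M N (u i) Y)) {..<k}"
      by (rule TN.M.finsum_cong') (use XY in \<open>auto simp: ahom_add[OF ctr_ahom[OF u]] ahom_add[OF tprepend_ahom[OF N]]
         b u ctr_closed intro!: TN.M.a_closed tprepend_closed[OF N] ctr_closed\<close>)
    also have "\<dots> = finsum (T N) (\<lambda>i. tprepend A M N [b i] (ctr A M N (u i) X)) {..<k} \<oplus>\<^bsub>T N\<^esub>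
       finsum (T N) (\<lambda>i. tprepend A M N [b i] (ctr A M N (u i) Y)) {..<k}"
      by (rule TN.M.finsum_addf) (use XY in \<open>auto intro!: tprepend_closed[OF N] ctr_closed b u\<close>)
    finally show "finsum (T N) (\<lambda>i. tprepend A M N [b i] (ctr A M N (u i) (X \<oplus>\<^bsub>T N\<^esub> Y))) {..<k} = \<dots>" .
  qed
  show ?thesis
  proof (rule tdeg_eqI[OF N T_ag[OF N] ahom_id h _ X])
    fix xs y assume *: "set xs \<subseteq> carrier M" "y \<in> carrier N" "length xs = Suc n"
    then obtain x zs where xs: "xs = x # zs" "x \<in> carrier M" "set zs \<subseteq> carrier M" by (cases xs) auto
    have Z: "pure N zs y \<in> carrier (T N)" using * xs by (simp add: pure_closed[OF N])
    have "pure N xs y = tprepend A M N [finsum M (\<lambda>i. b i \<odot>\<^sub>r\<^bsub>M\<^esub> u i x) {..<k}] (pure N zs y)"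
      using dual[OF xs(2)] xs * by (simp add: tp_pure[OF N])
    also have "\<dots> = finsum (T N) (\<lambda>i. tprepend A M N [b i \<odot>\<^sub>r\<^bsub>M\<^esub> u i x] (pure N zs y)) {..<k}"
      by (rule ahom_finsum[OF fs[OF Z] M.abelian_group_axioms T_ag[OF N]])
        (auto intro!: rsmult_closed b rlin_closed[OF u] xs)
    also have "\<dots> = finsum (T N) (\<lambda>i. tprepend A M N [b i] (ctr A M N (u i) (pure N xs y))) {..<k}"
      by (rule TN.M.finsum_cong') (use xs * in \<open>auto simp: b u Z tp_bal[OF N] rlin_closed[OF u] ctr_pure_Cons
        intro!: tprepend_closed[OF N] TN.smult_closed\<close>)
    finally show "pure N xs y = \<dots>" .
  qed
qed

lemma ctr_separates:
  assumes X: "X \<in> tdeg A M N (Suc n)" and zero: "\<And>i. i < k \<Longrightarrow> ctr A M N (u i) X = \<zero>\<^bsub>T N\<^esub>"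
  shows "X = \<zero>\<^bsub>T N\<^esub>"
proof -
  have "X = finsum (T N) (\<lambda>i. tprepend A M N [b i] (ctr A M N (u i) X)) {..<k}"
    by (rule ctr_expansion[OF X])
  also have "\<dots> = finsum (T N) (\<lambda>i. \<zero>\<^bsub>T N\<^esub>) {..<k}"
    by (rule TN.M.finsum_cong') (auto simp: zero b ahom_zero[OF tprepend_ahom[OF N] T_ag[OF N] T_ag[OF N]])
  finally show ?thesis by simp
qed

end

lemma tbal_apply_first:
  assumes u: "rlin A M u"
  shows "tbal A M N N (\<lambda>xs y. case xs of [\<omega>] \<Rightarrow> u \<omega> \<odot>\<^bsub>N\<^esub> y | _ \<Rightarrow> \<zero>\<^bsub>N\<^esub>)"
  by (rule tbal_single[OF N N.M.abelian_group_axioms])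
    (use u in \<open>auto simp: rlin_closed rlin_add rlin_rsmult N.smult_l_distr N.smult_assoc
      intro!: left_module_ahom[OF N]\<close>)

lemma apply_first_ahom: "rlin A M u \<Longrightarrow> ahom (T N) N (apply_first N u)"
  unfolding apply_first_def by (rule tlift_ahom[OF N N.M.abelian_group_axioms tbal_apply_first])

lemma apply_first_pure:
  "\<lbrakk>rlin A M u; x \<in> carrier M; y \<in> carrier N\<rbrakk> \<Longrightarrow> apply_first N u (pure N [x] y) = u x \<odot>\<^bsub>N\<^esub> y"
  unfolding apply_first_def by (subst tlift_pure[OF N N.M.abelian_group_axioms tbal_apply_first]) auto

lemma apply_first_closed: "\<lbrakk>rlin A M u; X \<in> carrier (T N)\<rbrakk> \<Longrightarrow> apply_first N u X \<in> carrier N"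
  by (rule ahom_closed[OF apply_first_ahom])

lemma apply_first_eqI:
  assumes "abelian_group P" "ahom (T N) P f" "ahom (T N) P g" "X \<in> tdeg A M N (Suc 0)"
    and "\<And>x y. \<lbrakk>x \<in> carrier M; y \<in> carrier N\<rbrakk> \<Longrightarrow> f (pure N [x] y) = g (pure N [x] y)"
  shows "f X = g X"
  by (rule tdeg_eqI[OF N assms(1-3) _ assms(4)]) (use assms(5) in \<open>auto simp: length_Suc_conv\<close>)

lemma ctr_apply_first:
  assumes u: "rlin A M u" and X: "X \<in> tdeg A M N (Suc 0)"
  shows "ctr A M N u X = pure N [] (apply_first N u X)"
  by (rule apply_first_eqI[OF T_ag[OF N] ctr_ahom[OF u] ahom_comp[OF apply_first_ahom[OF u] pure_Nil_ahom[OF N]] X])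
    (use u in \<open>simp add: ctr_pure_Cons apply_first_pure rlin_closed smult_pure_Nil[OF N]\<close>)

lemma apply_first_add_left:
  assumes "rlin A M u" "rlin A M v" "rlin A M w" "\<And>x. x \<in> carrier M \<Longrightarrow> w x = u x \<oplus>\<^bsub>A\<^esub> v x" "X \<in> tdeg A M N (Suc 0)"
  shows "apply_first N w X = apply_first N u X \<oplus>\<^bsub>N\<^esub> apply_first N v X"
  by (rule apply_first_eqI[OF N.M.abelian_group_axioms apply_first_ahom[OF assms(3)]
        ahom_sum[OF N.M.abelian_group_axioms apply_first_ahom[OF assms(1)] apply_first_ahom[OF assms(2)]] assms(5)])
    (use assms in \<open>simp add: apply_first_pure rlin_closed N.smult_l_distr\<close>)

lemma apply_first_smult_left:
  assumes "rlin A M u" "rlin A M w" "a \<in> carrier A" "\<And>x. x \<in> carrier M \<Longrightarrow> w x = a \<otimes>\<^bsub>A\<^esub> u x" "X \<in> tdeg A M N (Suc 0)"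
  shows "apply_first N w X = a \<odot>\<^bsub>N\<^esub> apply_first N u X"
  by (rule apply_first_eqI[OF N.M.abelian_group_axioms apply_first_ahom[OF assms(2)]
        ahom_comp[OF apply_first_ahom[OF assms(1)] left_module_ahom[OF N assms(3)]] assms(5)])
    (use assms in \<open>simp add: apply_first_pure rlin_closed N.smult_assoc\<close>)

lemma apply_first_smult_right:
  assumes "rlin A M u" "rlin A M w" "a \<in> carrier A" "\<And>x. x \<in> carrier M \<Longrightarrow> w x = u (a \<odot>\<^bsub>M\<^esub> x)" "X \<in> tdeg A M N (Suc 0)"
  shows "apply_first N w X = apply_first N u (a \<odot>\<^bsub>T N\<^esub> X)"
  by (rule apply_first_eqI[OF N.M.abelian_group_axioms apply_first_ahom[OF assms(2)]
        ahom_comp[OF smult_ahom[OF N assms(3)] apply_first_ahom[OF assms(1)]] assms(5)])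
    (use assms in \<open>simp add: apply_first_pure rlin_closed smult_pure_Cons[OF N] smult_closed\<close>)

end

context
  fixes N :: "('a, 'n, 'z) module_scheme" and N' :: "('a, 'p, 'w) module_scheme" and \<phi>
  assumes N: "left_module A N" and N': "left_module A N'" and \<phi>: "lhom A N' (T N) \<phi>"
begin

interpretation N: left_module A N by (rule N)
interpretation N': left_module A N' by (rule N')
interpretation TN: left_module A "T N" using N by simp

private lemma Suc_cons: "\<lbrakk>x \<in> carrier M; set xs \<subseteq> carrier M; y \<in> carrier N'\<rbrakk> \<Longrightarrow>
  tprepend A M N (x # xs) (\<phi> y) = tprepend A M N [x] (tprepend A M N xs (\<phi> y))"
  by (rule tprepend_Cons[OF N]) (auto intro: lhom_closed[OF \<phi>])

lemma tbind_tprepend_smult: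
  assumes "set xs \<subseteq> carrier M" "y \<in> carrier N'" "a \<in> carrier A"
  shows "tprepend A M N (fst (word_smult M N' a (xs, y))) (\<phi> (snd (word_smult M N' a (xs, y)))) =
    a \<odot>\<^bsub>T N\<^esub> tprepend A M N xs (\<phi> y)"
proof (cases xs)
  case Nil
  then show ?thesis using assms \<phi> by (simp add: tprepend_Nil[OF N] lhom_closed[OF \<phi>] lhom_smult[OF \<phi>] TN.smult_closed)
next
  case (Cons x zs)
  then show ?thesis
    using assms by (simp add: Suc_cons smult_closed smult_tp[OF N] tprepend_closed[OF N] lhom_closed[OF \<phi>])
qed

lemma tbal_tbind: "tbal A M N' (T N) (\<lambda>xs y. tprepend A M N xs (\<phi> y))"
proof (rule tbalI)
  fix xs y assume "set xs \<subseteq> carrier M" "y \<in> carrier N'"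
  then show "tprepend A M N xs (\<phi> y) \<in> carrier (T N)"
    by (intro tprepend_closed[OF N] lhom_closed[OF \<phi>])
next
  fix xs x x' zs y
  assume *: "set xs \<subseteq> carrier M" "x \<in> carrier M" "x' \<in> carrier M" "set zs \<subseteq> carrier M" "y \<in> carrier N'"
  then have c: "tprepend A M N zs (\<phi> y) \<in> carrier (T N)"
    by (intro tprepend_closed[OF N] lhom_closed[OF \<phi>])
  show "tprepend A M N (xs @ (x \<oplus>\<^bsub>M\<^esub> x') # zs) (\<phi> y) =
    tprepend A M N (xs @ x # zs) (\<phi> y) \<oplus>\<^bsub>T N\<^esub> tprepend A M N (xs @ x' # zs) (\<phi> y)"
    using * c
    by (simp add: tprepend_append[OF N] Suc_cons lhom_closed[OF \<phi>] tp_add[OF N] ahom_add[OF tprepend_ahom[OF N]]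
        tprepend_closed[OF N])
next
  fix xs y y'
  assume *: "set xs \<subseteq> carrier M" "y \<in> carrier N'" "y' \<in> carrier N'"
  then show "tprepend A M N xs (\<phi> (y \<oplus>\<^bsub>N'\<^esub> y')) = tprepend A M N xs (\<phi> y) \<oplus>\<^bsub>T N\<^esub> tprepend A M N xs (\<phi> y')"
    by (simp add: lhom_add[OF \<phi>] ahom_add[OF tprepend_ahom[OF N]] lhom_closed[OF \<phi>])
next
  fix xs x a x' zs y
  assume *: "set xs \<subseteq> carrier M" "x \<in> carrier M" "a \<in> carrier A" "x' \<in> carrier M" "set zs \<subseteq> carrier M"
    "y \<in> carrier N'"
  then have c: "tprepend A M N zs (\<phi> y) \<in> carrier (T N)"
    by (intro tprepend_closed[OF N] lhom_closed[OF \<phi>])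
  show "tprepend A M N (xs @ (x \<odot>\<^sub>r\<^bsub>M\<^esub> a) # x' # zs) (\<phi> y) = tprepend A M N (xs @ x # (a \<odot>\<^bsub>M\<^esub> x') # zs) (\<phi> y)"
    using * c
    by (simp add: tprepend_append[OF N] Suc_cons lhom_closed[OF \<phi>] tp_bal[OF N] rsmult_closed smult_closed smult_tp[OF N]
        tprepend_closed[OF N])
next
  fix xs x a y
  assume *: "set xs \<subseteq> carrier M" "x \<in> carrier M" "a \<in> carrier A" "y \<in> carrier N'"
  then show "tprepend A M N (xs @ [x \<odot>\<^sub>r\<^bsub>M\<^esub> a]) (\<phi> y) = tprepend A M N (xs @ [x]) (\<phi> (a \<odot>\<^bsub>N'\<^esub> y))"
    by (simp add: tprepend_append[OF N] lhom_closed[OF \<phi>] tp_bal[OF N] rsmult_closed lhom_smult[OF \<phi>] TN.smult_closed)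
qed

lemma tbind_ahom: "ahom (T N') (T N) (tbind A M N \<phi>)"
  unfolding tbind_def by (rule tlift_ahom[OF N' T_ag[OF N] tbal_tbind])

lemma tbind_closed: "X \<in> carrier (T N') \<Longrightarrow> tbind A M N \<phi> X \<in> carrier (T N)"
  by (rule ahom_closed[OF tbind_ahom])

lemma tbind_pure: "\<lbrakk>set xs \<subseteq> carrier M; y \<in> carrier N'\<rbrakk> \<Longrightarrow> tbind A M N \<phi> (pure N' xs y) = tprepend A M N xs (\<phi> y)"
  unfolding tbind_def by (rule tlift_pure[OF N' T_ag[OF N] tbal_tbind])

lemma tbind_pure_Nil: "y \<in> carrier N' \<Longrightarrow> tbind A M N \<phi> (pure N' [] y) = \<phi> y"
  by (simp add: tbind_pure tprepend_Nil[OF N] lhom_closed[OF \<phi>])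

lemma tbind_lhom: "lhom A (T N') (T N) (tbind A M N \<phi>)"
proof (rule lhomI[OF tbind_ahom])
  fix a X assume *: "a \<in> carrier A" "X \<in> carrier (T N')"
  show "tbind A M N \<phi> (a \<odot>\<^bsub>T N'\<^esub> X) = a \<odot>\<^bsub>T N\<^esub> tbind A M N \<phi> X"
  proof (rule T_eqI[OF N' T_ag[OF N] ahom_comp[OF smult_ahom[OF N' *(1)] tbind_ahom] ahom_comp[OF tbind_ahom smult_ahom[OF N *(1)]] _ *(2)])
    fix xs y assume xs: "set xs \<subseteq> carrier M" "y \<in> carrier N'"
    then show "tbind A M N \<phi> (a \<odot>\<^bsub>T N'\<^esub> pure N' xs y) = a \<odot>\<^bsub>T N\<^esub> tbind A M N \<phi> (pure N' xs y)"
      using * tbind_tprepend_smult[OF xs *(1)]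
      by (cases xs) (simp_all add: smult_pure_Nil[OF N'] smult_pure_Cons[OF N'] tbind_pure smult_closed N'.smult_closed)
  qed
qed

lemma tbind_tdeg:
  assumes "\<And>y. y \<in> carrier N' \<Longrightarrow> \<phi> y \<in> tdeg A M N k" "X \<in> tdeg A M N' n"
  shows "tbind A M N \<phi> X \<in> tdeg A M N (n + k)"
  by (rule tdeg_ahom[OF N' T_ag[OF N] tbind_ahom tdeg_aspan[OF N, symmetric] _ assms(2)])
    (auto simp: tbind_pure intro!: tprepend_tdeg[OF N] assms(1))

text \<open>Contraction acts on the first factor, substitution on the last. In degree 0 these would
  interfere: \<open>\<phi> y\<close> may bring letters of its own, which the contraction on the left
  would consume; hence the positive degree.\<close>

lemma ctr_tbind:
  assumes u: "rlin A M u" and X: "X \<in> tdeg A M N' (Suc n)"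
  shows "ctr A M N u (tbind A M N \<phi> X) = tbind A M N \<phi> (ctr A M N' u X)"
proof (rule tdeg_eqI[OF N' T_ag[OF N] ahom_comp[OF tbind_ahom ctr_ahom[OF N u]] ahom_comp[OF ctr_ahom[OF N' u] tbind_ahom] _ X])
  fix xs y assume *: "set xs \<subseteq> carrier M" "y \<in> carrier N'" "length xs = Suc n"
  then obtain x zs where xs: "xs = x # zs" "x \<in> carrier M" "set zs \<subseteq> carrier M" by (cases xs) auto
  show "ctr A M N u (tbind A M N \<phi> (pure N' xs y)) = tbind A M N \<phi> (ctr A M N' u (pure N' xs y))"
    using * xs by (simp add: tbind_pure Suc_cons ctr_tp[OF N u] ctr_pure_Cons[OF N' u] tprepend_closed[OF N] lhom_closed[OF \<phi>]
       lhom_smult[OF tbind_lhom] rlin_closed[OF u] pure_closed[OF N'])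
qed

end

end

text \<open>The case of \<open>tbind\<close> in which the substituted tensor has degree 0. With a
  definition of its own, \<open>fract\<close>, \<open>vattach\<close> and the evaluation inside
  \<open>boxV\<close> become instances by mere unfolding.\<close>

definition tmap ::
  "('a, 'x) ring_scheme \<Rightarrow> ('a, 'm, 'y) bimodule_scheme \<Rightarrow> ('a, 'n, 'z) module_scheme \<Rightarrow>
    ('p \<Rightarrow> 'n) \<Rightarrow> ('m, 'p) tensor \<Rightarrow> ('m, 'n) tensor"
  where "tmap A M N \<psi> = tlift (tmod A M N) (\<lambda>xs y. tpure A M N xs (\<psi> y))"

lemma tcat_tbind: "tcat A M N X Y = tbind A M N (\<lambda>a. a \<odot>\<^bsub>tmod A M N\<^esub> Y) X"
  by (simp add: tcat_def tbind_def)

context bimod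
begin

text \<open>Two word functions that agree on admissible words have the same lift, although the lift
  sums over a chosen representative; needed to replace the literal word function of a definition by
  a more tractable one.\<close>

lemma tlift_cong:
  assumes N: "left_module A N" and "abelian_group P" "tbal A M N P f"
    and "\<And>xs y. \<lbrakk>set xs \<subseteq> carrier M; y \<in> carrier N\<rbrakk> \<Longrightarrow> g xs y = f xs y" and "X \<in> carrier (T N)"
  shows "tlift P g X = tlift P f X"
proof -
  have g: "tbal A M N P g"
  proof (rule tbal_cong[OF assms(3)])
    show "left_module A M" by unfold_locales
  qed (rule assms(4)[symmetric] N rsmult_closed; assumption)+
  show ?thesis
    by (rule T_eqI[OF N assms(2) tlift_ahom[OF N assms(2) g] tlift_ahom[OF N assms(2,3)] _ assms(5)])
      (simp add: tlift_pure[OF N assms(2) g] tlift_pure[OF N assms(2,3)] assms(4))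
qed

context
  fixes N :: "('a, 'n, 'z) module_scheme" and N' :: "('a, 'p, 'w) module_scheme" and \<psi>
  assumes N: "left_module A N" and N': "left_module A N'" and \<psi>: "lhom A N' N \<psi>"
begin

lemma tmap_lhom0: "lhom A N' (T N) (\<lambda>y. pure N [] (\<psi> y))"
  by (rule lhom_comp[OF \<psi> pure_Nil_lhom[OF N]])

lemma tmap_fun: "\<lbrakk>set xs \<subseteq> carrier M; y \<in> carrier N'\<rbrakk> \<Longrightarrow> pure N xs (\<psi> y) = tprepend A M N xs (pure N [] (\<psi> y))"
  by (simp add: tprepend_pure[OF N] lhom_closed[OF \<psi>])

lemma tmap_tbind: "X \<in> carrier (T N') \<Longrightarrow> tmap A M N \<psi> X = tbind A M N (\<lambda>y. pure N [] (\<psi> y)) X"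
  unfolding tmap_def tbind_def
  by (rule tlift_cong[OF N' T_ag[OF N] tbal_tbind[OF N N' tmap_lhom0] tmap_fun])

lemma tmap_ahom: "ahom (T N') (T N) (tmap A M N \<psi>)"
  using tbind_ahom[OF N N' tmap_lhom0] abelian_group.axioms(1)[OF T_ag[OF N']]
  by (simp add: ahom_def tmap_tbind abelian_monoid.a_closed)

lemma tmap_lhom: "lhom A (T N') (T N) (tmap A M N \<psi>)"
proof (rule lhomI[OF tmap_ahom])
  fix a X assume "a \<in> carrier A" "X \<in> carrier (T N')"
  then show "tmap A M N \<psi> (a \<odot>\<^bsub>T N'\<^esub> X) = a \<odot>\<^bsub>T N\<^esub> tmap A M N \<psi> X"
    by (simp add: tmap_tbind left_module.smult_closed[OF T_left_module[OF N']] lhom_smult[OF tbind_lhom[OF N N' tmap_lhom0]])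
qed

lemma tmap_closed: "X \<in> carrier (T N') \<Longrightarrow> tmap A M N \<psi> X \<in> carrier (T N)"
  by (rule ahom_closed[OF tmap_ahom])

lemma tmap_pure: "\<lbrakk>set xs \<subseteq> carrier M; y \<in> carrier N'\<rbrakk> \<Longrightarrow> tmap A M N \<psi> (pure N' xs y) = pure N xs (\<psi> y)"
  by (simp add: tmap_tbind pure_closed[OF N'] tbind_pure[OF N N' tmap_lhom0] tprepend_pure[OF N] lhom_closed[OF \<psi>])

lemma tmap_tdeg: "X \<in> tdeg A M N' n \<Longrightarrow> tmap A M N \<psi> X \<in> tdeg A M N n"
  using tbind_tdeg[OF N N' tmap_lhom0, of 0 X n]
  by (simp add: tmap_tbind tdeg_carrier[OF N'] tdeg_pure[OF N] lhom_closed[OF \<psi>])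

text \<open>In contrast to \<open>ctr_tbind\<close>, degree 0 is included: no letters are created,
  and both sides vanish there.\<close>

lemma ctr_tmap:
  "\<lbrakk>rlin A M u; X \<in> carrier (T N')\<rbrakk> \<Longrightarrow> ctr A M N u (tmap A M N \<psi> X) = tmap A M N \<psi> (ctr A M N' u X)"
proof (rule T_eqI[OF N' T_ag[OF N] ahom_comp[OF tmap_ahom ctr_ahom[OF N]] ahom_comp[OF ctr_ahom[OF N'] tmap_ahom]])
  fix xs y assume *: "rlin A M u" "set xs \<subseteq> carrier M" "y \<in> carrier N'"
  show "ctr A M N u (tmap A M N \<psi> (pure N' xs y)) = tmap A M N \<psi> (ctr A M N' u (pure N' xs y))"
    using * by (cases xs) (simp_all add: tmap_pure ctr_pure_Nil[OF N] ctr_pure_Nil[OF N']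
      ctr_pure_Cons[OF N] ctr_pure_Cons[OF N'] lhom_closed[OF \<psi>] ahom_zero[OF tmap_ahom T_ag[OF N'] T_ag[OF N]]
      lhom_smult[OF tmap_lhom] rlin_closed pure_closed[OF N'])
qed

end

end

section \<open>Forms and vector fields\<close>

text \<open>Otherwise the simplifier turns \<open>Form C 1\<close> into \<open>Form C (Suc 0)\<close>.\<close>

declare One_nat_def [simp del]

lemma Form_sel [simp]:
  "carrier (Form C n) = hpart C n" "monoid.mult (Form C n) = monoid.mult C" "one (Form C n) = one C"
  "ring.zero (Form C n) = ring.zero C" "add (Form C n) = add C" "smult (Form C n) = monoid.mult C"
  "rsmult (Form C n) = monoid.mult C"
  by (simp_all add: Form_def)

context dga
begin

lemma hp_subgroup: "subgroup (hpart C n) (add_monoid C)"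
  using hpart_submodule[of n] by (simp add: submodule_def)

lemma hp_sub: "x \<in> hpart C n \<Longrightarrow> x \<in> carrier C"
  using subgroup.mem_carrier[OF hp_subgroup] by simp

lemma hp_add: "\<lbrakk>x \<in> hpart C n; y \<in> hpart C n\<rbrakk> \<Longrightarrow> x \<oplus> y \<in> hpart C n"
  using subgroup.m_closed[OF hp_subgroup] by simp

lemma hp_zero: "\<zero> \<in> hpart C n"
  using subgroup.one_closed[OF hp_subgroup] by simp

lemma hp_neg: "x \<in> hpart C n \<Longrightarrow> \<ominus> x \<in> hpart C n"
  using subgroup.m_inv_closed[OF hp_subgroup] by (simp add: a_inv_def)

lemma hp_mult0 [simp]: "\<lbrakk>a \<in> hpart C 0; x \<in> hpart C n\<rbrakk> \<Longrightarrow> a \<otimes> x \<in> hpart C n"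
  using mult_hpart[of a 0 x n] by simp

lemma hp_mult0r [simp]: "\<lbrakk>x \<in> hpart C n; a \<in> hpart C 0\<rbrakk> \<Longrightarrow> x \<otimes> a \<in> hpart C n"
  using mult_hpart[of x n a 0] by simp

lemma hp_mult11: "\<lbrakk>x \<in> hpart C 1; y \<in> hpart C 1\<rbrakk> \<Longrightarrow> x \<otimes> y \<in> hpart C 2"
  using mult_hpart[of x 1 y 1] by (simp add: numeral_2_eq_2 One_nat_def)

lemma hp_dif0 [simp]: "a \<in> hpart C 0 \<Longrightarrow> dif C a \<in> hpart C 1"
  using dif_hpart[of a 0] by (simp add: One_nat_def)

lemma hp_dif1 [simp]: "a \<in> hpart C 1 \<Longrightarrow> dif C a \<in> hpart C 2"
  using dif_hpart[of a 1] by (simp add: numeral_2_eq_2 One_nat_def)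

lemmas hp [simp] = hp_add hp_zero hp_neg one_hpart

lemma Form_ag [simp]: "abelian_group (Form C n)"
proof (rule abelian_groupI)
  fix x assume "x \<in> carrier (Form C n)"
  then show "\<exists>y\<in>carrier (Form C n). y \<oplus>\<^bsub>Form C n\<^esub> x = \<zero>\<^bsub>Form C n\<^esub>"
    using hp_neg l_neg hp_sub by force
qed (auto simp: a_ac hp_sub)

lemma ring_Form0 [simp]: "ring (Form C 0)"
proof (rule ringI)
  show "monoid (Form C 0)"
    by (rule monoidI) (auto simp: m_assoc hp_sub)
qed (auto simp: hp_sub l_distr r_distr)

lemma Form_lm [simp]: "left_module (Form C 0) (Form C n)"
  by (intro left_module.intro left_module_axioms.intro)
    (auto simp: hp_sub l_distr r_distr m_assoc)

lemma Form_bimod: "bimod (Form C 0) (Form C n)"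
  by (intro bimod.intro bimod_axioms.intro) (auto simp: hp_sub l_distr r_distr m_assoc)

text \<open>\<open>dual_basis\<close> sums in the whole algebra, whereas the general facts on
  bimodules sum in the record \<open>Form C n\<close>, whose carrier is only one homogeneous
  part.\<close>

lemma finsum_Form: "(\<And>i. i \<in> I \<Longrightarrow> f i \<in> hpart C n) \<Longrightarrow> finsum (Form C n) f I = finsum C f I"
proof (induction I rule: infinite_finite_induct)
  case (insert i I)
  have "finsum (Form C n) f (insert i I) = f i \<oplus> finsum (Form C n) f I"
    using insert by (subst abelian_monoid.finsum_insert[OF abelian_group.axioms(1)[OF Form_ag]]) auto
  moreover have "finsum C f (insert i I) = f i \<oplus> finsum C f I"
    using insert hp_sub by (subst finsum_insert) auto
  ultimately show ?case using insert by simp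
qed (simp_all add: finsum_def finprod_def)

lemma rlin_rhom: "\<alpha> \<in> rhom (Form C 0) (Form C n) (Form C 0) \<Longrightarrow> rlin (Form C 0) (Form C n) \<alpha>"
  by (auto simp: rhom_def rlin_def ahom_def)

lemma rhom_iff: "\<alpha> \<in> rhom (Form C 0) (Form C n) (Form C 0) \<longleftrightarrow> rlin (Form C 0) (Form C n) \<alpha> \<and> \<alpha> \<in> extensional (hpart C n)"
  by (auto simp: rhom_def rlin_def ahom_def PiE_iff)

lemma Vec_sel:
  "\<zero>\<^bsub>Vec C\<^esub> = (\<lambda>\<xi>\<in>hpart C 1. \<zero>)" "u \<oplus>\<^bsub>Vec C\<^esub> v = (\<lambda>\<xi>\<in>hpart C 1. u \<xi> \<oplus> v \<xi>)"
  "a \<odot>\<^bsub>Vec C\<^esub> v = (\<lambda>\<xi>\<in>hpart C 1. a \<otimes> v \<xi>)" "v \<odot>\<^sub>r\<^bsub>Vec C\<^esub> a = (\<lambda>\<xi>\<in>hpart C 1. v (a \<otimes> \<xi>))"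
  by (simp_all add: Vec_def)

lemma Vec_iff: "v \<in> carrier (Vec C) \<longleftrightarrow> rlin (Form C 0) (Form C 1) v \<and> v \<in> extensional (hpart C 1)"
  by (simp add: Vec_def rhom_iff)

lemma Vec_rlin [simp]: "v \<in> carrier (Vec C) \<Longrightarrow> rlin (Form C 0) (Form C 1) v"
  by (simp add: Vec_iff)

lemma Vec_app [simp]: "\<lbrakk>v \<in> carrier (Vec C); \<xi> \<in> hpart C 1\<rbrakk> \<Longrightarrow> v \<xi> \<in> hpart C 0"
  using rlin_closed[OF Vec_rlin, of v \<xi>] by simp

lemma Vec_app_add: "\<lbrakk>v \<in> carrier (Vec C); \<xi> \<in> hpart C 1; \<eta> \<in> hpart C 1\<rbrakk> \<Longrightarrow> v (\<xi> \<oplus> \<eta>) = v \<xi> \<oplus> v \<eta>"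
  using rlin_add[OF Vec_rlin, of v \<xi> \<eta>] by simp

lemma Vec_app_mult: "\<lbrakk>v \<in> carrier (Vec C); \<xi> \<in> hpart C 1; a \<in> hpart C 0\<rbrakk> \<Longrightarrow> v (\<xi> \<otimes> a) = v \<xi> \<otimes> a"
  using rlin_rsmult[OF Vec_rlin, of v \<xi> a] by simp

lemma Vec_ext: "\<lbrakk>u \<in> carrier (Vec C); v \<in> carrier (Vec C); \<And>\<xi>. \<xi> \<in> hpart C 1 \<Longrightarrow> u \<xi> = v \<xi>\<rbrakk> \<Longrightarrow> u = v"
  by (auto simp: Vec_iff intro: extensionalityI)

lemma VecI: "\<lbrakk>\<And>\<xi>. \<xi> \<in> hpart C 1 \<Longrightarrow> f \<xi> \<in> hpart C 0;
    \<And>\<xi> \<eta>. \<lbrakk>\<xi> \<in> hpart C 1; \<eta> \<in> hpart C 1\<rbrakk> \<Longrightarrow> f (\<xi> \<oplus> \<eta>) = f \<xi> \<oplus> f \<eta>;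
    \<And>\<xi> a. \<lbrakk>\<xi> \<in> hpart C 1; a \<in> hpart C 0\<rbrakk> \<Longrightarrow> f (\<xi> \<otimes> a) = f \<xi> \<otimes> a\<rbrakk> \<Longrightarrow> (\<lambda>\<xi>\<in>hpart C 1. f \<xi>) \<in> carrier (Vec C)"
  by (simp add: Vec_iff rlin_def ahom_def)

lemma Vec_closed:
  "\<zero>\<^bsub>Vec C\<^esub> \<in> carrier (Vec C)"
  "\<lbrakk>u \<in> carrier (Vec C); v \<in> carrier (Vec C)\<rbrakk> \<Longrightarrow> u \<oplus>\<^bsub>Vec C\<^esub> v \<in> carrier (Vec C)"
  "\<lbrakk>a \<in> hpart C 0; v \<in> carrier (Vec C)\<rbrakk> \<Longrightarrow> a \<odot>\<^bsub>Vec C\<^esub> v \<in> carrier (Vec C)"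
  "\<lbrakk>a \<in> hpart C 0; v \<in> carrier (Vec C)\<rbrakk> \<Longrightarrow> v \<odot>\<^sub>r\<^bsub>Vec C\<^esub> a \<in> carrier (Vec C)"
proof -
  note s = hp_sub[OF Vec_app] hp_sub
  show "\<zero>\<^bsub>Vec C\<^esub> \<in> carrier (Vec C)"
    unfolding Vec_sel by (rule VecI) (auto simp: hp_sub)
  show "u \<oplus>\<^bsub>Vec C\<^esub> v \<in> carrier (Vec C)" if "u \<in> carrier (Vec C)" "v \<in> carrier (Vec C)"
    unfolding Vec_sel by (rule VecI) (use that in \<open>auto simp: Vec_app_add Vec_app_mult a_ac l_distr s\<close>)
  show "a \<odot>\<^bsub>Vec C\<^esub> v \<in> carrier (Vec C)" if "a \<in> hpart C 0" "v \<in> carrier (Vec C)"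
    unfolding Vec_sel by (rule VecI) (use that in \<open>auto simp: Vec_app_add Vec_app_mult r_distr m_assoc s\<close>)
  show "v \<odot>\<^sub>r\<^bsub>Vec C\<^esub> a \<in> carrier (Vec C)" if "a \<in> hpart C 0" "v \<in> carrier (Vec C)"
    unfolding Vec_sel by (rule VecI)
      (use that in \<open>auto simp: Vec_app_add r_distr m_assoc[symmetric] s simp flip: Vec_app_mult\<close>)
qed

lemma Vec_apply [simp]:
  assumes "\<xi> \<in> hpart C 1"
  shows "\<zero>\<^bsub>Vec C\<^esub> \<xi> = \<zero>" "(u \<oplus>\<^bsub>Vec C\<^esub> v) \<xi> = u \<xi> \<oplus> v \<xi>" "(a \<odot>\<^bsub>Vec C\<^esub> v) \<xi> = a \<otimes> v \<xi>"
    "(v \<odot>\<^sub>r\<^bsub>Vec C\<^esub> a) \<xi> = v (a \<otimes> \<xi>)"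
  using assms by (simp_all add: Vec_sel)

declare Vec_closed [simp]

lemma Vec_ag [simp]: "abelian_group (Vec C)"
proof (rule abelian_groupI)
  fix u assume u: "u \<in> carrier (Vec C)"
  have m: "(\<lambda>\<xi>\<in>hpart C 1. \<ominus> u \<xi>) \<in> carrier (Vec C)"
    by (rule VecI) (use u in \<open>auto simp: Vec_app_add Vec_app_mult minus_add l_minus hp_sub[OF Vec_app] hp_sub\<close>)
  show "\<exists>y\<in>carrier (Vec C). y \<oplus>\<^bsub>Vec C\<^esub> u = \<zero>\<^bsub>Vec C\<^esub>"
    by (rule bexI[OF _ m], rule Vec_ext) (use u m in \<open>auto simp: l_neg hp_sub[OF Vec_app]\<close>)
next
  fix x y z assume "x \<in> carrier (Vec C)" "y \<in> carrier (Vec C)" "z \<in> carrier (Vec C)"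
  then show "x \<oplus>\<^bsub>Vec C\<^esub> y \<oplus>\<^bsub>Vec C\<^esub> z = x \<oplus>\<^bsub>Vec C\<^esub> (y \<oplus>\<^bsub>Vec C\<^esub> z)"
    by (intro Vec_ext) (auto simp: a_assoc hp_sub[OF Vec_app])
next
  fix x y assume "x \<in> carrier (Vec C)" "y \<in> carrier (Vec C)"
  then show "x \<oplus>\<^bsub>Vec C\<^esub> y = y \<oplus>\<^bsub>Vec C\<^esub> x"
    by (intro Vec_ext) (auto simp: a_comm hp_sub[OF Vec_app])
next
  fix x assume "x \<in> carrier (Vec C)"
  then show "\<zero>\<^bsub>Vec C\<^esub> \<oplus>\<^bsub>Vec C\<^esub> x = x"
    by (intro Vec_ext) (auto simp: hp_sub[OF Vec_app])
qed auto

lemma Vec_lm [simp]: "left_module (Form C 0) (Vec C)"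
proof (intro left_module.intro left_module_axioms.intro)
  fix a b x assume "a \<in> carrier (Form C 0)" "b \<in> carrier (Form C 0)" "x \<in> carrier (Vec C)"
  then show "(a \<oplus>\<^bsub>Form C 0\<^esub> b) \<odot>\<^bsub>Vec C\<^esub> x = a \<odot>\<^bsub>Vec C\<^esub> x \<oplus>\<^bsub>Vec C\<^esub> b \<odot>\<^bsub>Vec C\<^esub> x"
    by (intro Vec_ext) (auto simp: l_distr hp_sub[OF Vec_app] hp_sub)
next
  fix a x y assume "a \<in> carrier (Form C 0)" "x \<in> carrier (Vec C)" "y \<in> carrier (Vec C)"
  then show "a \<odot>\<^bsub>Vec C\<^esub> (x \<oplus>\<^bsub>Vec C\<^esub> y) = a \<odot>\<^bsub>Vec C\<^esub> x \<oplus>\<^bsub>Vec C\<^esub> a \<odot>\<^bsub>Vec C\<^esub> y"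
    by (intro Vec_ext) (auto simp: r_distr hp_sub[OF Vec_app] hp_sub)
next
  fix a b x assume "a \<in> carrier (Form C 0)" "b \<in> carrier (Form C 0)" "x \<in> carrier (Vec C)"
  then show "(a \<otimes>\<^bsub>Form C 0\<^esub> b) \<odot>\<^bsub>Vec C\<^esub> x = a \<odot>\<^bsub>Vec C\<^esub> (b \<odot>\<^bsub>Vec C\<^esub> x)"
    by (intro Vec_ext) (auto simp: m_assoc hp_sub[OF Vec_app] hp_sub)
next
  fix x assume "x \<in> carrier (Vec C)"
  then show "\<one>\<^bsub>Form C 0\<^esub> \<odot>\<^bsub>Vec C\<^esub> x = x"
    by (intro Vec_ext) (auto simp: hp_sub[OF Vec_app] hp_sub)
qed auto

lemma Vec_bimod: "bimod (Form C 0) (Vec C)"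
proof (intro bimod.intro bimod_axioms.intro)
  fix x y a assume "x \<in> carrier (Vec C)" "y \<in> carrier (Vec C)" "a \<in> carrier (Form C 0)"
  then show "(x \<oplus>\<^bsub>Vec C\<^esub> y) \<odot>\<^sub>r\<^bsub>Vec C\<^esub> a = x \<odot>\<^sub>r\<^bsub>Vec C\<^esub> a \<oplus>\<^bsub>Vec C\<^esub> y \<odot>\<^sub>r\<^bsub>Vec C\<^esub> a"
    by (intro Vec_ext) auto
next
  fix a x b assume "a \<in> carrier (Form C 0)" "x \<in> carrier (Vec C)" "b \<in> carrier (Form C 0)"
  then show "(a \<odot>\<^bsub>Vec C\<^esub> x) \<odot>\<^sub>r\<^bsub>Vec C\<^esub> b = a \<odot>\<^bsub>Vec C\<^esub> (x \<odot>\<^sub>r\<^bsub>Vec C\<^esub> b)"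
    by (intro Vec_ext) auto
qed auto

lemma Vec_eval_lhom: "\<xi> \<in> hpart C 1 \<Longrightarrow> lhom (Form C 0) (Vec C) (Form C 0) (\<lambda>v. v \<xi>)"
  by (simp add: lhom_def ahom_def)

lemma smult_one_complex: "x \<in> carrier C \<Longrightarrow> 1 \<odot> x = x"
  using cmod.smult_one[of x] by (simp add: complex_ring_def)

text \<open>The sign in the graded Leibniz rule is a complex scalar; this converts it into the
  additive inverse.\<close>

lemma smult_minus_one: "x \<in> carrier C \<Longrightarrow> (- 1) \<odot> x = \<ominus> x"
proof -
  assume x: "x \<in> carrier C"
  have "(- 1) \<odot> x \<oplus> x = ((- 1) + 1) \<odot> x"
    using cmod.smult_l_distr[of "- 1" 1 x] x smult_one_complex[OF x] by (simp add: complex_ring_def)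
  also have "\<dots> = \<zero>" using cmod.smult_l_null[of x] x by (simp add: complex_ring_def)
  finally show ?thesis using x cmod.smult_closed[of "- 1" x]
    by (simp add: complex_ring_def minus_equality)
qed

lemma leibniz0: "\<lbrakk>a \<in> hpart C 0; x \<in> hpart C n\<rbrakk> \<Longrightarrow> dif C (a \<otimes> x) = dif C a \<otimes> x \<oplus> a \<otimes> dif C x"
  using leibniz[of a 0 x] hp_sub[OF dif_hpart, of x n] by (simp add: smult_one_complex hp_sub)

lemma leibniz1: "\<lbrakk>\<xi> \<in> hpart C 1; x \<in> hpart C n\<rbrakk> \<Longrightarrow> dif C (\<xi> \<otimes> x) = dif C \<xi> \<otimes> x \<ominus> \<xi> \<otimes> dif C x"
  using leibniz[of \<xi> 1 x] hp_sub[OF dif_hpart, of x n] by (simp add: smult_minus_one hp_sub a_minus_def)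

lemma dif_one: "dif C \<one> = \<zero>"
proof -
  have c: "dif C \<one> \<in> carrier C" using hp_sub[OF hp_dif0[OF one_hpart]] .
  then have "dif C \<one> \<oplus> dif C \<one> = dif C \<one>" using leibniz0[OF one_hpart one_hpart] by simp
  then show ?thesis using c double_zero by blast
qed

end

lemma (in bimod) pure1_bal:
  "\<lbrakk>left_module A N; x \<in> carrier M; a \<in> carrier A; y \<in> carrier N\<rbrakk> \<Longrightarrow> pure N [x \<odot>\<^sub>r\<^bsub>M\<^esub> a] y = pure N [x] (a \<odot>\<^bsub>N\<^esub> y)"
  using tbal_last[OF tbal_pure, of N "[]"] by simp

lemma (in bimod) pure1_add:
  "\<lbrakk>left_module A N; x \<in> carrier M; x' \<in> carrier M; set xs \<subseteq> carrier M; y \<in> carrier N\<rbrakk> \<Longrightarrow>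
    pure N ((x \<oplus>\<^bsub>M\<^esub> x') # xs) y = pure N (x # xs) y \<oplus>\<^bsub>T N\<^esub> pure N (x' # xs) y"
  using tbal_add_mid[OF tbal_pure, of N "[]"] by simp

lemma (in bimod) pure_last_add:
  "\<lbrakk>left_module A N; set xs \<subseteq> carrier M; y \<in> carrier N; y' \<in> carrier N\<rbrakk> \<Longrightarrow>
    pure N xs (y \<oplus>\<^bsub>N\<^esub> y') = pure N xs y \<oplus>\<^bsub>T N\<^esub> pure N xs y'"
  by (rule tbal_add_last[OF tbal_pure])

lemma (in bimod) pure_last_ahom:
  "\<lbrakk>left_module A N; set xs \<subseteq> carrier M\<rbrakk> \<Longrightarrow> ahom N (T N) (pure N xs)"
  by (rule ahomI) (simp_all add: pure_closed pure_last_add)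

text \<open>Tensors are sets; otherwise \<open>auto\<close> splits equations between tensors into inclusions.\<close>

declare equalityI [rule del]

context dga
begin

sublocale O: bimod "Form C 0" "Form C 1"
  rewrites "carrier (Form C n) = hpart C n" and "add (Form C n) = add C"
    and "smult (Form C n) = monoid.mult C" and "rsmult (Form C n) = monoid.mult C"
    and "monoid.mult (Form C n) = monoid.mult C" and "ring.zero (Form C n) = ring.zero C"
  by (simp_all add: Form_bimod)

sublocale O2: bimod "Form C 0" "Form C 2"
  rewrites "carrier (Form C n) = hpart C n" and "add (Form C n) = add C"
    and "smult (Form C n) = monoid.mult C" and "rsmult (Form C n) = monoid.mult C"
    and "monoid.mult (Form C n) = monoid.mult C" and "ring.zero (Form C n) = ring.zero C"
  by (simp_all add: Form_bimod)

sublocale V: bimod "Form C 0" "Vec C"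
  rewrites "carrier (Form C n) = hpart C n" and "add (Form C n) = add C"
    and "smult (Form C n) = monoid.mult C" and "rsmult (Form C n) = monoid.mult C"
    and "monoid.mult (Form C n) = monoid.mult C" and "ring.zero (Form C n) = ring.zero C"
  by (simp_all add: Vec_bimod)

abbreviation "A \<equiv> Form C 0"
abbreviation "\<Omega> \<equiv> Form C 1"
abbreviation (input) "lm N \<equiv> left_module A N"
abbreviation "TA \<equiv> TForm C A"
abbreviation "TV \<equiv> TForm C (Vec C)"
abbreviation "TT \<equiv> TForm C (TVec C)"
sublocale TA: left_module A TA by simp
sublocale TV: left_module A TV by simp
sublocale TT: left_module A TT by simp
sublocale TW: left_module A "TVec C" by simp

abbreviation "omap N \<equiv> tmap A \<Omega> N"
abbreviation "octr N \<equiv> ctr A \<Omega> N"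
abbreviation "otp N \<equiv> tprepend A \<Omega> N"
abbreviation "otbind N \<equiv> tbind A \<Omega> N"
abbreviation "apure \<equiv> fpure C A"
abbreviation "evV \<xi> \<equiv> omap A (\<lambda>u. u \<xi>)"
abbreviation "vtp v w \<equiv> tprepend A (Vec C) A [v] w"
abbreviation "vdeg n \<equiv> tdeg A (Vec C) A n"

lemma octr_closed: "\<lbrakk>lm N; v \<in> carrier (Vec C); X \<in> carrier (TForm C N)\<rbrakk> \<Longrightarrow> octr N v X \<in> carrier (TForm C N)"
  by (rule O.ctr_closed) auto

lemma octr_deg: "\<lbrakk>lm N; v \<in> carrier (Vec C); X \<in> fdeg C N (Suc n)\<rbrakk> \<Longrightarrow> octr N v X \<in> fdeg C N n"
  by (rule O.ctr_tdeg) auto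

lemma contract_octr: "contract C v = octr A v"
  by (simp add: contract_def ctr_def)

lemma fract_omap: "fract C X b = omap A (\<lambda>a. a \<otimes> b) X"
  by (simp add: fract_def tmap_def)

lemma vattach_omap: "vattach C X w = omap (TVec C) (\<lambda>v. vtp v w) X"
  by (simp add: vattach_def tmap_def)

lemma lhom_rmult: "b \<in> hpart C 0 \<Longrightarrow> lhom A A A (\<lambda>a. a \<otimes> b)"
  by (simp add: lhom_def ahom_def l_distr m_assoc hp_sub)

lemma lhom_scal: "\<lbrakk>lm N; y \<in> carrier N\<rbrakk> \<Longrightarrow> lhom A A N (\<lambda>a. a \<odot>\<^bsub>N\<^esub> y)"
  using left_module.smult_closed[of A N] left_module.smult_l_distr[of A N]
    left_module.smult_assoc[of A N]
  by (simp add: lhom_def ahom_def)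

lemma lhom_vtp: "w \<in> carrier (TVec C) \<Longrightarrow> lhom A (Vec C) (TVec C) (\<lambda>v. vtp v w)"
  by (simp add: lhom_def ahom_def V.tprepend_closed V.tp_add V.smult_tp)

lemma lhom_rsmult: "a \<in> hpart C 0 \<Longrightarrow> lhom A (Vec C) (Vec C) (\<lambda>v. v \<odot>\<^sub>r\<^bsub>Vec C\<^esub> a)"
  by (simp add: lhom_def ahom_def V.rsmult_l_distr V.smult_rsmult)

end

context bimodule_connection
begin

lemmas bb [simp] = bform bvec

section \<open>The dual connection\<close>

lemma finsum_Vec_apply:
  assumes "g \<in> I \<rightarrow> carrier (Vec C)" "\<xi> \<in> hpart C 1"
  shows "(finsum (Vec C) g I) \<xi> = finsum C (\<lambda>i. g i \<xi>) I"
proof -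
  have "(finsum (Vec C) g I) \<xi> = finsum A (\<lambda>i. g i \<xi>) I"
    by (rule ahom_finsum[OF lhom_ahom[OF Vec_eval_lhom[OF assms(2)]] _ _ assms(1)]) simp_all
  also have "\<dots> = finsum C (\<lambda>i. g i \<xi>) I"
    by (rule finsum_Form) (use assms in \<open>simp add: Pi_iff\<close>)
  finally show ?thesis .
qed

lemma dual_Form: "\<xi> \<in> hpart C 1 \<Longrightarrow> \<xi> = finsum \<Omega> (\<lambda>i. bform C i \<otimes> bvec C i \<xi>) {..<bn C}"
  using dual_basis[of \<xi>] by (subst finsum_Form) auto

text \<open>Apply \<open>v\<close> to the dual basis expansion of a form: right linearity turns it
  into the value of the right-hand side at that form.\<close>

lemma dual_Vec:
  assumes v: "v \<in> carrier (Vec C)"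
  shows "v = finsum (Vec C) (\<lambda>i. v (bform C i) \<odot>\<^bsub>Vec C\<^esub> bvec C i) {..<bn C}"
proof (rule Vec_ext[OF v])
  have c: "(\<lambda>i. v (bform C i) \<odot>\<^bsub>Vec C\<^esub> bvec C i) \<in> {..<bn C} \<rightarrow> carrier (Vec C)" using v by auto
  show "finsum (Vec C) (\<lambda>i. v (bform C i) \<odot>\<^bsub>Vec C\<^esub> bvec C i) {..<bn C} \<in> carrier (Vec C)"
    by (rule abelian_monoid.finsum_closed[OF abelian_group.axioms(1)[OF Vec_ag] c])
  fix \<xi> assume \<xi>: "\<xi> \<in> hpart C 1"
  have "v \<xi> = v (finsum \<Omega> (\<lambda>i. bform C i \<otimes> bvec C i \<xi>) {..<bn C})"
    using dual_Form[OF \<xi>] by simp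
  also have "\<dots> = finsum A (\<lambda>i. v (bform C i \<otimes> bvec C i \<xi>)) {..<bn C}"
    by (rule ahom_finsum[OF rlin_ahom[OF Vec_rlin[OF v]]]) (use \<xi> in auto)
  also have "\<dots> = finsum C (\<lambda>i. v (bform C i \<otimes> bvec C i \<xi>)) {..<bn C}"
    by (rule finsum_Form) (use \<xi> v in auto)
  also have "\<dots> = finsum C (\<lambda>i. (v (bform C i) \<odot>\<^bsub>Vec C\<^esub> bvec C i) \<xi>) {..<bn C}"
    by (rule finsum_cong') (use \<xi> v in \<open>simp_all add: Vec_app_mult hp_sub[OF Vec_app]\<close>)
  finally show "v \<xi> = (finsum (Vec C) (\<lambda>i. v (bform C i) \<odot>\<^bsub>Vec C\<^esub> bvec C i) {..<bn C}) \<xi>"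
    by (simp add: finsum_Vec_apply[OF c \<xi>])
qed

lemma evV_closed: "\<lbrakk>\<xi> \<in> hpart C 1; X \<in> carrier TV\<rbrakk> \<Longrightarrow> evV \<xi> X \<in> carrier TA"
  by (rule O.tmap_closed[OF _ _ Vec_eval_lhom]) auto

lemma scal_closed:
  "\<lbrakk>lm N; y \<in> carrier N; X \<in> carrier TA\<rbrakk> \<Longrightarrow> omap N (\<lambda>a. a \<odot>\<^bsub>N\<^esub> y) X \<in> carrier (TForm C N)"
  by (rule O.tmap_closed[OF _ _ lhom_scal]) auto

lemma fract_closed: "\<lbrakk>b \<in> hpart C 0; X \<in> carrier TA\<rbrakk> \<Longrightarrow> fract C X b \<in> carrier TA"
  unfolding fract_omap by (rule O.tmap_closed[OF _ _ lhom_rmult]) auto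

lemma rsm_closed: "\<lbrakk>a \<in> hpart C 0; X \<in> carrier TV\<rbrakk> \<Longrightarrow> omap (Vec C) (\<lambda>v. v \<odot>\<^sub>r\<^bsub>Vec C\<^esub> a) X \<in> carrier TV"
  by (rule O.tmap_closed[OF _ _ lhom_rsmult]) auto

lemma vattach_closed: "\<lbrakk>w \<in> carrier (TVec C); X \<in> carrier TV\<rbrakk> \<Longrightarrow> vattach C X w \<in> carrier TT"
  unfolding vattach_omap by (rule O.tmap_closed[OF _ _ lhom_vtp]) auto

text \<open>Expanding the vector field in the last factor by \<open>dual_Vec\<close> leaves, as
  coefficients, the evaluations of \<open>X\<close> at the basis forms. A tensor is therefore
  determined by its evaluations.\<close>

lemma evV_expand:
  assumes X: "X \<in> carrier TV"
  shows "X = finsum TV (\<lambda>i. omap (Vec C) (\<lambda>a. a \<odot>\<^bsub>Vec C\<^esub> bvec C i) (evV (bform C i) X)) {..<bn C}"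
proof -
  let ?h = "\<lambda>i X. omap (Vec C) (\<lambda>a. a \<odot>\<^bsub>Vec C\<^esub> bvec C i) (evV (bform C i) X)"
  have h: "ahom TV TV (?h i)" if "i < bn C" for i
    using that by (intro ahom_comp[OF O.tmap_ahom O.tmap_ahom] lhom_scal Vec_eval_lhom) auto
  have s: "ahom TV TV (\<lambda>X. finsum TV (\<lambda>i. ?h i X) {..<bn C})"
  proof (rule ahomI)
    fix X assume "X \<in> carrier TV"
    then show "finsum TV (\<lambda>i. ?h i X) {..<bn C} \<in> carrier TV"
      by (intro TV.M.finsum_closed) (auto intro: ahom_closed[OF h])
  next
    fix X Y assume "X \<in> carrier TV" "Y \<in> carrier TV"
    then show "finsum TV (\<lambda>i. ?h i (X \<oplus>\<^bsub>TV\<^esub> Y)) {..<bn C} =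
        finsum TV (\<lambda>i. ?h i X) {..<bn C} \<oplus>\<^bsub>TV\<^esub> finsum TV (\<lambda>i. ?h i Y) {..<bn C}"
      by (subst TV.M.finsum_addf[symmetric])
        (auto intro!: TV.M.finsum_cong' TV.M.a_closed ahom_closed[OF h] simp: ahom_add[OF h])
  qed
  show ?thesis
  proof (rule O.T_eqI[OF _ _ ahom_id s _ X])
    fix xs v assume xs: "set xs \<subseteq> hpart C 1" and v: "v \<in> carrier (Vec C)"
    have "fpure C (Vec C) xs v = fpure C (Vec C) xs (finsum (Vec C) (\<lambda>i. v (bform C i) \<odot>\<^bsub>Vec C\<^esub> bvec C i) {..<bn C})"
      using dual_Vec[OF v] by simp
    also have "\<dots> = finsum TV (\<lambda>i. fpure C (Vec C) xs (v (bform C i) \<odot>\<^bsub>Vec C\<^esub> bvec C i)) {..<bn C}"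
      by (rule ahom_finsum[OF O.pure_last_ahom]) (use xs v in auto)
    also have "\<dots> = finsum TV (\<lambda>i. ?h i (fpure C (Vec C) xs v)) {..<bn C}"
      by (rule TV.M.finsum_cong')
        (use xs v in \<open>auto simp: O.tmap_pure lhom_scal Vec_eval_lhom intro!: O.pure_closed\<close>)
    finally show "fpure C (Vec C) xs v = \<dots>" .
  qed simp_all
qed

lemma evV_separates:
  assumes "X \<in> carrier TV" "Y \<in> carrier TV" "\<And>\<xi>. \<xi> \<in> hpart C 1 \<Longrightarrow> evV \<xi> X = evV \<xi> Y"
  shows "X = Y"
proof -
  have "X = finsum TV (\<lambda>i. omap (Vec C) (\<lambda>a. a \<odot>\<^bsub>Vec C\<^esub> bvec C i) (evV (bform C i) X)) {..<bn C}"
    by (rule evV_expand[OF assms(1)])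
  also have "\<dots> = finsum TV (\<lambda>i. omap (Vec C) (\<lambda>a. a \<odot>\<^bsub>Vec C\<^esub> bvec C i) (evV (bform C i) Y)) {..<bn C}"
    by (rule TV.M.finsum_cong') (use assms in \<open>auto intro!: scal_closed evV_closed\<close>)
  also have "\<dots> = Y" by (rule evV_expand[OF assms(2), symmetric])
  finally show ?thesis .
qed

text \<open>Right linear maps $\Omega^1A\to\Omega^1A$ are represented by elements of
  $\Omega^1A\otimes_A\mathrm{Vec}A$.\<close>

lemma dualize:
  assumes f: "\<And>\<eta>. \<eta> \<in> hpart C 1 \<Longrightarrow> f \<eta> \<in> fdeg C A 1"
    and f_add: "\<And>\<eta> \<zeta>. \<lbrakk>\<eta> \<in> hpart C 1; \<zeta> \<in> hpart C 1\<rbrakk> \<Longrightarrow> f (\<eta> \<oplus> \<zeta>) = f \<eta> \<oplus>\<^bsub>TA\<^esub> f \<zeta>"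
    and f_r: "\<And>\<eta> a. \<lbrakk>\<eta> \<in> hpart C 1; a \<in> hpart C 0\<rbrakk> \<Longrightarrow> f (\<eta> \<otimes> a) = fract C (f \<eta>) a"
    and X: "X = finsum TV (\<lambda>i. omap (Vec C) (\<lambda>a. a \<odot>\<^bsub>Vec C\<^esub> bvec C i) (f (bform C i))) {..<bn C}"
  shows "X \<in> fdeg C (Vec C) 1" and "\<xi> \<in> hpart C 1 \<Longrightarrow> evV \<xi> X = f \<xi>"
proof -
  show "X \<in> fdeg C (Vec C) 1"
    unfolding X by (rule O.tdeg_finsum) (auto intro!: O.tmap_tdeg f lhom_scal)
  assume \<xi>: "\<xi> \<in> hpart C 1"
  note fc = O.tdeg_carrier[OF Form_lm f]
  have fh: "ahom \<Omega> TA f"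
    by (rule ahomI) (auto simp: f_add fc)
  have "evV \<xi> X = finsum TA (\<lambda>i. evV \<xi> (omap (Vec C) (\<lambda>a. a \<odot>\<^bsub>Vec C\<^esub> bvec C i) (f (bform C i)))) {..<bn C}"
    unfolding X by (rule ahom_finsum[OF O.tmap_ahom])
      (auto intro!: scal_closed Vec_eval_lhom fc \<xi>)
  also have "\<dots> = finsum TA (\<lambda>i. f (bform C i \<otimes> bvec C i \<xi>)) {..<bn C}"
  proof (rule TA.M.finsum_cong')
    fix i assume "i \<in> {..<bn C}"
    then have i: "i < bn C" by simp
    \<comment> \<open>Inserting \<open>bvec C i\<close> and evaluating at \<xi> is right
      multiplication by \<open>bvec C i \<xi>\<close>, which right linearity of \<open>f\<close>
      then moves into its argument.\<close>
    have "evV \<xi> (omap (Vec C) (\<lambda>a. a \<odot>\<^bsub>Vec C\<^esub> bvec C i) Y) = fract C Y (bvec C i \<xi>)"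
      if Y: "Y \<in> carrier TA" for Y
      unfolding fract_omap
      by (rule O.T_eqI[OF _ _ ahom_comp[OF O.tmap_ahom O.tmap_ahom] O.tmap_ahom _ Y])
        (use i \<xi> in \<open>auto simp: O.tmap_pure lhom_scal Vec_eval_lhom lhom_rmult\<close>)
    then show "evV \<xi> (omap (Vec C) (\<lambda>a. a \<odot>\<^bsub>Vec C\<^esub> bvec C i) (f (bform C i))) = f (bform C i \<otimes> bvec C i \<xi>)"
      using i \<xi> by (simp add: f_r fc)
  qed (use \<xi> in \<open>auto intro!: fc\<close>)
  also have "\<dots> = f (finsum \<Omega> (\<lambda>i. bform C i \<otimes> bvec C i \<xi>) {..<bn C})"
    by (rule ahom_finsum[OF fh, symmetric]) (use \<xi> in auto)
  also have "\<dots> = f \<xi>" using dual_Form[OF \<xi>] by simp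
  finally show "evV \<xi> X = f \<xi>" .
qed

text \<open>The one-form db as a tensor of degree 1, under the identification of \<Omega>^1 with
  \<Omega>^1 \<otimes> A.\<close>

abbreviation "dpure b \<equiv> apure [dif C b] \<one>"

lemma dpure_closed: "b \<in> hpart C 0 \<Longrightarrow> dpure b \<in> fdeg C A 1"
  by (rule O.tdeg_pure) (simp_all flip: One_nat_def)

lemma dpure_carrier: "b \<in> hpart C 0 \<Longrightarrow> dpure b \<in> carrier TA"
  by (rule O.pure_closed) auto

lemmas oc = O.tdeg_carrier[OF Form_lm] O.tdeg_carrier[OF Vec_lm] O.pure_closed

lemma box_carrier: "\<xi> \<in> hpart C 1 \<Longrightarrow> box C \<xi> \<in> carrier TA"
  by (rule O.tdeg_carrier[OF Form_lm box_closed])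

lemma sinv_carrier: "X \<in> fdeg C A 2 \<Longrightarrow> sinv C X \<in> carrier TA"
  by (rule O.tdeg_carrier[OF Form_lm sinv_closed])

lemma octr_deg2: "\<lbrakk>lm N; v \<in> carrier (Vec C); X \<in> fdeg C N 2\<rbrakk> \<Longrightarrow> octr N v X \<in> fdeg C N 1"
  using octr_deg[of N v X 1] by (simp add: numeral_2_eq_2 One_nat_def)

lemma fract_ctr:
  "\<lbrakk>v \<in> carrier (Vec C); X \<in> carrier TA; b \<in> hpart C 0\<rbrakk> \<Longrightarrow>
    octr A v (fract C X b) = fract C (octr A v X) b"
  unfolding fract_omap by (rule O.ctr_tmap) (auto intro: lhom_rmult)

lemma dpure_mult:
  assumes "a \<in> hpart C 0" "b \<in> hpart C 0"
  shows "dpure (a \<otimes> b) = fract C (dpure a) b \<oplus>\<^bsub>TA\<^esub> a \<odot>\<^bsub>TA\<^esub> dpure b"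
proof -
  have "dpure (a \<otimes> b) = apure [dif C a \<otimes> b] \<one> \<oplus>\<^bsub>TA\<^esub> apure [a \<otimes> dif C b] \<one>"
    using assms by (simp add: leibniz0 O.pure1_add)
  moreover have "apure [dif C a \<otimes> b] \<one> = fract C (dpure a) b"
    using assms O.pure1_bal[of A "dif C a" b \<one>] unfolding fract_omap
    by (simp add: O.tmap_pure lhom_rmult hp_sub)
  ultimately show ?thesis using assms by (simp add: O.smult_pure_Cons)
qed

lemma dpure_add: "\<lbrakk>a \<in> hpart C 0; b \<in> hpart C 0\<rbrakk> \<Longrightarrow> dpure (a \<oplus> b) = dpure a \<oplus>\<^bsub>TA\<^esub> dpure b"
  by (simp add: dif_add hp_sub O.pure1_add)

text \<open>The map sending \<xi> to d(v(\<xi>)) - (v \<otimes> id)(\<box>\<xi>) is right linear,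
  because the Leibniz rules of d and of \<box> on the right both contribute v(\<xi>) da. So
  \<open>dualize\<close> represents it; uniqueness holds since evaluations separate.\<close>

lemma boxV_ex1:
  assumes v: "v \<in> carrier (Vec C)"
  shows "\<exists>!X. X \<in> fdeg C (Vec C) 1 \<and>
    (\<forall>\<xi>\<in>hpart C 1. dpure (v \<xi>) = evV \<xi> X \<oplus>\<^bsub>TA\<^esub> contract C v (box C \<xi>))"
proof -
  let ?f = "\<lambda>\<xi>. dpure (v \<xi>) \<ominus>\<^bsub>TA\<^esub> octr A v (box C \<xi>)"
  have c: "dpure (v \<xi>) \<in> carrier TA" "octr A v (box C \<xi>) \<in> carrier TA" if "\<xi> \<in> hpart C 1" for \<xi>
    using that v by (auto intro!: dpure_carrier octr_closed box_carrier)
  have f_deg: "?f \<eta> \<in> fdeg C A 1" if "\<eta> \<in> hpart C 1" for \<eta>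
    by (rule O.tdeg_minus) (use that v in \<open>auto intro!: dpure_closed octr_deg2 box_closed\<close>)
  have f_add: "?f (\<eta> \<oplus> \<zeta>) = ?f \<eta> \<oplus>\<^bsub>TA\<^esub> ?f \<zeta>" if "\<eta> \<in> hpart C 1" "\<zeta> \<in> hpart C 1" for \<eta> \<zeta>
    using that v c[of \<eta>] c[of \<zeta>]
    by (simp add: Vec_app_add dpure_add box_add ahom_add[OF O.ctr_ahom] box_carrier a_minus_def TA.M.minus_add TA.M.a_ac)
  have f_r: "?f (\<eta> \<otimes> a) = fract C (?f \<eta>) a" if "\<eta> \<in> hpart C 1" "a \<in> hpart C 0" for \<eta> a
  proof -
    have hf: "ahom TA TA (\<lambda>X. fract C X a)"
      unfolding fract_omap by (rule O.tmap_ahom[OF Form_lm Form_lm lhom_rmult[OF that(2)]])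
    have "?f (\<eta> \<otimes> a) = (fract C (dpure (v \<eta>)) a \<oplus>\<^bsub>TA\<^esub> v \<eta> \<odot>\<^bsub>TA\<^esub> dpure a)
      \<ominus>\<^bsub>TA\<^esub> (fract C (octr A v (box C \<eta>)) a \<oplus>\<^bsub>TA\<^esub> v \<eta> \<odot>\<^bsub>TA\<^esub> dpure a)"
      using that v c[of \<eta>] fract_closed[OF that(2) box_carrier[OF that(1)]]
      by (simp add: Vec_app_mult dpure_mult box_right ahom_add[OF O.ctr_ahom] box_carrier fract_ctr
          O.pure_closed O.ctr_pure_Cons)
    also have "\<dots> = fract C (dpure (v \<eta>)) a \<ominus>\<^bsub>TA\<^esub> fract C (octr A v (box C \<eta>)) a"
      using that v c[of \<eta>] ahom_closed[OF hf] TA.smult_closed[of "v \<eta>" "dpure a"]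
      by (simp add: a_minus_def TA.M.minus_add TA.M.a_ac TA.M.r_neg2 TA.M.r_neg O.pure_closed)
    also have "\<dots> = fract C (?f \<eta>) a"
      using c[OF that(1)] by (simp add: ahom_minus[OF hf])
    finally show ?thesis .
  qed
  define X where "X = finsum TV (\<lambda>i. omap (Vec C) (\<lambda>a. a \<odot>\<^bsub>Vec C\<^esub> bvec C i) (?f (bform C i))) {..<bn C}"
  have D: "X \<in> fdeg C (Vec C) 1" "\<And>\<xi>. \<xi> \<in> hpart C 1 \<Longrightarrow> evV \<xi> X = ?f \<xi>"
    by (rule dualize[OF f_deg f_add f_r X_def]; assumption)+
  have eq: "dpure (v \<xi>) = evV \<xi> Y \<oplus>\<^bsub>TA\<^esub> contract C v (box C \<xi>) \<longleftrightarrow> evV \<xi> Y = ?f \<xi>"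
    if "\<xi> \<in> hpart C 1" "Y \<in> carrier TV" for \<xi> Y
  proof -
    have "evV \<xi> Y \<in> carrier TA" using that by (intro evV_closed)
    then show ?thesis using c[OF that(1)] unfolding contract_octr
      by (metis TA.M.add.inv_solve_right TA.M.minus_eq)
  qed
  show ?thesis
  proof (rule ex1I[of _ X])
    show "X \<in> fdeg C (Vec C) 1 \<and> (\<forall>\<xi>\<in>hpart C 1. dpure (v \<xi>) = evV \<xi> X \<oplus>\<^bsub>TA\<^esub> contract C v (box C \<xi>))"
    proof (intro conjI ballI D(1))
      fix \<xi> assume "\<xi> \<in> hpart C 1"
      then show "dpure (v \<xi>) = evV \<xi> X \<oplus>\<^bsub>TA\<^esub> contract C v (box C \<xi>)"
        using eq[OF _ oc(2)[OF D(1)], of \<xi>] D(2)[of \<xi>] by blast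
    qed
  next
    fix Y assume Y: "Y \<in> fdeg C (Vec C) 1 \<and> (\<forall>\<xi>\<in>hpart C 1. dpure (v \<xi>) = evV \<xi> Y \<oplus>\<^bsub>TA\<^esub> contract C v (box C \<xi>))"
    show "Y = X"
    proof (rule evV_separates)
      fix \<xi> assume \<xi>: "\<xi> \<in> hpart C 1"
      have "evV \<xi> Y = ?f \<xi>"
        by (rule eq[THEN iffD1, OF \<xi> oc(2)]) (use Y \<xi> in blast)+
      then show "evV \<xi> Y = evV \<xi> X" by (simp add: D(2)[OF \<xi>])
    qed (use Y D(1) oc(2) in blast)+
  qed
qed

lemma boxV_deg: "v \<in> carrier (Vec C) \<Longrightarrow> boxV C v \<in> fdeg C (Vec C) 1"
  and boxV_dual: "\<lbrakk>v \<in> carrier (Vec C); \<xi> \<in> hpart C 1\<rbrakk> \<Longrightarrow>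
    dpure (v \<xi>) = evV \<xi> (boxV C v) \<oplus>\<^bsub>TA\<^esub> octr A v (box C \<xi>)"
  using theI'[OF boxV_ex1, of v] unfolding boxV_def tmap_def contract_octr by auto

lemma boxV_carrier: "v \<in> carrier (Vec C) \<Longrightarrow> boxV C v \<in> carrier TV"
  by (rule oc(2)[OF boxV_deg])

lemma evV_ahom: "\<xi> \<in> hpart C 1 \<Longrightarrow> ahom TV TA (evV \<xi>)"
  by (auto intro!: O.tmap_ahom Vec_eval_lhom)

lemma evV_boxV:
  assumes "v \<in> carrier (Vec C)" "\<xi> \<in> hpart C 1"
  shows "evV \<xi> (boxV C v) = dpure (v \<xi>) \<ominus>\<^bsub>TA\<^esub> octr A v (box C \<xi>)"
  using boxV_dual[OF assms] evV_closed[OF assms(2) boxV_carrier[OF assms(1)]]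
    octr_closed[OF _ assms(1) box_carrier[OF assms(2)]]
  by (simp add: a_minus_def TA.M.a_assoc TA.M.r_neg)

lemma sinv_pure_deg: "\<lbrakk>\<xi> \<in> hpart C 1; \<eta> \<in> hpart C 1; a \<in> hpart C 0\<rbrakk> \<Longrightarrow> sinv C (apure [\<xi>, \<eta>] a) \<in> fdeg C A 2"
  by (intro sinv_closed O.tdeg_pure) (auto simp: numeral_2_eq_2)

lemma pure2_deg: "\<lbrakk>\<xi> \<in> hpart C 1; \<eta> \<in> hpart C 1; a \<in> hpart C 0\<rbrakk> \<Longrightarrow> apure [\<xi>, \<eta>] a \<in> fdeg C A 2"
  by (intro O.tdeg_pure) (auto simp: numeral_2_eq_2)

text \<open>The sum defining \<open>sig\<close> has exactly the shape required by
  \<open>dualize\<close>, for the function sending \<eta> to (u \<otimes> id)(sinv(\<xi> \<otimes>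
  \<eta>)). All laws of \<open>sig\<close> below are therefore reduced to laws of
  \<open>sinv\<close> by evaluating at a form.\<close>

lemma
  assumes u: "u \<in> carrier (Vec C)" and \<xi>: "\<xi> \<in> hpart C 1"
  shows sig_deg: "sig C u \<xi> \<in> fdeg C (Vec C) 1"
    and evV_sig: "\<eta> \<in> hpart C 1 \<Longrightarrow> evV \<eta> (sig C u \<xi>) = octr A u (sinv C (apure [\<xi>, \<eta>] \<one>))"
proof -
  let ?f = "\<lambda>\<eta>. octr A u (sinv C (apure [\<xi>, \<eta>] \<one>))"
  have f_deg: "?f \<eta> \<in> fdeg C A 1" if "\<eta> \<in> hpart C 1" for \<eta>
    by (rule octr_deg2) (use that u \<xi> in \<open>auto intro!: sinv_pure_deg\<close>)
  have f_add: "?f (\<eta> \<oplus> \<zeta>) = ?f \<eta> \<oplus>\<^bsub>TA\<^esub> ?f \<zeta>" if "\<eta> \<in> hpart C 1" "\<zeta> \<in> hpart C 1" for \<eta> \<zeta>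
  proof -
    have "apure [\<xi>, \<eta> \<oplus> \<zeta>] \<one> = apure [\<xi>, \<eta>] \<one> \<oplus>\<^bsub>TA\<^esub> apure [\<xi>, \<zeta>] \<one>"
      using tbal_add_mid[OF O.tbal_pure[OF Form_lm], of "[\<xi>]" \<eta> \<zeta> "[]" \<one>] that \<xi> by simp
    then show ?thesis
      using that \<xi> u by (simp add: sinv_add pure2_deg ahom_add[OF O.ctr_ahom] sinv_carrier)
  qed
  have f_r: "?f (\<eta> \<otimes> a) = fract C (?f \<eta>) a" if "\<eta> \<in> hpart C 1" "a \<in> hpart C 0" for \<eta> a
  proof -
    have "apure [\<xi>, \<eta> \<otimes> a] \<one> = fract C (apure [\<xi>, \<eta>] \<one>) a"
      using tbal_last[OF O.tbal_pure[OF Form_lm], of "[\<xi>]" \<eta> a \<one>] that \<xi> unfolding fract_omap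
      by (simp add: O.tmap_pure lhom_rmult hp_sub)
    then show ?thesis
      using that \<xi> u by (simp add: sinv_rsmult pure2_deg fract_ctr sinv_carrier)
  qed
  have X: "sig C u \<xi> = finsum TV (\<lambda>i. omap (Vec C) (\<lambda>a. a \<odot>\<^bsub>Vec C\<^esub> bvec C i) (?f (bform C i))) {..<bn C}"
    by (simp add: sig_def tmap_def contract_octr)
  show "sig C u \<xi> \<in> fdeg C (Vec C) 1" "\<eta> \<in> hpart C 1 \<Longrightarrow> evV \<eta> (sig C u \<xi>) = ?f \<eta>"
    using dualize[OF f_deg f_add f_r X] by auto
qed

lemma sig_carrier: "\<lbrakk>u \<in> carrier (Vec C); \<xi> \<in> hpart C 1\<rbrakk> \<Longrightarrow> sig C u \<xi> \<in> carrier TV"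
  by (rule oc(2)[OF sig_deg])

lemma evV_omap_rsmult:
  assumes "\<xi> \<in> hpart C 1" "a \<in> hpart C 0" "X \<in> carrier TV"
  shows "evV \<xi> (omap (Vec C) (\<lambda>v. v \<odot>\<^sub>r\<^bsub>Vec C\<^esub> a) X) = evV (a \<otimes> \<xi>) X"
  by (rule O.T_eqI[OF _ _ ahom_comp[OF O.tmap_ahom O.tmap_ahom] O.tmap_ahom _ assms(3)])
    (use assms in \<open>auto simp: O.tmap_pure Vec_eval_lhom lhom_rsmult \<close>)

lemma boxV_add:
  assumes "u \<in> carrier (Vec C)" "v \<in> carrier (Vec C)"
  shows "boxV C (u \<oplus>\<^bsub>Vec C\<^esub> v) = boxV C u \<oplus>\<^bsub>TV\<^esub> boxV C v"
proof (rule evV_separates)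
  fix \<xi> assume \<xi>: "\<xi> \<in> hpart C 1"
  have "octr A (u \<oplus>\<^bsub>Vec C\<^esub> v) (box C \<xi>) = octr A u (box C \<xi>) \<oplus>\<^bsub>TA\<^esub> octr A v (box C \<xi>)"
    by (rule O.ctr_add_left) (use assms \<xi> in \<open>auto intro: box_carrier\<close>)
  moreover have "dpure (u \<xi>) \<in> carrier TA" "dpure (v \<xi>) \<in> carrier TA"
    using assms \<xi> by (auto intro!: dpure_carrier)
  ultimately show "evV \<xi> (boxV C (u \<oplus>\<^bsub>Vec C\<^esub> v)) = evV \<xi> (boxV C u \<oplus>\<^bsub>TV\<^esub> boxV C v)"
    using assms \<xi> octr_closed[OF Form_lm _ box_carrier[OF \<xi>]]
    by (simp add: ahom_add[OF evV_ahom] boxV_carrier evV_boxV dpure_add a_minus_def TA.M.minus_add TA.M.a_ac)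
qed (use assms in \<open>auto intro!: boxV_carrier TV.M.a_closed\<close>)

lemma boxV_smult:
  assumes "a \<in> hpart C 0" "v \<in> carrier (Vec C)"
  shows "boxV C (a \<odot>\<^bsub>Vec C\<^esub> v) = fpure C (Vec C) [dif C a] v \<oplus>\<^bsub>TV\<^esub> a \<odot>\<^bsub>TV\<^esub> boxV C v"
proof (rule evV_separates)
  fix \<xi> assume \<xi>: "\<xi> \<in> hpart C 1"
  have 1: "octr A (a \<odot>\<^bsub>Vec C\<^esub> v) (box C \<xi>) = a \<odot>\<^bsub>TA\<^esub> octr A v (box C \<xi>)"
    by (rule O.ctr_smult_left[where u = v]) (use assms \<xi> in \<open>auto intro: box_carrier\<close>)
  have 2: "dpure (v \<xi>) \<in> carrier TA"
    using assms \<xi> by (auto intro!: dpure_carrier)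
  have 3: "evV \<xi> (fpure C (Vec C) [dif C a] v) = fract C (dpure a) (v \<xi>)"
    using assms \<xi> unfolding fract_omap by (simp add: O.tmap_pure Vec_eval_lhom lhom_rmult hp_sub[OF Vec_app])
  have 4: "evV \<xi> (a \<odot>\<^bsub>TV\<^esub> boxV C v) = a \<odot>\<^bsub>TA\<^esub> evV \<xi> (boxV C v)"
    using assms \<xi> by (simp add: lhom_smult[OF O.tmap_lhom] Vec_eval_lhom boxV_carrier)
  have 5: "fract C (dpure a) (v \<xi>) \<in> carrier TA"
    using assms \<xi> unfolding fract_omap by (auto intro!: O.tmap_closed[OF _ _ lhom_rmult] dpure_carrier)
  have 6: "octr A v (box C \<xi>) \<in> carrier TA"
    using octr_closed[OF Form_lm assms(2) box_carrier[OF \<xi>]] .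
  show "evV \<xi> (boxV C (a \<odot>\<^bsub>Vec C\<^esub> v)) = evV \<xi> (fpure C (Vec C) [dif C a] v \<oplus>\<^bsub>TV\<^esub> a \<odot>\<^bsub>TV\<^esub> boxV C v)"
    using assms \<xi> 2 5 6 left_module_ahom[OF TA.left_module_axioms, of a]
    by (simp add: ahom_add[OF evV_ahom] 1 3 4 boxV_carrier evV_boxV dpure_mult O.pure_closed TV.smult_closed
        a_minus_def TA.smult_r_distr TA.smult_closed ahom_neg TA.M.a_assoc)
qed (use assms in \<open>auto intro!: boxV_carrier TV.M.a_closed O.pure_closed TV.smult_closed\<close>)

text \<open>Dual to \<open>box_left\<close>: evaluating v.a at \<xi> means evaluating v at a \<xi>,
  and the extra term \<open>sinv\<close> (da \<otimes> \<xi>) of \<box>(a \<xi>), contracted with v,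
  is the evaluation of \<open>sig C v (dif C a)\<close> at \<xi>.\<close>

lemma boxV_rsmult:
  assumes "a \<in> hpart C 0" "v \<in> carrier (Vec C)"
  shows "boxV C (v \<odot>\<^sub>r\<^bsub>Vec C\<^esub> a) = omap (Vec C) (\<lambda>u. u \<odot>\<^sub>r\<^bsub>Vec C\<^esub> a) (boxV C v) \<oplus>\<^bsub>TV\<^esub> sig C v (dif C a)"
proof (rule evV_separates)
  fix \<xi> assume \<xi>: "\<xi> \<in> hpart C 1"
  have 1: "octr A (v \<odot>\<^sub>r\<^bsub>Vec C\<^esub> a) (box C \<xi>) = octr A v (a \<odot>\<^bsub>TA\<^esub> box C \<xi>)"
    by (rule O.ctr_smult_right) (use assms \<xi> in \<open>auto intro: box_carrier\<close>)
  let ?s = "sinv C (apure [dif C a, \<xi>] \<one>)"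
  have s: "?s \<in> carrier TA" using assms \<xi> by (auto intro!: oc(1) sinv_pure_deg)
  have 2: "octr A v (box C (a \<otimes> \<xi>)) = octr A v (a \<odot>\<^bsub>TA\<^esub> box C \<xi>) \<oplus>\<^bsub>TA\<^esub> octr A v ?s"
    using assms \<xi> s by (simp add: box_left ahom_add[OF O.ctr_ahom] box_carrier TA.smult_closed)
  have 3: "octr A v (a \<odot>\<^bsub>TA\<^esub> box C \<xi>) \<in> carrier TA" "octr A v ?s \<in> carrier TA"
    using assms \<xi> s by (auto intro!: octr_closed TA.smult_closed box_carrier)
  have 4: "dpure (v (a \<otimes> \<xi>)) \<in> carrier TA"
    using assms \<xi> by (auto intro!: dpure_carrier)
  show "evV \<xi> (boxV C (v \<odot>\<^sub>r\<^bsub>Vec C\<^esub> a)) = evV \<xi> (omap (Vec C) (\<lambda>u. u \<odot>\<^sub>r\<^bsub>Vec C\<^esub> a) (boxV C v) \<oplus>\<^bsub>TV\<^esub> sig C v (dif C a))"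
    using assms \<xi> 3 4
    by (simp add: ahom_add[OF evV_ahom] rsm_closed boxV_carrier sig_carrier evV_omap_rsmult
        evV_boxV evV_sig 1 2 a_minus_def TA.M.minus_add TA.M.a_assoc TA.M.l_neg)
qed (use assms in \<open>auto intro!: boxV_carrier TV.M.a_closed rsm_closed sig_carrier\<close>)

lemma sig_add_left:
  assumes "u \<in> carrier (Vec C)" "v \<in> carrier (Vec C)" "\<xi> \<in> hpart C 1"
  shows "sig C (u \<oplus>\<^bsub>Vec C\<^esub> v) \<xi> = sig C u \<xi> \<oplus>\<^bsub>TV\<^esub> sig C v \<xi>"
proof (rule evV_separates)
  fix \<eta> assume \<eta>: "\<eta> \<in> hpart C 1"
  show "evV \<eta> (sig C (u \<oplus>\<^bsub>Vec C\<^esub> v) \<xi>) = evV \<eta> (sig C u \<xi> \<oplus>\<^bsub>TV\<^esub> sig C v \<xi>)"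
    using assms \<eta> by (simp add: ahom_add[OF evV_ahom] sig_carrier evV_sig)
      (rule O.ctr_add_left; auto intro!: oc(1) sinv_pure_deg)
qed (use assms in \<open>auto intro!: TV.M.a_closed sig_carrier\<close>)

lemma sig_add_right:
  assumes "u \<in> carrier (Vec C)" "\<zeta> \<in> hpart C 1" "\<xi> \<in> hpart C 1"
  shows "sig C u (\<xi> \<oplus> \<zeta>) = sig C u \<xi> \<oplus>\<^bsub>TV\<^esub> sig C u \<zeta>"
proof (rule evV_separates)
  fix \<eta> assume \<eta>: "\<eta> \<in> hpart C 1"
  show "evV \<eta> (sig C u (\<xi> \<oplus> \<zeta>)) = evV \<eta> (sig C u \<xi> \<oplus>\<^bsub>TV\<^esub> sig C u \<zeta>)"
    using assms \<eta> by (simp add: ahom_add[OF evV_ahom] sig_carrier evV_sig O.pure1_add sinv_add pure2_deg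
       ahom_add[OF O.ctr_ahom] sinv_carrier)
qed (use assms in \<open>auto intro!: TV.M.a_closed sig_carrier\<close>)

lemma sig_smult_left:
  assumes "u \<in> carrier (Vec C)" "a \<in> hpart C 0" "\<xi> \<in> hpart C 1"
  shows "sig C (a \<odot>\<^bsub>Vec C\<^esub> u) \<xi> = a \<odot>\<^bsub>TV\<^esub> sig C u \<xi>"
proof (rule evV_separates)
  fix \<eta> assume \<eta>: "\<eta> \<in> hpart C 1"
  show "evV \<eta> (sig C (a \<odot>\<^bsub>Vec C\<^esub> u) \<xi>) = evV \<eta> (a \<odot>\<^bsub>TV\<^esub> sig C u \<xi>)"
    using assms \<eta> by (simp add: lhom_smult[OF O.tmap_lhom] Vec_eval_lhom sig_carrier evV_sig)
      (rule O.ctr_smult_left[where u = u]; auto intro!: oc(1) sinv_pure_deg)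
qed (use assms in \<open>auto intro!: TV.smult_closed sig_carrier\<close>)

lemma sig_bal:
  assumes "u \<in> carrier (Vec C)" "a \<in> hpart C 0" "\<xi> \<in> hpart C 1"
  shows "sig C (u \<odot>\<^sub>r\<^bsub>Vec C\<^esub> a) \<xi> = sig C u (a \<otimes> \<xi>)"
proof (rule evV_separates)
  fix \<eta> assume \<eta>: "\<eta> \<in> hpart C 1"
  have "octr A (u \<odot>\<^sub>r\<^bsub>Vec C\<^esub> a) (sinv C (apure [\<xi>, \<eta>] \<one>)) =
    octr A u (a \<odot>\<^bsub>TA\<^esub> sinv C (apure [\<xi>, \<eta>] \<one>))"
    by (rule O.ctr_smult_right) (use assms \<eta> in \<open>auto intro!: oc(1) sinv_pure_deg\<close>)
  then show "evV \<eta> (sig C (u \<odot>\<^sub>r\<^bsub>Vec C\<^esub> a) \<xi>) = evV \<eta> (sig C u (a \<otimes> \<xi>))"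
    using assms \<eta> by (simp add: evV_sig O.smult_pure_Cons pure2_deg flip: sinv_smult)
qed (use assms in \<open>auto intro!: sig_carrier\<close>)

text \<open>The scalar passes from \<xi> to the evaluating form \<eta> across the tensor sign,
  before \<open>sinv\<close> is applied.\<close>

lemma sig_rsmult:
  assumes "u \<in> carrier (Vec C)" "a \<in> hpart C 0" "\<xi> \<in> hpart C 1"
  shows "sig C u (\<xi> \<otimes> a) = omap (Vec C) (\<lambda>v. v \<odot>\<^sub>r\<^bsub>Vec C\<^esub> a) (sig C u \<xi>)"
proof (rule evV_separates)
  fix \<eta> assume \<eta>: "\<eta> \<in> hpart C 1"
  have "apure [\<xi> \<otimes> a, \<eta>] \<one> = apure [\<xi>, a \<otimes> \<eta>] \<one>"
    using tbal_mid[OF O.tbal_pure[OF Form_lm], of "[]" \<xi> a \<eta> "[]" \<one>] assms \<eta> by simp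
  then show "evV \<eta> (sig C u (\<xi> \<otimes> a)) = evV \<eta> (omap (Vec C) (\<lambda>v. v \<odot>\<^sub>r\<^bsub>Vec C\<^esub> a) (sig C u \<xi>))"
    using assms \<eta> by (simp add: evV_sig evV_omap_rsmult sig_carrier)
qed (use assms in \<open>auto intro!: sig_carrier rsm_closed\<close>)

end

section \<open>Well-definedness of the covariant derivative on tensors of vector fields\<close>

context bimod
begin

lemma smult_pure:
  "\<lbrakk>left_module A N; a \<in> carrier A; set xs \<subseteq> carrier M; y \<in> carrier N\<rbrakk> \<Longrightarrow>
    a \<odot>\<^bsub>T N\<^esub> pure N xs y = pure N (fst (word_smult M N a (xs, y))) (snd (word_smult M N a (xs, y)))"
  by (cases xs) (simp_all add: smult_pure_Nil smult_pure_Cons)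

lemma word_smult_facts:
  assumes "left_module A N" "a \<in> carrier A" "set xs \<subseteq> carrier M" "y \<in> carrier N"
  shows "set (fst (word_smult M N a (xs, y))) \<subseteq> carrier M" "snd (word_smult M N a (xs, y)) \<in> carrier N"
    "length (fst (word_smult M N a (xs, y))) = length xs"
  using assms by (cases xs; simp add: smult_closed left_module.smult_closed[OF assms(1)])+

end

lemma tbal_comp: "\<lbrakk>tbal A M N P f; ahom P Q h\<rbrakk> \<Longrightarrow> tbal A M N Q (\<lambda>xs y. h (f xs y))"
  by (rule tbalI)
    (simp_all add: ahom_closed tbal_closed tbal_add_mid tbal_add_last tbal_mid tbal_last ahom_add)

text \<open>The map \<sigma> \<otimes> id with a fixed vector field \<open>u\<close> in front, as it
  occurs in the recursion of \<open>boxT_word\<close>; named in order to be treated as an additive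
  map.\<close>

definition sigT ::
  "('w, 'x) conn_scheme \<Rightarrow> ('w \<Rightarrow> 'w) \<Rightarrow> ('w, ('w \<Rightarrow> 'w, 'w) tensor) tensor \<Rightarrow> ('w, ('w \<Rightarrow> 'w, 'w) tensor) tensor"
  where "sigT C u = tlift (TForm C (TVec C)) (\<lambda>xs w. case xs of
    [\<xi>] \<Rightarrow> vattach C (sig C u \<xi>) w | _ \<Rightarrow> \<zero>\<^bsub>TForm C (TVec C)\<^esub>)"

lemma boxT_word_Cons:
  "boxT_word C (u # us) a =
    vattach C (boxV C u) (vpure C us a) \<oplus>\<^bsub>TForm C (TVec C)\<^esub> sigT C u (boxT_word C us a)"
  by (simp add: sigT_def)

declare boxT_word.simps(2) [simp del]

context dga
begin

lemma vdeg_carrier: "w \<in> vdeg n \<Longrightarrow> w \<in> carrier (TVec C)"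
  by (rule V.tdeg_carrier[OF Form_lm])

lemma vdeg_0E:
  assumes "v \<in> vdeg 0"
  obtains a where "a \<in> hpart C 0" "v = vpure C [] a"
proof
  show "tdown A v \<in> hpart C 0"
    using ahom_closed[OF V.tdown_ahom[OF Form_lm] vdeg_carrier[OF assms]] by simp
  show "v = vpure C [] (tdown A v)" by (rule V.tdeg_0_eq[OF Form_lm assms])
qed

lemma vdeg_eqI:
  assumes "abelian_group P" "ahom (TVec C) P f" "ahom (TVec C) P g"
    and "\<And>u w. \<lbrakk>u \<in> carrier (Vec C); w \<in> vdeg n\<rbrakk> \<Longrightarrow> f (vtp u w) = g (vtp u w)"
    and "w \<in> vdeg (Suc n)"
  shows "f w = g w"
proof (rule V.tdeg_eqI[OF _ assms(1-3) _ assms(5)])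
  fix us a assume us: "set us \<subseteq> carrier (Vec C)" "a \<in> carrier A" "length us = Suc n"
  then obtain u zs where uz: "us = u # zs" "u \<in> carrier (Vec C)" "set zs \<subseteq> carrier (Vec C)" "length zs = n"
    by (cases us) auto
  have "f (vtp u (vpure C zs a)) = g (vtp u (vpure C zs a))"
    by (rule assms(4)) (use us uz in \<open>auto intro!: V.tdeg_pure\<close>)
  then show "f (vpure C us a) = g (vpure C us a)" using us uz by (simp add: V.tp_pure)
qed simp

end

context bimodule_connection
begin

text \<open>The part \<Omega>^1 \<otimes> Vec^n. In \<open>TForm C (TVec C)\<close> the whole tensor
  algebra of vector fields is the last factor, so \<open>fdeg\<close> counts forms only and the
  degree n has to be recorded separately.\<close>

abbreviation "Tdeg n \<equiv> aspan TT {fpure C (TVec C) [\<xi>] w | \<xi> w. \<xi> \<in> hpart C 1 \<and> w \<in> vdeg n}"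

lemma Tdeg_gens: "{fpure C (TVec C) [\<xi>] w | \<xi> w. \<xi> \<in> hpart C 1 \<and> w \<in> vdeg n} \<subseteq> carrier TT"
  by (auto intro!: O.pure_closed vdeg_carrier)

lemma fdeg1: "\<lbrakk>lm N; \<xi> \<in> hpart C 1; y \<in> carrier N\<rbrakk> \<Longrightarrow> fpure C N [\<xi>] y \<in> fdeg C N 1"
  by (rule O.tdeg_pure) (simp_all flip: One_nat_def)

lemma Tdeg_base: "\<lbrakk>\<xi> \<in> hpart C 1; w \<in> vdeg n\<rbrakk> \<Longrightarrow> fpure C (TVec C) [\<xi>] w \<in> Tdeg n"
  by (rule aspan.base) blast

lemma length_1E: "length xs = 1 \<Longrightarrow> (\<And>x. xs = [x] \<Longrightarrow> P) \<Longrightarrow> P"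
  by (auto simp: One_nat_def length_Suc_conv)

lemma Tdeg_deg1: "X \<in> Tdeg n \<Longrightarrow> X \<in> fdeg C (TVec C) 1"
  unfolding O.tdeg_aspan[OF TW.left_module_axioms]
  by (erule aspan_mono[rotated]) (force simp: vdeg_carrier simp flip: One_nat_def)

lemma Tdeg_carrier: "X \<in> Tdeg n \<Longrightarrow> X \<in> carrier TT"
  by (rule TT.M.aspan_closed[OF Tdeg_gens])

lemma deg1_eqI:
  assumes "lm N" "abelian_group P" "ahom (TForm C N) P f" "ahom (TForm C N) P g" "X \<in> fdeg C N 1"
    and "\<And>x y. \<lbrakk>x \<in> hpart C 1; y \<in> carrier N\<rbrakk> \<Longrightarrow> f (fpure C N [x] y) = g (fpure C N [x] y)"
  shows "f X = g X"
  using O.apply_first_eqI[OF assms(1-4) _ assms(6)] assms(5) by (simp add: One_nat_def)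

lemma vattach_pure:
  "\<lbrakk>set xs \<subseteq> hpart C 1; v \<in> carrier (Vec C); w \<in> carrier (TVec C)\<rbrakk> \<Longrightarrow>
    vattach C (fpure C (Vec C) xs v) w = fpure C (TVec C) xs (vtp v w)"
  unfolding vattach_omap by (rule O.tmap_pure) (auto intro: lhom_vtp)

lemma vattach_ahom: "w \<in> carrier (TVec C) \<Longrightarrow> ahom TV TT (\<lambda>X. vattach C X w)"
  unfolding vattach_omap by (rule O.tmap_ahom) (auto intro: lhom_vtp)

lemma vtp_ahom: "v \<in> carrier (Vec C) \<Longrightarrow> ahom (TVec C) (TVec C) (vtp v)"
  by (rule V.tprepend_ahom) auto

lemma vtp_closed: "\<lbrakk>v \<in> carrier (Vec C); w \<in> carrier (TVec C)\<rbrakk> \<Longrightarrow> vtp v w \<in> carrier (TVec C)"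
  by (rule ahom_closed[OF vtp_ahom])

lemma vattach_ahom_right: "X \<in> carrier TV \<Longrightarrow> ahom (TVec C) TT (vattach C X)"
proof (rule ahomI)
  fix w w' assume X: "X \<in> carrier TV" and w: "w \<in> carrier (TVec C)" "w' \<in> carrier (TVec C)"
  show "vattach C X (w \<oplus>\<^bsub>TVec C\<^esub> w') = vattach C X w \<oplus>\<^bsub>TT\<^esub> vattach C X w'"
    by (rule O.T_eqI[OF Vec_lm _ vattach_ahom ahom_sum[OF _ vattach_ahom vattach_ahom] _ X])
      (use w in \<open>auto simp: vattach_pure ahom_add[OF vtp_ahom] O.pure_last_add vtp_closed\<close>)
qed (rule vattach_closed)

lemma vattach_smult:
  "\<lbrakk>a \<in> hpart C 0; X \<in> carrier TV; w \<in> carrier (TVec C)\<rbrakk> \<Longrightarrow> vattach C (a \<odot>\<^bsub>TV\<^esub> X) w = a \<odot>\<^bsub>TT\<^esub> vattach C X w"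
  unfolding vattach_omap by (rule lhom_smult[OF O.tmap_lhom]) (auto intro: lhom_vtp)

lemma vattach_rsmult:
  assumes "a \<in> hpart C 0" "X \<in> carrier TV" "w \<in> carrier (TVec C)"
  shows "vattach C (omap (Vec C) (\<lambda>u. u \<odot>\<^sub>r\<^bsub>Vec C\<^esub> a) X) w = vattach C X (a \<odot>\<^bsub>TVec C\<^esub> w)"
  by (rule O.T_eqI[OF Vec_lm _ ahom_comp[OF O.tmap_ahom vattach_ahom] vattach_ahom _ assms(2)])
    (use assms in \<open>auto simp: O.tmap_pure lhom_rsmult vattach_pure V.tp_bal TW.smult_closed\<close>)

lemma vtp_deg: "\<lbrakk>v \<in> carrier (Vec C); w \<in> vdeg n\<rbrakk> \<Longrightarrow> vtp v w \<in> vdeg (Suc n)"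
  by (rule V.tprepend_tdeg) auto

lemma vattach_deg:
  assumes "X \<in> fdeg C (Vec C) 1" "w \<in> vdeg n"
  shows "vattach C X w \<in> Tdeg (Suc n)"
proof (rule O.tdeg_ahom[OF Vec_lm _ vattach_ahom refl _ assms(1)])
  fix xs v assume "set xs \<subseteq> hpart C 1" "v \<in> carrier (Vec C)" "length xs = 1"
  then show "vattach C (fpure C (Vec C) xs v) w \<in> Tdeg (Suc n)"
    using assms(2)
    by (elim length_1E) (auto simp: vattach_pure vdeg_carrier intro!: Tdeg_base vtp_deg)
qed (use assms in \<open>auto simp: vdeg_carrier\<close>)

lemma sigT_tbal:
  assumes u: "u \<in> carrier (Vec C)"
  shows "tbal A \<Omega> (TVec C) TT (\<lambda>xs w. case xs of
    [\<xi>] \<Rightarrow> vattach C (sig C u \<xi>) w | _ \<Rightarrow> \<zero>\<^bsub>TT\<^esub>)"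
  by (rule O.tbal_single)
    (use u in \<open>auto intro!: vattach_ahom_right sig_carrier simp: sig_add_right ahom_add[OF vattach_ahom] sig_carrier
      sig_rsmult vattach_rsmult\<close>)

lemma sigT_ahom: "u \<in> carrier (Vec C) \<Longrightarrow> ahom TT TT (sigT C u)"
  unfolding sigT_def by (rule O.tlift_ahom[OF _ _ sigT_tbal]) auto

lemma sigT_pure:
  "\<lbrakk>u \<in> carrier (Vec C); \<xi> \<in> hpart C 1; w \<in> carrier (TVec C)\<rbrakk> \<Longrightarrow>
    sigT C u (fpure C (TVec C) [\<xi>] w) = vattach C (sig C u \<xi>) w"
  unfolding sigT_def by (subst O.tlift_pure[OF _ _ sigT_tbal]) auto

lemma sigT_closed: "\<lbrakk>u \<in> carrier (Vec C); Z \<in> carrier TT\<rbrakk> \<Longrightarrow> sigT C u Z \<in> carrier TT"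
  by (rule ahom_closed[OF sigT_ahom])

lemma sigT_add_left:
  assumes "u \<in> carrier (Vec C)" "v \<in> carrier (Vec C)" "Z \<in> fdeg C (TVec C) 1"
  shows "sigT C (u \<oplus>\<^bsub>Vec C\<^esub> v) Z = sigT C u Z \<oplus>\<^bsub>TT\<^esub> sigT C v Z"
  by (rule deg1_eqI[OF _ _ sigT_ahom ahom_sum[OF _ sigT_ahom sigT_ahom] assms(3)])
    (use assms in \<open>auto simp: sigT_pure sig_add_left ahom_add[OF vattach_ahom] sig_carrier\<close>)

lemma sigT_smult_left:
  assumes "u \<in> carrier (Vec C)" "a \<in> hpart C 0" "Z \<in> fdeg C (TVec C) 1"
  shows "sigT C (a \<odot>\<^bsub>Vec C\<^esub> u) Z = a \<odot>\<^bsub>TT\<^esub> sigT C u Z"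
  by (rule deg1_eqI[OF _ _ sigT_ahom ahom_comp[OF sigT_ahom O.smult_ahom] assms(3)])
    (use assms in \<open>auto simp: sigT_pure sig_smult_left vattach_smult sig_carrier\<close>)

lemma sigT_bal:
  assumes "u \<in> carrier (Vec C)" "a \<in> hpart C 0" "Z \<in> fdeg C (TVec C) 1"
  shows "sigT C (u \<odot>\<^sub>r\<^bsub>Vec C\<^esub> a) Z = sigT C u (a \<odot>\<^bsub>TT\<^esub> Z)"
  by (rule deg1_eqI[OF _ _ sigT_ahom ahom_comp[OF O.smult_ahom sigT_ahom] assms(3)])
    (use assms in \<open>auto simp: sigT_pure sig_bal O.smult_pure_Cons\<close>)

lemma sigT_deg:
  assumes "u \<in> carrier (Vec C)" "Z \<in> Tdeg n"
  shows "sigT C u Z \<in> Tdeg (Suc n)"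
  by (rule ahom_aspan[OF sigT_ahom[OF assms(1)] _ _ Tdeg_gens _ assms(2)])
    (use assms(1) in \<open>auto simp: sigT_pure vdeg_carrier intro!: vattach_deg sig_deg\<close>)

lemma boxT_word_deg: "\<lbrakk>set us \<subseteq> carrier (Vec C); a \<in> hpart C 0\<rbrakk> \<Longrightarrow> boxT_word C us a \<in> Tdeg (length us)"
proof (induction us)
  case Nil
  then show ?case by (auto intro!: Tdeg_base V.tdeg_pure)
next
  case (Cons u us)
  then show ?case
    by (auto simp: boxT_word_Cons intro!: aspan.add vattach_deg boxV_deg sigT_deg V.tdeg_pure)
qed

lemma boxT_word_leibniz:
  assumes "set us \<subseteq> carrier (Vec C)" "a \<in> hpart C 0" "b \<in> hpart C 0"
  shows "boxT_word C (fst (word_smult (Vec C) A b (us, a))) (snd (word_smult (Vec C) A b (us, a)))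
    = fpure C (TVec C) [dif C b] (vpure C us a) \<oplus>\<^bsub>TT\<^esub> b \<odot>\<^bsub>TT\<^esub> boxT_word C us a"
proof (cases us)
  case Nil
  have "fpure C (TVec C) [dif C b \<otimes> a] (vpure C [] \<one>) = fpure C (TVec C) [dif C b] (vpure C [] a)"
    using assms O.pure1_bal[of "TVec C" "dif C b" a "vpure C [] \<one>"]
    by (simp add: V.smult_pure_Nil V.pure_closed hp_sub)
  then show ?thesis
    using assms Nil by (simp add: leibniz0 O.pure1_add V.pure_closed O.smult_pure_Cons)
next
  case (Cons u us')
  have w: "vpure C us' a \<in> carrier (TVec C)" using assms Cons by (simp add: V.pure_closed)
  have d: "boxT_word C us' a \<in> fdeg C (TVec C) 1"
    using boxT_word_deg[of us' a] assms Cons Tdeg_deg1 by auto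
  have c: "boxT_word C us' a \<in> carrier TT" "boxV C u \<in> carrier TV"
    using O.tdeg_carrier[OF _ d] Cons assms by (auto intro: boxV_carrier)
  show ?thesis
    using assms Cons w d c
    by (simp add: boxT_word_Cons boxV_smult ahom_add[OF vattach_ahom] O.pure_closed TV.smult_closed vattach_pure
        vattach_smult sigT_smult_left TT.smult_r_distr vattach_closed sigT_closed V.tp_pure
        TT.M.a_assoc TT.smult_closed V.pure_closed)
qed

text \<open>Cut off to one length, the word function can be lifted before the other degrees are
  known to be balanced.\<close>

abbreviation "boxT_n n \<equiv> tlift TT (\<lambda>us a. if length us = n then boxT_word C us a else \<zero>\<^bsub>TT\<^esub>)"

lemma boxT_n_facts:
  assumes B: "tbal A (Vec C) A TT (\<lambda>us a. if length us = n then boxT_word C us a else \<zero>\<^bsub>TT\<^esub>)"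
    and X: "X \<in> vdeg n"
  shows "boxT_n n X \<in> Tdeg n"
    and "a \<in> hpart C 0 \<Longrightarrow> boxT_n n (a \<odot>\<^bsub>TVec C\<^esub> X) = fpure C (TVec C) [dif C a] X \<oplus>\<^bsub>TT\<^esub> a \<odot>\<^bsub>TT\<^esub> boxT_n n X"
proof -
  have h: "ahom (TVec C) TT (boxT_n n)" by (rule V.tlift_ahom[OF _ _ B]) simp_all
  have p: "boxT_n n (vpure C us b) = boxT_word C us b"
    if "set us \<subseteq> carrier (Vec C)" "b \<in> hpart C 0" "length us = n" for us b
    using that by (subst V.tlift_pure[OF _ _ B]) simp_all
  show "boxT_n n X \<in> Tdeg n"
    by (rule V.tdeg_ahom[OF _ _ h refl _ X]) (use boxT_word_deg in \<open>auto simp: p\<close>)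
  assume a: "a \<in> hpart C 0"
  show "boxT_n n (a \<odot>\<^bsub>TVec C\<^esub> X) = fpure C (TVec C) [dif C a] X \<oplus>\<^bsub>TT\<^esub> a \<odot>\<^bsub>TT\<^esub> boxT_n n X"
  proof (rule V.tdeg_eqI[OF _ _ ahom_comp[OF V.smult_ahom h] ahom_sum[OF _ O.pure_last_ahom ahom_comp[OF h O.smult_ahom]] _ X])
    fix us b assume us: "set us \<subseteq> carrier (Vec C)" "b \<in> carrier A" "length us = n"
    have "boxT_n n (a \<odot>\<^bsub>TVec C\<^esub> vpure C us b) =
      boxT_word C (fst (word_smult (Vec C) A a (us, b))) (snd (word_smult (Vec C) A a (us, b)))"
      using us a V.word_smult_facts[OF Form_lm, of a us b] by (simp add: V.smult_pure p)
    then show "boxT_n n (a \<odot>\<^bsub>TVec C\<^esub> vpure C us b) =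
      fpure C (TVec C) [dif C a] (vpure C us b) \<oplus>\<^bsub>TT\<^esub> a \<odot>\<^bsub>TT\<^esub> boxT_n n (vpure C us b)"
      using us a by (simp add: boxT_word_leibniz p)
  qed (use a in auto)
qed

text \<open>To balance \<open>u.a\<close> against \<open>a X\<close>: on one side
  \<open>boxV_rsmult\<close> yields the additional term \<sigma>(u \<otimes> da) \<otimes> X, on the
  other the same term comes from applying \<sigma> to the Leibniz rule for a X, which is available
  because degree n is already well defined (\<open>boxT_n_facts\<close>).\<close>

lemma tbal_boxT_n:
  "tbal A (Vec C) A TT (\<lambda>us a. if length us = n then boxT_word C us a else \<zero>\<^bsub>TT\<^esub>)"
proof (induction n)
  case 0
  have e: "(\<lambda>us a. if length us = 0 then boxT_word C us a else \<zero>\<^bsub>TT\<^esub>) =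
    (\<lambda>us a. if us = [] then fpure C (TVec C) [dif C a] (vpure C [] \<one>) else \<zero>\<^bsub>TT\<^esub>)"
    by (intro ext) auto
  show ?case unfolding e
    by (rule V.tbal_Nil) (auto intro!: ahomI O.pure_closed V.pure_closed simp: dif_add hp_sub O.pure1_add V.pure_closed)
next
  case (Suc n)
  note B = Suc
  have h: "ahom (TVec C) TT (boxT_n n)" by (rule V.tlift_ahom[OF _ _ B]) simp_all
  note F = boxT_n_facts[OF B]
  note Fd = Tdeg_deg1[OF F(1)]
  show ?case
  proof (rule V.tbal_cons_deg[where g = "\<lambda>u X. vattach C (boxV C u) X \<oplus>\<^bsub>TT\<^esub> sigT C u (boxT_n n X)"])
    fix u us b assume "u \<in> carrier (Vec C)" "set us \<subseteq> carrier (Vec C)" "b \<in> carrier A" "length us = n"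
    then show "boxT_word C (u # us) b = vattach C (boxV C u) (vpure C us b) \<oplus>\<^bsub>TT\<^esub> sigT C u (boxT_n n (vpure C us b))"
      by (subst V.tlift_pure[OF _ _ B]) (simp_all add: boxT_word_Cons)
  next
    fix u assume "u \<in> carrier (Vec C)"
    then show "ahom (TVec C) TT (\<lambda>X. vattach C (boxV C u) X \<oplus>\<^bsub>TT\<^esub> sigT C u (boxT_n n X))"
      by (intro ahom_sum vattach_ahom_right boxV_carrier ahom_comp[OF h sigT_ahom]) simp_all
  next
    fix u v X assume "u \<in> carrier (Vec C)" "v \<in> carrier (Vec C)" "X \<in> vdeg n"
    then show "vattach C (boxV C (u \<oplus>\<^bsub>Vec C\<^esub> v)) X \<oplus>\<^bsub>TT\<^esub> sigT C (u \<oplus>\<^bsub>Vec C\<^esub> v) (boxT_n n X) =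
      vattach C (boxV C u) X \<oplus>\<^bsub>TT\<^esub> sigT C u (boxT_n n X) \<oplus>\<^bsub>TT\<^esub> (vattach C (boxV C v) X \<oplus>\<^bsub>TT\<^esub> sigT C v (boxT_n n X))"
      using ahom_closed[OF h, of X]
      by (simp add: boxV_add ahom_add[OF vattach_ahom] boxV_carrier vdeg_carrier sigT_add_left Fd vattach_closed
          sigT_closed TT.M.a_ac)
  next
    fix u a X assume *: "u \<in> carrier (Vec C)" "a \<in> hpart C 0" "X \<in> vdeg n"
    then show "vattach C (boxV C (u \<odot>\<^sub>r\<^bsub>Vec C\<^esub> a)) X \<oplus>\<^bsub>TT\<^esub> sigT C (u \<odot>\<^sub>r\<^bsub>Vec C\<^esub> a) (boxT_n n X) =
      vattach C (boxV C u) (a \<odot>\<^bsub>TVec C\<^esub> X) \<oplus>\<^bsub>TT\<^esub> sigT C u (boxT_n n (a \<odot>\<^bsub>TVec C\<^esub> X))"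
      using ahom_closed[OF h, of X]
      by (simp add: boxV_rsmult ahom_add[OF vattach_ahom] boxV_carrier vdeg_carrier sigT_bal Fd vattach_closed
          sigT_closed TT.M.a_ac rsm_closed sig_carrier vattach_rsmult F(2) ahom_add[OF sigT_ahom] O.pure_closed
          TT.smult_closed sigT_pure TW.smult_closed)
  qed simp_all
qed

lemma tbal_boxT: "tbal A (Vec C) A TT (boxT_word C)"
proof -
  from tbal_by_length[where F = "\<lambda>n us a. if length us = n then boxT_word C us a else \<zero>\<^bsub>TT\<^esub>", OF tbal_boxT_n]
  show ?thesis by simp
qed

lemma boxT_ahom: "ahom (TVec C) TT (boxT C)"
  unfolding boxT_def by (rule V.tlift_ahom[OF _ _ tbal_boxT]) simp_all

lemma boxT_pure: "\<lbrakk>set us \<subseteq> carrier (Vec C); a \<in> hpart C 0\<rbrakk> \<Longrightarrow> boxT C (vpure C us a) = boxT_word C us a"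
  unfolding boxT_def by (rule V.tlift_pure[OF _ _ tbal_boxT]) simp_all

lemma boxT_deg: "X \<in> vdeg n \<Longrightarrow> boxT C X \<in> Tdeg n"
  by (rule V.tdeg_ahom[OF _ _ boxT_ahom refl]) (use boxT_word_deg in \<open>auto simp: boxT_pure\<close>)

lemma boxT_deg1: "X \<in> carrier (TVec C) \<Longrightarrow> boxT C X \<in> fdeg C (TVec C) 1"
proof (induction rule: V.T_induct[OF Form_lm, consumes 1, case_names zero pure add neg])
  case zero
  then show ?case by (simp add: ahom_zero[OF boxT_ahom] O.tdeg_zero)
next
  case (pure xs y)
  then show ?case using Tdeg_deg1[OF boxT_deg[OF V.tdeg_pure[OF Form_lm _ _ refl], of xs y]] by simp
next
  case (add X Y)
  then show ?case by (simp add: ahom_add[OF boxT_ahom] O.tdeg_add)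
next
  case (neg X)
  then show ?case by (simp add: ahom_neg[OF boxT_ahom] O.tdeg_neg)
qed

lemma boxT_closed: "X \<in> carrier (TVec C) \<Longrightarrow> boxT C X \<in> carrier TT"
  by (rule ahom_closed[OF boxT_ahom])

lemma boxT_smult:
  assumes a: "a \<in> hpart C 0" and X: "X \<in> carrier (TVec C)"
  shows "boxT C (a \<odot>\<^bsub>TVec C\<^esub> X) = fpure C (TVec C) [dif C a] X \<oplus>\<^bsub>TT\<^esub> a \<odot>\<^bsub>TT\<^esub> boxT C X"
proof (rule V.T_eqI[OF _ _ ahom_comp[OF V.smult_ahom boxT_ahom] ahom_sum[OF _ O.pure_last_ahom ahom_comp[OF boxT_ahom O.smult_ahom]] _ X])
  fix us b assume us: "set us \<subseteq> carrier (Vec C)" "b \<in> carrier A"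
  have "boxT C (a \<odot>\<^bsub>TVec C\<^esub> vpure C us b) =
    boxT_word C (fst (word_smult (Vec C) A a (us, b))) (snd (word_smult (Vec C) A a (us, b)))"
    using us a V.word_smult_facts[OF Form_lm, of a us b] by (simp add: V.smult_pure boxT_pure)
  then show "boxT C (a \<odot>\<^bsub>TVec C\<^esub> vpure C us b) =
    fpure C (TVec C) [dif C a] (vpure C us b) \<oplus>\<^bsub>TT\<^esub> a \<odot>\<^bsub>TT\<^esub> boxT C (vpure C us b)"
    using us a by (simp add: boxT_word_leibniz boxT_pure)
qed (use a in auto)

lemma boxT_vtp:
  assumes "u \<in> carrier (Vec C)" "X \<in> carrier (TVec C)"
  shows "boxT C (vtp u X) = vattach C (boxV C u) X \<oplus>\<^bsub>TT\<^esub> sigT C u (boxT C X)"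
  by (rule V.T_eqI[OF _ _ ahom_comp[OF vtp_ahom boxT_ahom] ahom_sum[OF _ vattach_ahom_right ahom_comp[OF boxT_ahom sigT_ahom]] _ assms(2)])
    (use assms in \<open>auto simp: V.tp_pure boxT_pure boxT_word_Cons boxV_carrier\<close>)

section \<open>The product on the tensor algebra of vector fields\<close>

abbreviation "ap u Z \<equiv> apply_first (TVec C) u Z"

lemma ap_closed: "\<lbrakk>u \<in> carrier (Vec C); Z \<in> carrier TT\<rbrakk> \<Longrightarrow> ap u Z \<in> carrier (TVec C)"
  by (rule O.apply_first_closed) auto

lemma ap_ahom: "u \<in> carrier (Vec C) \<Longrightarrow> ahom TT (TVec C) (apply_first (TVec C) u)"
  by (rule O.apply_first_ahom) auto

lemma ap_pure: "\<lbrakk>u \<in> carrier (Vec C); \<xi> \<in> hpart C 1; w \<in> carrier (TVec C)\<rbrakk> \<Longrightarrow> ap u (fpure C (TVec C) [\<xi>] w) = u \<xi> \<odot>\<^bsub>TVec C\<^esub> w"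
  by (rule O.apply_first_pure) auto

lemma deg1_Suc: "X \<in> fdeg C N 1 \<Longrightarrow> X \<in> fdeg C N (Suc 0)"
  by (simp add: One_nat_def)

lemma ap_add_left:
  "\<lbrakk>u \<in> carrier (Vec C); v \<in> carrier (Vec C); Z \<in> fdeg C (TVec C) 1\<rbrakk> \<Longrightarrow>
    ap (u \<oplus>\<^bsub>Vec C\<^esub> v) Z = ap u Z \<oplus>\<^bsub>TVec C\<^esub> ap v Z"
  by (rule O.apply_first_add_left) (auto intro: deg1_Suc)

lemma ap_smult_left:
  "\<lbrakk>u \<in> carrier (Vec C); a \<in> hpart C 0; Z \<in> fdeg C (TVec C) 1\<rbrakk> \<Longrightarrow>
    ap (a \<odot>\<^bsub>Vec C\<^esub> u) Z = a \<odot>\<^bsub>TVec C\<^esub> ap u Z"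
  by (rule O.apply_first_smult_left[where u = u]) (auto intro: deg1_Suc)

lemma ap_bal:
  "\<lbrakk>u \<in> carrier (Vec C); a \<in> hpart C 0; Z \<in> fdeg C (TVec C) 1\<rbrakk> \<Longrightarrow>
    ap (u \<odot>\<^sub>r\<^bsub>Vec C\<^esub> a) Z = ap u (a \<odot>\<^bsub>TT\<^esub> Z)"
  by (rule O.apply_first_smult_right) (auto intro: deg1_Suc)

lemma ap_deg: "\<lbrakk>u \<in> carrier (Vec C); X \<in> vdeg n\<rbrakk> \<Longrightarrow> ap u (boxT C X) \<in> vdeg n"
proof -
  assume u: "u \<in> carrier (Vec C)" and X: "X \<in> vdeg n"
  show ?thesis
    unfolding V.tdeg_aspan[OF Form_lm]
    by (rule ahom_aspan[OF ap_ahom[OF u] _ _ Tdeg_gens _ boxT_deg[OF X]], unfold V.tdeg_aspan[OF Form_lm, symmetric])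
      (use u in \<open>auto simp: ap_pure vdeg_carrier intro!: V.smult_tdeg\<close>)
qed

lemma bullet1_ahom: "u \<in> carrier (Vec C) \<Longrightarrow> ahom (TVec C) (TVec C) (bullet1 C u)"
  unfolding bullet1_def by (intro ahom_sum vtp_ahom ahom_comp[OF boxT_ahom ap_ahom]) simp_all

lemma bullet1_closed: "\<lbrakk>u \<in> carrier (Vec C); w \<in> carrier (TVec C)\<rbrakk> \<Longrightarrow> bullet1 C u w \<in> carrier (TVec C)"
  by (rule ahom_closed[OF bullet1_ahom])

lemma bullet1_add_left:
  "\<lbrakk>u \<in> carrier (Vec C); v \<in> carrier (Vec C); w \<in> carrier (TVec C)\<rbrakk> \<Longrightarrow>
    bullet1 C (u \<oplus>\<^bsub>Vec C\<^esub> v) w = bullet1 C u w \<oplus>\<^bsub>TVec C\<^esub> bullet1 C v w"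
  by (simp add: bullet1_def V.tp_add ap_add_left boxT_deg1 TW.M.a_ac vtp_closed ap_closed boxT_closed)

lemma bullet1_smult_left:
  "\<lbrakk>u \<in> carrier (Vec C); a \<in> hpart C 0; w \<in> carrier (TVec C)\<rbrakk> \<Longrightarrow>
    bullet1 C (a \<odot>\<^bsub>Vec C\<^esub> u) w = a \<odot>\<^bsub>TVec C\<^esub> bullet1 C u w"
  by (simp add: bullet1_def V.smult_tp ap_smult_left boxT_deg1 TW.smult_r_distr vtp_closed ap_closed boxT_closed)

text \<open>The term u(da) w stems from the Leibniz rule for \<box>(a w). It shows that u \<bullet>
  w is not balanced over A, a defect that the correction term of \<open>bullet_deg\<close>
  compensates.\<close>

lemma bullet1_smult:
  "\<lbrakk>u \<in> carrier (Vec C); a \<in> hpart C 0; w \<in> carrier (TVec C)\<rbrakk> \<Longrightarrow>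
    bullet1 C u (a \<odot>\<^bsub>TVec C\<^esub> w) = bullet1 C (u \<odot>\<^sub>r\<^bsub>Vec C\<^esub> a) w \<oplus>\<^bsub>TVec C\<^esub> u (dif C a) \<odot>\<^bsub>TVec C\<^esub> w"
  by (simp add: bullet1_def V.tp_bal ap_bal boxT_deg1 boxT_smult ahom_add[OF ap_ahom] O.pure_closed TT.smult_closed boxT_closed
      ap_pure TW.smult_closed TW.M.a_ac vtp_closed ap_closed)

lemma lhom_neg_smult: "\<lbrakk>a \<in> hpart C 0; x \<in> carrier (TVec C); y \<in> carrier (TVec C)\<rbrakk> \<Longrightarrow>
    a \<odot>\<^bsub>TVec C\<^esub> (x \<ominus>\<^bsub>TVec C\<^esub> y) = a \<odot>\<^bsub>TVec C\<^esub> x \<ominus>\<^bsub>TVec C\<^esub> a \<odot>\<^bsub>TVec C\<^esub> y"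
  by (rule ahom_minus[OF left_module_ahom[OF TW.left_module_axioms]]) auto

text \<open>Moving a scalar from u.a to a X adds u(da) (X \<bullet> w) to the main term, by
  \<open>bullet1_smult\<close>. The Leibniz rule for \<box>(a X) and left linearity in degree n add
  the same to the correction term, and the two cancel.\<close>

lemma bullet_deg_tbal_Suc:
  assumes w: "w \<in> carrier (TVec C)"
    and L: "lhom A (TVec C) (TVec C) (\<lambda>v. bullet_deg C n v w)"
  shows "tbal A (Vec C) A (TVec C) (\<lambda>us a.
      if length us = Suc n
      then bullet1 C (hd us) (bullet_deg C n (vpure C (tl us) a) w)
        \<ominus>\<^bsub>TVec C\<^esub> bullet_deg C n (ap (hd us) (boxT C (vpure C (tl us) a))) w
      else \<zero>\<^bsub>TVec C\<^esub>)"
proof (rule V.tbal_cons_deg[where g = "\<lambda>u X. bullet1 C u (bullet_deg C n X w) \<ominus>\<^bsub>TVec C\<^esub> bullet_deg C n (ap u (boxT C X)) w"])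
  note Lc = lhom_closed[OF L] and La = lhom_ahom[OF L]
  fix u assume u: "u \<in> carrier (Vec C)"
  show "ahom (TVec C) (TVec C) (\<lambda>X. bullet1 C u (bullet_deg C n X w) \<ominus>\<^bsub>TVec C\<^esub> bullet_deg C n (ap u (boxT C X)) w)"
    by (intro ahom_diff ahom_comp[OF La bullet1_ahom] ahom_comp[OF ahom_comp[OF boxT_ahom ap_ahom] La] u) simp
next
  note Lc = lhom_closed[OF L] and La = lhom_ahom[OF L]
  fix u v X assume "u \<in> carrier (Vec C)" "v \<in> carrier (Vec C)" "X \<in> vdeg n"
  then show "bullet1 C (u \<oplus>\<^bsub>Vec C\<^esub> v) (bullet_deg C n X w) \<ominus>\<^bsub>TVec C\<^esub> bullet_deg C n (ap (u \<oplus>\<^bsub>Vec C\<^esub> v) (boxT C X)) w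
      = bullet1 C u (bullet_deg C n X w) \<ominus>\<^bsub>TVec C\<^esub> bullet_deg C n (ap u (boxT C X)) w \<oplus>\<^bsub>TVec C\<^esub>
       (bullet1 C v (bullet_deg C n X w) \<ominus>\<^bsub>TVec C\<^esub> bullet_deg C n (ap v (boxT C X)) w)"
    by (simp add: bullet1_add_left Lc vdeg_carrier ap_add_left boxT_deg1 lhom_add[OF L] ap_closed boxT_closed
        a_minus_def TW.M.minus_add TW.M.a_ac bullet1_closed)
next
  note Lc = lhom_closed[OF L] and La = lhom_ahom[OF L]
  fix u a X assume *: "u \<in> carrier (Vec C)" "a \<in> hpart C 0" "X \<in> vdeg n"
  have s: "u (dif C a) \<odot>\<^bsub>TVec C\<^esub> bullet_deg C n X w \<in> carrier (TVec C)"
    "bullet1 C (u \<odot>\<^sub>r\<^bsub>Vec C\<^esub> a) (bullet_deg C n X w) \<in> carrier (TVec C)"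
    "bullet_deg C n (ap u (a \<odot>\<^bsub>TT\<^esub> boxT C X)) w \<in> carrier (TVec C)"
    using * by (auto intro!: TW.smult_closed Lc bullet1_closed ap_closed TT.smult_closed boxT_closed simp: vdeg_carrier)
  show "bullet1 C (u \<odot>\<^sub>r\<^bsub>Vec C\<^esub> a) (bullet_deg C n X w) \<ominus>\<^bsub>TVec C\<^esub> bullet_deg C n (ap (u \<odot>\<^sub>r\<^bsub>Vec C\<^esub> a) (boxT C X)) w
      = bullet1 C u (bullet_deg C n (a \<odot>\<^bsub>TVec C\<^esub> X) w) \<ominus>\<^bsub>TVec C\<^esub> bullet_deg C n (ap u (boxT C (a \<odot>\<^bsub>TVec C\<^esub> X))) w"
    using * s
    by (simp add: Lc vdeg_carrier ap_bal boxT_deg1 lhom_add[OF L] lhom_smult[OF L] ap_closed boxT_closed TT.smult_closed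
        bullet1_smult boxT_smult ahom_add[OF ap_ahom] O.pure_closed ap_pure TW.smult_closed
        a_minus_def TW.M.minus_add)
      (simp add: TW.M.a_assoc TW.M.r_neg1 TW.M.r_neg2 Lc vdeg_carrier TW.smult_closed ap_closed TT.smult_closed boxT_closed)
qed simp_all

text \<open>Balancedness in degree n + 1 presupposes left linearity in degree n; this induction
  supplies both.\<close>

lemma bullet_deg_lhom:
  "w \<in> carrier (TVec C) \<Longrightarrow> lhom A (TVec C) (TVec C) (\<lambda>v. bullet_deg C n v w)"
proof (induction n)
  case 0
  have t: "tbal A (Vec C) A (TVec C) (\<lambda>us a. if us = [] then a \<odot>\<^bsub>TVec C\<^esub> w else \<zero>\<^bsub>TVec C\<^esub>)"
    by (rule V.tbal_Nil) (use 0 left_module_ahom_scalar[OF TW.left_module_axioms] in auto)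
  have h: "ahom (TVec C) (TVec C) (\<lambda>v. bullet_deg C 0 v w)"
    using V.tlift_ahom[OF _ _ t] by simp
  show ?case
  proof (rule lhomI[OF h])
    fix b X assume *: "b \<in> carrier A" "X \<in> carrier (TVec C)"
    show "bullet_deg C 0 (b \<odot>\<^bsub>TVec C\<^esub> X) w = b \<odot>\<^bsub>TVec C\<^esub> bullet_deg C 0 X w"
    proof (rule V.T_eqI[OF _ _ ahom_comp[OF V.smult_ahom h] ahom_comp[OF h V.smult_ahom] _ *(2)])
      fix us a assume "set us \<subseteq> carrier (Vec C)" "a \<in> carrier A"
      then show "bullet_deg C 0 (b \<odot>\<^bsub>TVec C\<^esub> vpure C us a) w = b \<odot>\<^bsub>TVec C\<^esub> bullet_deg C 0 (vpure C us a) w"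
        using * 0 TW.smult_assoc[of b a w] by (cases us)
          (simp_all add: V.smult_pure_Nil V.smult_pure_Cons V.tlift_pure[OF _ _ t] left_module_smult_zero[OF TW.left_module_axioms])
    qed (use * in auto)
  qed
next
  case (Suc n)
  note L = Suc.IH[OF Suc.prems] and w = Suc.prems
  note Lc = lhom_closed[OF L]
  note t = bullet_deg_tbal_Suc[OF w L]
  have h: "ahom (TVec C) (TVec C) (\<lambda>v. bullet_deg C (Suc n) v w)"
    using V.tlift_ahom[OF _ _ t] by simp
  show ?case
  proof (rule lhomI[OF h])
    fix b X assume *: "b \<in> carrier A" "X \<in> carrier (TVec C)"
    show "bullet_deg C (Suc n) (b \<odot>\<^bsub>TVec C\<^esub> X) w = b \<odot>\<^bsub>TVec C\<^esub> bullet_deg C (Suc n) X w"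
    proof (rule V.T_eqI[OF _ _ ahom_comp[OF V.smult_ahom h] ahom_comp[OF h V.smult_ahom] _ *(2)])
      fix us a assume us: "set us \<subseteq> carrier (Vec C)" "a \<in> carrier A"
      show "bullet_deg C (Suc n) (b \<odot>\<^bsub>TVec C\<^esub> vpure C us a) w = b \<odot>\<^bsub>TVec C\<^esub> bullet_deg C (Suc n) (vpure C us a) w"
      proof (cases us)
        case Nil
        then show ?thesis using us * by (simp add: V.smult_pure_Nil V.tlift_pure[OF _ _ t] left_module_smult_zero[OF TW.left_module_axioms])
      next
        case (Cons u vs)
        have X: "vpure C vs a \<in> carrier (TVec C)" using us Cons by (auto intro!: V.pure_closed)
        then show ?thesis using us * Cons
          by (simp add: V.smult_pure_Cons V.tlift_pure[OF _ _ t] left_module_smult_zero[OF TW.left_module_axioms]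
             bullet1_smult_left Lc ap_smult_left boxT_deg1 lhom_smult[OF L] ap_closed boxT_closed lhom_neg_smult bullet1_closed)
      qed
    qed (use * in auto)
  qed
qed

lemma bullet_deg_pure_Cons:
  assumes "u \<in> carrier (Vec C)" "set us \<subseteq> carrier (Vec C)" "a \<in> hpart C 0" "w \<in> carrier (TVec C)" "length us = n"
  shows "bullet_deg C (Suc n) (vpure C (u # us) a) w =
    bullet1 C u (bullet_deg C n (vpure C us a) w) \<ominus>\<^bsub>TVec C\<^esub> bullet_deg C n (ap u (boxT C (vpure C us a))) w"
  using assms by (simp add: V.tlift_pure[OF _ _ bullet_deg_tbal_Suc[OF assms(4) bullet_deg_lhom[OF assms(4)]]])

lemma bullet_deg_pure_Nil:
  assumes "a \<in> hpart C 0" "w \<in> carrier (TVec C)"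
  shows "bullet_deg C 0 (vpure C [] a) w = a \<odot>\<^bsub>TVec C\<^esub> w"
proof -
  have t: "tbal A (Vec C) A (TVec C) (\<lambda>us a. if us = [] then a \<odot>\<^bsub>TVec C\<^esub> w else \<zero>\<^bsub>TVec C\<^esub>)"
    by (rule V.tbal_Nil) (use assms left_module_ahom_scalar[OF TW.left_module_axioms] in auto)
  show ?thesis using assms by (simp add: V.tlift_pure[OF _ _ t])
qed

lemma tbal_bullet:
  assumes "w \<in> carrier (TVec C)"
  shows "tbal A (Vec C) A (TVec C) (\<lambda>us a. bullet_deg C (length us) (vpure C us a) w)"
proof -
  have "tbal A (Vec C) A (TVec C) (\<lambda>us a. (\<lambda>n us a. bullet_deg C n (vpure C us a) w) (length us) us a)"
    by (rule tbal_by_length, rule tbal_comp[OF V.tbal_pure lhom_ahom[OF bullet_deg_lhom]]) (use assms in auto)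
  then show ?thesis by simp
qed

lemma bullet_ahom: "w \<in> carrier (TVec C) \<Longrightarrow> ahom (TVec C) (TVec C) (\<lambda>v. bullet C v w)"
  unfolding bullet_def by (rule V.tlift_ahom[OF _ _ tbal_bullet]) simp_all

lemma bullet_closed: "\<lbrakk>v \<in> carrier (TVec C); w \<in> carrier (TVec C)\<rbrakk> \<Longrightarrow> bullet C v w \<in> carrier (TVec C)"
  by (rule ahom_closed[OF bullet_ahom])

lemma bullet_pure: "\<lbrakk>set us \<subseteq> carrier (Vec C); a \<in> hpart C 0; w \<in> carrier (TVec C)\<rbrakk> \<Longrightarrow>
    bullet C (vpure C us a) w = bullet_deg C (length us) (vpure C us a) w"
  unfolding bullet_def by (rule V.tlift_pure[OF _ _ tbal_bullet]) simp_all

lemma bullet_vdeg: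
  assumes "v \<in> vdeg n" "w \<in> carrier (TVec C)"
  shows "bullet C v w = bullet_deg C n v w"
  by (rule V.tdeg_eqI[OF _ _ bullet_ahom lhom_ahom[OF bullet_deg_lhom] _ assms(1)])
    (use assms in \<open>auto simp: bullet_pure\<close>)

lemma bullet_pure_Nil: "\<lbrakk>a \<in> hpart C 0; w \<in> carrier (TVec C)\<rbrakk> \<Longrightarrow> bullet C (vpure C [] a) w = a \<odot>\<^bsub>TVec C\<^esub> w"
  by (simp add: bullet_pure bullet_deg_pure_Nil del: bullet_deg.simps)

text \<open>Contracting \<open>u\<close> with \<box>X keeps the degree of \<open>X\<close>
  (\<open>ap_deg\<close>). Hence the recursion of \<open>bullet_deg\<close> can be restated with no
  degrees in it, for inhomogeneous \<open>X\<close> as well.\<close>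

lemma bullet_vtp:
  assumes u: "u \<in> carrier (Vec C)" and X: "X \<in> carrier (TVec C)" and w: "w \<in> carrier (TVec C)"
  shows "bullet C (vtp u X) w = bullet1 C u (bullet C X w) \<ominus>\<^bsub>TVec C\<^esub> bullet C (ap u (boxT C X)) w"
proof (rule V.T_eqI[OF _ _ ahom_comp[OF vtp_ahom bullet_ahom] ahom_diff[OF _ ahom_comp[OF bullet_ahom bullet1_ahom]
        ahom_comp[OF ahom_comp[OF boxT_ahom ap_ahom] bullet_ahom]] _ X])
  fix us a assume us: "set us \<subseteq> carrier (Vec C)" "a \<in> carrier A"
  have d: "ap u (boxT C (vpure C us a)) \<in> vdeg (length us)"
    by (rule ap_deg[OF u V.tdeg_pure]) (use us in auto)
  show "bullet C (vtp u (vpure C us a)) w =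
    bullet1 C u (bullet C (vpure C us a) w) \<ominus>\<^bsub>TVec C\<^esub> bullet C (ap u (boxT C (vpure C us a))) w"
    using us u w by (simp add: V.tp_pure bullet_pure bullet_deg_pure_Cons bullet_vdeg[OF d] del: bullet_deg.simps)
qed (use u w in auto)

lemma bullet_smult:
  assumes a: "a \<in> hpart C 0" and X: "X \<in> carrier (TVec C)" and w: "w \<in> carrier (TVec C)"
  shows "bullet C (a \<odot>\<^bsub>TVec C\<^esub> X) w = a \<odot>\<^bsub>TVec C\<^esub> bullet C X w"
proof (rule V.T_eqI[OF _ _ ahom_comp[OF V.smult_ahom bullet_ahom] ahom_comp[OF bullet_ahom V.smult_ahom] _ X])
  fix us b assume us: "set us \<subseteq> carrier (Vec C)" "b \<in> carrier A"
  have d: "a \<odot>\<^bsub>TVec C\<^esub> vpure C us b \<in> vdeg (length us)"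
    by (rule V.smult_tdeg[OF _ _ V.tdeg_pure]) (use us a in auto)
  show "bullet C (a \<odot>\<^bsub>TVec C\<^esub> vpure C us b) w = a \<odot>\<^bsub>TVec C\<^esub> bullet C (vpure C us b) w"
    using us a w by (simp add: bullet_vdeg[OF d] bullet_pure lhom_smult[OF bullet_deg_lhom] V.pure_closed del: bullet_deg.simps)
qed (use a w in auto)

text \<open>A map \<open>\<rho>\<close> satisfying the recursion which defines the product in its left argument is
  automatically multiplicative.  Applied to left multiplication this gives associativity, applied to
  \<open>act\<close> it gives the action.\<close>

lemma multiplicative_if_recursive:
  assumes E: "left_module A E"
    and rho: "\<And>x. x \<in> carrier E \<Longrightarrow> ahom (TVec C) E (\<lambda>v. rho v x)"
    and rho_smult: "\<And>a v x. \<lbrakk>a \<in> hpart C 0; v \<in> carrier (TVec C); x \<in> carrier E\<rbrakk> \<Longrightarrow> rho (a \<odot>\<^bsub>TVec C\<^esub> v) x = a \<odot>\<^bsub>E\<^esub> rho v x"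
    and rho_nil: "\<And>a x. \<lbrakk>a \<in> hpart C 0; x \<in> carrier E\<rbrakk> \<Longrightarrow> rho (vpure C [] a) x = a \<odot>\<^bsub>E\<^esub> x"
    and U: "\<And>u x. \<lbrakk>u \<in> carrier (Vec C); x \<in> carrier E\<rbrakk> \<Longrightarrow> U u x \<in> carrier E"
    and rho_vtp: "\<And>u X x. \<lbrakk>u \<in> carrier (Vec C); X \<in> carrier (TVec C); x \<in> carrier E\<rbrakk> \<Longrightarrow>
      rho (vtp u X) x = U u (rho X x) \<ominus>\<^bsub>E\<^esub> rho (ap u (boxT C X)) x"
    and v: "v \<in> carrier (TVec C)" and w: "w \<in> carrier (TVec C)" and x: "x \<in> carrier E"
  shows "rho (bullet C v w) x = rho v (rho w x)"
proof -
  interpret E: left_module A E by (rule E)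
  note rc = ahom_closed[OF rho]
  \<comment> \<open>u \<bullet> z is u \<otimes> z plus the contraction of u with \<box>z, and the
    recursion for u \<otimes> z subtracts just the value at that contraction.\<close>
  have b1: "rho (bullet1 C u z) x = U u (rho z x)" if "u \<in> carrier (Vec C)" "z \<in> carrier (TVec C)" "x \<in> carrier E" for u z x
    using that rc[OF that(3)] U[OF that(1) rc[OF that(3,2)]]
    by (simp add: bullet1_def ahom_add[OF rho] vtp_closed ap_closed boxT_closed rho_vtp a_minus_def E.M.a_assoc E.M.l_neg)
  have deg: "\<lbrakk>v \<in> vdeg n; w \<in> carrier (TVec C); x \<in> carrier E\<rbrakk> \<Longrightarrow> rho (bullet C v w) x = rho v (rho w x)" for n v w x
  proof (induction n arbitrary: v w x)
    case 0
    have "rho (bullet C (vpure C [] a) w) x = rho (vpure C [] a) (rho w x)" if "a \<in> hpart C 0" for a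
      using that 0 rc by (simp add: bullet_pure_Nil rho_smult rho_nil)
    with vdeg_0E[OF 0(1)] show ?case by metis
  next
    case (Suc n)
    show ?case
    proof (rule vdeg_eqI[OF _ ahom_comp[OF bullet_ahom rho] rho _ Suc.prems(1)])
      fix u X assume u: "u \<in> carrier (Vec C)" and X: "X \<in> vdeg n"
      note Xc = vdeg_carrier[OF X] and rwx = rc[OF Suc.prems(3,2)]
      have "rho (bullet C (vtp u X) w) x = rho (bullet1 C u (bullet C X w)) x \<ominus>\<^bsub>E\<^esub> rho (bullet C (ap u (boxT C X)) w) x"
        using Suc.prems u Xc
        by (simp add: bullet_vtp ahom_minus[OF rho] bullet1_closed bullet_closed ap_closed boxT_closed E.M.abelian_group_axioms)
      \<comment> \<open>Besides X, the contraction of u with \<box>X has degree n too, so the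
        induction hypothesis is used for both; this is why it leaves the left factor
        arbitrary.\<close>
      also have "\<dots> = U u (rho X (rho w x)) \<ominus>\<^bsub>E\<^esub> rho (ap u (boxT C X)) (rho w x)"
        using Suc.prems u Xc by (simp add: b1 bullet_closed Suc.IH[OF X] Suc.IH[OF ap_deg[OF u X]])
      also have "\<dots> = rho (vtp u X) (rho w x)"
        using Suc.prems u Xc rwx by (simp add: rho_vtp)
      finally show "rho (bullet C (vtp u X) w) x = rho (vtp u X) (rho w x)" .
    qed (use Suc.prems rc E.M.abelian_group_axioms in auto)
  qed
  show ?thesis
    by (rule V.T_eqI[OF _ _ ahom_comp[OF bullet_ahom rho] rho _ v])
      (use w x rc E.M.abelian_group_axioms deg[OF V.tdeg_pure] in auto)
qed

text \<open>The product is a lift in its left argument only. On the right, additivity is carried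
  through the recursion from \<open>bullet1\<close>, by induction on the degree of the left
  factor.\<close>

lemma bullet_ahom_right:
  assumes v: "v \<in> carrier (TVec C)" shows "ahom (TVec C) (TVec C) (bullet C v)"
proof (rule ahomI)
  fix w w' assume w: "w \<in> carrier (TVec C)" "w' \<in> carrier (TVec C)"
  note ww = TW.M.a_closed[OF w]
  have deg: "v \<in> vdeg n \<Longrightarrow> bullet C v (w \<oplus>\<^bsub>TVec C\<^esub> w') = bullet C v w \<oplus>\<^bsub>TVec C\<^esub> bullet C v w'" for n v
  proof (induction n arbitrary: v)
    case 0
    have "bullet C (vpure C [] a) (w \<oplus>\<^bsub>TVec C\<^esub> w') = bullet C (vpure C [] a) w \<oplus>\<^bsub>TVec C\<^esub> bullet C (vpure C [] a) w'" if "a \<in> hpart C 0" for a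
      using that w by (simp add: bullet_pure_Nil TW.smult_r_distr)
    with vdeg_0E[OF 0(1)] show ?case by metis
  next
    case (Suc n)
    show ?case
    proof (rule vdeg_eqI[OF _ bullet_ahom ahom_sum[OF _ bullet_ahom bullet_ahom] _ Suc.prems])
      fix u X assume u: "u \<in> carrier (Vec C)" and X: "X \<in> vdeg n"
      show "bullet C (vtp u X) (w \<oplus>\<^bsub>TVec C\<^esub> w') = bullet C (vtp u X) w \<oplus>\<^bsub>TVec C\<^esub> bullet C (vtp u X) w'"
        using u vdeg_carrier[OF X] w ww
        by (simp add: bullet_vtp Suc.IH[OF X] Suc.IH[OF ap_deg[OF u X]] ahom_add[OF bullet1_ahom] bullet_closed bullet1_closed
            ap_closed boxT_closed a_minus_def TW.M.minus_add)
          (simp add: bullet_closed bullet1_closed ap_closed boxT_closed TW.M.a_ac)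
    qed (use w ww in auto)
  qed
  show "bullet C v (w \<oplus>\<^bsub>TVec C\<^esub> w') = bullet C v w \<oplus>\<^bsub>TVec C\<^esub> bullet C v w'"
    by (rule V.T_eqI[OF _ _ bullet_ahom ahom_sum[OF _ bullet_ahom bullet_ahom] _ v])
      (use w ww deg[OF V.tdeg_pure] in auto)
qed (rule bullet_closed[OF v])

text \<open>Given X \<bullet> 1 = X, and the same for the contraction of u with \<box>X, the
  recursion for u \<otimes> X first adds this contraction within u \<bullet> X and then subtracts
  it.\<close>

lemma bullet_one_right:
  assumes v: "v \<in> carrier (TVec C)" shows "bullet C v (vpure C [] \<one>) = v"
proof -
  have o: "vpure C [] \<one> \<in> carrier (TVec C)" by (rule V.pure_closed) auto
  have deg: "v \<in> vdeg n \<Longrightarrow> bullet C v (vpure C [] \<one>) = v" for n v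
  proof (induction n arbitrary: v)
    case 0
    have "bullet C (vpure C [] a) (vpure C [] \<one>) = vpure C [] a" if "a \<in> hpart C 0" for a
      using that o by (simp add: bullet_pure_Nil V.smult_pure_Nil hp_sub)
    with vdeg_0E[OF 0(1)] show ?case by metis
  next
    case (Suc n)
    show ?case
    proof (rule vdeg_eqI[OF _ bullet_ahom ahom_id _ Suc.prems])
      fix u X assume u: "u \<in> carrier (Vec C)" and X: "X \<in> vdeg n"
      show "bullet C (vtp u X) (vpure C [] \<one>) = vtp u X"
        using u vdeg_carrier[OF X] o
        by (simp add: bullet_vtp Suc.IH[OF X] Suc.IH[OF ap_deg[OF u X]] bullet1_def vtp_closed
            ap_closed boxT_closed a_minus_def TW.M.a_assoc TW.M.r_neg)
    qed (use o in auto)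
  qed
  show ?thesis
    by (rule V.T_eqI[OF _ _ bullet_ahom ahom_id _ v])
      (use o deg[OF V.tdeg_pure] in auto)
qed

lemma bullet_assoc:
  "\<lbrakk>v \<in> carrier (TVec C); w \<in> carrier (TVec C); x \<in> carrier (TVec C)\<rbrakk> \<Longrightarrow>
    bullet C (bullet C v w) x = bullet C v (bullet C w x)"
  by (rule multiplicative_if_recursive[where U = "bullet1 C" and E = "TVec C"])
    (simp_all add: bullet_ahom bullet_smult bullet_pure_Nil bullet1_closed bullet_vtp)

lemma TVec_alg_sel [simp]:
  "carrier (TVec_alg C) = carrier (TVec C)" "monoid.mult (TVec_alg C) = bullet C"
  "one (TVec_alg C) = vpure C [] \<one>" "ring.zero (TVec_alg C) = \<zero>\<^bsub>TVec C\<^esub>" "add (TVec_alg C) = add (TVec C)"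
  by (simp_all add: TVec_alg_def)

lemma ring_TVec_alg: "ring (TVec_alg C)"
proof (rule ringI)
  show "abelian_group (TVec_alg C)"
  proof (rule abelian_groupI)
    fix x assume "x \<in> carrier (TVec_alg C)"
    then show "\<exists>y\<in>carrier (TVec_alg C). y \<oplus>\<^bsub>TVec_alg C\<^esub> x = \<zero>\<^bsub>TVec_alg C\<^esub>"
      by (auto intro!: bexI[of _ "\<ominus>\<^bsub>TVec C\<^esub> x"] simp: TW.M.l_neg)
  qed (simp_all add: TW.M.a_ac)
  show "monoid (TVec_alg C)"
    by (rule monoidI)
      (simp_all add: bullet_closed bullet_assoc V.pure_closed bullet_one_right bullet_pure_Nil TW.smult_one[simplified])
qed (simp_all add: ahom_add[OF bullet_ahom] ahom_add[OF bullet_ahom_right])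

end

lemma (in bimod) tbal_restrict:
  assumes "tbal A M N P f" "abelian_group P"
  shows "tbal A M N P (\<lambda>xs y. if length xs = n then f xs y else \<zero>\<^bsub>P\<^esub>)"
proof -
  interpret P: abelian_group P by fact
  show ?thesis
    by (rule tbalI)
      (simp_all add: tbal_closed[OF assms(1)] tbal_add_mid[OF assms(1)] tbal_add_last[OF assms(1)]
        tbal_mid[OF assms(1)] tbal_last[OF assms(1)])
qed

section \<open>Evaluation of vector fields on forms\<close>

text \<open>\<open>evd C N n w X\<close> evaluates \<open>w\<close> of degree $n$ on the first $n$ tensor factors of \<open>X\<close>, in the nested order
  of \<open>nested_ev\<close>.\<close>

primrec evd ::
  "('w, 'x) dga_scheme \<Rightarrow> ('w, 'n, 'z) module_scheme \<Rightarrow> nat \<Rightarrow> ('w \<Rightarrow> 'w, 'w) tensor \<Rightarrow> ('w, 'n) tensor \<Rightarrow> ('w, 'n) tensor"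
  where
    "evd C N 0 = (\<lambda>w X. tlift (TForm C N) (\<lambda>us a.
      if us = [] then a \<odot>\<^bsub>TForm C N\<^esub> X else \<zero>\<^bsub>TForm C N\<^esub>) w)"
  | "evd C N (Suc n) = (\<lambda>w X. tlift (TForm C N) (\<lambda>us a.
      if length us = Suc n then ctr (Form C 0) (Form C 1) N (hd us) (evd C N n (vpure C (tl us) a) X)
      else \<zero>\<^bsub>TForm C N\<^esub>) w)"

declare evd.simps [simp del]

context dga
begin

context
  fixes N :: "('w, 'n, 'z) module_scheme"
  assumes N [simp]: "lm N"
begin

interpretation N: left_module A N by (rule N)
interpretation TN: left_module A "TForm C N" by simp

lemma octr_ahom: "u \<in> carrier (Vec C) \<Longrightarrow> ahom (TForm C N) (TForm C N) (octr N u)"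
  by (rule O.ctr_ahom) auto

lemma evd_tbal_Suc:
  assumes L: "lhom A (TVec C) (TForm C N) (\<lambda>w. evd C N n w X)"
  shows "tbal A (Vec C) A (TForm C N) (\<lambda>us a.
      if length us = Suc n then octr N (hd us) (evd C N n (vpure C (tl us) a) X) else \<zero>\<^bsub>TForm C N\<^esub>)"
proof (rule V.tbal_cons_deg[where g = "\<lambda>u w. octr N u (evd C N n w X)"])
  fix u assume "u \<in> carrier (Vec C)"
  then show "ahom (TVec C) (TForm C N) (\<lambda>w. octr N u (evd C N n w X))"
    by (intro ahom_comp[OF lhom_ahom[OF L] octr_ahom])
next
  fix u v w assume *: "u \<in> carrier (Vec C)" "v \<in> carrier (Vec C)" "w \<in> vdeg n"
  have "evd C N n w X \<in> carrier (TForm C N)"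
    by (rule lhom_closed[OF L]) (use * V.tdeg_carrier[OF Form_lm] in auto)
  then show "octr N (u \<oplus>\<^bsub>Vec C\<^esub> v) (evd C N n w X) = octr N u (evd C N n w X) \<oplus>\<^bsub>TForm C N\<^esub> octr N v (evd C N n w X)"
    by (intro O.ctr_add_left) (use * in auto)
next
  fix u a w assume *: "u \<in> carrier (Vec C)" "a \<in> hpart C 0" "w \<in> vdeg n"
  have w: "w \<in> carrier (TVec C)" using * V.tdeg_carrier[OF Form_lm] by auto
  have "octr N (u \<odot>\<^sub>r\<^bsub>Vec C\<^esub> a) (evd C N n w X) = octr N u (a \<odot>\<^bsub>TForm C N\<^esub> evd C N n w X)"
    by (rule O.ctr_smult_right) (use * lhom_closed[OF L w] in auto)
  then show "octr N (u \<odot>\<^sub>r\<^bsub>Vec C\<^esub> a) (evd C N n w X) = octr N u (evd C N n (a \<odot>\<^bsub>TVec C\<^esub> w) X)"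
    using * w by (simp add: lhom_smult[OF L])
qed simp_all

lemma evd_tbal_0:
  "X \<in> carrier (TForm C N) \<Longrightarrow>
    tbal A (Vec C) A (TForm C N) (\<lambda>us a. if us = [] then a \<odot>\<^bsub>TForm C N\<^esub> X else \<zero>\<^bsub>TForm C N\<^esub>)"
  by (rule V.tbal_Nil) (use left_module_ahom_scalar[OF TN.left_module_axioms] in auto)

lemma evd_lhom:
  "X \<in> carrier (TForm C N) \<Longrightarrow> lhom A (TVec C) (TForm C N) (\<lambda>w. evd C N n w X)"
proof (induction n)
  case 0
  note t = evd_tbal_0[OF 0]
  have h: "ahom (TVec C) (TForm C N) (\<lambda>w. evd C N 0 w X)"
    using V.tlift_ahom[OF _ _ t] by (simp add: evd.simps)
  show ?case
  proof (rule lhomI[OF h])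
    fix b w assume *: "b \<in> carrier A" "w \<in> carrier (TVec C)"
    show "evd C N 0 (b \<odot>\<^bsub>TVec C\<^esub> w) X = b \<odot>\<^bsub>TForm C N\<^esub> evd C N 0 w X"
    proof (rule V.T_eqI[OF _ _ ahom_comp[OF V.smult_ahom h] ahom_comp[OF h O.smult_ahom] _ *(2)])
      fix us a assume "set us \<subseteq> carrier (Vec C)" "a \<in> carrier A"
      then show "evd C N 0 (b \<odot>\<^bsub>TVec C\<^esub> vpure C us a) X = b \<odot>\<^bsub>TForm C N\<^esub> evd C N 0 (vpure C us a) X"
        using * 0 TN.smult_assoc[of b a X] by (cases us)
          (simp_all add: evd.simps V.smult_pure_Nil V.smult_pure_Cons V.tlift_pure[OF _ _ t] left_module_smult_zero[OF TN.left_module_axioms])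
    qed (use * in auto)
  qed
next
  case (Suc n)
  note L = Suc.IH[OF Suc.prems]
  note t = evd_tbal_Suc[OF L]
  have h: "ahom (TVec C) (TForm C N) (\<lambda>w. evd C N (Suc n) w X)"
    using V.tlift_ahom[OF _ _ t] by (simp add: evd.simps)
  show ?case
  proof (rule lhomI[OF h])
    fix b w assume *: "b \<in> carrier A" "w \<in> carrier (TVec C)"
    show "evd C N (Suc n) (b \<odot>\<^bsub>TVec C\<^esub> w) X = b \<odot>\<^bsub>TForm C N\<^esub> evd C N (Suc n) w X"
    proof (rule V.T_eqI[OF _ _ ahom_comp[OF V.smult_ahom h] ahom_comp[OF h O.smult_ahom] _ *(2)])
      fix us a assume us: "set us \<subseteq> carrier (Vec C)" "a \<in> carrier A"
      show "evd C N (Suc n) (b \<odot>\<^bsub>TVec C\<^esub> vpure C us a) X = b \<odot>\<^bsub>TForm C N\<^esub> evd C N (Suc n) (vpure C us a) X"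
      proof (cases us)
        case Nil
        then show ?thesis using us * by (simp add: evd.simps V.smult_pure_Nil V.tlift_pure[OF _ _ t] left_module_smult_zero[OF TN.left_module_axioms])
      next
        case (Cons u vs)
        have X: "evd C N n (vpure C vs a) X \<in> carrier (TForm C N)"
          by (rule lhom_closed[OF L]) (use us Cons in \<open>auto intro!: V.pure_closed\<close>)
        have "octr N (b \<odot>\<^bsub>Vec C\<^esub> u) (evd C N n (vpure C vs a) X) = b \<odot>\<^bsub>TForm C N\<^esub> octr N u (evd C N n (vpure C vs a) X)"
          by (rule O.ctr_smult_left[where u = u]) (use us * Cons X in auto)
        then show ?thesis using us * Cons
          by (simp add: evd.simps V.smult_pure_Cons V.tlift_pure[OF _ _ t] left_module_smult_zero[OF TN.left_module_axioms])
      qed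
    qed (use * in auto)
  qed
qed

lemma evd_ahom: "X \<in> carrier (TForm C N) \<Longrightarrow> ahom (TVec C) (TForm C N) (\<lambda>w. evd C N n w X)"
  by (rule lhom_ahom[OF evd_lhom])

lemma evd_closed: "\<lbrakk>w \<in> carrier (TVec C); X \<in> carrier (TForm C N)\<rbrakk> \<Longrightarrow> evd C N n w X \<in> carrier (TForm C N)"
  by (rule ahom_closed[OF evd_ahom])

lemma evd_pure_Nil: "\<lbrakk>a \<in> hpart C 0; X \<in> carrier (TForm C N)\<rbrakk> \<Longrightarrow> evd C N 0 (vpure C [] a) X = a \<odot>\<^bsub>TForm C N\<^esub> X"
  using V.tlift_pure[OF _ _ evd_tbal_0, of X "[]" a] by (simp add: evd.simps)

lemma evd_pure_Cons:
  assumes "u \<in> carrier (Vec C)" "set us \<subseteq> carrier (Vec C)" "a \<in> hpart C 0" "X \<in> carrier (TForm C N)" "length us = n"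
  shows "evd C N (Suc n) (vpure C (u # us) a) X = octr N u (evd C N n (vpure C us a) X)"
  using V.tlift_pure[OF _ _ evd_tbal_Suc[OF evd_lhom[OF assms(4)]], of "u # us" a n] assms by (simp add: evd.simps)

lemma evd_vtp:
  assumes "u \<in> carrier (Vec C)" "w \<in> vdeg n" "X \<in> carrier (TForm C N)"
  shows "evd C N (Suc n) (vtp u w) X = octr N u (evd C N n w X)"
  by (rule V.tdeg_eqI[OF _ _ ahom_comp[OF V.tprepend_ahom evd_ahom] ahom_comp[OF evd_ahom octr_ahom] _ assms(2)])
    (use assms in \<open>auto simp: V.tp_pure evd_pure_Cons\<close>)

lemma evd_ahom_right:
  "w \<in> vdeg n \<Longrightarrow> ahom (TForm C N) (TForm C N) (evd C N n w)"
proof (induction n arbitrary: w)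
  case 0
  then obtain a where a: "a \<in> hpart C 0" "w = vpure C [] a" by (rule vdeg_0E)
  show ?case
    by (rule ahomI) (use a in \<open>simp_all add: evd_pure_Nil TN.smult_r_distr TN.smult_closed\<close>)
next
  case (Suc n)
  show ?case
  proof (rule ahomI)
    fix X Y assume XY: "X \<in> carrier (TForm C N)" "Y \<in> carrier (TForm C N)"
    show "evd C N (Suc n) w (X \<oplus>\<^bsub>TForm C N\<^esub> Y) = evd C N (Suc n) w X \<oplus>\<^bsub>TForm C N\<^esub> evd C N (Suc n) w Y"
      by (rule vdeg_eqI[OF _ evd_ahom ahom_sum[OF _ evd_ahom evd_ahom] _ Suc.prems])
        (use XY in \<open>simp_all add: evd_vtp ahom_add[OF Suc.IH] ahom_add[OF octr_ahom] evd_closed vdeg_carrier\<close>)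
  qed (use Suc.prems evd_closed vdeg_carrier in auto)
qed

lemma evd_deg:
  "\<lbrakk>w \<in> vdeg n; X \<in> fdeg C N (n + k)\<rbrakk> \<Longrightarrow> evd C N n w X \<in> fdeg C N k"
proof (induction n arbitrary: w k)
  case 0
  obtain a where a: "a \<in> hpart C 0" "w = vpure C [] a" by (rule vdeg_0E[OF 0(1)])
  then show ?case using 0 by (simp add: evd_pure_Nil O.tdeg_carrier[OF N] O.smult_tdeg)
next
  case (Suc n)
  note Xc = O.tdeg_carrier[OF N Suc.prems(2)]
  show ?case
  proof (rule V.tdeg_ahom[OF _ _ evd_ahom[OF Xc] O.tdeg_aspan[OF N, symmetric] _ Suc.prems(1)])
    fix us a assume us: "set us \<subseteq> carrier (Vec C)" "a \<in> carrier A" "length us = Suc n"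
    then obtain u zs where uz: "us = u # zs" "u \<in> carrier (Vec C)" "set zs \<subseteq> carrier (Vec C)" "length zs = n"
      by (cases us) auto
    have "evd C N n (vpure C zs a) X \<in> fdeg C N (Suc k)"
      by (rule Suc.IH) (use us uz Suc.prems in \<open>auto intro!: V.tdeg_pure\<close>)
    then show "evd C N (Suc n) (vpure C us a) X \<in> fdeg C N k"
      using us uz Xc by (simp add: evd_pure_Cons octr_deg)
  qed simp_all
qed

end

text \<open>The scalar obtained by evaluating \<open>w\<close> on the word \<open>zs\<close>. Going
  through \<open>evd\<close> makes it a function on classes that is additive in \<open>w\<close>; on
  pure tensors it is \<open>nested_ev\<close> (\<open>nev_nested_ev\<close>).\<close>

definition nev :: "nat \<Rightarrow> ('w \<Rightarrow> 'w, 'w) tensor \<Rightarrow> 'w list \<Rightarrow> 'w"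
  where "nev n w zs = tdown A (evd C A n w (apure zs \<one>))"

lemma nev_ahom: "set zs \<subseteq> hpart C 1 \<Longrightarrow> ahom (TVec C) A (\<lambda>w. nev n w zs)"
  unfolding nev_def by (rule ahom_comp[OF evd_ahom O.tdown_ahom]) (auto intro: O.pure_closed)

lemma nev_closed: "\<lbrakk>set zs \<subseteq> hpart C 1; w \<in> carrier (TVec C)\<rbrakk> \<Longrightarrow> nev n w zs \<in> hpart C 0"
  using ahom_closed[OF nev_ahom, of zs w n] by simp

lemma pure_Nil_closed: "\<lbrakk>lm N; y \<in> carrier N\<rbrakk> \<Longrightarrow> fpure C N [] y \<in> carrier (TForm C N)"
  by (rule O.pure_closed) auto

lemma tdown_pure_Nil: "\<lbrakk>lm N; y \<in> carrier N\<rbrakk> \<Longrightarrow> tdown N (fpure C N [] y) = y"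
  by (subst O.tdown_pure) auto

lemma nev_Nil: "a \<in> hpart C 0 \<Longrightarrow> nev 0 (vpure C [] a) [] = a"
  by (simp add: nev_def evd_pure_Nil pure_Nil_closed O.smult_pure_Nil tdown_pure_Nil hp_sub)

lemma evd_tprepend_0:
  assumes "lm N" "w \<in> vdeg 0" "X \<in> carrier (TForm C N)"
  shows "evd C N 0 w X = nev 0 w [] \<odot>\<^bsub>TForm C N\<^esub> X"
proof -
  obtain a where a: "a \<in> hpart C 0" "w = vpure C [] a" by (rule vdeg_0E[OF assms(2)])
  then show ?thesis using assms by (simp add: evd_pure_Nil nev_Nil)
qed

text \<open>The evaluation rule in degree n is a hypothesis here because the rule in degree n + 1 is
  derived from this formula; \<open>evd_tprepend\<close> resolves the mutual dependence.\<close>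

lemma nev_snoc_aux:
  assumes IH: "\<And>w zs X. \<lbrakk>w \<in> vdeg n; set zs \<subseteq> hpart C 1; length zs = n; X \<in> carrier TA\<rbrakk> \<Longrightarrow>
      evd C A n w (otp A zs X) = nev n w zs \<odot>\<^bsub>TA\<^esub> X"
    and u: "u \<in> carrier (Vec C)" and w: "w \<in> vdeg n" and zs: "set zs \<subseteq> hpart C 1" "length zs = n" and \<xi>: "\<xi> \<in> hpart C 1"
  shows "nev (Suc n) (vtp u w) (zs @ [\<xi>]) = u (nev n w zs \<otimes> \<xi>)"
proof -
  have c: "nev n w zs \<in> hpart C 0" by (rule nev_closed[OF zs(1) vdeg_carrier[OF w]])
  have p: "apure (zs @ [\<xi>]) \<one> = otp A zs (apure [\<xi>] \<one>)"
    using zs \<xi> by (simp add: O.tprepend_pure)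
  have x: "apure [\<xi>] \<one> \<in> carrier TA" by (rule O.pure_closed) (use \<xi> in auto)
  have "evd C A (Suc n) (vtp u w) (apure (zs @ [\<xi>]) \<one>) =
    octr A u (nev n w zs \<odot>\<^bsub>TA\<^esub> apure [\<xi>] \<one>)"
    unfolding p using u w zs \<xi> x by (simp add: evd_vtp O.tprepend_closed IH)
  also have "\<dots> = apure [] (u (nev n w zs \<otimes> \<xi>))"
    using c u \<xi> by (simp add: O.smult_pure_Cons O.ctr_pure_Cons O.smult_pure_Nil hp_sub[OF Vec_app])
  finally show ?thesis
    using c u \<xi> by (simp add: nev_def tdown_pure_Nil)
qed

text \<open>The scalars \<open>nev\<close> are built from evaluation with last factor
  \<open>A\<close>. So the induction is first run for \<open>A\<close>, where it alternates with
  \<open>nev_snoc_aux\<close>, and only then for the given module; the inductive step is shared and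
  therefore generic in the type of the module.\<close>

lemma evd_tprepend:
  assumes "lm N"
  shows "\<lbrakk>w \<in> vdeg n; set zs \<subseteq> hpart C 1; length zs = n; X \<in> carrier (TForm C N)\<rbrakk> \<Longrightarrow>
    evd C N n w (otp N zs X) = nev n w zs \<odot>\<^bsub>TForm C N\<^esub> X"
proof -
  have step: "evd C N (Suc n) w (otp N zs X) = nev (Suc n) w zs \<odot>\<^bsub>TForm C N\<^esub> X"
    if N: "lm N"
      and nev_snoc: "\<And>u w zs \<xi>. \<lbrakk>u \<in> carrier (Vec C); w \<in> vdeg n; set zs \<subseteq> hpart C 1; length zs = n; \<xi> \<in> hpart C 1\<rbrakk> \<Longrightarrow>
        nev (Suc n) (vtp u w) (zs @ [\<xi>]) = u (nev n w zs \<otimes> \<xi>)"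
      and IH: "\<And>w zs X. \<lbrakk>w \<in> vdeg n; set zs \<subseteq> hpart C 1; length zs = n; X \<in> carrier (TForm C N)\<rbrakk> \<Longrightarrow>
        evd C N n w (otp N zs X) = nev n w zs \<odot>\<^bsub>TForm C N\<^esub> X"
      and *: "w \<in> vdeg (Suc n)" "set zs \<subseteq> hpart C 1" "length zs = Suc n" "X \<in> carrier (TForm C N)"
    for N :: "('w, 'k, 'l) module_scheme" and n w zs X
  proof -
    obtain ys \<xi> where ys: "zs = ys @ [\<xi>]" "set ys \<subseteq> hpart C 1" "\<xi> \<in> hpart C 1" "length ys = n"
      using *(2,3) by (cases zs rule: rev_cases) auto
    have p: "otp N zs X =
      otp N ys (otp N [\<xi>] X)"
      unfolding ys(1) by (rule O.tprepend_append) (use N ys * in auto)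
    show ?thesis
    proof (rule vdeg_eqI[OF _ evd_ahom[OF N] ahom_comp[OF nev_ahom left_module_ahom_scalar] _ *(1)])
      fix u w assume uw: "u \<in> carrier (Vec C)" "w \<in> vdeg n"
      have c: "nev n w ys \<in> hpart C 0" by (rule nev_closed[OF ys(2) vdeg_carrier[OF uw(2)]])
      show "evd C N (Suc n) (vtp u w) (otp N zs X) = nev (Suc n) (vtp u w) zs \<odot>\<^bsub>TForm C N\<^esub> X"
        unfolding p using uw ys * N c
        by (simp add: evd_vtp O.tprepend_closed IH nev_snoc O.smult_tp O.ctr_tp)
    qed (use * N in \<open>auto intro!: O.tprepend_closed\<close>)
  qed
  have A: "\<lbrakk>w \<in> vdeg n; set zs \<subseteq> hpart C 1; length zs = n; X \<in> carrier TA\<rbrakk> \<Longrightarrow>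
    evd C A n w (otp A zs X) = nev n w zs \<odot>\<^bsub>TA\<^esub> X" for n w zs X
  proof (induction n arbitrary: w zs X)
    case 0
    then show ?case by (simp add: O.tprepend_Nil evd_tprepend_0)
  next
    case (Suc n)
    show ?case by (rule step[OF _ nev_snoc_aux Suc.IH]) (use Suc in auto)
  qed
  show "\<lbrakk>w \<in> vdeg n; set zs \<subseteq> hpart C 1; length zs = n; X \<in> carrier (TForm C N)\<rbrakk> \<Longrightarrow>
    evd C N n w (otp N zs X) = nev n w zs \<odot>\<^bsub>TForm C N\<^esub> X"
  proof (induction n arbitrary: w zs X)
    case 0
    then show ?case using assms by (simp add: O.tprepend_Nil evd_tprepend_0)
  next
    case (Suc n)
    show ?case by (rule step[OF _ nev_snoc_aux[OF A] Suc.IH]) (use Suc assms in auto)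
  qed
qed

lemma nev_snoc:
  "\<lbrakk>u \<in> carrier (Vec C); w \<in> vdeg n; set zs \<subseteq> hpart C 1; length zs = n; \<xi> \<in> hpart C 1\<rbrakk> \<Longrightarrow>
    nev (Suc n) (vtp u w) (zs @ [\<xi>]) = u (nev n w zs \<otimes> \<xi>)"
  by (rule nev_snoc_aux[OF evd_tprepend]) auto

lemma evd_pure:
  assumes "lm N" "w \<in> vdeg n" "set zs \<subseteq> hpart C 1" "length zs = n" "y \<in> carrier N"
  shows "evd C N n w (fpure C N zs y) = fpure C N [] (nev n w zs \<odot>\<^bsub>N\<^esub> y)"
  using evd_tprepend[OF assms(1-4) pure_Nil_closed[OF assms(1,5)]] assms nev_closed[OF assms(3) vdeg_carrier[OF assms(2)]]
  by (simp add: O.tprepend_pure O.smult_pure_Nil)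

lemma nev_nested_ev:
  "\<lbrakk>set us \<subseteq> carrier (Vec C); a \<in> hpart C 0; set zs \<subseteq> hpart C 1; length us = n; length zs = n\<rbrakk> \<Longrightarrow>
    nev n (vpure C us a) zs = nested_ev C us a (rev zs)"
proof (induction n arbitrary: us zs)
  case 0
  then show ?case by (simp add: nev_Nil)
next
  case (Suc n)
  obtain ys \<xi> where ys: "zs = ys @ [\<xi>]" "set ys \<subseteq> hpart C 1" "\<xi> \<in> hpart C 1" "length ys = n"
    using Suc.prems(3,5) by (cases zs rule: rev_cases) auto
  obtain u vs where uv: "us = u # vs" "u \<in> carrier (Vec C)" "set vs \<subseteq> carrier (Vec C)" "length vs = n"
    using Suc.prems by (cases us) auto
  have "nev (Suc n) (vtp u (vpure C vs a)) zs = u (nev n (vpure C vs a) ys \<otimes> \<xi>)"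
    unfolding ys(1) by (rule nev_snoc) (use ys uv Suc.prems in \<open>auto intro!: V.tdeg_pure\<close>)
  then show ?case using uv ys Suc by (simp add: V.tp_pure)
qed

text \<open>Evaluation consumes the first n factors and substitution changes the last one. A degree
  of at least n keeps \<open>evd\<close> from reaching the letters that the substitution
  creates.\<close>

lemma evd_tbind:
  assumes N: "lm N" and N': "lm N'" and \<phi>: "lhom A N' (TForm C N) \<phi>"
  shows "\<lbrakk>w \<in> vdeg n; X \<in> fdeg C N' (n + k)\<rbrakk> \<Longrightarrow>
    evd C N n w (otbind N \<phi> X) = otbind N \<phi> (evd C N' n w X)"
proof (induction n arbitrary: w k)
  case 0
  obtain a where a: "a \<in> hpart C 0" "w = vpure C [] a" by (rule vdeg_0E[OF 0(1)])
  have X: "X \<in> carrier (TForm C N')" by (rule O.tdeg_carrier[OF N' 0(2)])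
  show ?case using a X N N'
    by (simp add: evd_pure_Nil O.tbind_closed[OF N N' \<phi>] lhom_smult[OF O.tbind_lhom[OF N N' \<phi>]])
next
  case (Suc n)
  note Xc = O.tdeg_carrier[OF N' Suc.prems(2)]
  note tc = O.tbind_closed[OF N N' \<phi>]
  show ?case
  proof (rule vdeg_eqI[OF _ evd_ahom[OF N tc[OF Xc]] ahom_comp[OF evd_ahom[OF N' Xc] O.tbind_ahom[OF N N' \<phi>]] _ Suc.prems(1)])
    fix u w assume uw: "u \<in> carrier (Vec C)" "w \<in> vdeg n"
    have X': "X \<in> fdeg C N' (n + Suc k)" using Suc.prems by simp
    show "evd C N (Suc n) (vtp u w) (otbind N \<phi> X) =
      otbind N \<phi> (evd C N' (Suc n) (vtp u w) X)"
      using uw N N' Xc tc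
      by (simp add: evd_vtp Suc.IH[OF uw(2) X'] O.ctr_tbind[OF N N' \<phi> _ evd_deg[OF N' uw(2) X']])
  qed (use N in simp)
qed

end

section \<open>Separation of tensors of forms by evaluation on vector fields\<close>

context bimodule_connection
begin

lemma ctr_basis_separates:
  assumes "lm N" "X \<in> fdeg C N (Suc n)" "\<And>u. u \<in> carrier (Vec C) \<Longrightarrow> octr N u X = \<zero>\<^bsub>TForm C N\<^esub>"
  shows "X = \<zero>\<^bsub>TForm C N\<^esub>"
  by (rule O.ctr_separates[where b = "bform C" and u = "bvec C" and k = "bn C"])
    (use assms dual_Form in auto)

text \<open>Evaluation on u \<otimes> w is contraction with u of the evaluation on w, and in
  positive degree contractions with all u separate, by the dual basis. The induction strips one
  vector field at a time and passes its degree to k.\<close>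

lemma evd_separates:
  assumes N: "lm N"
  shows "\<lbrakk>X \<in> fdeg C N (n + k); Y \<in> fdeg C N (n + k); \<And>w. w \<in> vdeg n \<Longrightarrow> evd C N n w X = evd C N n w Y\<rbrakk> \<Longrightarrow> X = Y"
proof (induction n arbitrary: k)
  case 0
  have "vpure C [] \<one> \<in> vdeg 0" by (rule V.tdeg_pure) auto
  from 0(3)[OF this] show ?case
    using N 0(1,2)[THEN O.tdeg_carrier[OF N]] left_module.smult_one[OF O.T_left_module[OF N]]
    by (simp add: evd_pure_Nil)
next
  case (Suc n)
  interpret TN: left_module A "TForm C N" using N by simp
  note c = Suc.prems(1,2)[THEN O.tdeg_carrier[OF N]]
  have k: "X \<in> fdeg C N (n + Suc k)" "Y \<in> fdeg C N (n + Suc k)" using Suc.prems by auto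
  show ?case
  proof (rule Suc.IH[OF k])
    fix w assume w: "w \<in> vdeg n"
    note e = evd_closed[OF N vdeg_carrier[OF w]]
    have "evd C N n w X \<ominus>\<^bsub>TForm C N\<^esub> evd C N n w Y = \<zero>\<^bsub>TForm C N\<^esub>"
    proof (rule ctr_basis_separates[OF N O.tdeg_minus[OF N evd_deg[OF N w k(1)] evd_deg[OF N w k(2)]]])
      fix u assume u: "u \<in> carrier (Vec C)"
      have "octr N u (evd C N n w X) = octr N u (evd C N n w Y)"
        using Suc.prems(3)[OF vtp_deg[OF u w]] u w N c by (simp add: evd_vtp)
      then show "octr N u (evd C N n w X \<ominus>\<^bsub>TForm C N\<^esub> evd C N n w Y) = \<zero>\<^bsub>TForm C N\<^esub>"
        using u N c e octr_closed[OF N u e[OF c(2)]] by (simp add: ahom_minus[OF octr_ahom] TN.M.minus_self_iff)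
    qed
    then show "evd C N n w X = evd C N n w Y" using e c by (simp add: TN.M.minus_self_iff)
  qed
qed

text \<open>This replaces a direct verification that \<open>boxF\<close> and \<open>nabla_step\<close> are well defined, for which one
  would first have to establish the right Leibniz rule of $\square^{\langle n\rangle}$.\<close>

lemma tbal_by_evaluation:
  assumes N: "lm N"
    and deg: "\<And>xs y. \<lbrakk>set xs \<subseteq> hpart C 1; y \<in> carrier N\<rbrakk> \<Longrightarrow> f xs y \<in> fdeg C N (length xs + 1)"
    and \<Psi>: "\<And>n w. w \<in> vdeg n \<Longrightarrow> ahom (TForm C N) (TForm C N) (\<Psi> n w)"
    and ev: "\<And>n w xs y. \<lbrakk>w \<in> vdeg n; set xs \<subseteq> hpart C 1; y \<in> carrier N; length xs = n\<rbrakk> \<Longrightarrow>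
      evd C N n w (f xs y) = \<Psi> n w (fpure C N xs y)"
  shows "tbal A \<Omega> N (TForm C N) f"
proof -
  interpret N: left_module A N by (rule N)
  note B = O.tbal_pure[OF N]
  note dc = O.tdeg_carrier[OF N deg]
  note pc = O.pure_closed[OF N]
  show ?thesis
  proof (rule tbalI)
    fix xs y assume "set xs \<subseteq> carrier \<Omega>" "y \<in> carrier N"
    then show "f xs y \<in> carrier (TForm C N)" using dc by simp
  next
    fix xs x x' zs y
    assume *: "set xs \<subseteq> carrier \<Omega>" "x \<in> carrier \<Omega>" "x' \<in> carrier \<Omega>" "set zs \<subseteq> carrier \<Omega>" "y \<in> carrier N"
    let ?n = "Suc (length xs + length zs)"
    show "f (xs @ (x \<oplus>\<^bsub>\<Omega>\<^esub> x') # zs) y = f (xs @ x # zs) y \<oplus>\<^bsub>TForm C N\<^esub> f (xs @ x' # zs) y"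
    proof (rule evd_separates[OF N, where n = ?n and k = 1])
      show "f (xs @ (x \<oplus>\<^bsub>\<Omega>\<^esub> x') # zs) y \<in> fdeg C N (?n + 1)"
        using deg[of "xs @ (x \<oplus>\<^bsub>\<Omega>\<^esub> x') # zs" y] * by simp
      show "f (xs @ x # zs) y \<oplus>\<^bsub>TForm C N\<^esub> f (xs @ x' # zs) y \<in> fdeg C N (?n + 1)"
        using deg[of "xs @ x # zs" y] deg[of "xs @ x' # zs" y] * by (simp add: O.tdeg_add[OF N])
      fix w assume w: "w \<in> vdeg ?n"
      show "evd C N ?n w (f (xs @ (x \<oplus>\<^bsub>\<Omega>\<^esub> x') # zs) y) = evd C N ?n w (f (xs @ x # zs) y \<oplus>\<^bsub>TForm C N\<^esub> f (xs @ x' # zs) y)"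
        using * w tbal_add_mid[OF B, of xs x x' zs y]
        by (simp add: ev ahom_add[OF evd_ahom_right[OF N w]] dc ahom_add[OF \<Psi>[OF w]] pc)
    qed
  next
    fix xs y y'
    assume *: "set xs \<subseteq> carrier \<Omega>" "y \<in> carrier N" "y' \<in> carrier N"
    let ?n = "length xs"
    show "f xs (y \<oplus>\<^bsub>N\<^esub> y') = f xs y \<oplus>\<^bsub>TForm C N\<^esub> f xs y'"
    proof (rule evd_separates[OF N, where n = ?n and k = 1])
      show "f xs (y \<oplus>\<^bsub>N\<^esub> y') \<in> fdeg C N (?n + 1)"
        using * by (intro deg) auto
      show "f xs y \<oplus>\<^bsub>TForm C N\<^esub> f xs y' \<in> fdeg C N (?n + 1)"
        using * by (intro O.tdeg_add[OF N] deg) auto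
      fix w assume w: "w \<in> vdeg ?n"
      show "evd C N ?n w (f xs (y \<oplus>\<^bsub>N\<^esub> y')) = evd C N ?n w (f xs y \<oplus>\<^bsub>TForm C N\<^esub> f xs y')"
        using * w tbal_add_last[OF B, of xs y y']
        by (simp add: ev ahom_add[OF evd_ahom_right[OF N w]] dc ahom_add[OF \<Psi>[OF w]] pc)
    qed
  next
    fix xs x a x' zs y
    assume *: "set xs \<subseteq> carrier \<Omega>" "x \<in> carrier \<Omega>" "a \<in> carrier A" "x' \<in> carrier \<Omega>" "set zs \<subseteq> carrier \<Omega>"
      "y \<in> carrier N"
    let ?n = "Suc (Suc (length xs + length zs))"
    show "f (xs @ (x \<odot>\<^sub>r\<^bsub>\<Omega>\<^esub> a) # x' # zs) y = f (xs @ x # (a \<odot>\<^bsub>\<Omega>\<^esub> x') # zs) y"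
    proof (rule evd_separates[OF N, where n = ?n and k = 1])
      show "f (xs @ (x \<odot>\<^sub>r\<^bsub>\<Omega>\<^esub> a) # x' # zs) y \<in> fdeg C N (?n + 1)"
        using deg[of "xs @ (x \<odot>\<^sub>r\<^bsub>\<Omega>\<^esub> a) # x' # zs" y] * by simp
      show "f (xs @ x # (a \<odot>\<^bsub>\<Omega>\<^esub> x') # zs) y \<in> fdeg C N (?n + 1)"
        using deg[of "xs @ x # (a \<odot>\<^bsub>\<Omega>\<^esub> x') # zs" y] * by simp
      fix w assume w: "w \<in> vdeg ?n"
      show "evd C N ?n w (f (xs @ (x \<odot>\<^sub>r\<^bsub>\<Omega>\<^esub> a) # x' # zs) y) = evd C N ?n w (f (xs @ x # (a \<odot>\<^bsub>\<Omega>\<^esub> x') # zs) y)"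
        using * w tbal_mid[OF B, of xs x a x' zs y] by (simp add: ev)
    qed
  next
    fix xs x a y
    assume *: "set xs \<subseteq> carrier \<Omega>" "x \<in> carrier \<Omega>" "a \<in> carrier A" "y \<in> carrier N"
    let ?n = "Suc (length xs)"
    have ay: "a \<odot>\<^bsub>N\<^esub> y \<in> carrier N" using * N.smult_closed by simp
    show "f (xs @ [x \<odot>\<^sub>r\<^bsub>\<Omega>\<^esub> a]) y = f (xs @ [x]) (a \<odot>\<^bsub>N\<^esub> y)"
    proof (rule evd_separates[OF N, where n = ?n and k = 1])
      show "f (xs @ [x \<odot>\<^sub>r\<^bsub>\<Omega>\<^esub> a]) y \<in> fdeg C N (?n + 1)"
        using deg[of "xs @ [x \<odot>\<^sub>r\<^bsub>\<Omega>\<^esub> a]" y] * by simp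
      show "f (xs @ [x]) (a \<odot>\<^bsub>N\<^esub> y) \<in> fdeg C N (?n + 1)"
        using deg[of "xs @ [x]" "a \<odot>\<^bsub>N\<^esub> y"] * ay by simp
      fix w assume w: "w \<in> vdeg ?n"
      show "evd C N ?n w (f (xs @ [x \<odot>\<^sub>r\<^bsub>\<Omega>\<^esub> a]) y) = evd C N ?n w (f (xs @ [x]) (a \<odot>\<^bsub>N\<^esub> y))"
        using * w ay tbal_last[OF B, of xs x a y] by (simp add: ev)
    qed
  qed
qed

end

section \<open>The map \<open>sinv\<close> on the last two tensor factors\<close>

context bimodule_connection
begin

lemma sinv_zero: "sinv C \<zero>\<^bsub>TA\<^esub> = \<zero>\<^bsub>TA\<^esub>"
proof -
  have z: "\<zero>\<^bsub>TA\<^esub> \<in> fdeg C A 2" by (rule O.tdeg_zero) simp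
  have "sinv C \<zero>\<^bsub>TA\<^esub> \<oplus>\<^bsub>TA\<^esub> sinv C \<zero>\<^bsub>TA\<^esub> = sinv C \<zero>\<^bsub>TA\<^esub>"
    using sinv_add[OF z z] by simp
  then show ?thesis using TA.M.double_zero sinv_carrier[OF z] by blast
qed

lemma sinv_neg:
  assumes X: "X \<in> fdeg C A 2"
  shows "sinv C (\<ominus>\<^bsub>TA\<^esub> X) = \<ominus>\<^bsub>TA\<^esub> sinv C X"
proof -
  have n: "\<ominus>\<^bsub>TA\<^esub> X \<in> fdeg C A 2" by (rule O.tdeg_neg[OF Form_lm X])
  have "sinv C (\<ominus>\<^bsub>TA\<^esub> X) \<oplus>\<^bsub>TA\<^esub> sinv C X = \<zero>\<^bsub>TA\<^esub>"
    using sinv_add[OF n X] O.tdeg_carrier[OF Form_lm X] by (simp add: TA.M.l_neg sinv_zero)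
  then show ?thesis using sinv_carrier[OF n] sinv_carrier[OF X] by (simp add: TA.M.minus_equality)
qed

text \<open>\<open>sinv\<close> is specified in degree 2 only, hence the cut-off. The balancing laws
  are inherited from the pure tensors, because \<open>sinv\<close> is applied to a class and not to
  a word.\<close>

lemma tbal_sinv:
  "tbal A \<Omega> A TA (\<lambda>xs a. if length xs = 2 then sinv C (apure xs a) else \<zero>\<^bsub>TA\<^esub>)"
proof -
  have d: "apure xs a \<in> fdeg C A 2"
    if "set xs \<subseteq> hpart C 1" "a \<in> hpart C 0" "length xs = 2" for xs a
    by (rule O.tdeg_pure) (use that in auto)
  note B = O.tbal_pure[OF Form_lm]
  show ?thesis
  proof (rule tbalI)
    fix xs x x' zs y
    assume *: "set xs \<subseteq> carrier \<Omega>" "x \<in> carrier \<Omega>" "x' \<in> carrier \<Omega>" "set zs \<subseteq> carrier \<Omega>" "y \<in> carrier A"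
    show "(if length (xs @ (x \<oplus>\<^bsub>\<Omega>\<^esub> x') # zs) = 2 then sinv C (apure (xs @ (x \<oplus>\<^bsub>\<Omega>\<^esub> x') # zs) y) else \<zero>\<^bsub>TA\<^esub>) =
      (if length (xs @ x # zs) = 2 then sinv C (apure (xs @ x # zs) y) else \<zero>\<^bsub>TA\<^esub>) \<oplus>\<^bsub>TA\<^esub>
      (if length (xs @ x' # zs) = 2 then sinv C (apure (xs @ x' # zs) y) else \<zero>\<^bsub>TA\<^esub>)"
    proof (cases "length (xs @ x # zs) = 2")
      case True
      have "sinv C (apure (xs @ (x \<oplus>\<^bsub>\<Omega>\<^esub> x') # zs) y) =
        sinv C (apure (xs @ x # zs) y) \<oplus>\<^bsub>TA\<^esub> sinv C (apure (xs @ x' # zs) y)"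
        unfolding tbal_add_mid[OF B, OF *] by (rule sinv_add) (use * True in \<open>auto intro!: d\<close>)
      then show ?thesis using True by simp
    qed simp
  next
    fix xs y y'
    assume *: "set xs \<subseteq> carrier \<Omega>" "y \<in> carrier A" "y' \<in> carrier A"
    show "(if length xs = 2 then sinv C (apure xs (y \<oplus>\<^bsub>A\<^esub> y')) else \<zero>\<^bsub>TA\<^esub>) =
      (if length xs = 2 then sinv C (apure xs y) else \<zero>\<^bsub>TA\<^esub>) \<oplus>\<^bsub>TA\<^esub>
      (if length xs = 2 then sinv C (apure xs y') else \<zero>\<^bsub>TA\<^esub>)"
      unfolding tbal_add_last[OF B, OF *] using * d by (simp add: sinv_add)
  next
    fix xs x a x' zs y
    assume *: "set xs \<subseteq> carrier \<Omega>" "x \<in> carrier \<Omega>" "a \<in> carrier A" "x' \<in> carrier \<Omega>" "set zs \<subseteq> carrier \<Omega>"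
      "y \<in> carrier A"
    show "(if length (xs @ (x \<odot>\<^sub>r\<^bsub>\<Omega>\<^esub> a) # x' # zs) = 2 then sinv C (apure (xs @ (x \<odot>\<^sub>r\<^bsub>\<Omega>\<^esub> a) # x' # zs) y) else \<zero>\<^bsub>TA\<^esub>) =
      (if length (xs @ x # (a \<odot>\<^bsub>\<Omega>\<^esub> x') # zs) = 2 then sinv C (apure (xs @ x # (a \<odot>\<^bsub>\<Omega>\<^esub> x') # zs) y) else \<zero>\<^bsub>TA\<^esub>)"
      unfolding tbal_mid[OF B, OF *] by simp
  next
    fix xs x a y
    assume *: "set xs \<subseteq> carrier \<Omega>" "x \<in> carrier \<Omega>" "a \<in> carrier A" "y \<in> carrier A"
    show "(if length (xs @ [x \<odot>\<^sub>r\<^bsub>\<Omega>\<^esub> a]) = 2 then sinv C (apure (xs @ [x \<odot>\<^sub>r\<^bsub>\<Omega>\<^esub> a]) y) else \<zero>\<^bsub>TA\<^esub>) =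
      (if length (xs @ [x]) = 2 then sinv C (apure (xs @ [x]) (a \<odot>\<^bsub>A\<^esub> y)) else \<zero>\<^bsub>TA\<^esub>)"
      unfolding tbal_last[OF B, OF *] by simp
  qed (use d in \<open>auto intro!: sinv_carrier\<close>)
qed

text \<open>The two claims share one induction: balancing the first letter of a longer word moves a
  scalar into the tail, where left linearity of the map for shorter words is required.\<close>

lemma sinv_last_facts:
  "tbal A \<Omega> A TA (\<lambda>xs a. if length xs = n + 2
    then otp A (take n xs) (sinv C (apure (drop n xs) a)) else \<zero>\<^bsub>TA\<^esub>) \<and>
   lhom A TA TA (sinv_last C n)"
proof (induction n)
  case 0
  have d: "apure xs a \<in> fdeg C A 2"
    if "set xs \<subseteq> hpart C 1" "a \<in> hpart C 0" "length xs = 2" for xs a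
    by (rule O.tdeg_pure) (use that in auto)
  have t: "tbal A \<Omega> A TA (\<lambda>xs a. if length xs = 0 + 2
    then otp A (take 0 xs) (sinv C (apure (drop 0 xs) a)) else \<zero>\<^bsub>TA\<^esub>)"
    by (rule tbal_cong[OF tbal_sinv]) (auto simp: O.tprepend_Nil d sinv_carrier)
  have h: "ahom TA TA (sinv_last C 0)"
    unfolding sinv_last_def by (rule O.tlift_ahom[OF _ _ t]) simp_all
  have "lhom A TA TA (sinv_last C 0)"
  proof (rule lhomI[OF h])
    fix b X assume *: "b \<in> carrier A" "X \<in> carrier TA"
    show "sinv_last C 0 (b \<odot>\<^bsub>TA\<^esub> X) = b \<odot>\<^bsub>TA\<^esub> sinv_last C 0 X"
    proof (rule O.T_eqI[OF _ _ ahom_comp[OF O.smult_ahom h] ahom_comp[OF h O.smult_ahom] _ *(2)])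
      fix xs a assume xs: "set xs \<subseteq> hpart C 1" "a \<in> carrier A"
      have p: "sinv_last C 0 (apure ys c) = (if length ys = 2 then sinv C (apure ys c) else \<zero>\<^bsub>TA\<^esub>)"
        if "set ys \<subseteq> hpart C 1" "c \<in> hpart C 0" for ys c
        unfolding sinv_last_def using that
        by (subst O.tlift_pure[OF _ _ t]) (auto simp: O.tprepend_Nil d sinv_carrier)
      show "sinv_last C 0 (b \<odot>\<^bsub>TA\<^esub> apure xs a) = b \<odot>\<^bsub>TA\<^esub> sinv_last C 0 (apure xs a)"
      proof (cases "length xs = 2")
        case True
        have "sinv_last C 0 (b \<odot>\<^bsub>TA\<^esub> apure xs a) = sinv C (b \<odot>\<^bsub>TA\<^esub> apure xs a)"
          using xs * True O.word_smult_facts[OF Form_lm, of b xs a]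
          by (simp add: O.smult_pure p)
        then show ?thesis using True xs * by (simp add: p sinv_smult d)
      next
        case False
        then show ?thesis
          using xs * O.word_smult_facts[OF Form_lm, of b xs a]
          by (simp add: O.smult_pure[of A b xs a] p left_module_smult_zero[OF TA.left_module_axioms])
      qed
    qed (use * in auto)
  qed
  with t show ?case ..
next
  case (Suc n)
  then have tn: "tbal A \<Omega> A TA (\<lambda>xs a. if length xs = n + 2
      then otp A (take n xs) (sinv C (apure (drop n xs) a)) else \<zero>\<^bsub>TA\<^esub>)"
    and L: "lhom A TA TA (sinv_last C n)" by auto
  have d: "sinv C (apure (drop n xs) a) \<in> carrier TA"
    if "set xs \<subseteq> hpart C 1" "a \<in> hpart C 0" "length xs = n + 2" for xs a
    by (rule sinv_carrier, rule O.tdeg_pure) (use that set_drop_subset[of n xs] in auto)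
  have pn: "sinv_last C n (apure ys c) = otp A (take n ys) (sinv C (apure (drop n ys) c))"
    if "set ys \<subseteq> hpart C 1" "c \<in> hpart C 0" "length ys = n + 2" for ys c
    unfolding sinv_last_def using that by (subst O.tlift_pure[OF _ _ tn]) auto
  have t: "tbal A \<Omega> A TA (\<lambda>xs a. if length xs = Suc (n + 2)
    then otp A (take (Suc n) xs) (sinv C (apure (drop (Suc n) xs) a)) else \<zero>\<^bsub>TA\<^esub>)"
  proof (rule O.tbal_cons_deg[where g = "\<lambda>x X. otp A [x] (sinv_last C n X)"])
    fix x xs y assume *: "x \<in> hpart C 1" "set xs \<subseteq> hpart C 1" "y \<in> carrier A" "length xs = n + 2"
    then have "set (take n xs) \<subseteq> hpart C 1" using set_take_subset[of n xs] by auto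
    with * show "otp A (take (Suc n) (x # xs)) (sinv C (apure (drop (Suc n) (x # xs)) y)) =
      otp A [x] (sinv_last C n (apure xs y))"
      using d[of xs y] by (simp add: pn O.tprepend_Cons[where zs = "take n xs"])
  qed (auto intro!: ahom_comp[OF lhom_ahom[OF L] O.tprepend_ahom] O.tdeg_carrier[OF Form_lm]
      simp: O.tp_add O.tp_bal lhom_closed[OF L] lhom_smult[OF L] O.tdeg_carrier[OF Form_lm])
  have t': "tbal A \<Omega> A TA (\<lambda>xs a. if length xs = Suc n + 2
    then otp A (take (Suc n) xs) (sinv C (apure (drop (Suc n) xs) a)) else \<zero>\<^bsub>TA\<^esub>)"
    using t by simp
  have h: "ahom TA TA (sinv_last C (Suc n))"
    unfolding sinv_last_def by (rule O.tlift_ahom[OF _ _ t']) simp_all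
  have p: "sinv_last C (Suc n) (apure ys c) =
    (if length ys = Suc n + 2 then otp A (take (Suc n) ys) (sinv C (apure (drop (Suc n) ys) c)) else \<zero>\<^bsub>TA\<^esub>)"
    if "set ys \<subseteq> hpart C 1" "c \<in> hpart C 0" for ys c
    unfolding sinv_last_def using that by (subst O.tlift_pure[OF _ _ t']) auto
  have "lhom A TA TA (sinv_last C (Suc n))"
  proof (rule lhomI[OF h])
    fix b X assume *: "b \<in> carrier A" "X \<in> carrier TA"
    show "sinv_last C (Suc n) (b \<odot>\<^bsub>TA\<^esub> X) = b \<odot>\<^bsub>TA\<^esub> sinv_last C (Suc n) X"
    proof (rule O.T_eqI[OF _ _ ahom_comp[OF O.smult_ahom h] ahom_comp[OF h O.smult_ahom] _ *(2)])
      fix xs a assume xs: "set xs \<subseteq> hpart C 1" "a \<in> carrier A"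
      show "sinv_last C (Suc n) (b \<odot>\<^bsub>TA\<^esub> apure xs a) = b \<odot>\<^bsub>TA\<^esub> sinv_last C (Suc n) (apure xs a)"
      proof (cases xs)
        case Nil
        then show ?thesis using xs * by (simp add: O.smult_pure_Nil p left_module_smult_zero[OF TA.left_module_axioms])
      next
        case (Cons x zs)
        show ?thesis
        proof (cases "length zs = n + 2")
          case True
          have z: "set (take n zs) \<subseteq> hpart C 1" using set_take_subset[of n zs] xs Cons by auto
          show ?thesis
            using True z xs * Cons d[of zs a]
            by (simp add: O.smult_pure_Cons p O.tprepend_Cons[where zs = "take n zs"] O.smult_tp O.tprepend_closed)
        next
          case False
          then show ?thesis using xs * Cons
            by (simp add: O.smult_pure_Cons p left_module_smult_zero[OF TA.left_module_axioms])
        qed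
      qed
    qed (use * in auto)
  qed
  with t' show ?case ..
qed

lemmas sinv_last_tbal = sinv_last_facts[THEN conjunct1]
  and sinv_last_lhom = sinv_last_facts[THEN conjunct2]

lemmas sinv_last_ahom = lhom_ahom[OF sinv_last_lhom]

lemma sinv_last_closed: "X \<in> carrier TA \<Longrightarrow> sinv_last C n X \<in> carrier TA"
  by (rule ahom_closed[OF sinv_last_ahom])

lemma sinv_last_pure:
  assumes "set ys \<subseteq> hpart C 1" "c \<in> hpart C 0" "length ys = n + 2"
  shows "sinv_last C n (apure ys c) = otp A (take n ys) (sinv C (apure (drop n ys) c))"
  unfolding sinv_last_def using assms by (subst O.tlift_pure[OF _ _ sinv_last_tbal]) auto

lemma sinv_drop_deg:
  assumes "set xs \<subseteq> hpart C 1" "a \<in> hpart C 0" "length xs = n + 2"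
  shows "sinv C (apure (drop n xs) a) \<in> fdeg C A 2"
  by (rule sinv_closed, rule O.tdeg_pure) (use assms set_drop_subset[of n xs] in auto)

lemma sinv_last_deg: "X \<in> fdeg C A (n + 2) \<Longrightarrow> sinv_last C n X \<in> fdeg C A (n + 2)"
proof (rule O.tdeg_ahom[OF _ _ sinv_last_ahom O.tdeg_aspan[symmetric]])
  fix xs a assume *: "set xs \<subseteq> hpart C 1" "a \<in> carrier A" "length xs = n + 2"
  then have "set (take n xs) \<subseteq> hpart C 1" using set_take_subset[of n xs] by auto
  with * show "sinv_last C n (apure xs a) \<in> fdeg C A (n + 2)"
    by (auto simp: sinv_last_pure intro!: O.tprepend_tdeg sinv_drop_deg)
qed simp_all

text \<open>Proved by induction over the span instead of comparing two additive maps, since outside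
  degree 2 nothing is known about \<open>sinv\<close>.\<close>

lemma sinv_last_0:
  assumes "X \<in> fdeg C A 2" shows "sinv_last C 0 X = sinv C X"
proof -
  let ?S = "{apure xs y | xs y. set xs \<subseteq> hpart C 1 \<and> y \<in> carrier A \<and> length xs = 2}"
  note A = O.tdeg_aspan[of A 2, OF Form_lm]
  have "X \<in> aspan TA ?S" using assms unfolding A .
  then show ?thesis
  proof induction
    case zero
    then show ?case by (simp add: sinv_zero ahom_zero[OF sinv_last_ahom])
  next
    case (base s)
    then show ?case using O.tdeg_carrier[OF Form_lm sinv_drop_deg[where n = 0]]
      by (auto simp: sinv_last_pure O.tprepend_Nil)
  next
    case (add x y)
    have "x \<in> fdeg C A 2" "y \<in> fdeg C A 2" using add A by auto
    then show ?case using add by (simp add: sinv_add ahom_add[OF sinv_last_ahom] O.tdeg_carrier[OF Form_lm])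
  next
    case (neg x)
    have "x \<in> fdeg C A 2" using neg A by auto
    then show ?case using neg by (simp add: sinv_neg ahom_neg[OF sinv_last_ahom] O.tdeg_carrier[OF Form_lm])
  qed
qed

text \<open>Among at least three factors the first is not one of the two on which
  \<open>sinv\<close> acts; the index drops since a factor is consumed.\<close>

lemma octr_sinv_last:
  assumes u: "u \<in> carrier (Vec C)" and Y: "Y \<in> fdeg C A (Suc m + 2)"
  shows "octr A u (sinv_last C (Suc m) Y) = sinv_last C m (octr A u Y)"
proof (rule O.tdeg_eqI[OF _ _ ahom_comp[OF sinv_last_ahom octr_ahom] ahom_comp[OF octr_ahom sinv_last_ahom] _ Y])
  fix xs a assume *: "set xs \<subseteq> hpart C 1" "a \<in> carrier A" "length xs = Suc m + 2"
  then obtain x zs where xs: "xs = x # zs" "x \<in> hpart C 1" "set zs \<subseteq> hpart C 1" "length zs = m + 2"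
    by (cases xs) auto
  have z: "set (take m zs) \<subseteq> hpart C 1" using set_take_subset[of m zs] xs by auto
  have s: "sinv C (apure (drop m zs) a) \<in> carrier TA"
    using O.tdeg_carrier[OF Form_lm sinv_drop_deg[of zs a m]] xs * by simp
  have l: "sinv_last C (Suc m) (apure (x # zs) a) = otp A [x] (otp A (take m zs) (sinv C (apure (drop m zs) a)))"
    using xs * z s by (simp add: sinv_last_pure O.tprepend_Cons[where zs = "take m zs"])
  show "octr A u (sinv_last C (Suc m) (apure xs a)) = sinv_last C m (octr A u (apure xs a))"
    unfolding xs(1) l using xs * z s u
    by (simp add: O.ctr_tp O.tprepend_closed O.ctr_pure_Cons lhom_smult[OF sinv_last_lhom] O.pure_closed sinv_last_pure)
qed (use u in simp_all)

lemma evd_sinv_last: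
  "\<lbrakk>w \<in> vdeg k; X \<in> fdeg C A (k + m + 2)\<rbrakk> \<Longrightarrow>
    evd C A k w (sinv_last C (k + m) X) = sinv_last C m (evd C A k w X)"
proof (induction k arbitrary: w m)
  case 0
  obtain a where a: "a \<in> hpart C 0" "w = vpure C [] a" by (rule vdeg_0E[OF 0(1)])
  have X: "X \<in> carrier TA" by (rule O.tdeg_carrier[OF Form_lm 0(2)])
  then show ?case using a by (simp add: evd_pure_Nil sinv_last_closed lhom_smult[OF sinv_last_lhom])
next
  case (Suc k)
  note Xc = O.tdeg_carrier[OF Form_lm Suc.prems(2)]
  show ?case
  proof (rule vdeg_eqI[OF _ evd_ahom[OF Form_lm sinv_last_closed[OF Xc]] ahom_comp[OF evd_ahom[OF Form_lm Xc] sinv_last_ahom] _ Suc.prems(1)])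
    fix u w assume uw: "u \<in> carrier (Vec C)" "w \<in> vdeg k"
    have X': "X \<in> fdeg C A (k + Suc m + 2)" using Suc.prems by simp
    have e: "evd C A k w X \<in> fdeg C A (Suc m + 2)"
      by (rule evd_deg) (use uw X' in \<open>simp_all add: add.assoc\<close>)
    show "evd C A (Suc k) (vtp u w) (sinv_last C (Suc k + m) X) = sinv_last C m (evd C A (Suc k) (vtp u w) X)"
      using uw Suc.IH[OF uw(2) X'] octr_sinv_last[OF uw(1) e] Xc
      by (simp add: evd_vtp sinv_last_closed)
  qed simp
qed

section \<open>Duality between the connections on forms and on vector fields\<close>

text \<open>Evaluation of the vector field leg of an element of \<Omega>^1 \<otimes> Vec^n on the
  tensor \<open>X\<close>, with the form leg staying in front.\<close>

abbreviation "pair N n X \<equiv> otbind N (\<lambda>w. evd C N n w X)"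

lemma pair_ahom: "\<lbrakk>lm N; X \<in> carrier (TForm C N)\<rbrakk> \<Longrightarrow> ahom TT (TForm C N) (pair N n X)"
  by (rule O.tbind_ahom[OF _ _ evd_lhom]) auto

lemma pair_closed: "\<lbrakk>lm N; X \<in> carrier (TForm C N); Z \<in> carrier TT\<rbrakk> \<Longrightarrow> pair N n X Z \<in> carrier (TForm C N)"
  by (rule ahom_closed[OF pair_ahom])

lemma pair_pure:
  "\<lbrakk>lm N; X \<in> carrier (TForm C N); set xs \<subseteq> hpart C 1; w \<in> carrier (TVec C)\<rbrakk> \<Longrightarrow>
    pair N n X (fpure C (TVec C) xs w) = otp N xs (evd C N n w X)"
  by (rule O.tbind_pure[OF _ _ evd_lhom]) auto

lemma Tdeg_eqI:
  assumes "abelian_group P" "ahom TT P f" "ahom TT P g" "Z \<in> Tdeg n"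
    and "\<And>\<xi> w. \<lbrakk>\<xi> \<in> hpart C 1; w \<in> vdeg n\<rbrakk> \<Longrightarrow> f (fpure C (TVec C) [\<xi>] w) = g (fpure C (TVec C) [\<xi>] w)"
  shows "f Z = g Z"
  by (rule ahom_eq_on_aspan[OF assms(2,3) _ assms(1) Tdeg_gens _ assms(4)]) (use assms(5) in auto)

lemma pair_deg:
  assumes N: "lm N" and X: "X \<in> fdeg C N n" and Z: "Z \<in> Tdeg n"
  shows "pair N n X Z \<in> fdeg C N 1"
proof -
  note Xc = O.tdeg_carrier[OF N X]
  have "pair N n X (fpure C (TVec C) [\<xi>] w) \<in> fdeg C N 1" if "\<xi> \<in> hpart C 1" "w \<in> vdeg n" for \<xi> w
  proof -
    have e: "evd C N n w X \<in> fdeg C N 0" by (rule evd_deg[OF N that(2)]) (use X in simp)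
    have "otp N [\<xi>] (evd C N n w X) \<in> fdeg C N 1"
      by (rule O.tprepend_tdeg[OF N _ e]) (use that in \<open>simp_all flip: One_nat_def\<close>)
    then show ?thesis using that N Xc by (simp add: pair_pure vdeg_carrier)
  qed
  then show ?thesis
    unfolding O.tdeg_aspan[OF N, of 1]
    by (intro ahom_aspan[OF pair_ahom[OF N Xc] _ _ Tdeg_gens _ Z])
      (use N in \<open>auto simp flip: O.tdeg_aspan[OF N, of 1]\<close>)
qed

lemma pair_ahom_right:
  assumes N: "lm N" and Z: "Z \<in> Tdeg n"
  shows "ahom (TForm C N) (TForm C N) (\<lambda>X. pair N n X Z)"
proof (rule ahomI)
  fix X Y assume XY: "X \<in> carrier (TForm C N)" "Y \<in> carrier (TForm C N)"
  interpret TN: left_module A "TForm C N" using N by simp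
  show "pair N n (X \<oplus>\<^bsub>TForm C N\<^esub> Y) Z = pair N n X Z \<oplus>\<^bsub>TForm C N\<^esub> pair N n Y Z"
    by (rule Tdeg_eqI[OF _ pair_ahom ahom_sum[OF _ pair_ahom pair_ahom] Z])
      (use N XY in \<open>simp_all add: pair_pure vdeg_carrier ahom_add[OF evd_ahom_right] ahom_add[OF O.tprepend_ahom] evd_closed\<close>)
qed (use N Z in \<open>auto intro!: pair_closed Tdeg_carrier\<close>)

abbreviation "otcat N X Y \<equiv> tcat A \<Omega> N X Y"

lemma otcat_ahom: "\<lbrakk>lm N; Y \<in> carrier (TForm C N)\<rbrakk> \<Longrightarrow> ahom TA (TForm C N) (\<lambda>X. otcat N X Y)"
  unfolding tcat_tbind by (rule O.tbind_ahom[OF _ _ lhom_scal]) auto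

lemma otcat_closed: "\<lbrakk>lm N; Y \<in> carrier (TForm C N); X \<in> carrier TA\<rbrakk> \<Longrightarrow> otcat N X Y \<in> carrier (TForm C N)"
  by (rule ahom_closed[OF otcat_ahom])

lemma otcat_pure:
  "\<lbrakk>lm N; Y \<in> carrier (TForm C N); set xs \<subseteq> hpart C 1; a \<in> hpart C 0\<rbrakk> \<Longrightarrow>
    otcat N (apure xs a) Y = otp N xs (a \<odot>\<^bsub>TForm C N\<^esub> Y)"
  unfolding tcat_tbind by (rule O.tbind_pure[OF _ _ lhom_scal]) auto

lemma otcat_deg:
  "\<lbrakk>lm N; X \<in> fdeg C A n; Y \<in> fdeg C N k\<rbrakk> \<Longrightarrow> otcat N X Y \<in> fdeg C N (n + k)"
  unfolding tcat_tbind
  by (rule O.tbind_tdeg[OF _ _ lhom_scal]) (auto intro!: O.smult_tdeg O.tdeg_carrier)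

lemma evd_otcat:
  "\<lbrakk>lm N; w \<in> vdeg n; X \<in> fdeg C A (n + k); Y \<in> carrier (TForm C N)\<rbrakk> \<Longrightarrow>
    evd C N n w (otcat N X Y) = otcat N (evd C A n w X) Y"
  unfolding tcat_tbind by (rule evd_tbind[OF _ _ lhom_scal]) auto

lemma boxF_word_snoc:
  "boxF_word C (rev (zs @ [\<xi>])) a = otp A zs (box C (\<xi> \<otimes> a)) \<oplus>\<^bsub>TA\<^esub>
    sinv_last C (length zs) (otcat A (boxF_word C (rev zs) \<one>) (apure [\<xi> \<otimes> a] \<one>))"
  by simp

lemma boxF_word_deg:
  "\<lbrakk>set xs \<subseteq> hpart C 1; a \<in> hpart C 0\<rbrakk> \<Longrightarrow> boxF_word C (rev xs) a \<in> fdeg C A (length xs + 1)"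
proof (induction xs arbitrary: a rule: rev_induct)
  case Nil
  then show ?case using dpure_closed by simp
next
  case (snoc \<xi> zs)
  have 1: "otp A zs (box C (\<xi> \<otimes> a)) \<in> fdeg C A (length zs + 2)"
    by (rule O.tprepend_tdeg) (use snoc.prems in \<open>auto intro!: box_closed\<close>)
  have "otcat A (boxF_word C (rev zs) \<one>) (apure [\<xi> \<otimes> a] \<one>) \<in> fdeg C A (length zs + 1 + 1)"
    by (rule otcat_deg) (use snoc in \<open>auto intro!: fdeg1\<close>)
  then have 2: "sinv_last C (length zs) (otcat A (boxF_word C (rev zs) \<one>) (apure [\<xi> \<otimes> a] \<one>)) \<in> fdeg C A (length zs + 2)"
    by (intro sinv_last_deg) (simp add: numeral_2_eq_2 One_nat_def)
  show ?case
    using O.tdeg_add[OF Form_lm 1 2] unfolding boxF_word_snoc by (simp add: One_nat_def)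
qed

lemma boxF_word_closed: "\<lbrakk>set xs \<subseteq> hpart C 1; a \<in> hpart C 0\<rbrakk> \<Longrightarrow> boxF_word C (rev xs) a \<in> carrier TA"
  by (rule O.tdeg_carrier[OF Form_lm boxF_word_deg])

declare boxF_word.simps(2) [simp del]

lemma boxT_pure_Nil: "a \<in> hpart C 0 \<Longrightarrow> boxT C (vpure C [] a) = fpure C (TVec C) [dif C a] (vpure C [] \<one>)"
  by (simp add: boxT_pure)

text \<open>The new leftmost vector field meets the new rightmost form: w consumes zs first and
  leaves its value as a scalar in front of \<eta>, where the vector field leg of \<open>Y\<close> is
  evaluated.\<close>

lemma pair_vattach:
  assumes v: "w \<in> vdeg n" and zs: "set zs \<subseteq> hpart C 1" "length zs = n" and \<eta>: "\<eta> \<in> hpart C 1"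
    and Y: "Y \<in> carrier TV"
  shows "pair A (Suc n) (otp A zs (apure [\<eta>] \<one>)) (vattach C Y w) = evV (nev n w zs \<otimes> \<eta>) Y"
proof -
  have c: "nev n w zs \<in> hpart C 0" by (rule nev_closed[OF zs(1) vdeg_carrier[OF v]])
  have P: "apure [\<eta>] \<one> \<in> carrier TA" using \<eta> by (intro O.pure_closed) auto
  have X: "otp A zs (apure [\<eta>] \<one>) \<in> carrier TA" using zs P by (intro O.tprepend_closed) auto
  show ?thesis
  proof (rule O.T_eqI[OF _ _ ahom_comp[OF vattach_ahom pair_ahom] evV_ahom _ Y])
    fix xs v assume xs: "set xs \<subseteq> hpart C 1" "v \<in> carrier (Vec C)"
    have "evd C A (Suc n) (vtp v w) (otp A zs (apure [\<eta>] \<one>)) = apure [] (v (nev n w zs \<otimes> \<eta>))"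
      using xs zs v c \<eta> P X
      by (simp add: evd_vtp evd_tprepend O.smult_pure_Cons O.ctr_pure_Cons O.smult_pure_Nil hp_sub[OF Vec_app])
    then show "pair A (Suc n) (otp A zs (apure [\<eta>] \<one>)) (vattach C (fpure C (Vec C) xs v) w) =
      evV (nev n w zs \<otimes> \<eta>) (fpure C (Vec C) xs v)"
      using xs zs v c \<eta> X
      by (simp add: vattach_pure vdeg_carrier pair_pure vtp_closed O.tmap_pure Vec_eval_lhom O.tprepend_pure)
  qed (use v c \<eta> X in \<open>auto simp: vdeg_carrier\<close>)
qed

text \<open>For Z = \<theta> \<otimes> w both sides are the contraction with u of
  \<open>sinv\<close> applied to \<theta> \<otimes> w(zs) \<eta>; on the left this is the
  description of \<open>sig\<close> through its evaluations.\<close>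

lemma pair_sigT:
  assumes u: "u \<in> carrier (Vec C)" and Z: "Z \<in> Tdeg n" and zs: "set zs \<subseteq> hpart C 1" "length zs = n" and \<eta>: "\<eta> \<in> hpart C 1"
  shows "pair A (Suc n) (otp A zs (apure [\<eta>] \<one>)) (sigT C u Z) =
    octr A u (sinv_last C 0 (otcat A (pair A n (apure zs \<one>) Z) (apure [\<eta>] \<one>)))"
proof -
  have P: "apure [\<eta>] \<one> \<in> carrier TA" using \<eta> by (intro O.pure_closed) auto
  have X: "otp A zs (apure [\<eta>] \<one>) \<in> carrier TA" using zs P by (intro O.tprepend_closed) auto
  have X': "apure zs \<one> \<in> carrier TA" using zs by (intro O.pure_closed) auto
  show ?thesis
  proof (rule Tdeg_eqI[OF _ ahom_comp[OF sigT_ahom pair_ahom]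
        ahom_comp[OF ahom_comp[OF ahom_comp[OF pair_ahom otcat_ahom] sinv_last_ahom] octr_ahom] Z])
    fix \<theta> w assume \<theta>: "\<theta> \<in> hpart C 1" and w: "w \<in> vdeg n"
    have c: "nev n w zs \<in> hpart C 0" by (rule nev_closed[OF zs(1) vdeg_carrier[OF w]])
    have "pair A (Suc n) (otp A zs (apure [\<eta>] \<one>)) (sigT C u (fpure C (TVec C) [\<theta>] w)) =
      octr A u (sinv C (apure [\<theta>, nev n w zs \<otimes> \<eta>] \<one>))"
      using u \<theta> w zs \<eta> c by (simp add: sigT_pure vdeg_carrier pair_vattach sig_carrier evV_sig)
    moreover have "otcat A (pair A n (apure zs \<one>) (fpure C (TVec C) [\<theta>] w)) (apure [\<eta>] \<one>) =
      apure [\<theta>, nev n w zs \<otimes> \<eta>] \<one>"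
      using u \<theta> w zs \<eta> c P X'
      by (simp add: pair_pure vdeg_carrier evd_pure O.tprepend_pure hp_sub otcat_pure O.smult_pure_Cons)
    ultimately show "pair A (Suc n) (otp A zs (apure [\<eta>] \<one>)) (sigT C u (fpure C (TVec C) [\<theta>] w)) =
      octr A u (sinv_last C 0 (otcat A (pair A n (apure zs \<one>) (fpure C (TVec C) [\<theta>] w)) (apure [\<eta>] \<one>)))"
      using \<theta> \<eta> c by (simp add: sinv_last_0 pure2_deg)
  qed (use u P X X' in auto)
qed

lemma dpure_ahom: "ahom A TA (\<lambda>b. dpure b)"
  by (rule ahomI) (simp_all add: dpure_carrier dpure_add)

lemma dpure_nev_ahom: "set xs \<subseteq> hpart C 1 \<Longrightarrow> b \<in> hpart C 0 \<Longrightarrow> ahom (TVec C) TA (\<lambda>w. dpure (nev n w xs \<otimes> b))"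
  by (rule ahom_comp[OF nev_ahom]) (auto intro!: ahomI simp: dpure_carrier dpure_add l_distr hp_sub)

text \<open>The inductive step takes u off the left of the vector fields and \<xi> off the right of
  the forms. With c = w(zs), duality for the single field u expresses d(u(c \<eta>)) by \<box>u and
  \<box>(c \<eta>) = c \<box>\<eta> + \<open>sinv\<close> (dc \<otimes> \<eta>). The induction
  hypothesis splits dc into two halves: one completes the recursion of \<box> on forms, the other
  that of \<box> on vector fields. Words of forms are used because \<open>boxF\<close> is shown to
  be well defined by means of this identity.\<close>

lemma boxF_duality:
  "\<lbrakk>w \<in> vdeg n; set xs \<subseteq> hpart C 1; length xs = n; a \<in> hpart C 0\<rbrakk> \<Longrightarrow>
    evd C A n w (boxF_word C (rev xs) a) \<oplus>\<^bsub>TA\<^esub> pair A n (apure xs a) (boxT C w)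
    = dpure (nev n w xs \<otimes> a)"
proof (induction n arbitrary: w xs a)
  case 0
  obtain b where b: "b \<in> hpart C 0" "w = vpure C [] b" by (rule vdeg_0E[OF 0(1)])
  have p: "pair A 0 (apure [] a) (fpure C (TVec C) [dif C b] (vpure C [] \<one>)) = fract C (dpure b) a"
    using 0 b unfolding fract_omap
    by (simp add: pair_pure pure_Nil_closed V.pure_closed evd_pure_Nil O.smult_pure_Nil O.tprepend_pure O.tmap_pure lhom_rmult hp_sub)
  have "fract C (dpure b) a \<in> carrier TA" using 0 b by (intro fract_closed dpure_carrier) auto
  then show ?case using 0 b p dpure_mult[of b a]
    by (simp add: evd_pure_Nil dpure_carrier boxT_pure_Nil nev_Nil TA.M.a_comm TA.smult_closed)
next
  case (Suc n)
  obtain zs \<xi> where zs: "xs = zs @ [\<xi>]" "set zs \<subseteq> hpart C 1" "\<xi> \<in> hpart C 1" "length zs = n"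
    using Suc.prems(2,3) by (cases xs rule: rev_cases) auto
  \<comment> \<open>As in \<open>boxF_word\<close>, the scalar is absorbed into the last form, so
    that the remaining tensors end in the unit.\<close>
  define \<eta> where "\<eta> = \<xi> \<otimes> a"
  have \<eta>: "\<eta> \<in> hpart C 1" using zs Suc.prems by (simp add: \<eta>_def)
  define P where "P = apure [\<eta>] \<one>"
  have P: "P \<in> carrier TA" "P \<in> fdeg C A 1"
    unfolding P_def using \<eta> by (auto intro!: O.pure_closed fdeg1)
  define X where "X = otp A zs P"
  have X: "X \<in> carrier TA" unfolding X_def using zs P by (intro O.tprepend_closed) auto
  have Xp: "apure xs a = X"
    using zs Suc.prems O.pure1_bal[of A \<xi> a \<one>] hp_sub[OF Suc.prems(4)]
    by (simp add: X_def P_def \<eta>_def O.tprepend_pure[symmetric])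
  define X' where "X' = apure zs \<one>"
  have X': "X' \<in> carrier TA" "X' \<in> fdeg C A n" unfolding X'_def using zs by (auto intro!: O.pure_closed O.tdeg_pure)
  note bwc = boxF_word_closed[OF Suc.prems(2,4)]
  have fx: "set xs \<subseteq> hpart C 1" by (rule Suc.prems(2))
  show ?case
    unfolding Xp
  proof (rule vdeg_eqI[OF _ ahom_sum[OF _ evd_ahom[OF Form_lm bwc] ahom_comp[OF boxT_ahom pair_ahom[OF Form_lm X]]] dpure_nev_ahom[OF Suc.prems(2,4)] _ Suc.prems(1)])
    fix u w assume u: "u \<in> carrier (Vec C)" and w: "w \<in> vdeg n"
    note wc = vdeg_carrier[OF w]
    define c where "c = nev n w zs"
    have c: "c \<in> hpart C 0" unfolding c_def by (rule nev_closed[OF zs(2) wc])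
    have c\<eta>: "c \<otimes> \<eta> \<in> hpart C 1" using c \<eta> by simp
    define bz where "bz = boxF_word C (rev zs) \<one>"
    have bz: "bz \<in> fdeg C A (n + 1)" unfolding bz_def using boxF_word_deg[OF zs(2) one_hpart] zs by simp
    define Q where "Q = pair A n X' (boxT C w)"
    define R where "R = evd C A n w bz"
    have Q: "Q \<in> fdeg C A 1" unfolding Q_def by (rule pair_deg[OF Form_lm X'(2) boxT_deg[OF w]])
    have R: "R \<in> fdeg C A 1" unfolding R_def by (rule evd_deg[OF Form_lm w bz])
    note Qc = O.tdeg_carrier[OF Form_lm Q] and Rc = O.tdeg_carrier[OF Form_lm R]
    have QP: "otcat A Q P \<in> fdeg C A 2" "otcat A R P \<in> fdeg C A 2"
      using otcat_deg[OF Form_lm Q P(2)] otcat_deg[OF Form_lm R P(2)] by (simp_all add: one_add_one)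
    \<comment> \<open>The two halves of dc: \<open>R\<close> is w evaluated on \<box>(zs),
      \<open>Q\<close> is \<box>w evaluated on zs.\<close>
    have IH: "R \<oplus>\<^bsub>TA\<^esub> Q = dpure c"
      using Suc.IH[OF w zs(2,4) one_hpart] c by (simp add: R_def Q_def bz_def X'_def c_def hp_sub)
    have "otcat A R P \<oplus>\<^bsub>TA\<^esub> otcat A Q P = apure [dif C c, \<eta>] \<one>"
      using IH c \<eta> P Qc Rc TA.smult_one[OF P(1)] unfolding ahom_add[OF otcat_ahom[OF Form_lm P(1)] Rc Qc, symmetric]
      by (simp add: otcat_pure) (simp add: P_def O.tprepend_pure)
    then have s: "sinv C (otcat A R P) \<oplus>\<^bsub>TA\<^esub> sinv C (otcat A Q P) = sinv C (apure [dif C c, \<eta>] \<one>)"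
      using sinv_add[OF QP(2,1)] by simp
    have t2: "otcat A bz P \<in> fdeg C A (n + 0 + 2)" "otcat A bz P \<in> carrier TA"
      using otcat_deg[OF Form_lm bz P(2)] O.tdeg_carrier[OF Form_lm otcat_deg[OF Form_lm bz P(2)]]
      by (simp_all add: numeral_2_eq_2 One_nat_def)
    have bb: "boxF_word C (rev xs) a = otp A zs (box C \<eta>) \<oplus>\<^bsub>TA\<^esub> sinv_last C n (otcat A bz P)"
      unfolding zs(1) boxF_word_snoc using zs by (simp add: \<eta>_def bz_def P_def)
    \<comment> \<open>After w has consumed zs, exactly two factors remain, namely \<open>R\<close>
      and the last form, and \<open>sinv\<close> acts on them.\<close>
    have ebw: "evd C A n w (boxF_word C (rev xs) a) = c \<odot>\<^bsub>TA\<^esub> box C \<eta> \<oplus>\<^bsub>TA\<^esub> sinv C (otcat A R P)"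
      unfolding bb using w zs \<eta> t2 box_carrier[OF \<eta>] bz P
        evd_sinv_last[OF w t2(1)] sinv_last_0[OF QP(2)] evd_otcat[OF Form_lm w bz P(1)]
      by (simp add: ahom_add[OF evd_ahom_right] O.tprepend_closed sinv_last_closed evd_tprepend c_def R_def)
    note sc = sinv_carrier[OF QP(1)] sinv_carrier[OF QP(2)]
    have bc: "c \<odot>\<^bsub>TA\<^esub> box C \<eta> \<in> carrier TA" using c \<eta> by (simp add: TA.smult_closed box_carrier)
    \<comment> \<open>Of the term \<open>sinv\<close> (dc \<otimes> \<eta>) produced by
      \<open>box_left\<close>, the half belonging to \<open>R\<close> is already contained in the
      evaluation just computed.\<close>
    have "box C (c \<otimes> \<eta>) = evd C A n w (boxF_word C (rev xs) a) \<oplus>\<^bsub>TA\<^esub> sinv C (otcat A Q P)"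
      unfolding ebw using c \<eta> s sc bc by (simp add: box_left TA.M.a_assoc)
    then have "octr A u (box C (c \<otimes> \<eta>)) =
      octr A u (evd C A n w (boxF_word C (rev xs) a)) \<oplus>\<^bsub>TA\<^esub> octr A u (sinv C (otcat A Q P))"
      using u sc bwc wc by (simp add: ahom_add[OF octr_ahom] evd_closed)
    moreover have "pair A (Suc n) X (boxT C (vtp u w)) = evV (c \<otimes> \<eta>) (boxV C u) \<oplus>\<^bsub>TA\<^esub> octr A u (sinv C (otcat A Q P))"
    proof -
      have 1: "pair A (Suc n) X (vattach C (boxV C u) w) = evV (c \<otimes> \<eta>) (boxV C u)"
        unfolding X_def P_def c_def by (rule pair_vattach[OF w zs(2,4) \<eta> boxV_carrier[OF u]])
      have 2: "pair A (Suc n) X (sigT C u (boxT C w)) = octr A u (sinv C (otcat A Q P))"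
        using pair_sigT[OF u boxT_deg[OF w] zs(2,4) \<eta>] sinv_last_0[OF QP(1)] by (simp add: X_def P_def Q_def X'_def)
      show ?thesis
        using u wc X by (simp add: boxT_vtp ahom_add[OF pair_ahom] vattach_closed boxV_carrier sigT_closed boxT_closed 1 2)
    qed
    moreover have "dpure (u (c \<otimes> \<eta>)) = evV (c \<otimes> \<eta>) (boxV C u) \<oplus>\<^bsub>TA\<^esub> octr A u (box C (c \<otimes> \<eta>))"
      by (rule boxV_dual[OF u c\<eta>])
    moreover have "nev (Suc n) (vtp u w) xs \<otimes> a = u (c \<otimes> \<eta>)"
      unfolding zs(1) using u w zs c Suc.prems
      by (simp add: nev_snoc \<eta>_def c_def Vec_app_mult[symmetric] m_assoc hp_sub)
    moreover have "evV (c \<otimes> \<eta>) (boxV C u) \<in> carrier TA" by (rule evV_closed[OF c\<eta> boxV_carrier[OF u]])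
    moreover have "octr A u (sinv C (otcat A Q P)) \<in> carrier TA"
      "octr A u (evd C A n w (boxF_word C (rev xs) a)) \<in> carrier TA"
      using u sc bwc wc by (auto intro!: octr_closed evd_closed)
    ultimately show "evd C A (Suc n) (vtp u w) (boxF_word C (rev xs) a) \<oplus>\<^bsub>TA\<^esub> pair A (Suc n) X (boxT C (vtp u w))
      = dpure (nev (Suc n) (vtp u w) xs \<otimes> a)"
      using u w bwc by (simp add: evd_vtp TA.M.a_ac)
  qed simp_all
qed

end

section \<open>Iterated covariant derivatives, and the action on a module with connection\<close>

context bimodule_connection
begin

text \<open>By duality, w takes on the word expression the value d(w(X)) minus the pairing of
  \<box>w with X, where X is the tensor represented by the word; this no longer refers to the word
  itself.\<close>

lemma tbal_boxF: "tbal A \<Omega> A TA (\<lambda>xs a. boxF_word C (rev xs) a)"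
proof (rule tbal_by_evaluation[where \<Psi> = "\<lambda>n w X. dpure (tdown A (evd C A n w X)) \<ominus>\<^bsub>TA\<^esub> pair A n X (boxT C w)"])
  fix n w assume w: "w \<in> vdeg n"
  show "ahom TA TA (\<lambda>X. dpure (tdown A (evd C A n w X)) \<ominus>\<^bsub>TA\<^esub> pair A n X (boxT C w))"
    by (intro ahom_diff ahom_comp[OF ahom_comp[OF evd_ahom_right O.tdown_ahom] dpure_ahom] pair_ahom_right boxT_deg w) simp_all
next
  fix n w xs y assume *: "w \<in> vdeg n" "set xs \<subseteq> hpart C 1" "y \<in> carrier A" "length xs = n"
  then have c: "nev n w xs \<in> hpart C 0" by (intro nev_closed vdeg_carrier)
  have p: "apure xs y \<in> carrier TA" using * by (intro O.pure_closed) auto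
  have e: "evd C A n w (boxF_word C (rev xs) y) \<in> carrier TA"
    using * by (intro evd_closed boxF_word_closed vdeg_carrier) auto
  have q: "pair A n (apure xs y) (boxT C w) \<in> carrier TA"
    using * p by (intro pair_closed boxT_closed vdeg_carrier) auto
  have "dpure (tdown A (evd C A n w (apure xs y))) = dpure (nev n w xs \<otimes> y)"
    using * c by (simp add: evd_pure tdown_pure_Nil)
  then show "evd C A n w (boxF_word C (rev xs) y) =
    dpure (tdown A (evd C A n w (apure xs y))) \<ominus>\<^bsub>TA\<^esub> pair A n (apure xs y) (boxT C w)"
    using boxF_duality[OF *(1,2,4), of y] * e q
    by (simp add: a_minus_def TA.M.a_assoc TA.M.r_neg flip: boxF_duality)
qed (auto intro: boxF_word_deg)

lemma boxF_pure: "\<lbrakk>set xs \<subseteq> hpart C 1; a \<in> hpart C 0\<rbrakk> \<Longrightarrow> boxF C (apure xs a) = boxF_word C (rev xs) a"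
  unfolding boxF_def by (rule O.tlift_pure[OF _ _ tbal_boxF]) simp_all

lemma otcat_pair:
  assumes "lm N" "Z \<in> Tdeg n" "set xs \<subseteq> hpart C 1" "length xs = n" "y \<in> carrier N"
  shows "otcat N (pair A n (apure xs \<one>) Z) (fpure C N [] y) = pair N n (fpure C N xs y) Z"
proof -
  interpret N: left_module A N by fact
  have p: "apure xs \<one> \<in> carrier TA" "fpure C N xs y \<in> carrier (TForm C N)" "fpure C N [] y \<in> carrier (TForm C N)"
    using assms by (auto intro!: O.pure_closed)
  show ?thesis
  proof (rule Tdeg_eqI[OF _ ahom_comp[OF pair_ahom otcat_ahom] pair_ahom assms(2)])
    fix \<xi> w assume *: "\<xi> \<in> hpart C 1" "w \<in> vdeg n"
    have c: "nev n w xs \<in> hpart C 0" by (rule nev_closed[OF assms(3) vdeg_carrier[OF *(2)]])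
    show "otcat N (pair A n (apure xs \<one>) (fpure C (TVec C) [\<xi>] w)) (fpure C N [] y) =
      pair N n (fpure C N xs y) (fpure C (TVec C) [\<xi>] w)"
      using * c p assms
      by (simp add: pair_pure vdeg_carrier evd_pure hp_sub O.tprepend_pure otcat_pure O.smult_pure_Nil N.smult_closed)
  qed (use assms p in auto)
qed

end

locale module_connection = bimodule_connection C + E: left_module "Form C 0" E
  for C :: "('w, 'x) conn_scheme" (structure) and E :: "('w, 'e, 'z) module_scheme"
    and nabla :: "'e \<Rightarrow> ('w, 'e) tensor" +
  assumes nabla: "left_cov_deriv C E nabla"
begin

lemma lmE [simp]: "lm E"
  by (rule E.left_module_axioms)

abbreviation "TE \<equiv> TForm C E"

sublocale TE: left_module A TE by simp

lemma nabla_deg: "e \<in> carrier E \<Longrightarrow> nabla e \<in> fdeg C E 1"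
  using nabla by (simp add: left_cov_deriv_def)

lemma nabla_closed: "e \<in> carrier E \<Longrightarrow> nabla e \<in> carrier TE"
  by (rule O.tdeg_carrier[OF lmE nabla_deg])

lemma nabla_ahom: "ahom E TE nabla"
  by (rule ahomI) (use nabla nabla_closed in \<open>auto simp: left_cov_deriv_def\<close>)

lemma nabla_smult: "\<lbrakk>a \<in> hpart C 0; e \<in> carrier E\<rbrakk> \<Longrightarrow> nabla (a \<odot>\<^bsub>E\<^esub> e) = fpure C E [dif C a] e \<oplus>\<^bsub>TE\<^esub> a \<odot>\<^bsub>TE\<^esub> nabla e"
  using nabla by (simp add: left_cov_deriv_def)

lemma smult_closed_E [simp]: "\<lbrakk>a \<in> hpart C 0; e \<in> carrier E\<rbrakk> \<Longrightarrow> a \<odot>\<^bsub>E\<^esub> e \<in> carrier E"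
  using E.smult_closed by simp

abbreviation "nabla_word xs e \<equiv> otcat E (boxF C (apure xs \<one>)) (fpure C E [] e) \<oplus>\<^bsub>TE\<^esub> otp E xs (nabla e)"

text \<open>The value at w that a Leibniz rule for \<nabla>(w(X)) forces on
  \<open>nabla_step\<close>. It depends on the tensor X and not on a word for it, as
  \<open>tbal_by_evaluation\<close> demands.\<close>

abbreviation "step_eval n w X \<equiv> nabla (tdown E (evd C E n w X)) \<ominus>\<^bsub>TE\<^esub> pair E n X (boxT C w)"

lemma step_eval_ahom: "w \<in> vdeg n \<Longrightarrow> ahom TE TE (step_eval n w)"
  by (intro ahom_diff ahom_comp[OF ahom_comp[OF evd_ahom_right O.tdown_ahom] nabla_ahom] pair_ahom_right boxT_deg) simp_all

lemma nabla_word_deg: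
  assumes "set xs \<subseteq> hpart C 1" "e \<in> carrier E"
  shows "nabla_word xs e \<in> fdeg C E (length xs + 1)"
proof (rule O.tdeg_add[OF lmE])
  have 1: "fpure C E [] e \<in> fdeg C E 0" by (rule O.tdeg_pure) (use assms in auto)
  have "otcat E (boxF_word C (rev xs) \<one>) (fpure C E [] e) \<in> fdeg C E (length xs + 1 + 0)"
    by (rule otcat_deg[OF lmE boxF_word_deg 1]) (use assms in auto)
  then show "otcat E (boxF C (apure xs \<one>)) (fpure C E [] e) \<in> fdeg C E (length xs + 1)"
    using assms by (simp add: boxF_pure)
  show "otp E xs (nabla e) \<in> fdeg C E (length xs + 1)"
    by (rule O.tprepend_tdeg[OF lmE assms(1) nabla_deg[OF assms(2)]]) simp
qed

text \<open>With c = w(xs), the duality on forms turns the first summand of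
  \<open>nabla_word\<close> into dc \<otimes> e minus a pairing, while the second becomes c
  \<nabla>e; the Leibniz rule of \<nabla> combines dc \<otimes> e and c \<nabla>e into \<nabla>(c
  e).\<close>

lemma evd_nabla_word:
  assumes w: "w \<in> vdeg n" and xs: "set xs \<subseteq> hpart C 1" "length xs = n" and e: "e \<in> carrier E"
  shows "evd C E n w (nabla_word xs e) = step_eval n w (fpure C E xs e)"
proof -
  define c where "c = nev n w xs"
  have c: "c \<in> hpart C 0" unfolding c_def by (rule nev_closed[OF xs(1) vdeg_carrier[OF w]])
  define B where "B = boxF_word C (rev xs) \<one>"
  have B: "B \<in> fdeg C A (n + 1)" unfolding B_def using boxF_word_deg[OF xs(1) one_hpart] xs by simp
  note Bc = O.tdeg_carrier[OF Form_lm B]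
  have p: "fpure C E [] e \<in> carrier TE" "fpure C E xs e \<in> carrier TE" "apure xs \<one> \<in> carrier TA"
    using xs e by (auto intro!: O.pure_closed)
  define Q where "Q = pair A n (apure xs \<one>) (boxT C w)"
  have Q: "Q \<in> carrier TA" unfolding Q_def using p w by (intro pair_closed boxT_closed vdeg_carrier) auto
  note eB = evd_closed[OF Form_lm vdeg_carrier[OF w] Bc, of n]
  have D: "evd C A n w B \<oplus>\<^bsub>TA\<^esub> Q = dpure c"
    using boxF_duality[OF w xs one_hpart] c by (simp add: B_def Q_def c_def hp_sub)
  have tQ: "otcat E Q (fpure C E [] e) = pair E n (fpure C E xs e) (boxT C w)"
    unfolding Q_def by (rule otcat_pair[OF lmE boxT_deg[OF w] xs e])
  have h: "otcat E (evd C A n w B) (fpure C E [] e) \<oplus>\<^bsub>TE\<^esub> otcat E Q (fpure C E [] e) = fpure C E [dif C c] e"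
    unfolding ahom_add[OF otcat_ahom[OF lmE p(1)] eB Q, symmetric] D
    using c e p TE.smult_one[OF p(1)] by (simp add: otcat_pure O.tprepend_pure)
  have 1: "otcat E (evd C A n w B) (fpure C E [] e) = fpure C E [dif C c] e \<ominus>\<^bsub>TE\<^esub> pair E n (fpure C E xs e) (boxT C w)"
    unfolding h[symmetric] tQ using otcat_closed[OF lmE p(1) eB] pair_closed[OF lmE p(2) boxT_closed[OF vdeg_carrier[OF w]]]
    by (simp add: a_minus_def TE.M.a_assoc TE.M.r_neg)
  have "evd C E n w (nabla_word xs e) = otcat E (evd C A n w B) (fpure C E [] e) \<oplus>\<^bsub>TE\<^esub> c \<odot>\<^bsub>TE\<^esub> nabla e"
    using w xs e p Bc B by (simp add: boxF_pure ahom_add[OF evd_ahom_right] otcat_closed O.tprepend_closed nabla_closed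
      evd_tprepend evd_otcat c_def flip: B_def)
  also have "\<dots> = nabla (c \<odot>\<^bsub>E\<^esub> e) \<ominus>\<^bsub>TE\<^esub> pair E n (fpure C E xs e) (boxT C w)"
    unfolding 1 using c e pair_closed[OF lmE p(2) boxT_closed[OF vdeg_carrier[OF w]]]
    by (simp add: nabla_smult a_minus_def O.pure_closed TE.smult_closed nabla_closed TE.M.a_ac)
  also have "c \<odot>\<^bsub>E\<^esub> e = tdown E (evd C E n w (fpure C E xs e))"
    using w xs e c by (simp add: evd_pure tdown_pure_Nil c_def)
  finally show ?thesis .
qed

lemma tbal_nabla_word: "tbal A \<Omega> E TE nabla_word"
  by (rule tbal_by_evaluation[where \<Psi> = step_eval, OF lmE nabla_word_deg step_eval_ahom evd_nabla_word])

lemma nabla_step_ahom: "ahom TE TE (nabla_step C E nabla)"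
  unfolding nabla_step_def by (rule O.tlift_ahom[OF _ _ tbal_nabla_word]) simp_all

lemma nabla_step_pure: "\<lbrakk>set xs \<subseteq> hpart C 1; e \<in> carrier E\<rbrakk> \<Longrightarrow> nabla_step C E nabla (fpure C E xs e) = nabla_word xs e"
  unfolding nabla_step_def by (rule O.tlift_pure[OF _ _ tbal_nabla_word]) simp_all

lemma nabla_step_deg: "X \<in> fdeg C E n \<Longrightarrow> nabla_step C E nabla X \<in> fdeg C E (n + 1)"
  by (rule O.tdeg_ahom[OF _ _ nabla_step_ahom O.tdeg_aspan[symmetric]])
    (use nabla_word_deg in \<open>auto simp: nabla_step_pure\<close>)

lemma evd_nabla_step:
  assumes w: "w \<in> vdeg n" and X: "X \<in> fdeg C E n"
  shows "evd C E n w (nabla_step C E nabla X) = step_eval n w X"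
  by (rule O.tdeg_eqI[OF _ _ ahom_comp[OF nabla_step_ahom evd_ahom_right] step_eval_ahom _ X])
    (use w in \<open>simp_all add: nabla_step_pure evd_nabla_word\<close>)

text \<open>\<open>nabla_pow\<close> has separate clauses for the powers 0 and 1. Since d1 = 0, the
  general step also leads from power 0 to power 1, which gives the uniform rule
  \<open>nabla_pow_Suc\<close>.\<close>

lemma nabla_step_0:
  assumes e: "e \<in> carrier E" shows "nabla_step C E nabla (fpure C E [] e) = nabla e"
proof -
  have p: "fpure C E [] e \<in> carrier TE" using e by (intro O.pure_closed) auto
  have "fpure C E [\<zero>] e = \<zero>\<^bsub>TE\<^esub>"
  proof -
    have "ahom \<Omega> TE (\<lambda>x. fpure C E [x] e)"
      by (rule ahomI) (use e in \<open>simp_all add: O.pure_closed O.pure1_add\<close>)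
    from ahom_zero[OF this] show ?thesis by simp
  qed
  then show ?thesis
    using e p TE.smult_one[OF p] nabla_closed[OF e]
    by (simp add: nabla_step_pure boxF_pure dif_one otcat_pure O.tprepend_pure O.tprepend_Nil)
qed

lemma nabla_pow_Suc: "e \<in> carrier E \<Longrightarrow> nabla_pow C E nabla (Suc n) e = nabla_step C E nabla (nabla_pow C E nabla n e)"
  by (cases n) (simp_all add: nabla_step_0)

lemma nabla_pow_deg: "e \<in> carrier E \<Longrightarrow> nabla_pow C E nabla n e \<in> fdeg C E n"
proof (induction n)
  case 0
  then show ?case by (auto intro: O.tdeg_pure)
next
  case (Suc n)
  then show ?case using nabla_step_deg[of "nabla_pow C E nabla n e" n] by (simp add: nabla_pow_Suc One_nat_def)
qed

lemma nabla_pow_closed: "e \<in> carrier E \<Longrightarrow> nabla_pow C E nabla n e \<in> carrier TE"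
  by (rule O.tdeg_carrier[OF lmE nabla_pow_deg])

lemma nabla_pow_ahom: "ahom E TE (nabla_pow C E nabla n)"
proof (induction n)
  case 0
  then show ?case using O.pure_Nil_ahom[OF lmE] by (simp add: ahom_def)
next
  case (Suc n)
  then show ?case
    by (intro ahomI) (simp_all add: nabla_pow_Suc ahom_add ahom_closed ahom_add[OF nabla_step_ahom] ahom_closed[OF nabla_step_ahom])
qed

text \<open>A mismatch of lengths makes the innermost value zero, and the surrounding vector fields
  preserve zero by additivity.\<close>

lemma nested_ev_length:
  "\<lbrakk>set us \<subseteq> carrier (Vec C); set rs \<subseteq> hpart C 1; length us \<noteq> length rs\<rbrakk> \<Longrightarrow> nested_ev C us a rs = \<zero>"
proof (induction us arbitrary: rs)
  case Nil
  then show ?case by (cases rs) auto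
next
  case (Cons v vs)
  have "v \<zero> = \<zero>"
    using ahom_zero[OF rlin_ahom[OF Vec_rlin[of v]]] Cons.prems by simp
  then show ?case
    using Cons by (cases rs) (auto simp: hp_sub)
qed

text \<open>The function on words of forms in \<open>act\<close> vanishes off length n and is given
  by \<open>evd\<close> on length n. This replaces nested evaluation of words by an evaluation of
  tensors, whose laws are known.\<close>

lemma tlift_nested_ev:
  assumes us: "set us \<subseteq> carrier (Vec C)" "a \<in> hpart C 0" "length us = n" and P: "P \<in> fdeg C E n"
  shows "tlift E (\<lambda>xs f. nested_ev C us a (rev xs) \<odot>\<^bsub>E\<^esub> f) P = tdown E (evd C E n (vpure C us a) P)"
proof -
  have w: "vpure C us a \<in> vdeg n" using us by (intro V.tdeg_pure) auto
  let ?F = "\<lambda>xs f. if length xs = n then tdown E (evd C E n (vpure C us a) (fpure C E xs f)) else \<zero>\<^bsub>E\<^esub>"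
  have t: "tbal A \<Omega> E E ?F"
    by (rule O.tbal_restrict[OF tbal_comp[OF tbal_comp[OF O.tbal_pure evd_ahom_right] O.tdown_ahom]])
      (use w E.M.abelian_group_axioms in auto)
  have eq: "nested_ev C us a (rev xs) \<odot>\<^bsub>E\<^esub> f = ?F xs f" if "set xs \<subseteq> hpart C 1" "f \<in> carrier E" for xs f
  proof (cases "length xs = n")
    case True
    have "nev n (vpure C us a) xs \<in> hpart C 0" by (rule nev_closed[OF that(1) vdeg_carrier[OF w]])
    then show ?thesis
      using True that us w nev_nested_ev[OF us(1,2) that(1) us(3) True] by (simp add: evd_pure tdown_pure_Nil)
  next
    case False
    then have "nested_ev C us a (rev xs) = \<zero>" using us that by (intro nested_ev_length) auto
    then show ?thesis using False that left_module_zero_scalar[OF lmE, of f] by simp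
  qed
  have "tlift E (\<lambda>xs f. nested_ev C us a (rev xs) \<odot>\<^bsub>E\<^esub> f) P = tlift E ?F P"
    by (rule O.tlift_cong[OF lmE E.M.abelian_group_axioms t]) (use eq O.tdeg_carrier[OF lmE P] in auto)
  also have "\<dots> = tdown E (evd C E n (vpure C us a) P)"
    by (rule O.tdeg_eqI[OF lmE E.M.abelian_group_axioms O.tlift_ahom[OF lmE E.M.abelian_group_axioms t]
          ahom_comp[OF evd_ahom_right[OF lmE w] O.tdown_ahom[OF lmE]] _ P])
      (simp add: O.tlift_pure[OF lmE E.M.abelian_group_axioms t])
  finally show ?thesis .
qed

lemma tbal_act:
  assumes e: "e \<in> carrier E"
  shows "tbal A (Vec C) A E (\<lambda>us a. tdown E (evd C E (length us) (vpure C us a) (nabla_pow C E nabla (length us) e)))"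
proof -
  have "tbal A (Vec C) A E
    (\<lambda>us a. (\<lambda>n us a. tdown E (evd C E n (vpure C us a) (nabla_pow C E nabla n e))) (length us) us a)"
    by (rule tbal_by_length, rule tbal_comp[OF tbal_comp[OF V.tbal_pure evd_ahom] O.tdown_ahom])
      (use nabla_pow_closed[OF e] in auto)
  then show ?thesis by simp
qed

lemma act_tlift:
  assumes e: "e \<in> carrier E" and v: "v \<in> carrier (TVec C)"
  shows "act C E nabla v e = tlift E (\<lambda>us a. tdown E (evd C E (length us) (vpure C us a) (nabla_pow C E nabla (length us) e))) v"
  unfolding act_def
  by (rule V.tlift_cong[OF Form_lm E.M.abelian_group_axioms tbal_act[OF e] _ v])
    (use e in \<open>auto simp: tlift_nested_ev nabla_pow_deg\<close>)

lemma act_ahom: "e \<in> carrier E \<Longrightarrow> ahom (TVec C) E (\<lambda>v. act C E nabla v e)"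
  using V.tlift_ahom[OF Form_lm E.M.abelian_group_axioms tbal_act, of e]
  by (simp add: ahom_def act_tlift)

lemma act_pure:
  "\<lbrakk>e \<in> carrier E; set us \<subseteq> carrier (Vec C); a \<in> hpart C 0\<rbrakk> \<Longrightarrow>
    act C E nabla (vpure C us a) e = tdown E (evd C E (length us) (vpure C us a) (nabla_pow C E nabla (length us) e))"
  by (simp add: act_tlift V.pure_closed V.tlift_pure[OF Form_lm E.M.abelian_group_axioms tbal_act])

lemma act_vdeg:
  assumes e: "e \<in> carrier E" and v: "v \<in> vdeg n"
  shows "act C E nabla v e = tdown E (evd C E n v (nabla_pow C E nabla n e))"
  by (rule V.tdeg_eqI[OF Form_lm E.M.abelian_group_axioms act_ahom[OF e] ahom_comp[OF evd_ahom O.tdown_ahom] _ v])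
    (use e nabla_pow_closed in \<open>auto simp: act_pure\<close>)

lemma act_closed: "\<lbrakk>v \<in> carrier (TVec C); e \<in> carrier E\<rbrakk> \<Longrightarrow> act C E nabla v e \<in> carrier E"
  by (rule ahom_closed[OF act_ahom])

lemma act_pure_Nil: "\<lbrakk>a \<in> hpart C 0; e \<in> carrier E\<rbrakk> \<Longrightarrow> act C E nabla (vpure C [] a) e = a \<odot>\<^bsub>E\<^esub> e"
  using pure_Nil_closed[OF lmE, of e]
  by (simp add: act_pure evd_pure_Nil O.smult_pure_Nil tdown_pure_Nil)

lemma act_smult:
  assumes a: "a \<in> hpart C 0" and v: "v \<in> carrier (TVec C)" and e: "e \<in> carrier E"
  shows "act C E nabla (a \<odot>\<^bsub>TVec C\<^esub> v) e = a \<odot>\<^bsub>E\<^esub> act C E nabla v e"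
proof (rule V.T_eqI[OF _ _ ahom_comp[OF V.smult_ahom act_ahom] ahom_comp[OF act_ahom left_module_ahom[OF lmE]] _ v])
  fix us b assume us: "set us \<subseteq> carrier (Vec C)" "b \<in> carrier A"
  have d: "vpure C us b \<in> vdeg (length us)" by (rule V.tdeg_pure) (use us in auto)
  have d': "a \<odot>\<^bsub>TVec C\<^esub> vpure C us b \<in> vdeg (length us)" by (rule V.smult_tdeg[OF _ _ d]) (use a in auto)
  show "act C E nabla (a \<odot>\<^bsub>TVec C\<^esub> vpure C us b) e = a \<odot>\<^bsub>E\<^esub> act C E nabla (vpure C us b) e"
    using a e d nabla_pow_closed[OF e]
    by (simp add: act_vdeg[OF e d'] act_vdeg[OF e d] lhom_smult[OF evd_lhom] vdeg_carrier evd_closed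
        lhom_smult[OF O.tdown_lhom])
qed (use a e E.M.abelian_group_axioms in auto)

lemma act_ahom_right:
  assumes v: "v \<in> carrier (TVec C)" shows "ahom E E (act C E nabla v)"
proof (rule ahomI)
  fix e f assume ef: "e \<in> carrier E" "f \<in> carrier E"
  show "act C E nabla v (e \<oplus>\<^bsub>E\<^esub> f) = act C E nabla v e \<oplus>\<^bsub>E\<^esub> act C E nabla v f"
  proof (rule V.T_eqI[OF _ _ act_ahom ahom_sum[OF _ act_ahom act_ahom] _ v])
    fix us b assume us: "set us \<subseteq> carrier (Vec C)" "b \<in> carrier A"
    have d: "vpure C us b \<in> vdeg (length us)" by (rule V.tdeg_pure) (use us in auto)
    show "act C E nabla (vpure C us b) (e \<oplus>\<^bsub>E\<^esub> f) = act C E nabla (vpure C us b) e \<oplus>\<^bsub>E\<^esub> act C E nabla (vpure C us b) f"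
      using ef d by (simp add: act_vdeg[OF _ d] ahom_add[OF nabla_pow_ahom] nabla_pow_closed
          ahom_add[OF evd_ahom_right] evd_closed vdeg_carrier ahom_add[OF O.tdown_ahom])
  qed (use ef E.M.abelian_group_axioms in auto)
qed (rule act_closed[OF v])

abbreviation "act1 u e \<equiv> apply_first E u (nabla e)"

lemma act1_closed: "\<lbrakk>u \<in> carrier (Vec C); e \<in> carrier E\<rbrakk> \<Longrightarrow> act1 u e \<in> carrier E"
  by (rule O.apply_first_closed) (auto intro: nabla_closed)

text \<open>One more vector field calls for one more step of \<nabla>. By
  \<open>evd_nabla_step\<close>, w evaluates that step to \<nabla> of the result of w acting on e,
  minus a pairing with \<box>w; contraction with u turns the two terms into those claimed.\<close>

lemma act_vtp:
  assumes u: "u \<in> carrier (Vec C)" and v: "v \<in> carrier (TVec C)" and e: "e \<in> carrier E"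
  shows "act C E nabla (vtp u v) e = act1 u (act C E nabla v e) \<ominus>\<^bsub>E\<^esub> act C E nabla (ap u (boxT C v)) e"
proof (rule V.T_eqI[OF _ _ ahom_comp[OF vtp_ahom act_ahom] ahom_diff[OF _ ahom_comp[OF ahom_comp[OF act_ahom nabla_ahom] O.apply_first_ahom]
        ahom_comp[OF ahom_comp[OF boxT_ahom ap_ahom] act_ahom]] _ v])
  fix us b assume us: "set us \<subseteq> carrier (Vec C)" "b \<in> carrier A"
  define n where "n = length us"
  define w where "w = vpure C us b"
  have w: "w \<in> vdeg n" unfolding w_def n_def by (rule V.tdeg_pure) (use us in auto)
  note wc = vdeg_carrier[OF w]
  define P where "P = nabla_pow C E nabla n e"
  have P: "P \<in> fdeg C E n" unfolding P_def by (rule nabla_pow_deg[OF e])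
  note Pc = O.tdeg_carrier[OF lmE P]
  have nc: "nabla (act C E nabla w e) \<in> fdeg C E (Suc 0)" using nabla_deg[OF act_closed[OF wc e]] by (simp add: One_nat_def)
  have Tc: "boxT C w \<in> carrier TT" "boxT C w \<in> fdeg C (TVec C) (Suc 0)"
    using boxT_closed[OF wc] boxT_deg1[OF wc] by (simp_all add: One_nat_def)
  have pc: "pair E n P (boxT C w) \<in> carrier TE" by (rule pair_closed[OF lmE Pc Tc(1)])
  have a: "ap u (boxT C w) \<in> vdeg n" by (rule ap_deg[OF u w])
  have 1: "octr E u (nabla (act C E nabla w e)) = fpure C E [] (act1 u (act C E nabla w e))"
    by (rule O.ctr_apply_first[OF lmE Vec_rlin[OF u] nc])
  \<comment> \<open>Contraction with u concerns the form leg of \<box>w, evaluation on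
    \<open>P\<close> the vector field leg, so they commute.\<close>
  have 2: "octr E u (pair E n P (boxT C w)) = evd C E n (ap u (boxT C w)) P"
  proof -
    have "octr E u (pair E n P (boxT C w)) = pair E n P (octr (TVec C) u (boxT C w))"
      by (rule O.ctr_tbind[OF lmE _ evd_lhom[OF lmE Pc] Vec_rlin[OF u] Tc(2)]) simp
    also have "octr (TVec C) u (boxT C w) = fpure C (TVec C) [] (ap u (boxT C w))"
      by (rule O.ctr_apply_first[OF _ Vec_rlin[OF u] Tc(2)]) simp
    also have "pair E n P \<dots> = evd C E n (ap u (boxT C w)) P"
      by (rule O.tbind_pure_Nil[OF lmE _ evd_lhom[OF lmE Pc]]) (simp_all add: ap_closed u Tc(1))
    finally show ?thesis .
  qed
  have "act C E nabla (vtp u w) e = tdown E (evd C E (Suc n) (vtp u w) (nabla_step C E nabla P))"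
    using act_vdeg[OF e vtp_deg[OF u w]] e by (simp add: nabla_pow_Suc P_def del: nabla_pow.simps)
  also have "evd C E (Suc n) (vtp u w) (nabla_step C E nabla P) = octr E u (step_eval n w P)"
    using u w Pc by (simp add: evd_vtp ahom_closed[OF nabla_step_ahom] evd_nabla_step[OF w P])
  also have "tdown E (evd C E n w P) = act C E nabla w e"
    unfolding P_def by (rule act_vdeg[OF e w, symmetric])
  also have "tdown E (octr E u (nabla (act C E nabla w e) \<ominus>\<^bsub>TE\<^esub> pair E n P (boxT C w))) =
     act1 u (act C E nabla w e) \<ominus>\<^bsub>E\<^esub> act C E nabla (ap u (boxT C w)) e"
    using u e wc Pc pc nabla_closed[OF act_closed[OF wc e]] act_closed[OF wc e]
    by (simp add: ahom_minus[OF octr_ahom] 1 2 ahom_minus[OF O.tdown_ahom] E.M.abelian_group_axioms pure_Nil_closed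
        act1_closed evd_closed vdeg_carrier[OF a] tdown_pure_Nil act_vdeg[OF e a, folded P_def])
  finally show "act C E nabla (vtp u (vpure C us b)) e =
    act1 u (act C E nabla (vpure C us b) e) \<ominus>\<^bsub>E\<^esub> act C E nabla (ap u (boxT C (vpure C us b))) e"
    unfolding w_def .
qed (use u e E.M.abelian_group_axioms in auto)

lemma act_bullet:
  "\<lbrakk>v \<in> carrier (TVec C); w \<in> carrier (TVec C); e \<in> carrier E\<rbrakk> \<Longrightarrow>
    act C E nabla (bullet C v w) e = act C E nabla v (act C E nabla w e)"
  by (rule multiplicative_if_recursive[where U = act1 and E = E])
    (simp_all add: act_ahom act_smult act_pure_Nil act1_closed act_vtp)

text \<open>The unit as tail in \<open>act_vtp\<close>: the correction is a contraction of \<box>1,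
  which vanishes because d1 = 0.\<close>

lemma act_vpure1:
  assumes "u \<in> carrier (Vec C)" "e \<in> carrier E"
  shows "act C E nabla (vpure C [u] \<one>) e = act1 u e"
proof -
  have o: "vpure C [] \<one> \<in> carrier (TVec C)" by (rule V.pure_closed) auto
  have z: "fpure C (TVec C) [\<zero>] (vpure C [] \<one>) = \<zero>\<^bsub>TT\<^esub>"
  proof -
    have "ahom \<Omega> TT (\<lambda>x. fpure C (TVec C) [x] (vpure C [] \<one>))"
      by (rule ahomI) (use o in \<open>simp_all add: O.pure_closed O.pure1_add\<close>)
    from ahom_zero[OF this] show ?thesis by simp
  qed
  have "act C E nabla (vtp u (vpure C [] \<one>)) e = act1 u (\<one> \<odot>\<^bsub>E\<^esub> e) \<ominus>\<^bsub>E\<^esub> act C E nabla \<zero>\<^bsub>TVec C\<^esub> e"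
    using assms o by (simp add: act_vtp act_pure_Nil boxT_pure_Nil dif_one z ahom_zero[OF ap_ahom])
  also have "\<dots> = act1 u e"
    using assms E.smult_one[of e] act1_closed[OF assms]
    by (simp add: ahom_zero[OF act_ahom] E.M.abelian_group_axioms a_minus_def E.M.r_zero)
  finally show ?thesis using assms by (simp add: V.tp_pure)
qed

end

section \<open>Curvature\<close>

text \<open>Reconciles the sum over pairs in \<open>curv_elem\<close> with the iterated sum that
  arises from applying \<nabla> twice.\<close>

lemma (in abelian_monoid) finsum_Times:
  assumes "finite I" "finite J" "\<And>i j. \<lbrakk>i \<in> I; j \<in> J\<rbrakk> \<Longrightarrow> f i j \<in> carrier G"
  shows "finsum G (\<lambda>(i, j). f i j) (I \<times> J) = finsum G (\<lambda>i. finsum G (f i) J) I"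
  using assms(1,3)
proof (induction I)
  case (insert i I)
  have e: "insert i I \<times> J = Pair i ` J \<union> I \<times> J" by (rule equalityI) auto
  have "finsum G (\<lambda>(i, j). f i j) (insert i I \<times> J) =
      finsum G (\<lambda>(i, j). f i j) (Pair i ` J) \<oplus> finsum G (\<lambda>(i, j). f i j) (I \<times> J)"
    unfolding e by (rule finsum_Un_disjoint) (use insert assms(2) in \<open>auto intro!: equalityI\<close>)
  also have "finsum G (\<lambda>(i, j). f i j) (Pair i ` J) = finsum G (f i) J"
    by (subst finsum_reindex) (use insert in \<open>auto simp: inj_on_def\<close>)
  also have "finsum G (\<lambda>(i, j). f i j) (I \<times> J) = finsum G (\<lambda>i. finsum G (f i) J) I"
    by (rule insert.IH) (use insert in auto)
  also have "finsum G (f i) J \<oplus> finsum G (\<lambda>i. finsum G (f i) J) I = finsum G (\<lambda>i. finsum G (f i) J) (insert i I)"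
    using insert by (subst finsum_insert) (auto intro!: finsum_closed)
  finally show ?case .
qed simp

lemma finsum_minus:
  assumes "abelian_group G" "f \<in> I \<rightarrow> carrier G" "g \<in> I \<rightarrow> carrier G"
  shows "finsum G (\<lambda>i. f i \<ominus>\<^bsub>G\<^esub> g i) I = finsum G f I \<ominus>\<^bsub>G\<^esub> finsum G g I"
proof -
  interpret G: abelian_group G by fact
  have "finsum G (\<lambda>i. \<ominus>\<^bsub>G\<^esub> g i) I = \<ominus>\<^bsub>G\<^esub> finsum G g I"
    by (rule ahom_finsum[OF ahom_uminus[OF assms(1) ahom_id] assms(1,1,3), symmetric])
  then show ?thesis
    unfolding a_minus_def using assms by (subst G.finsum_addf) auto
qed

text \<open>Kept general in the bimodule because it is applied to one-forms, for expanding
  \<nabla>e, and to two-forms, for detecting the curvature.\<close>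

lemma (in bimod) degree_1_expansion:
  fixes k :: nat
  assumes N: "left_module A N"
    and b: "\<And>i. i < k \<Longrightarrow> b i \<in> carrier M" and u: "\<And>i. i < k \<Longrightarrow> rlin A M (u i)"
    and dual: "\<And>x. x \<in> carrier M \<Longrightarrow> x = finsum M (\<lambda>i. b i \<odot>\<^sub>r\<^bsub>M\<^esub> u i x) {..<k}"
    and X: "X \<in> tdeg A M N (Suc 0)"
  shows "X = finsum (T N) (\<lambda>i. pure N [b i] (apply_first N (u i) X)) {..<k}"
proof -
  interpret TN: abelian_group "T N" using N by simp
  have "X = finsum (T N) (\<lambda>i. tprepend A M N [b i] (ctr A M N (u i) X)) {..<k}"
    by (rule ctr_expansion[OF N _ _ _ X]) (rule b u dual; assumption)+
  also have "\<dots> = finsum (T N) (\<lambda>i. pure N [b i] (apply_first N (u i) X)) {..<k}"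
    by (rule TN.finsum_cong')
      (auto simp: ctr_apply_first[OF N _ X] b u tp_pure[OF N] apply_first_closed[OF N] tdeg_carrier[OF N X]
        intro!: pure_closed[OF N])
  finally show ?thesis .
qed

lemma (in dga) a_inv_Form: "x \<in> hpart C n \<Longrightarrow> a_inv (Form C n) x = \<ominus> x"
  by (rule abelian_group.minus_equality[OF Form_ag]) (auto simp: l_neg hp_sub)

text \<open>The inner lift in \<open>curvature\<close>, that is the wedge product with \<xi> from
  the left, named so that its dependence on \<xi> can be studied.\<close>

definition (in module_connection) wedge_first :: "'w \<Rightarrow> ('w, 'e) tensor \<Rightarrow> ('w, 'e) tensor"
  where "wedge_first \<xi> = tlift (tmod (Form C 0) (Form C 2) E) (\<lambda>ys g. case ys of
    [\<eta>] \<Rightarrow> tpure (Form C 0) (Form C 2) E [\<xi> \<otimes> \<eta>] g | _ \<Rightarrow> \<zero>\<^bsub>tmod (Form C 0) (Form C 2) E\<^esub>)"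

context module_connection
begin

abbreviation "P2 \<equiv> tmod A (Form C 2) E"
abbreviation "pure2 \<equiv> tpure A (Form C 2) E"

interpretation P2: left_module A P2 by simp

lemma tbal_wedge_first:
  assumes "\<xi> \<in> hpart C 1"
  shows "tbal A \<Omega> E P2 (\<lambda>ys g. case ys of [\<eta>] \<Rightarrow> pure2 [\<xi> \<otimes> \<eta>] g | _ \<Rightarrow> \<zero>\<^bsub>P2\<^esub>)"
proof (rule O.tbal_single)
  fix \<eta> a g assume "\<eta> \<in> hpart C 1" "a \<in> hpart C 0" "g \<in> carrier E"
  then show "pure2 [\<xi> \<otimes> (\<eta> \<otimes> a)] g = pure2 [\<xi> \<otimes> \<eta>] (a \<odot>\<^bsub>E\<^esub> g)"
    using assms O2.pure1_bal[of E "\<xi> \<otimes> \<eta>" a g] by (simp add: m_assoc hp_sub hp_mult11)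
qed (use assms in \<open>auto intro!: O2.pure_last_ahom simp: r_distr hp_sub hp_mult11 O2.pure1_add\<close>)

lemma wedge_first_ahom: "\<xi> \<in> hpart C 1 \<Longrightarrow> ahom TE P2 (wedge_first \<xi>)"
  unfolding wedge_first_def by (rule O.tlift_ahom[OF _ _ tbal_wedge_first]) simp_all

lemma wedge_first_pure:
  "\<lbrakk>\<xi> \<in> hpart C 1; \<eta> \<in> hpart C 1; g \<in> carrier E\<rbrakk> \<Longrightarrow> wedge_first \<xi> (fpure C E [\<eta>] g) = pure2 [\<xi> \<otimes> \<eta>] g"
  unfolding wedge_first_def by (subst O.tlift_pure[OF _ _ tbal_wedge_first]) simp_all

lemma wedge_first_closed: "\<lbrakk>\<xi> \<in> hpart C 1; Z \<in> carrier TE\<rbrakk> \<Longrightarrow> wedge_first \<xi> Z \<in> carrier P2"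
  by (rule ahom_closed[OF wedge_first_ahom])

lemma wedge_first_add:
  assumes "\<xi> \<in> hpart C 1" "\<zeta> \<in> hpart C 1" "Z \<in> fdeg C E 1"
  shows "wedge_first (\<xi> \<oplus> \<zeta>) Z = wedge_first \<xi> Z \<oplus>\<^bsub>P2\<^esub> wedge_first \<zeta> Z"
  by (rule deg1_eqI[OF _ _ wedge_first_ahom ahom_sum[OF _ wedge_first_ahom wedge_first_ahom] assms(3)])
    (use assms in \<open>simp_all add: wedge_first_pure l_distr hp_sub hp_mult11 O2.pure1_add\<close>)

lemma wedge_first_bal:
  assumes "\<xi> \<in> hpart C 1" "a \<in> hpart C 0" "Z \<in> fdeg C E 1"
  shows "wedge_first (\<xi> \<otimes> a) Z = wedge_first \<xi> (a \<odot>\<^bsub>TE\<^esub> Z)"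
  by (rule deg1_eqI[OF _ _ wedge_first_ahom ahom_comp[OF O.smult_ahom wedge_first_ahom] assms(3)])
    (use assms in \<open>simp_all add: wedge_first_pure O.smult_pure_Cons m_assoc hp_sub\<close>)

abbreviation "curv_word \<equiv> (\<lambda>xs f. case xs of
  [\<xi>] \<Rightarrow> pure2 [dif C \<xi>] f \<ominus>\<^bsub>P2\<^esub> wedge_first \<xi> (nabla f) | _ \<Rightarrow> \<zero>\<^bsub>P2\<^esub>)"

lemma curvature_wedge_first: "curvature C E nabla e = tlift P2 curv_word (nabla e)"
  unfolding curvature_def wedge_first_def Let_def ..

lemma pure2_diff:
  assumes "x \<in> hpart C 2" "y \<in> hpart C 2" "f \<in> carrier E"
  shows "pure2 [x \<ominus> y] f = pure2 [x] f \<ominus>\<^bsub>P2\<^esub> pure2 [y] f"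
proof -
  have "ahom (Form C 2) P2 (\<lambda>x. pure2 [x] f)"
    by (rule ahomI) (use assms in \<open>simp_all add: O2.pure_closed O2.pure1_add\<close>)
  from ahom_minus[OF this] show ?thesis
    using assms by (simp add: a_minus_def a_inv_Form)
qed

text \<open>Neither d\<xi> \<otimes> f nor \<xi> \<and> \<nabla>f is balanced on its own. Both fail
  by \<xi> \<and> da \<otimes> f, the first through the sign in the graded Leibniz rule and the
  second through the Leibniz rule of \<nabla>, so their difference is balanced.\<close>

lemma tbal_curv_word: "tbal A \<Omega> E P2 curv_word"
proof (rule O.tbal_single)
  fix \<xi> assume "\<xi> \<in> hpart C 1"
  then show "ahom E P2 (\<lambda>f. pure2 [dif C \<xi>] f \<ominus>\<^bsub>P2\<^esub> wedge_first \<xi> (nabla f))"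
    by (intro ahom_diff ahom_comp[OF nabla_ahom wedge_first_ahom] O2.pure_last_ahom) simp_all
next
  fix \<xi> \<zeta> f assume "\<xi> \<in> hpart C 1" "\<zeta> \<in> hpart C 1" "f \<in> carrier E"
  then show "pure2 [dif C (\<xi> \<oplus> \<zeta>)] f \<ominus>\<^bsub>P2\<^esub> wedge_first (\<xi> \<oplus> \<zeta>) (nabla f) =
    pure2 [dif C \<xi>] f \<ominus>\<^bsub>P2\<^esub> wedge_first \<xi> (nabla f) \<oplus>\<^bsub>P2\<^esub> (pure2 [dif C \<zeta>] f \<ominus>\<^bsub>P2\<^esub> wedge_first \<zeta> (nabla f))"
    by (simp add: dif_add hp_sub O2.pure1_add wedge_first_add nabla_deg O2.pure_closed wedge_first_closed nabla_closed
        a_minus_def P2.M.minus_add P2.M.a_ac)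
next
  fix \<xi> a f assume *: "\<xi> \<in> hpart C 1" "a \<in> hpart C 0" "f \<in> carrier E"
  have 1: "pure2 [dif C (\<xi> \<otimes> a)] f = pure2 [dif C \<xi>] (a \<odot>\<^bsub>E\<^esub> f) \<ominus>\<^bsub>P2\<^esub> pure2 [\<xi> \<otimes> dif C a] f"
    using * O2.pure1_bal[of E "dif C \<xi>" a f] by (simp add: leibniz1 pure2_diff hp_mult11)
  have 2: "wedge_first \<xi> (nabla (a \<odot>\<^bsub>E\<^esub> f)) = pure2 [\<xi> \<otimes> dif C a] f \<oplus>\<^bsub>P2\<^esub> wedge_first (\<xi> \<otimes> a) (nabla f)"
    using * by (simp add: nabla_smult ahom_add[OF wedge_first_ahom] O.pure_closed TE.smult_closed nabla_closed
        wedge_first_pure wedge_first_bal nabla_deg)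
  show "pure2 [dif C (\<xi> \<otimes> a)] f \<ominus>\<^bsub>P2\<^esub> wedge_first (\<xi> \<otimes> a) (nabla f) =
    pure2 [dif C \<xi>] (a \<odot>\<^bsub>E\<^esub> f) \<ominus>\<^bsub>P2\<^esub> wedge_first \<xi> (nabla (a \<odot>\<^bsub>E\<^esub> f))"
    unfolding 1 2 using *
    by (simp add: a_minus_def P2.M.minus_add P2.M.a_assoc O2.pure_closed hp_mult11 wedge_first_closed nabla_closed)
qed simp_all

lemma curv_lift_ahom: "ahom TE P2 (tlift P2 curv_word)"
  by (rule O.tlift_ahom[OF _ _ tbal_curv_word]) simp_all

lemma curv_lift_pure:
  "\<lbrakk>\<xi> \<in> hpart C 1; f \<in> carrier E\<rbrakk> \<Longrightarrow> tlift P2 curv_word (fpure C E [\<xi>] f) = pure2 [dif C \<xi>] f \<ominus>\<^bsub>P2\<^esub> wedge_first \<xi> (nabla f)"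
  by (subst O.tlift_pure[OF _ _ tbal_curv_word]) simp_all

lemma wedge_first_deg:
  assumes \<xi>: "\<xi> \<in> hpart C 1" and Z: "Z \<in> fdeg C E 1"
  shows "wedge_first \<xi> Z \<in> tdeg A (Form C 2) E (Suc 0)"
proof (rule O.tdeg_ahom[OF _ _ wedge_first_ahom[OF \<xi>] O2.tdeg_aspan[symmetric] _ Z])
  fix xs y assume "set xs \<subseteq> hpart C 1" "y \<in> carrier E" "length xs = 1"
  then show "wedge_first \<xi> (fpure C E xs y) \<in> tdeg A (Form C 2) E (Suc 0)"
    using \<xi> by (elim length_1E) (auto simp: wedge_first_pure hp_mult11 intro!: O2.tdeg_pure)
qed simp_all

lemma curvature_deg:
  assumes "e \<in> carrier E" shows "curvature C E nabla e \<in> tdeg A (Form C 2) E (Suc 0)"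
  unfolding curvature_wedge_first
proof (rule O.tdeg_ahom[OF _ _ curv_lift_ahom O2.tdeg_aspan[symmetric] _ nabla_deg[OF assms]])
  fix xs y assume "set xs \<subseteq> hpart C 1" "y \<in> carrier E" "length xs = 1"
  then show "tlift P2 curv_word (fpure C E xs y) \<in> tdeg A (Form C 2) E (Suc 0)"
    by (elim length_1E) (auto simp: curv_lift_pure intro!: O2.tdeg_minus O2.tdeg_pure wedge_first_deg nabla_deg)
qed simp_all

lemma deg1_expand:
  assumes "X \<in> fdeg C E 1"
  shows "X = finsum TE (\<lambda>i. fpure C E [bform C i] (apply_first E (bvec C i) X)) {..<bn C}"
  by (rule O.degree_1_expansion) (use assms dual_Form in \<open>auto intro: deg1_Suc\<close>)

lemma nabla_expand: "e \<in> carrier E \<Longrightarrow> nabla e = finsum TE (\<lambda>i. fpure C E [bform C i] (act1 (bvec C i) e)) {..<bn C}"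
  by (rule deg1_expand[OF nabla_deg])

context
  fixes \<alpha>
  assumes \<alpha>: "\<alpha> \<in> rhom A (Form C 2) A"
begin

private lemma \<alpha>l: "rlin A (Form C 2) \<alpha>"
  by (rule rlin_rhom[OF \<alpha>])

private lemma \<alpha>c: "\<omega> \<in> hpart C 2 \<Longrightarrow> \<alpha> \<omega> \<in> hpart C 0"
  using rlin_closed[OF \<alpha>l] by simp

private lemma \<alpha>_ahom: "ahom P2 E (apply_first E \<alpha>)"
  by (rule O2.apply_first_ahom[OF lmE \<alpha>l])

private lemma \<alpha>_pure: "\<lbrakk>\<omega> \<in> hpart C 2; f \<in> carrier E\<rbrakk> \<Longrightarrow> apply_first E \<alpha> (pure2 [\<omega>] f) = \<alpha> \<omega> \<odot>\<^bsub>E\<^esub> f"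
  by (rule O2.apply_first_pure[OF lmE \<alpha>l])

lemma apply_first_wedge:
  assumes "\<xi> \<in> hpart C 1" "f \<in> carrier E"
  shows "apply_first E \<alpha> (wedge_first \<xi> (nabla f)) =
    finsum E (\<lambda>j. \<alpha> (\<xi> \<otimes> bform C j) \<odot>\<^bsub>E\<^esub> act1 (bvec C j) f) {..<bn C}"
proof -
  have "apply_first E \<alpha> (wedge_first \<xi> (nabla f)) =
    apply_first E \<alpha> (wedge_first \<xi> (finsum TE (\<lambda>j. fpure C E [bform C j] (act1 (bvec C j) f)) {..<bn C}))"
    using nabla_expand[OF assms(2)] by simp
  also have "\<dots> = finsum E (\<lambda>j. apply_first E \<alpha> (wedge_first \<xi> (fpure C E [bform C j] (act1 (bvec C j) f)))) {..<bn C}"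
    by (rule ahom_finsum[OF ahom_comp[OF wedge_first_ahom[OF assms(1)] \<alpha>_ahom]])
      (use assms E.M.abelian_group_axioms in \<open>auto intro!: O.pure_closed act1_closed\<close>)
  also have "\<dots> = finsum E (\<lambda>j. \<alpha> (\<xi> \<otimes> bform C j) \<odot>\<^bsub>E\<^esub> act1 (bvec C j) f) {..<bn C}"
    by (rule E.M.finsum_cong') (use assms in \<open>auto simp: wedge_first_pure act1_closed \<alpha>_pure hp_mult11 \<alpha>c\<close>)
  finally show ?thesis .
qed

text \<open>The expansion of \<nabla> in the dual basis is inserted twice, for \<nabla>e and for the
  \<nabla> inside the wedge product; this brings the curvature into the shape of
  \<open>curv_elem\<close>.\<close>

lemma apply_first_curvature:
  assumes e: "e \<in> carrier E"
  shows "apply_first E \<alpha> (curvature C E nabla e) =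
    finsum E (\<lambda>i. \<alpha> (dif C (bform C i)) \<odot>\<^bsub>E\<^esub> act1 (bvec C i) e) {..<bn C} \<ominus>\<^bsub>E\<^esub>
    finsum E (\<lambda>i. finsum E (\<lambda>j. \<alpha> (bform C i \<otimes> bform C j) \<odot>\<^bsub>E\<^esub> act1 (bvec C j) (act1 (bvec C i) e)) {..<bn C}) {..<bn C}"
proof -
  have "apply_first E \<alpha> (curvature C E nabla e) =
    apply_first E \<alpha> (tlift P2 curv_word (finsum TE (\<lambda>i. fpure C E [bform C i] (act1 (bvec C i) e)) {..<bn C}))"
    unfolding curvature_wedge_first using nabla_expand[OF e] by simp
  also have "\<dots> = finsum E (\<lambda>i. apply_first E \<alpha> (tlift P2 curv_word (fpure C E [bform C i] (act1 (bvec C i) e)))) {..<bn C}"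
    by (rule ahom_finsum[OF ahom_comp[OF curv_lift_ahom \<alpha>_ahom]])
      (use e E.M.abelian_group_axioms in \<open>auto intro!: O.pure_closed act1_closed\<close>)
  also have "\<dots> = finsum E (\<lambda>i. \<alpha> (dif C (bform C i)) \<odot>\<^bsub>E\<^esub> act1 (bvec C i) e \<ominus>\<^bsub>E\<^esub>
    finsum E (\<lambda>j. \<alpha> (bform C i \<otimes> bform C j) \<odot>\<^bsub>E\<^esub> act1 (bvec C j) (act1 (bvec C i) e)) {..<bn C}) {..<bn C}"
    by (rule E.M.finsum_cong')
      (use e E.M.abelian_group_axioms in \<open>auto simp: curv_lift_pure act1_closed ahom_minus[OF \<alpha>_ahom] O2.pure_closed
        wedge_first_closed nabla_closed \<alpha>_pure apply_first_wedge \<alpha>c hp_mult11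
        intro!: E.M.minus_closed E.M.finsum_closed\<close>)
  also have "\<dots> = finsum E (\<lambda>i. \<alpha> (dif C (bform C i)) \<odot>\<^bsub>E\<^esub> act1 (bvec C i) e) {..<bn C} \<ominus>\<^bsub>E\<^esub>
    finsum E (\<lambda>i. finsum E (\<lambda>j. \<alpha> (bform C i \<otimes> bform C j) \<odot>\<^bsub>E\<^esub> act1 (bvec C j) (act1 (bvec C i) e)) {..<bn C}) {..<bn C}"
    by (rule finsum_minus[OF E.M.abelian_group_axioms])
      (use e in \<open>auto simp: act1_closed \<alpha>c hp_mult11 intro!: E.M.finsum_closed\<close>)
  finally show ?thesis .
qed

private abbreviation (input) "vb i \<equiv> vpure C [bvec C i] \<one>"

private lemma vb: "i < bn C \<Longrightarrow> vb i \<in> carrier (TVec C)"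
  by (rule V.pure_closed) auto

lemma curv_hat_eq:
  "curv_hat C \<alpha> = finsum (TVec C) (\<lambda>i. \<alpha> (dif C (bform C i)) \<odot>\<^bsub>TVec C\<^esub> vb i) {..<bn C} \<ominus>\<^bsub>TVec C\<^esub>
    finsum (TVec C) (\<lambda>(i, j). \<alpha> (bform C i \<otimes> bform C j) \<odot>\<^bsub>TVec C\<^esub> bullet C (vb j) (vb i)) ({..<bn C} \<times> {..<bn C})"
proof -
  let ?P = "tmod A (Form C 2) (TVec C)"
  let ?p = "tpure A (Form C 2) (TVec C)"
  interpret P: left_module A ?P by simp
  have h: "ahom ?P (TVec C) (apply_first (TVec C) \<alpha>)" by (rule O2.apply_first_ahom[OF _ \<alpha>l]) simp
  have p: "apply_first (TVec C) \<alpha> (?p [\<omega>] w) = \<alpha> \<omega> \<odot>\<^bsub>TVec C\<^esub> w" if "\<omega> \<in> hpart C 2" "w \<in> carrier (TVec C)" for \<omega> w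
    by (rule O2.apply_first_pure[OF _ \<alpha>l]) (use that in auto)
  let ?s1 = "\<lambda>i. ?p [dif C (bform C i)] (vb i)"
  let ?s2 = "\<lambda>(i, j). ?p [bform C i \<otimes> bform C j] (bullet C (vb j) (vb i))"
  have c1: "?s1 \<in> {..<bn C} \<rightarrow> carrier ?P" by (auto intro!: O2.pure_closed vb)
  have c2: "?s2 \<in> {..<bn C} \<times> {..<bn C} \<rightarrow> carrier ?P"
    by (auto intro!: O2.pure_closed vb bullet_closed hp_mult11)
  have "curv_hat C \<alpha> = apply_first (TVec C) \<alpha> (finsum ?P ?s1 {..<bn C}) \<ominus>\<^bsub>TVec C\<^esub>
     apply_first (TVec C) \<alpha> (finsum ?P ?s2 ({..<bn C} \<times> {..<bn C}))"
    unfolding curv_hat_def curv_elem_def Let_def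
    by (rule ahom_minus[OF h]) (use c1 c2 in \<open>auto intro!: P.M.finsum_closed\<close>)
  also have "apply_first (TVec C) \<alpha> (finsum ?P ?s1 {..<bn C}) = finsum (TVec C) (\<lambda>i. apply_first (TVec C) \<alpha> (?s1 i)) {..<bn C}"
    by (rule ahom_finsum[OF h _ _ c1]) simp_all
  also have "\<dots> = finsum (TVec C) (\<lambda>i. \<alpha> (dif C (bform C i)) \<odot>\<^bsub>TVec C\<^esub> vb i) {..<bn C}"
    by (rule TW.M.finsum_cong') (auto simp: p vb \<alpha>c intro!: TW.smult_closed)
  also have "apply_first (TVec C) \<alpha> (finsum ?P ?s2 ({..<bn C} \<times> {..<bn C})) =
     finsum (TVec C) (\<lambda>ij. apply_first (TVec C) \<alpha> (?s2 ij)) ({..<bn C} \<times> {..<bn C})"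
    by (rule ahom_finsum[OF h _ _ c2]) simp_all
  also have "\<dots> = finsum (TVec C) (\<lambda>(i, j). \<alpha> (bform C i \<otimes> bform C j) \<odot>\<^bsub>TVec C\<^esub> bullet C (vb j) (vb i)) ({..<bn C} \<times> {..<bn C})"
    by (rule TW.M.finsum_cong') (auto simp: p vb \<alpha>c hp_mult11 bullet_closed intro!: TW.smult_closed)
  finally show ?thesis .
qed

lemma curv_hat_closed: "curv_hat C \<alpha> \<in> carrier (TVec C)"
  unfolding curv_hat_eq
  by (intro TW.M.minus_closed TW.M.finsum_closed) (auto simp: vb \<alpha>c hp_mult11 bullet_closed intro!: TW.smult_closed)

text \<open>The order of the factors matters: u_j \<bullet> u_i acts by u_i first, as does the
  curvature, where u_i comes from \<nabla>e and u_j from the second \<nabla>. This agrees with the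
  order \<xi>_i \<and> \<xi>_j of the forms.\<close>

lemma act_curv_hat:
  assumes e: "e \<in> carrier E"
  shows "act C E nabla (curv_hat C \<alpha>) e = apply_first E \<alpha> (curvature C E nabla e)"
proof -
  let ?t1 = "\<lambda>i. \<alpha> (dif C (bform C i)) \<odot>\<^bsub>TVec C\<^esub> vb i"
  let ?t2 = "\<lambda>(i, j). \<alpha> (bform C i \<otimes> bform C j) \<odot>\<^bsub>TVec C\<^esub> bullet C (vb j) (vb i)"
  have c1: "?t1 \<in> {..<bn C} \<rightarrow> carrier (TVec C)" by (auto simp: vb \<alpha>c intro!: TW.smult_closed)
  have c2: "?t2 \<in> {..<bn C} \<times> {..<bn C} \<rightarrow> carrier (TVec C)"
    by (auto simp: vb \<alpha>c hp_mult11 bullet_closed intro!: TW.smult_closed)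
  note h = act_ahom[OF e]
  have "act C E nabla (curv_hat C \<alpha>) e =
    act C E nabla (finsum (TVec C) ?t1 {..<bn C}) e \<ominus>\<^bsub>E\<^esub> act C E nabla (finsum (TVec C) ?t2 ({..<bn C} \<times> {..<bn C})) e"
    unfolding curv_hat_eq
    by (rule ahom_minus[OF h]) (use c1 c2 E.M.abelian_group_axioms in \<open>auto intro!: TW.M.finsum_closed\<close>)
  also have "act C E nabla (finsum (TVec C) ?t1 {..<bn C}) e = finsum E (\<lambda>i. act C E nabla (?t1 i) e) {..<bn C}"
    by (rule ahom_finsum[OF h _ _ c1]) (simp_all add: E.M.abelian_group_axioms)
  also have "\<dots> = finsum E (\<lambda>i. \<alpha> (dif C (bform C i)) \<odot>\<^bsub>E\<^esub> act1 (bvec C i) e) {..<bn C}"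
    by (rule E.M.finsum_cong') (use e in \<open>auto simp: act_smult act_vpure1 vb \<alpha>c act1_closed\<close>)
  also have "act C E nabla (finsum (TVec C) ?t2 ({..<bn C} \<times> {..<bn C})) e =
    finsum E (\<lambda>ij. act C E nabla (?t2 ij) e) ({..<bn C} \<times> {..<bn C})"
    by (rule ahom_finsum[OF h _ _ c2]) (simp_all add: E.M.abelian_group_axioms)
  also have "\<dots> = finsum E (\<lambda>(i, j). \<alpha> (bform C i \<otimes> bform C j) \<odot>\<^bsub>E\<^esub> act1 (bvec C j) (act1 (bvec C i) e)) ({..<bn C} \<times> {..<bn C})"
    by (rule E.M.finsum_cong')
      (use e in \<open>auto simp: act_smult act_bullet act_vpure1 vb \<alpha>c hp_mult11 bullet_closed act1_closed\<close>)
  also have "\<dots> = finsum E (\<lambda>i. finsum E (\<lambda>j. \<alpha> (bform C i \<otimes> bform C j) \<odot>\<^bsub>E\<^esub> act1 (bvec C j) (act1 (bvec C i) e)) {..<bn C}) {..<bn C}"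
    by (rule E.M.finsum_Times) (use e in \<open>auto simp: \<alpha>c hp_mult11 act1_closed\<close>)
  finally show ?thesis unfolding apply_first_curvature[OF e] .
qed

end

text \<open>A direct summand of a free module has a dual basis, consisting of projected unit vectors
  and coordinate functionals. Expanding the two-form factor of \<open>X\<close> in it leaves
  coefficients of the kind assumed to vanish.\<close>

lemma fgp_separates:
  assumes "fgp_right A (Form C 2)" and X: "X \<in> tdeg A (Form C 2) E (Suc 0)"
    and zero: "\<And>\<alpha>. \<alpha> \<in> rhom A (Form C 2) A \<Longrightarrow> apply_first E \<alpha> X = \<zero>\<^bsub>E\<^esub>"
  shows "X = \<zero>\<^bsub>P2\<^esub>"
proof -
  obtain n i p where i: "i \<in> rhom A (Form C 2) (free_mod A n)"
    and p: "p \<in> rhom A (free_mod A n) (Form C 2)"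
    and pi: "\<And>x. x \<in> hpart C 2 \<Longrightarrow> p (i x) = x"
    using assms(1) by (auto simp: fgp_right_def)
  \<comment> \<open>The dual basis obtained from the splitting: \<open>b k\<close> is the image of
    the k-th unit vector, and \<open>a k\<close> below is the k-th coordinate, restricted so as to
    be extensional as \<open>rhom\<close> demands.\<close>
  define b where "b k = p (\<lambda>j\<in>{..<n}. if j = k then \<one> else \<zero>)" for k
  define a where "a k = (\<lambda>\<omega>\<in>hpart C 2. i \<omega> k)" for k
  have ic: "i \<omega> \<in> {..<n} \<rightarrow>\<^sub>E hpart C 0" if "\<omega> \<in> hpart C 2" for \<omega>
    using i that by (auto simp: rhom_def free_mod_def)
  have ia: "i (x \<oplus> y) = (\<lambda>k\<in>{..<n}. i x k \<oplus> i y k)" if "x \<in> hpart C 2" "y \<in> hpart C 2" for x y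
    using i that by (auto simp: rhom_def free_mod_def)
  have ir: "i (x \<otimes> c) = (\<lambda>k\<in>{..<n}. i x k \<otimes> c)" if "x \<in> hpart C 2" "c \<in> hpart C 0" for x c
    using i that by (auto simp: rhom_def free_mod_def)
  have pc: "p x \<in> hpart C 2" if "x \<in> {..<n} \<rightarrow>\<^sub>E hpart C 0" for x
    using p that by (auto simp: rhom_def free_mod_def)
  have pa: "p (\<lambda>k\<in>{..<n}. x k \<oplus> y k) = p x \<oplus> p y" if "x \<in> {..<n} \<rightarrow>\<^sub>E hpart C 0" "y \<in> {..<n} \<rightarrow>\<^sub>E hpart C 0" for x y
    using p that by (auto simp: rhom_def free_mod_def)
  have pr: "p (\<lambda>k\<in>{..<n}. x k \<otimes> c) = p x \<otimes> c" if "x \<in> {..<n} \<rightarrow>\<^sub>E hpart C 0" "c \<in> hpart C 0" for x c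
    using p that by (auto simp: rhom_def free_mod_def)
  have al: "a k \<in> rhom A (Form C 2) A" if "k < n" for k
    using that ic ia ir by (auto simp: rhom_def a_def PiE_iff)
  have bc: "b k \<in> hpart C 2" for k
    unfolding b_def by (rule pc) auto
  \<comment> \<open>Additivity of \<open>p\<close> is available for two summands only, so the vector
    \<open>x\<close> is built up by truncations, each adding one coordinate.\<close>
  have sum: "p (\<lambda>j\<in>{..<n}. if j < m then x j else \<zero>) = finsum C (\<lambda>k. b k \<otimes> x k) {..<m}"
    if x: "x \<in> {..<n} \<rightarrow>\<^sub>E hpart C 0" and "m \<le> n" for x m
    using \<open>m \<le> n\<close>
  proof (induction m)
    case 0
    have z: "(\<lambda>j\<in>{..<n}. \<zero>) \<in> {..<n} \<rightarrow>\<^sub>E hpart C 0" by auto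
    have "(\<lambda>k\<in>{..<n}. (\<lambda>j\<in>{..<n}. \<zero>) k \<oplus> (\<lambda>j\<in>{..<n}. \<zero>) k) = (\<lambda>j\<in>{..<n}. \<zero>)"
      by (rule restrict_ext) simp
    then have "p (\<lambda>j\<in>{..<n}. \<zero>) \<oplus> p (\<lambda>j\<in>{..<n}. \<zero>) = p (\<lambda>j\<in>{..<n}. \<zero>)"
      using pa[OF z z] by simp
    then have "p (\<lambda>j\<in>{..<n}. \<zero>) = \<zero>" by (rule double_zero[OF hp_sub[OF pc[OF z]]])
    moreover have "(\<lambda>j\<in>{..<n}. if j < 0 then x j else \<zero>) = (\<lambda>j\<in>{..<n}. \<zero>)" by (rule restrict_ext) simp
    ultimately show ?case by (simp del: restrict_apply)
  next
    case (Suc m)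
    have xm: "x m \<in> hpart C 0" using Suc.prems x by (auto simp: PiE_iff)
    have s: "(\<lambda>j\<in>{..<n}. if j < m then x j else \<zero>) \<in> {..<n} \<rightarrow>\<^sub>E hpart C 0" using x by (auto simp: PiE_iff)
    have d: "(\<lambda>j\<in>{..<n}. if j = m then \<one> else \<zero>) \<in> {..<n} \<rightarrow>\<^sub>E hpart C 0" by auto
    have dm: "(\<lambda>j\<in>{..<n}. (\<lambda>j\<in>{..<n}. if j = m then \<one> else \<zero>) j \<otimes> x m) \<in> {..<n} \<rightarrow>\<^sub>E hpart C 0" using xm d by auto
    have "(\<lambda>j\<in>{..<n}. if j < Suc m then x j else \<zero>) =
      (\<lambda>j\<in>{..<n}. (\<lambda>j\<in>{..<n}. if j < m then x j else \<zero>) j \<oplus> (\<lambda>j\<in>{..<n}. (\<lambda>j\<in>{..<n}. if j = m then \<one> else \<zero>) j \<otimes> x m) j)"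
      using xm x by (intro restrict_ext) (auto simp: hp_sub PiE_iff less_Suc_eq)
    then have "p (\<lambda>j\<in>{..<n}. if j < Suc m then x j else \<zero>) =
      p (\<lambda>j\<in>{..<n}. if j < m then x j else \<zero>) \<oplus> p (\<lambda>j\<in>{..<n}. (\<lambda>j\<in>{..<n}. if j = m then \<one> else \<zero>) j \<otimes> x m)"
      using pa[OF s dm] by argo
    also have "\<dots> = finsum C (\<lambda>k. b k \<otimes> x k) {..<m} \<oplus> b m \<otimes> x m"
      unfolding pr[OF d xm] Suc.IH[OF Suc_leD[OF Suc.prems]] b_def ..
    also have "\<dots> = finsum C (\<lambda>k. b k \<otimes> x k) {..<Suc m}"
    proof -
      have c: "b k \<otimes> x k \<in> carrier C" if "k \<le> m" for k
        by (rule hp_sub[of _ 2], rule hp_mult0r[OF bc]) (use that Suc.prems x in \<open>auto simp: PiE_iff\<close>)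
      then have "finsum C (\<lambda>k. b k \<otimes> x k) (insert m {..<m}) = b m \<otimes> x m \<oplus> finsum C (\<lambda>k. b k \<otimes> x k) {..<m}"
        by (intro finsum_insert) auto
      moreover have "finsum C (\<lambda>k. b k \<otimes> x k) {..<m} \<in> carrier C" using c by (intro finsum_closed) auto
      ultimately show ?thesis using c[of m] by (simp add: lessThan_Suc a_comm)
    qed
    finally show ?case .
  qed
  have dual: "x = finsum (Form C 2) (\<lambda>k. b k \<otimes> a k x) {..<n}" if x: "x \<in> hpart C 2" for x
  proof -
    have "(\<lambda>j\<in>{..<n}. if j < n then i x j else \<zero>) = i x"
      using ic[OF x] by (auto simp: PiE_iff extensional_def)
    then have "x = finsum C (\<lambda>k. b k \<otimes> i x k) {..<n}"
      using sum[OF ic[OF x] order_refl] pi[OF x] by simp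
    also have "\<dots> = finsum (Form C 2) (\<lambda>k. b k \<otimes> a k x) {..<n}"
      using x ic[OF x] by (subst finsum_Form) (auto simp: a_def bc PiE_iff)
    finally show ?thesis .
  qed
  have "X = finsum P2 (\<lambda>k. pure2 [b k] (apply_first E (a k) X)) {..<n}"
    by (rule O2.degree_1_expansion[OF lmE _ _ _ X]) (use bc al rlin_rhom dual in auto)
  also have "\<dots> = finsum P2 (\<lambda>k. \<zero>\<^bsub>P2\<^esub>) {..<n}"
    by (rule P2.M.finsum_cong')
      (auto simp: zero al ahom_zero[OF O2.pure_last_ahom] bc E.M.abelian_group_axioms)
  finally show ?thesis by simp
qed

section \<open>Actions of the algebra of differential operators\<close>

interpretation R: ring "TVec_alg C" by (rule ring_TVec_alg)

lemma curv_hat_image: "curv_hat C ` rhom A (Form C 2) A \<subseteq> carrier (TVec_alg C)"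
  using curv_hat_closed by auto

lemma W_ideal_ideal: "ideal (W_ideal C) (TVec_alg C)"
  unfolding W_ideal_def by (rule R.genideal_ideal[OF curv_hat_image])

interpretation W: ideal "W_ideal C" "TVec_alg C" by (rule W_ideal_ideal)

text \<open>Multiplicativity of the action makes the annihilator stable on both sides; for
  multiplication on the right by v one uses that v maps E into E, for the left that v maps zero to
  zero. Minimality of the generated ideal then reduces statements about \<open>W_ideal\<close> to
  its generators.\<close>

lemma ideal_annihilator: "ideal {v \<in> carrier (TVec C). \<forall>e\<in>carrier E. act C E nabla v e = \<zero>\<^bsub>E\<^esub>} (TVec_alg C)"
    (is "ideal ?I _")
proof (rule idealI[OF ring_TVec_alg])
  have inv: "a_inv (TVec_alg C) v = \<ominus>\<^bsub>TVec C\<^esub> v" if "v \<in> carrier (TVec C)" for v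
    using that by (intro R.minus_equality) (auto simp: TW.M.l_neg)
  show "subgroup ?I (add_monoid (TVec_alg C))"
  proof (rule group.subgroupI)
    show "group (add_monoid (TVec_alg C))" by (rule R.a_group)
    have "\<zero>\<^bsub>TVec C\<^esub> \<in> ?I" by (simp add: ahom_zero[OF act_ahom] E.M.abelian_group_axioms)
    then show "?I \<noteq> {}" by blast
  next
    fix v assume "v \<in> ?I"
    then show "inv\<^bsub>add_monoid (TVec_alg C)\<^esub> v \<in> ?I"
      using inv[of v] ahom_neg[OF act_ahom] E.M.abelian_group_axioms by (simp add: a_inv_def)
  qed (auto simp: ahom_add[OF act_ahom])
qed (auto simp: act_bullet bullet_closed act_closed ahom_zero[OF act_ahom_right E.M.abelian_group_axioms E.M.abelian_group_axioms])

lemma act_W_ideal: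
  assumes "zero_curvature C E nabla" "v \<in> W_ideal C" "e \<in> carrier E"
  shows "act C E nabla v e = \<zero>\<^bsub>E\<^esub>"
proof -
  have "curv_hat C \<alpha> \<in> {v \<in> carrier (TVec C). \<forall>e\<in>carrier E. act C E nabla v e = \<zero>\<^bsub>E\<^esub>}"
    if "\<alpha> \<in> rhom A (Form C 2) A" for \<alpha>
    using that assms(1) ahom_zero[OF O2.apply_first_ahom[OF lmE rlin_rhom[OF that]]] E.M.abelian_group_axioms
    by (simp add: act_curv_hat curv_hat_closed zero_curvature_def)
  then have "W_ideal C \<subseteq> {v \<in> carrier (TVec C). \<forall>e\<in>carrier E. act C E nabla v e = \<zero>\<^bsub>E\<^esub>}"
    unfolding W_ideal_def by (intro R.genideal_minimal[OF ideal_annihilator]) auto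
  then show ?thesis using assms(2,3) by blast
qed

lemma D_alg_carrier: "carrier (D_alg C) = {D_class C v | v. v \<in> carrier (TVec C)}"
  by (auto simp: D_alg_def D_class_def FactRing_def A_RCOSETS_def' intro!: equalityI)

lemma D_alg_sel:
  "v \<in> carrier (TVec C) \<Longrightarrow> w \<in> carrier (TVec C) \<Longrightarrow> D_class C v \<oplus>\<^bsub>D_alg C\<^esub> D_class C w = D_class C (v \<oplus>\<^bsub>TVec C\<^esub> w)"
  "v \<in> carrier (TVec C) \<Longrightarrow> w \<in> carrier (TVec C) \<Longrightarrow> D_class C v \<otimes>\<^bsub>D_alg C\<^esub> D_class C w = D_class C (bullet C v w)"
  "\<one>\<^bsub>D_alg C\<^esub> = D_class C (vpure C [] \<one>)"
  using W.a_rcos_sum[of v w] W.rcoset_mult_add[of v w]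
  by (auto simp: D_alg_def D_class_def FactRing_simps)

lemma ring_D_alg: "ring (D_alg C)"
  unfolding D_alg_def by (rule W.quotient_is_ring)

lemma D_action_if_zero_curvature:
  assumes Z: "zero_curvature C E nabla"
  shows "defines_D_action C E nabla"
proof -
  \<comment> \<open>The choice is harmless: representatives differ by an element of
    \<open>W_ideal\<close>, which acts by zero.\<close>
  define f where "f X e = act C E nabla (SOME v. v \<in> X) e" for X e
  have f: "f (D_class C v) e = act C E nabla v e" if v: "v \<in> carrier (TVec C)" and e: "e \<in> carrier E" for v e
  proof -
    have "v \<in> D_class C v" unfolding D_class_def using W.a_rcos_self[of v] v by simp
    then have "(SOME v'. v' \<in> D_class C v) \<in> D_class C v" by (rule someI)
    then obtain w where w: "w \<in> W_ideal C" "(SOME v'. v' \<in> D_class C v) = w \<oplus>\<^bsub>TVec C\<^esub> v"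
      unfolding D_class_def by (auto simp: a_r_coset_def')
    have wc: "w \<in> carrier (TVec C)" using W.Icarr[OF w(1)] by simp
    show ?thesis
      unfolding f_def w(2) using v e wc by (simp add: ahom_add[OF act_ahom] act_W_ideal[OF Z w(1)] act_closed)
  qed
  have "left_module (D_alg C) (with_action E f)"
  proof (intro left_module.intro left_module_axioms.intro)
    show "ring (D_alg C)" by (rule ring_D_alg)
    show "abelian_group (with_action E f)"
    proof (rule abelian_groupI)
      fix x assume "x \<in> carrier (with_action E f)"
      then show "\<exists>y\<in>carrier (with_action E f). y \<oplus>\<^bsub>with_action E f\<^esub> x = \<zero>\<^bsub>with_action E f\<^esub>"
        by (auto simp: with_action_def intro!: bexI[of _ "\<ominus>\<^bsub>E\<^esub> x"] E.M.l_neg)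
    qed (auto simp: with_action_def E.M.a_ac)
  qed (auto simp: with_action_def D_alg_carrier D_alg_sel f act_closed ahom_add[OF act_ahom] ahom_add[OF act_ahom_right]
      act_bullet bullet_closed V.pure_closed act_pure_Nil E.smult_one[simplified])
  then show ?thesis
    unfolding defines_D_action_def using f by auto
qed

text \<open>A generator of the ideal has the same class as zero, so a function on classes forces it
  to act by zero. Its value is the component of the curvature along \<alpha>, and these components
  determine the curvature.\<close>

lemma zero_curvature_if_D_action:
  assumes fgp: "fgp_right A (Form C 2)" and D: "defines_D_action C E nabla"
  shows "zero_curvature C E nabla"
  unfolding zero_curvature_def
proof
  fix e assume e: "e \<in> carrier E"
  obtain f where f: "\<And>v e. \<lbrakk>v \<in> carrier (TVec C); e \<in> carrier E\<rbrakk> \<Longrightarrow> f (D_class C v) e = act C E nabla v e"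
    using D unfolding defines_D_action_def by auto
  show "curvature C E nabla e = \<zero>\<^bsub>P2\<^esub>"
  proof (rule fgp_separates[OF fgp curvature_deg[OF e]])
    fix \<alpha> assume \<alpha>: "\<alpha> \<in> rhom A (Form C 2) A"
    have "curv_hat C \<alpha> \<in> W_ideal C"
      unfolding W_ideal_def using R.genideal_self[OF curv_hat_image] \<alpha> by blast
    then have "D_class C (curv_hat C \<alpha>) = D_class C \<zero>\<^bsub>TVec C\<^esub>"
      unfolding D_class_def using W.a_rcos_const[of "curv_hat C \<alpha>"] W.a_rcos_const[OF W.zero_closed] by simp
    then have "act C E nabla (curv_hat C \<alpha>) e = act C E nabla \<zero>\<^bsub>TVec C\<^esub> e"
      using f[OF curv_hat_closed[OF \<alpha>] e] f[OF TW.M.zero_closed e] by simp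
    also have "\<dots> = \<zero>\<^bsub>E\<^esub>" using e by (simp add: ahom_zero[OF act_ahom] E.M.abelian_group_axioms)
    finally show "apply_first E \<alpha> (curvature C E nabla e) = \<zero>\<^bsub>E\<^esub>" by (simp add: act_curv_hat[OF \<alpha> e])
  qed
qed

end

theorem proposition5p1:
  fixes C :: "'w conn" and E :: "('w, 'e) module" and nabla :: "'e \<Rightarrow> ('w, 'e) tensor"
  assumes "bimodule_connection C"
    and "left_module (Form C 0) E"
    and "left_cov_deriv C E nabla"
  shows "(zero_curvature C E nabla \<longrightarrow> defines_D_action C E nabla) \<and>
    (fgp_right (Form C 0) (Form C 2) \<and> defines_D_action C E nabla \<longrightarrow> zero_curvature C E nabla)"
proof -
  interpret module_connection C E nabla
    using assms by (intro module_connection.intro module_connection_axioms.intro)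
  show ?thesis
    using D_action_if_zero_curvature zero_curvature_if_D_action by blast
qed

end
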